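(* Let $U'$ be an open, relatively compact subset of $U$ and $T_0\in(0,T)$. In the following, $C>0$ denotes a constant depending only on $N$, the $a_i$'s, the $\alpha_i$'s, $U$, $U'$ (and $s$ in (ii)), and in particular independent of $T$, $T_0$, $\phi$, $\mathcal R$, $\chi_*$, $M_*$, $\mathcal Z$, $u$, $\Psi$. (i) One has $$\int_0^T\!\!\int_{U'}|\nabla u|^{4-a}dxdt\le C\chi_*^{4(4+a)}(M_*+1)^{12}\mathcal N_2,$$ $$\int_{T_0}^T\!\int_{U'}|\nabla u|^{4-a}dxdt\le C(1+T_0^{-1})^2\chi_*^{4(4+a)}(M_*+1)^{12}\mathcal N_*.$$ (ii) If $s$ is any number in $(2-a,4-a)$, then $$\int_0^T\!\!\int_{U'}|\nabla u|^sdxdt\le C\chi_*^{(4+a)(s+a)}(M_*+1)^{4(s+a-1)}\mathcal N_2,$$ $$\int_{T_0}^T\!\int_{U'}|\nabla u|^sdxdt\le C(1+T_0^{-1})^{s+a-2}\chi_*^{(4+a)(s+a)}(M_*+1)^{4(s+a-1)}\mathcal N_*.$$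
   Context: $N\ge1$ is an integer, $0=\alpha_0<\alpha_1<\dots<\alpha_N$ are real numbers, $a_0,\dots,a_N>0$ are constants, and $g(s)=\sum_{i=0}^N a_is^{\alpha_i}$ for $s\ge0$. $\vec k\in\mathbb R^3$ is a fixed unit vector, $\mathbf J$ is the $3\times3$ matrix with $\mathbf Jx=\vec k\times x$. Constants: $0<\phi\le1$, $\mathcal G>0$, $\Omega\ge0$, $\rho_*\ge0$, and $\mathcal R=2\rho_*\Omega/\phi$. The function $F:\mathbb R^3\to\mathbb R^3$, $F(v)=g(|v|)v+\mathcal R\,\mathbf Jv$, is a $C^1$ bijection whose inverse $X=F^{-1}$ is also $C^1$. $a=\frac{\alpha_N}{1+\alpha_N}\in(0,1)$. $U\subset\mathbb R^3$ is a nonempty open bounded set with $C^1$ boundary $\Gamma$; $T>0$; $e_0:\mathbb R\to\mathbb R^3$ is smooth with $|e_0(t)|=1$, and $\mathcal Z(x,t)=-\mathcal Ge_0(t)+\Omega^2\mathbf J^2x$. Put $r_0=\max\{|x|:x\in\bar U\}$, $\Omega_*=\Omega\sqrt{r_0/\mathcal G}$, $d_*=\sqrt{\mathcal G/r_0}\,\max\{2\rho_*/\phi,\sqrt{r_0},2^{1/4}\}$ and $\chi_*=\max\{1,d_*(1+\Omega_* )\}$. $u\in C^{2,1}_{x,t}(\bar U\times(0,T])\cap C(\bar U\times[0,T])$ (not necessarily non-negative) solves $\phi u_t=\nabla\cdot(X(\nabla u+u^2\mathcal Z))$ in $U\times(0,T]$, $u(x,0)=u_0(x)$ in $U$, $u=\psi$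 on $\Gamma\times(0,T]$. $\Psi\in C^1(\bar U\times[0,T])$ is an extension of $\psi$, i.e. $\Psi=\psi$ on $\Gamma\times(0,T]$, and $\bar u_0=u_0-\Psi(\cdot,0)$. Spatial norms are over $U$; where $\nabla u_0$ appears, $u_0$ is assumed weakly differentiable (the estimate is trivial if the norm is infinite). Quantities: $M_*=\sup_{U\times[0,T]}|u|$, $$\mathcal E_*=\int_0^T\!\!\int_U(|\nabla\Psi|^2+\phi|\Psi_t|^2+\phi\Psi^2)dxdt,\quad\mathcal N_*=\phi\|\bar u_0\|_{L^2}^2+T+\mathcal E_*,\quad\mathcal N_2=\phi(\|\bar u_0\|_{L^2}^2+\|\nabla u_0\|_{L^2}^2)+T+\mathcal E_*.$$ *)

theory Defs
  imports "HOL-Analysis.Analysis"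
begin

section \<open>Differential operators and function classes\<close>

definition gradient :: "('a::real_inner \<Rightarrow> real) \<Rightarrow> 'a \<Rightarrow> 'a" where
  "gradient f x = (THE D. GDERIV f x :> D)"

lemma gradient_eq:
  assumes "GDERIV f x :> D"
  shows "gradient f x = D"
  unfolding gradient_def
proof (rule the_equality)
  fix E assume "GDERIV f x :> E"
  then have "(\<lambda>h. h \<bullet> E) = (\<lambda>h. h \<bullet> D)"
    using assms unfolding gderiv_def by (rule has_derivative_unique)
  then have "(E - D) \<bullet> E = (E - D) \<bullet> D"
    by (rule fun_cong)
  then have "(E - D) \<bullet> (E - D) = 0"
    by (simp only: inner_diff_right diff_self)
  then show "E = D"
    by simp
qed (fact assms)

definition divergence :: "(real^3 \<Rightarrow> real^3) \<Rightarrow> real^3 \<Rightarrow> real" where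
  "divergence V x = trace (jacobian V (at x))"

text \<open>A function is smooth iff all its iterated partial derivatives are differentiable everywhere;
  the list \<open>bs\<close> records the coordinate directions of the successive derivatives.\<close>

definition smooth :: "('a::euclidean_space \<Rightarrow> 'b::real_normed_vector) \<Rightarrow> bool" where
  "smooth f \<longleftrightarrow>
     (\<forall>bs. set bs \<subseteq> Basis \<longrightarrow>
       (\<forall>x. fold (\<lambda>b h y. frechet_derivative h (at y) b) bs f differentiable (at x)))"

definition test_function :: "'a::euclidean_space set \<Rightarrow> ('a \<Rightarrow> real) \<Rightarrow> bool" where
  "test_function U \<eta> \<longleftrightarrow>
     smooth \<eta> \<and> compact (closure {x. \<eta> x \<noteq> 0}) \<and> closure {x. \<eta> x \<noteq> 0} \<subseteq> U"

definition weak_gradient :: "'a::euclidean_space set \<Rightarrow> ('a \<Rightarrow> real) \<Rightarrow> ('a \<Rightarrow> 'a) \<Rightarrow> bool" where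
  "weak_gradient U f w \<longleftrightarrow>
     (\<forall>K. compact K \<and> K \<subseteq> U \<longrightarrow>
        f absolutely_integrable_on K \<and> w absolutely_integrable_on K) \<and>
     (\<forall>\<eta>. test_function U \<eta> \<longrightarrow>
        (LINT x:U|lebesgue. f x *\<^sub>R gradient \<eta> x) = - (LINT x:U|lebesgue. \<eta> x *\<^sub>R w x))"

text \<open>Near each boundary point the set is, in suitably rotated or reflected orthonormal
  coordinates, the part above the graph of a \<open>C\<^sup>1\<close> function.\<close>

definition C1_boundary :: "(real^3) set \<Rightarrow> bool" where
  "C1_boundary U \<longleftrightarrow>
     (\<forall>p \<in> frontier U. \<exists>r>0. \<exists>(Q :: real^3 \<Rightarrow> real^3) (\<gamma> :: real^2 \<Rightarrow> real) \<gamma>'.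
        orthogonal_transformation Q \<and>
        (\<forall>y. GDERIV \<gamma> y :> \<gamma>' y) \<and> continuous_on UNIV \<gamma>' \<and>
        U \<inter> ball p r = {x \<in> ball p r. \<gamma> (vector [Q x $ 1, Q x $ 2]) < Q x $ 3})"

text \<open>Regularity up to the lateral boundary: the derivatives exist over the open set \<open>U\<close>
  (one-sided in time at the end points of the time interval) and extend continuously
  to \<open>closure U\<close>.\<close>

definition C21_cylinder :: "(real^3) set \<Rightarrow> real \<Rightarrow> (real^3 \<Rightarrow> real \<Rightarrow> real) \<Rightarrow> bool" where
  "C21_cylinder U T u \<longleftrightarrow>
     (\<exists>(Du :: real^3 \<Rightarrow> real \<Rightarrow> real^3) (D2u :: real^3 \<Rightarrow> real \<Rightarrow> real^3^3)
        (ut :: real^3 \<Rightarrow> real \<Rightarrow> real).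
        continuous_on (closure U \<times> {0<..T}) (\<lambda>(x, t). u x t) \<and>
        continuous_on (closure U \<times> {0<..T}) (\<lambda>(x, t). Du x t) \<and>
        continuous_on (closure U \<times> {0<..T}) (\<lambda>(x, t). D2u x t) \<and>
        continuous_on (closure U \<times> {0<..T}) (\<lambda>(x, t). ut x t) \<and>
        (\<forall>x\<in>U. \<forall>t\<in>{0<..T}.
           (GDERIV (\<lambda>y. u y t) x :> Du x t) \<and>
           ((\<lambda>y. Du y t) has_derivative (\<lambda>h. D2u x t *v h)) (at x) \<and>
           (u x has_vector_derivative ut x t) (at t within {0..T})))"

definition C1_cylinder :: "(real^3) set \<Rightarrow> real \<Rightarrow> (real^3 \<Rightarrow> real \<Rightarrow> real) \<Rightarrow> bool" where
  "C1_cylinder U T v \<longleftrightarrow>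
     (\<exists>(Dv :: real^3 \<Rightarrow> real \<Rightarrow> real^3) (vt :: real^3 \<Rightarrow> real \<Rightarrow> real).
        continuous_on (closure U \<times> {0..T}) (\<lambda>(x, t). v x t) \<and>
        continuous_on (closure U \<times> {0..T}) (\<lambda>(x, t). Dv x t) \<and>
        continuous_on (closure U \<times> {0..T}) (\<lambda>(x, t). vt x t) \<and>
        (\<forall>x\<in>U. \<forall>t\<in>{0..T}.
           (GDERIV (\<lambda>y. v y t) x :> Dv x t) \<and>
           (v x has_vector_derivative vt x t) (at t within {0..T})))"

section \<open>The rotating Forchheimer flow problem\<close>

text \<open>The summand with index 0 is written as the constant \<open>a 0\<close> because \<open>\<alpha> 0 = 0\<close> and
  \<open>0 powr 0 = 0\<close>.\<close>

definition forch_g :: "nat \<Rightarrow> (nat \<Rightarrow> real) \<Rightarrow> (nat \<Rightarrow> real) \<Rightarrow> real \<Rightarrow> real" where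
  "forch_g N a \<alpha> s = a 0 + (\<Sum>i=1..N. a i * s powr \<alpha> i)"

definition forch_exp :: "nat \<Rightarrow> (nat \<Rightarrow> real) \<Rightarrow> real" where
  "forch_exp N \<alpha> = \<alpha> N / (1 + \<alpha> N)"

definition rotJ :: "real^3 \<Rightarrow> real^3 \<Rightarrow> real^3" where
  "rotJ k x = cross3 k x"

definition forch_F ::
    "nat \<Rightarrow> (nat \<Rightarrow> real) \<Rightarrow> (nat \<Rightarrow> real) \<Rightarrow> real \<Rightarrow> real^3 \<Rightarrow> real^3 \<Rightarrow> real^3" where
  "forch_F N a \<alpha> R k v = forch_g N a \<alpha> (norm v) *\<^sub>R v + R *\<^sub>R rotJ k v"

definition forch_X ::
    "nat \<Rightarrow> (nat \<Rightarrow> real) \<Rightarrow> (nat \<Rightarrow> real) \<Rightarrow> real \<Rightarrow> real^3 \<Rightarrow> real^3 \<Rightarrow> real^3" where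
  "forch_X N a \<alpha> R k = inv (forch_F N a \<alpha> R k)"

definition rot_number :: "real \<Rightarrow> real \<Rightarrow> real \<Rightarrow> real" where
  "rot_number \<phi> \<Omega> \<rho> = 2 * \<rho> * \<Omega> / \<phi>"

definition body_Z :: "real \<Rightarrow> real \<Rightarrow> real^3 \<Rightarrow> (real \<Rightarrow> real^3) \<Rightarrow> real^3 \<Rightarrow> real \<Rightarrow> real^3" where
  "body_Z G \<Omega> k e0 x t = - (G *\<^sub>R e0 t) + \<Omega>\<^sup>2 *\<^sub>R rotJ k (rotJ k x)"

text \<open>For bounded nonempty \<open>U\<close> the supremum is attained, hence a maximum.\<close>

definition r0 :: "(real^3) set \<Rightarrow> real" where
  "r0 U = (SUP x\<in>closure U. norm x)"

definition Omega_star :: "(real^3) set \<Rightarrow> real \<Rightarrow> real \<Rightarrow> real" where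
  "Omega_star U G \<Omega> = \<Omega> * sqrt (r0 U / G)"

definition d_star :: "(real^3) set \<Rightarrow> real \<Rightarrow> real \<Rightarrow> real \<Rightarrow> real" where
  "d_star U \<phi> G \<rho> = sqrt (G / r0 U) * Max {2 * \<rho> / \<phi>, sqrt (r0 U), 2 powr (1/4)}"

definition chi_star :: "(real^3) set \<Rightarrow> real \<Rightarrow> real \<Rightarrow> real \<Rightarrow> real \<Rightarrow> real" where
  "chi_star U \<phi> G \<Omega> \<rho> = max 1 (d_star U \<phi> G \<rho> * (1 + Omega_star U G \<Omega>))"

definition ibvp_solution ::
    "(real^3) set \<Rightarrow> real \<Rightarrow> real \<Rightarrow> (real^3 \<Rightarrow> real^3) \<Rightarrow> (real^3 \<Rightarrow> real \<Rightarrow> real^3)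
      \<Rightarrow> (real^3 \<Rightarrow> real) \<Rightarrow> (real^3 \<Rightarrow> real \<Rightarrow> real) \<Rightarrow> (real^3 \<Rightarrow> real \<Rightarrow> real) \<Rightarrow> bool" where
  "ibvp_solution U T \<phi> X Z u0 \<psi> u \<longleftrightarrow>
     C21_cylinder U T u \<and>
     continuous_on (closure U \<times> {0..T}) (\<lambda>(x, t). u x t) \<and>
     (\<forall>x\<in>U. \<forall>t\<in>{0<..T}.
        \<phi> * vector_derivative (u x) (at t within {0..T})
          = divergence (\<lambda>y. X (gradient (\<lambda>z. u z t) y + (u y t)\<^sup>2 *\<^sub>R Z y t)) x) \<and>
     (\<forall>x\<in>U. u x 0 = u0 x) \<and>
     (\<forall>x\<in>frontier U. \<forall>t\<in>{0<..T}. u x t = \<psi> x t)"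

definition flow_setting ::
    "nat \<Rightarrow> (nat \<Rightarrow> real) \<Rightarrow> (nat \<Rightarrow> real) \<Rightarrow> (real^3) set
      \<Rightarrow> real \<Rightarrow> real \<Rightarrow> real \<Rightarrow> real \<Rightarrow> real^3 \<Rightarrow> (real \<Rightarrow> real^3) \<Rightarrow> real
      \<Rightarrow> (real^3 \<Rightarrow> real) \<Rightarrow> (real^3 \<Rightarrow> real \<Rightarrow> real) \<Rightarrow> (real^3 \<Rightarrow> real \<Rightarrow> real)
      \<Rightarrow> (real^3 \<Rightarrow> real \<Rightarrow> real) \<Rightarrow> bool" where
  "flow_setting N a \<alpha> U \<phi> G \<Omega> \<rho> k e0 T u0 \<psi> u \<Psi> \<longleftrightarrow>
     0 < \<phi> \<and> \<phi> \<le> 1 \<and> 0 < G \<and> 0 \<le> \<Omega> \<and> 0 \<le> \<rho> \<and> norm k = 1 \<and>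
     smooth e0 \<and> (\<forall>t. norm (e0 t) = 1) \<and> 0 < T \<and>
     ibvp_solution U T \<phi> (forch_X N a \<alpha> (rot_number \<phi> \<Omega> \<rho>) k) (body_Z G \<Omega> k e0) u0 \<psi> u \<and>
     C1_cylinder U T \<Psi> \<and> (\<forall>x\<in>frontier U. \<forall>t\<in>{0<..T}. \<Psi> x t = \<psi> x t)"

section \<open>Quantities in the estimates\<close>

definition M_star :: "(real^3) set \<Rightarrow> real \<Rightarrow> (real^3 \<Rightarrow> real \<Rightarrow> real) \<Rightarrow> real" where
  "M_star U T u = (SUP (x, t)\<in>U \<times> {0..T}. \<bar>u x t\<bar>)"

definition L2_norm_sq :: "(real^3) set \<Rightarrow> (real^3 \<Rightarrow> 'b::real_normed_vector) \<Rightarrow> ennreal" where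
  "L2_norm_sq U f = (\<integral>\<^sup>+x\<in>U. ennreal ((norm (f x))\<^sup>2) \<partial>lebesgue)"

definition E_star :: "(real^3) set \<Rightarrow> real \<Rightarrow> real \<Rightarrow> (real^3 \<Rightarrow> real \<Rightarrow> real) \<Rightarrow> ennreal" where
  "E_star U T \<phi> \<Psi> =
     (\<integral>\<^sup>+t\<in>{0..T}. (\<integral>\<^sup>+x\<in>U.
        ennreal ((norm (gradient (\<lambda>y. \<Psi> y t) x))\<^sup>2
          + \<phi> * \<bar>vector_derivative (\<Psi> x) (at t within {0..T})\<bar>\<^sup>2
          + \<phi> * (\<Psi> x t)\<^sup>2) \<partial>lebesgue) \<partial>lebesgue)"

definition N_star ::
    "(real^3) set \<Rightarrow> real \<Rightarrow> real \<Rightarrow> (real^3 \<Rightarrow> real) \<Rightarrow> (real^3 \<Rightarrow> real \<Rightarrow> real) \<Rightarrow> ennreal" where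
  "N_star U T \<phi> u0 \<Psi> =
     ennreal \<phi> * L2_norm_sq U (\<lambda>x. u0 x - \<Psi> x 0) + ennreal T + E_star U T \<phi> \<Psi>"

text \<open>\<open>w\<close> stands for the weak gradient of \<open>u0\<close>; its norm, and hence \<open>N_2\<close>, may be infinite.\<close>

definition N_2 ::
    "(real^3) set \<Rightarrow> real \<Rightarrow> real \<Rightarrow> (real^3 \<Rightarrow> real) \<Rightarrow> (real^3 \<Rightarrow> real^3)
      \<Rightarrow> (real^3 \<Rightarrow> real \<Rightarrow> real) \<Rightarrow> ennreal" where
  "N_2 U T \<phi> u0 w \<Psi> =
     ennreal \<phi> * (L2_norm_sq U (\<lambda>x. u0 x - \<Psi> x 0) + L2_norm_sq U w)
       + ennreal T + E_star U T \<phi> \<Psi>"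

definition grad_integral ::
    "(real^3) set \<Rightarrow> real \<Rightarrow> real \<Rightarrow> real \<Rightarrow> (real^3 \<Rightarrow> real \<Rightarrow> real) \<Rightarrow> ennreal" where
  "grad_integral V t1 t2 s u =
     (\<integral>\<^sup>+t\<in>{t1..t2}. (\<integral>\<^sup>+x\<in>V.
        ennreal (norm (gradient (\<lambda>y. u y t) x) powr s) \<partial>lebesgue) \<partial>lebesgue)"

end

theory Submission
  imports Defs
begin

text \<open>All bounds are local, so neither the boundary values nor the regularity of \<open>\<Gamma>\<close> matter. Put
  \<open>\<Phi> = \<nabla>u + u\<^sup>2 Z\<close>, \<open>V = X \<Phi>\<close> and \<open>G = g |V|\<close>. Testing the equation with a cut-off times
  \<open>u - trunc \<Psi>\<close> bounds the integral of \<open>G |V|\<^sup>2\<close>, hence that of \<open>|\<nabla>u|\<close> to the power \<open>2 - a\<close>. Testing the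
  difference quotient of the equation with that of \<open>u\<close> bounds the integral of \<open>|D\<Phi>|\<^sup>2 / G\<close>; the
  initial term is controlled by the weak gradient of \<open>u0\<close>, or removed by a weight vanishing
  at time 0. An integration by parts that moves the derivative from \<open>u\<close>, which is bounded by \<open>M\<close>, to the field
  \<open>(1 + |\<Phi>|\<^sup>2) powr (-a/2) |\<Phi>|\<^sup>2 \<Phi>\<close> then bounds the integral of \<open>|\<nabla>u|\<close> to the power \<open>4 - a\<close>.
  A finite covering of \<open>closure U'\<close> by balls gives (i), and interpolating between
  the two powers gives (ii).\<close>

section \<open>The constitutive law\<close>

text \<open>The law degenerates: the coercivity of \<open>X\<close> is of order
  \<open>1 / G\<close>, and \<open>G\<close> may grow like |\<Phi>| to the power
  \<open>\<theta>\<close>. Hence the weight \<open>1 / G\<close> in the Hessian bound and the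
  matching negative power in the field of the last integration by parts. The obstacle is the term
  u^2 Z. In the difference quotient of the equation it leaves the square of the difference quotient
  of \<open>u\<close>, with no small factor to absorb it. That square is integrated by parts once
  more: a factor bounded by \<open>M\<close> comes out and only the first power of the difference
  quotient of \<open>\<Phi>\<close> remains. Young's inequality with weight \<open>G\<close> splits
  it into a small part of the dissipation and the integral of \<open>G\<close>, which the energy
  controls. The exponents, with m = M + 1: the energy costs \<xi>^4 m^4, the absorption \<xi>^10
  m^6, the coercivity \<xi>^2 and the last step m^2. This makes \<xi>^16 m^12, and 16 is at most 4(4
  + \<theta>). For the power 2 - \<theta> the count stops at \<xi>^6 m^4.\<close>

lemma mult_powr_diff_le:
  fixes s t b :: real
  assumes "0 \<le> t" "t \<le> s" "0 < b"
  shows "t * (s powr b - t powr b) \<le> (1 + b) * s powr b * (s - t)"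
proof (cases "t = 0 \<or> t = s")
  case True
  then show ?thesis using assms by auto
next
  case False
  then have t: "0 < t" "t < s" using assms by auto
  \<comment> \<open>The mean value theorem is applied to z^(1 + b): for b < 1 the derivative of z^b
    is unbounded near 0, and the factor \<open>t\<close> in the claim is what makes the higher power
    available.\<close>
  have "\<exists>z. z > t \<and> z < s \<and> s powr (1+b) - t powr (1+b) = (s - t) * ((1+b) * z powr b)"
  proof (rule MVT2)
    fix z assume "t \<le> z" "z \<le> s"
    then have "z > 0" using t by auto
    then show "((\<lambda>z. z powr (1+b)) has_real_derivative (1+b) * z powr b) (at z)"
      by (auto intro!: derivative_eq_intros)
  qed (use t in auto)
  then obtain z where z: "t < z" "z < s" "s powr (1+b) - t powr (1+b) = (s - t) * ((1+b) * z powr b)"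
    by blast
  have "t * (s powr b - t powr b) = t * s powr b - t powr (1+b)"
    using t by (simp add: powr_add algebra_simps)
  also have "\<dots> \<le> s * s powr b - t powr (1+b)"
    using t by (simp add: mult_right_mono)
  also have "\<dots> = s powr (1+b) - t powr (1+b)"
    using t by (simp add: powr_add)
  also have "\<dots> \<le> (s - t) * ((1+b) * s powr b)"
    unfolding z(3) using z t assms
    by (intro mult_left_mono mult_nonneg_nonneg powr_mono2) auto
  finally show ?thesis by (simp add: mult_ac)
qed

lemma has_derivative_quotient:
  assumes "(f has_derivative f') (at x)"
  shows "((\<lambda>s. (f (x + s *\<^sub>R h) - f x) /\<^sub>R s) \<longlongrightarrow> f' h) (at (0::real))"
proof -
  interpret bounded_linear f' using assms by (rule has_derivative_bounded_linear)
  have "((\<lambda>s. x + s *\<^sub>R h) has_derivative (\<lambda>s. s *\<^sub>R h)) (at 0)"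
    by (auto intro!: derivative_eq_intros)
  then have "((\<lambda>s. f (x + s *\<^sub>R h)) has_derivative (\<lambda>s. f' (s *\<^sub>R h))) (at 0)"
    using assms has_derivative_compose[of "\<lambda>s. x + s *\<^sub>R h" "\<lambda>s. s *\<^sub>R h" 0 UNIV f f'] by simp
  then have "((\<lambda>s. norm (f (x + s *\<^sub>R h) - f x - s *\<^sub>R f' h) / norm s) \<longlongrightarrow> 0) (at 0)"
    by (simp add: has_derivative_at scaleR)
  moreover have "\<forall>\<^sub>F s in at 0. norm (f (x + s *\<^sub>R h) - f x - s *\<^sub>R f' h) / norm s
      = norm ((f (x + s *\<^sub>R h) - f x) /\<^sub>R s - f' h)"
    unfolding eventually_at_filter
  proof (intro always_eventually allI impI)
    fix s :: real assume s: "s \<noteq> 0"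
    then have "(f (x + s *\<^sub>R h) - f x) /\<^sub>R s - f' h = (f (x + s *\<^sub>R h) - f x - s *\<^sub>R f' h) /\<^sub>R s"
      by (simp add: scaleR_diff_right)
    then show "norm (f (x + s *\<^sub>R h) - f x - s *\<^sub>R f' h) / norm s
        = norm ((f (x + s *\<^sub>R h) - f x) /\<^sub>R s - f' h)"
      by (simp add: divide_inverse mult.commute)
  qed
  ultimately have "((\<lambda>s. norm ((f (x + s *\<^sub>R h) - f x) /\<^sub>R s - f' h)) \<longlongrightarrow> 0) (at 0)"
    by (rule Lim_transform_eventually)
  then show ?thesis by (simp add: tendsto_norm_zero_iff LIM_zero_iff)
qed

text \<open>The lower bound passes to the limit in the difference quotients. It serves to show that
  the derivative of the flow law is injective.\<close>

lemma has_derivative_expanding: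
  assumes f': "(f has_derivative f') (at x)" and le: "\<And>y. c * norm (y - x) \<le> norm (f y - f x)"
  shows "c * norm h \<le> norm (f' h)"
proof (rule tendsto_lowerbound[OF tendsto_norm[OF has_derivative_quotient[OF f']]])
  show "\<forall>\<^sub>F s in at (0::real). c * norm h \<le> norm ((f (x + s *\<^sub>R h) - f x) /\<^sub>R s)"
    unfolding eventually_at_filter
  proof (intro always_eventually allI impI)
    fix s :: real assume "s \<noteq> 0"
    then show "c * norm h \<le> norm ((f (x + s *\<^sub>R h) - f x) /\<^sub>R s)"
      using le[of "x + s *\<^sub>R h"] unfolding norm_scaleR by (simp add: field_simps)
  qed
qed simp

lemma has_derivative_lipschitz:
  assumes f': "(f has_derivative f') (at x)" and le: "\<And>y. norm (f y - f x) \<le> c * norm (y - x)"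
  shows "norm (f' h) \<le> c * norm h"
proof (rule tendsto_upperbound[OF tendsto_norm[OF has_derivative_quotient[OF f']]])
  show "\<forall>\<^sub>F s in at (0::real). norm ((f (x + s *\<^sub>R h) - f x) /\<^sub>R s) \<le> c * norm h"
    unfolding eventually_at_filter
  proof (intro always_eventually allI impI)
    fix s :: real assume "s \<noteq> 0"
    then show "norm ((f (x + s *\<^sub>R h) - f x) /\<^sub>R s) \<le> c * norm h"
      using le[of "x + s *\<^sub>R h"] unfolding norm_scaleR by (simp add: field_simps)
  qed
qed simp

text \<open>Here \<open>\<xi>\<close> is \<open>\<chi>\<^sub>*\<close>, \<open>\<theta>\<close> is the exponent \<open>a\<close> and \<open>G y\<close> is \<open>g |X y|\<close>. The single constant \<open>\<kappa>\<close>
  absorbs everything that depends only on the coefficients of \<open>g\<close> and, later, on the ball; the rotation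
  number enters only through \<open>\<xi>\<close>.\<close>

locale flow_law =
  fixes \<kappa> \<xi> \<theta> :: real and X :: "real^3 \<Rightarrow> real^3" and G :: "real^3 \<Rightarrow> real"
  assumes kappa_ge_1: "1 \<le> \<kappa>" and chi_ge_1: "1 \<le> \<xi>" and theta_pos: "0 < \<theta>" and theta_less_1: "\<theta> < 1"
    and G_lower: "1 \<le> \<kappa> * G y"
    and X_inner: "X y \<bullet> y = G y * (norm (X y))\<^sup>2"
    and norm_le_X: "norm y \<le> \<kappa> * \<xi> * (G y * norm (X y))"
    and X_monotone: "(G y + G y') * (norm (X y - X y'))\<^sup>2 \<le> 2 * ((X y - X y') \<bullet> (y - y'))"
    and X_coercive: "(norm (y - y'))\<^sup>2 \<le> \<kappa> * \<xi>\<^sup>2 * ((G y + G y') * ((X y - X y') \<bullet> (y - y')))"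
    and G_upper: "G y \<le> \<kappa> * (1 + (norm y)\<^sup>2) powr (\<theta> / 2)"
    and norm_powr_le: "norm y powr (2 - \<theta>) \<le> \<kappa> * \<xi>\<^sup>2 * (1 + G y * (norm (X y))\<^sup>2)"
    and G_le_energy: "G y \<le> \<kappa> * (1 + G y * (norm (X y))\<^sup>2)"
    and X_differentiable: "X differentiable (at y)"
    and G_continuous: "continuous_on UNIV G"

section \<open>Growth and monotonicity of the Forchheimer polynomial\<close>

locale forchheimer =
  fixes N :: nat and a \<alpha> :: "nat \<Rightarrow> real"
  assumes N_ge_1: "N \<ge> 1" and alpha_0: "\<alpha> 0 = 0" and alpha_mono: "strict_mono_on {0..N} \<alpha>"
    and a_pos: "\<forall>i\<le>N. a i > 0"
begin

abbreviation g :: "real \<Rightarrow> real" where "g \<equiv> forch_g N a \<alpha>"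

lemma alpha_pos: "i \<in> {1..N} \<Longrightarrow> 0 < \<alpha> i"
  using alpha_mono alpha_0 by (fastforce simp: strict_mono_on_def)

lemma alpha_le: "i \<in> {1..N} \<Longrightarrow> \<alpha> i \<le> \<alpha> N"
  using alpha_mono by (cases "i = N") (auto simp: strict_mono_on_def intro!: less_imp_le)

lemma a0_pos: "0 < a 0" and aN_pos: "0 < a N" and alphaN_pos: "0 < \<alpha> N"
  using a_pos N_ge_1 alpha_pos by auto

lemma a_nonneg: "i \<in> {1..N} \<Longrightarrow> 0 \<le> a i"
  using a_pos by (auto intro: less_imp_le)

lemma g_ge_a0: "a 0 \<le> g s"
  unfolding forch_g_def using a_nonneg by (auto intro!: sum_nonneg)

lemma g_pos: "0 < g s"
  using g_ge_a0 a0_pos by (rule less_le_trans[rotated])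

lemma g_mono: "0 \<le> s \<Longrightarrow> s \<le> t \<Longrightarrow> g s \<le> g t"
  unfolding forch_g_def using a_nonneg alpha_pos
  by (auto intro!: sum_mono mult_left_mono powr_mono2 intro: less_imp_le)

text \<open>Every exponent is at most \<open>\<alpha> N\<close>; raising the base from s to 1 + s
  makes the comparison of powers valid for s < 1 as well.\<close>

lemma g_upper: "0 \<le> s \<Longrightarrow> g s \<le> (\<Sum>i\<le>N. a i) * (1 + s) powr \<alpha> N"
proof -
  assume s: "0 \<le> s"
  have "a i * s powr \<alpha> i \<le> a i * (1 + s) powr \<alpha> N" if i: "i \<in> {1..N}" for i
  proof -
    have "s powr \<alpha> i \<le> (1 + s) powr \<alpha> i" using s alpha_pos[OF i] by (intro powr_mono2) auto
    also have "\<dots> \<le> (1 + s) powr \<alpha> N" using s alpha_le[OF i] by (intro powr_mono) auto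
    finally show ?thesis using a_nonneg[OF i] by (intro mult_left_mono)
  qed
  moreover have "a 0 \<le> a 0 * (1 + s) powr \<alpha> N"
    using s a0_pos alphaN_pos by (simp add: ge_one_powr_ge_zero)
  ultimately have "g s \<le> a 0 * (1 + s) powr \<alpha> N + (\<Sum>i=1..N. a i * (1 + s) powr \<alpha> N)"
    unfolding forch_g_def by (intro add_mono sum_mono) auto
  also have "\<dots> = (\<Sum>i\<le>N. a i) * (1 + s) powr \<alpha> N"
    by (simp add: sum_distrib_right distrib_right atMost_atLeast0 sum.atLeast_Suc_atMost)
  finally show ?thesis .
qed

text \<open>Only the constant and the leading term are kept. The factor
  \<open>2 powr \<alpha> N\<close> comes from 1 + s \<le> 2 max(1, s).\<close>

lemma g_lower: "0 \<le> s \<Longrightarrow> min (a 0) (a N) * (1 + s) powr \<alpha> N \<le> 2 powr \<alpha> N * g s"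
proof -
  assume s: "0 \<le> s"
  have "(1 + s) powr \<alpha> N \<le> (2 * max 1 s) powr \<alpha> N"
    using s alphaN_pos by (intro powr_mono2) auto
  also have "\<dots> = 2 powr \<alpha> N * max 1 s powr \<alpha> N" using s by (simp add: powr_mult)
  also have "\<dots> \<le> 2 powr \<alpha> N * (1 + s powr \<alpha> N)"
    by (intro mult_left_mono) (auto simp: max_def)
  finally have 1: "(1 + s) powr \<alpha> N \<le> 2 powr \<alpha> N * (1 + s powr \<alpha> N)" .
  have "min (a 0) (a N) * (1 + s powr \<alpha> N) \<le> a 0 + a N * s powr \<alpha> N"
    by (simp add: distrib_left mult_right_mono add_mono)
  also have "\<dots> \<le> g s"
    unfolding forch_g_def using N_ge_1 a_nonneg
    by (auto intro!: member_le_sum[where f="\<lambda>i. a i * s powr \<alpha> i"])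
  finally have 2: "min (a 0) (a N) * (1 + s powr \<alpha> N) \<le> g s" .
  have "min (a 0) (a N) * (1 + s) powr \<alpha> N \<le> min (a 0) (a N) * (2 powr \<alpha> N * (1 + s powr \<alpha> N))"
    using 1 a0_pos aN_pos by (intro mult_left_mono) auto
  also have "\<dots> = 2 powr \<alpha> N * (min (a 0) (a N) * (1 + s powr \<alpha> N))" by simp
  also have "\<dots> \<le> 2 powr \<alpha> N * g s" using 2 by (intro mult_left_mono) auto
  finally show ?thesis .
qed

text \<open>Summed form of \<open>mult_powr_diff_le\<close> with every exponent raised to the
  largest one. It is an integrated version of s g'(s) \<le> \<alpha> g(s): relative changes of
  \<open>g\<close> are controlled by relative changes of its argument.\<close>

lemma g_diff: "0 \<le> t \<Longrightarrow> t \<le> s \<Longrightarrow> t * (g s - g t) \<le> (1 + \<alpha> N) * g s * (s - t)"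
proof -
  assume t: "0 \<le> t" "t \<le> s"
  have "t * (g s - g t) = (\<Sum>i=1..N. a i * (t * (s powr \<alpha> i - t powr \<alpha> i)))"
    unfolding forch_g_def by (simp add: sum_subtractf[symmetric] sum_distrib_left algebra_simps)
  also have "\<dots> \<le> (\<Sum>i=1..N. a i * ((1 + \<alpha> N) * s powr \<alpha> i * (s - t)))"
  proof (intro sum_mono mult_left_mono)
    fix i assume i: "i \<in> {1..N}"
    have "t * (s powr \<alpha> i - t powr \<alpha> i) \<le> (1 + \<alpha> i) * s powr \<alpha> i * (s - t)"
      using t alpha_pos[OF i] by (intro mult_powr_diff_le)
    also have "\<dots> \<le> (1 + \<alpha> N) * s powr \<alpha> i * (s - t)"
      using t alpha_le[OF i] by (intro mult_right_mono) auto
    finally show "t * (s powr \<alpha> i - t powr \<alpha> i) \<le> (1 + \<alpha> N) * s powr \<alpha> i * (s - t)" .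
  qed (use a_nonneg in auto)
  also have "\<dots> = (1 + \<alpha> N) * (\<Sum>i=1..N. a i * s powr \<alpha> i) * (s - t)"
    by (simp add: sum_distrib_left sum_distrib_right algebra_simps)
  also have "\<dots> \<le> (1 + \<alpha> N) * g s * (s - t)"
    unfolding forch_g_def using t a0_pos alphaN_pos by (intro mult_right_mono mult_left_mono) auto
  finally show ?thesis .
qed

text \<open>The right side exceeds the left by exactly (g(|v|) - g(|w|)) (|v|^2 - |w|^2), and this
  product is nonnegative because \<open>g\<close> is nondecreasing.\<close>

lemma gv_monotone:
  fixes v w :: "'v::real_inner"
  shows "(g (norm v) + g (norm w)) * (norm (v - w))\<^sup>2
    \<le> 2 * ((g (norm v) *\<^sub>R v - g (norm w) *\<^sub>R w) \<bullet> (v - w))"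
proof -
  have "0 \<le> (g (norm v) - g (norm w)) * ((norm v)\<^sup>2 - (norm w)\<^sup>2)"
    using g_mono[of "norm v" "norm w"] g_mono[of "norm w" "norm v"]
    by (cases "norm v \<le> norm w") (auto intro!: mult_nonneg_nonneg mult_nonpos_nonpos power_mono)
  then show ?thesis
    unfolding power2_norm_eq_inner by (simp add: algebra_simps inner_commute)
qed

text \<open>For |w| \<le> |v| the difference splits into g(|v|) (v - w) and (g(|v|) - g(|w|)) w. The
  second part contains the factor |w| that \<open>g_diff\<close> asks for.\<close>

lemma gv_lipschitz:
  fixes v w :: "'v::real_inner"
  shows "norm (g (norm v) *\<^sub>R v - g (norm w) *\<^sub>R w) \<le> (2 + \<alpha> N) * (g (norm v) + g (norm w)) * norm (v - w)"
proof -
  have *: "norm (g (norm v) *\<^sub>R v - g (norm w) *\<^sub>R w) \<le> (2 + \<alpha> N) * g (norm v) * norm (v - w)"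
    if le: "norm w \<le> norm v" for v w :: 'v
  proof -
    have "g (norm v) *\<^sub>R v - g (norm w) *\<^sub>R w = g (norm v) *\<^sub>R (v - w) + (g (norm v) - g (norm w)) *\<^sub>R w"
      by (simp add: algebra_simps)
    also have "norm \<dots> \<le> g (norm v) * norm (v - w) + (g (norm v) - g (norm w)) * norm w"
      using g_pos[of "norm v"] g_mono[OF _ le]
      by (intro order.trans[OF norm_triangle_ineq]) auto
    also have "(g (norm v) - g (norm w)) * norm w \<le> (1 + \<alpha> N) * g (norm v) * (norm v - norm w)"
      using g_diff[OF _ le] by (simp add: mult.commute)
    also have "\<dots> \<le> (1 + \<alpha> N) * g (norm v) * norm (v - w)"
      using g_pos[of "norm v"] alphaN_pos by (intro mult_left_mono norm_triangle_ineq2) auto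
    finally show ?thesis by (simp add: algebra_simps)
  qed
  have "(2 + \<alpha> N) * g (norm x) * norm (v - w) \<le> (2 + \<alpha> N) * (g (norm v) + g (norm w)) * norm (v - w)"
    if "x = v \<or> x = w" for x
    using that g_pos[of "norm v"] g_pos[of "norm w"] alphaN_pos
    by (intro mult_right_mono mult_left_mono) auto
  then show ?thesis
    using *[of w v] *[of v w] by (cases "norm w \<le> norm v") (force simp: norm_minus_commute)+
qed


text \<open>The factor |v|^b need not be differentiable at 0, so the origin is treated by hand:
  there |v|^b v is o(|v|) and the derivative vanishes.\<close>

lemma norm_powr_differentiable:
  fixes v :: "'v::real_inner"
  assumes "0 < b"
  shows "(\<lambda>v::'v. norm v powr b *\<^sub>R v) differentiable (at v)"
proof (cases "v = 0")
  case False
  then have "norm v > 0" by simp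
  then show ?thesis
    using False has_real_derivative_powr[of "norm v" b]
    by (intro differentiable_scaleR differentiable_ident differentiable_compose[of "\<lambda>z. z powr b" norm]
        differentiable_norm_at) (auto intro: differentiableI simp: has_field_derivative_def)
next
  case True
  have "((\<lambda>h::'v. norm h powr b) \<longlongrightarrow> 0) (at 0)"
  proof -
    have "((\<lambda>h::'v. norm h powr b) \<longlongrightarrow> 0 powr b) (at 0)"
    proof (rule tendsto_powr')
      show "((\<lambda>h::'v. norm h) \<longlongrightarrow> 0) (at 0)" by (rule tendsto_norm_zero) (rule tendsto_ident_at)
    qed (use assms in auto)
    then show ?thesis using assms by simp
  qed
  then have "((\<lambda>h::'v. norm (norm h powr b *\<^sub>R h) / norm h) \<longlongrightarrow> 0) (at 0)"
  proof (rule Lim_transform_eventually)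
    show "\<forall>\<^sub>F h::'v in at 0. norm h powr b = norm (norm h powr b *\<^sub>R h) / norm h"
      by (auto simp: eventually_at_filter)
  qed
  then have "((\<lambda>v::'v. norm v powr b *\<^sub>R v) has_derivative (\<lambda>h. 0)) (at 0)"
    unfolding has_derivative_at by simp
  then show ?thesis using True differentiable_def by blast
qed

lemma gv_differentiable: "(\<lambda>v::'v::real_inner. g (norm v) *\<^sub>R v) differentiable (at v)"
proof -
  have "(\<lambda>v::'v. g (norm v) *\<^sub>R v) = (\<lambda>v. a 0 *\<^sub>R v + (\<Sum>i=1..N. a i *\<^sub>R (norm v powr \<alpha> i *\<^sub>R v)))"
    unfolding forch_g_def by (simp add: scaleR_add_left scaleR_sum_left)
  moreover have "(\<lambda>v::'v. a i *\<^sub>R (norm v powr \<alpha> i *\<^sub>R v)) differentiable (at v)" if "i \<in> {1..N}" for i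
    using norm_powr_differentiable[OF alpha_pos[OF that]]
    by (rule differentiable_scaleR[OF differentiable_const])
  then have "(\<lambda>v::'v. a 0 *\<^sub>R v + (\<Sum>i=1..N. a i *\<^sub>R (norm v powr \<alpha> i *\<^sub>R v))) differentiable (at v)"
    by (intro differentiable_add differentiable_scaleR differentiable_const
        differentiable_ident differentiable_sum) auto
  ultimately show ?thesis by simp
qed

lemma g_continuous: "continuous_on {0..} g"
  unfolding forch_g_def
  using alpha_pos by (intro continuous_intros continuous_on_powr') force+

end

section \<open>The rotation term and the inversion of the full law\<close>

lemma norm_rotJ_le: "norm k = 1 \<Longrightarrow> norm (rotJ k x) \<le> norm x"
  unfolding rotJ_def by (rule power2_le_imp_le) (simp_all only: norm_cross power_one mult_1_left
      diff_le_eq le_add_same_cancel1 zero_le_power2 norm_ge_zero)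

lemma rotJ_inner_self: "rotJ k x \<bullet> x = 0"
  by (simp add: rotJ_def dot_cross_self)

lemma rotJ_diff: "rotJ k (x - y) = rotJ k x - rotJ k y"
  by (simp add: rotJ_def cross3_def vec_eq_iff forall_3 algebra_simps)

lemma bounded_linear_rotJ: "bounded_linear (rotJ k)"
  unfolding rotJ_def linear_conv_bounded_linear[symmetric]
  by (rule linearI) (auto simp: cross_add_right cross_mult_right)

context forchheimer
begin

context
  fixes R :: real and k :: "real^3"
  assumes R_nonneg: "0 \<le> R" and k_unit: "norm k = 1"
begin

abbreviation F :: "real^3 \<Rightarrow> real^3" where "F \<equiv> forch_F N a \<alpha> R k"
abbreviation X :: "real^3 \<Rightarrow> real^3" where "X \<equiv> forch_X N a \<alpha> R k"

text \<open>The rotation contributes nothing, since J x is orthogonal to x. This is why monotonicity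
  holds with the same constant for every rotation number.\<close>

lemma F_monotone:
  "(g (norm v) + g (norm w)) * (norm (v - w))\<^sup>2 \<le> 2 * ((F v - F w) \<bullet> (v - w))"
proof -
  have "F v - F w = (g (norm v) *\<^sub>R v - g (norm w) *\<^sub>R w) + R *\<^sub>R rotJ k (v - w)"
    by (simp add: forch_F_def rotJ_diff algebra_simps)
  then have "(F v - F w) \<bullet> (v - w) = (g (norm v) *\<^sub>R v - g (norm w) *\<^sub>R w) \<bullet> (v - w)"
    by (simp add: inner_add_left rotJ_inner_self)
  then show ?thesis using gv_monotone[of v w] by simp
qed

text \<open>Monotonicity, g \<ge> a 0 and Cauchy--Schwarz. Injectivity, closedness of the range,
  continuity of the inverse and invertibility of the derivative are all drawn from this one
  inequality.\<close>

lemma F_expanding: "a 0 * norm (v - w) \<le> norm (F v - F w)"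
proof (cases "v = w")
  case False
  have "2 * a 0 * (norm (v - w))\<^sup>2 \<le> (g (norm v) + g (norm w)) * (norm (v - w))\<^sup>2"
    using g_ge_a0[of "norm v"] g_ge_a0[of "norm w"] by (intro mult_right_mono) auto
  also have "\<dots> \<le> 2 * (norm (F v - F w) * norm (v - w))"
    using F_monotone[of v w] norm_cauchy_schwarz[of "F v - F w" "v - w"] by linarith
  finally show ?thesis using False by (simp add: power2_eq_square)
qed simp

lemma F_differentiable: "F differentiable (at v)"
proof -
  have "(\<lambda>v. g (norm v) *\<^sub>R v + R *\<^sub>R rotJ k v) differentiable (at v)"
    by (intro differentiable_add gv_differentiable differentiable_scaleR differentiable_const
        bounded_linear_imp_differentiable bounded_linear_rotJ)
  then show ?thesis by (simp add: forch_F_def[abs_def])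
qed

lemma F_continuous: "continuous_on UNIV F"
  using F_differentiable by (simp add: continuous_on_eq_continuous_at differentiable_imp_continuous_within)

lemma F_inj: "inj F"
proof (rule injI)
  fix v w assume "F v = F w"
  then show "v = w" using F_expanding[of v w] a0_pos by (simp add: mult_le_0_iff)
qed

text \<open>The range is closed because \<open>F\<close> is expanding, and open by invariance of
  domain; connectedness of the space does the rest.\<close>

lemma F_surj: "surj F"
proof -
  have "closed (range F)"
    unfolding closed_sequential_limits
  proof (intro allI impI, elim conjE)
    fix f l assume f: "\<forall>n. f n \<in> range F" "f \<longlonglongrightarrow> l"
    then have "\<forall>n. \<exists>v. f n = F v" by auto
    then obtain h where h: "\<And>n. f n = F (h n)" using choice[of "\<lambda>n v. f n = F v"] by auto
    have "Cauchy h"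
    proof (rule metric_CauchyI)
      fix e :: real assume e: "0 < e"
      have "Cauchy f" using f(2) by (rule LIMSEQ_imp_Cauchy)
      then obtain M where M: "\<And>m n. m \<ge> M \<Longrightarrow> n \<ge> M \<Longrightarrow> dist (f m) (f n) < a 0 * e"
        using metric_CauchyD[of f "a 0 * e"] mult_pos_pos[OF a0_pos e] by auto
      have "dist (h m) (h n) < e" if "m \<ge> M" "n \<ge> M" for m n
        using le_less_trans[OF F_expanding[of "h m" "h n"], of "a 0 * e"] M[OF that] a0_pos
        by (simp add: dist_norm h)
      then show "\<exists>M. \<forall>m\<ge>M. \<forall>n\<ge>M. dist (h m) (h n) < e" by blast
    qed
    then obtain z where "h \<longlonglongrightarrow> z" using Cauchy_convergent_iff convergent_def by blast
    moreover have "continuous (at z) F"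
      using F_continuous by (simp add: continuous_on_eq_continuous_at)
    ultimately have "(\<lambda>n. F (h n)) \<longlonglongrightarrow> F z" by (metis isCont_tendsto_compose)
    then have "f \<longlonglongrightarrow> F z" by (simp add: h[symmetric])
    then have "l = F z" using f(2) by (intro LIMSEQ_unique)
    then show "l \<in> range F" by simp
  qed
  moreover have "open (range F)"
    using F_inj by (rule invariance_of_domain[OF F_continuous open_UNIV])
  ultimately have "range F = {} \<or> range F = UNIV" using clopen[of "range F"] by iprover
  then show ?thesis by simp
qed

lemma F_X [simp]: "F (X y) = y" and X_F [simp]: "X (F v) = v"
  unfolding forch_X_def using F_surj F_inj by (auto simp: surj_f_inv_f inv_f_f)

text \<open>The derivative of \<open>F\<close> expands lengths by at least \<open>a 0\<close>, so it
  has a linear left inverse, and this is the derivative of \<open>X\<close>. Continuity of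
  \<open>X\<close>, which the inverse function rule requires, is again the expansion of
  \<open>F\<close>.\<close>

lemma X_differentiable': "X differentiable (at y)"
proof -
  obtain F' where F': "(F has_derivative F') (at (X y))"
    using F_differentiable differentiable_def by blast
  have X_cont: "continuous (at y) X"
    unfolding continuous_at_eps_delta
  proof (intro allI impI)
    fix e :: real assume "0 < e"
    moreover have "dist (X z) (X y) < e" if "dist z y < a 0 * e" for z
      using le_less_trans[OF F_expanding[of "X z" "X y"], of "a 0 * e"] that a0_pos
      by (simp add: dist_norm)
    ultimately show "\<exists>d>0. \<forall>z. dist z y < d \<longrightarrow> dist (X z) (X y) < e"
      using a0_pos by (meson mult_pos_pos)
  qed
  have bl: "bounded_linear F'" using F' has_derivative_bounded_linear by blast
  have "inj F'"
  proof (subst linear_injective_0[OF bounded_linear.linear[OF bl]], intro allI impI, rule ccontr)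
    fix h assume h: "F' h = 0" "h \<noteq> 0"
    have "a 0 * norm h \<le> norm (F' h)"
      using has_derivative_expanding[OF F'] F_expanding by blast
    then show False using h a0_pos by (simp add: mult_le_0_iff)
  qed
  then obtain G' where "linear G'" "G' \<circ> F' = id"
    using linear_injective_left_inverse[OF bounded_linear.linear[OF bl]] by blast
  then have "(X has_derivative G') (at y)"
    by (intro has_derivative_inverse_basic[OF F' _ _ X_cont open_UNIV])
       (auto simp: linear_conv_bounded_linear)
  then show ?thesis using differentiable_def by blast
qed


lemma X_continuous: "continuous_on UNIV X"
  using X_differentiable' by (simp add: continuous_on_eq_continuous_at differentiable_imp_continuous_within)

end

end

section \<open>The structural inequalities for the inverse law\<close>

context forchheimer
begin

text \<open>Converts \<open>g s * s\<close>, which is comparable with the size of the argument of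
  \<open>X\<close>, and the energy density \<open>g s * s\<^sup>2\<close> back into powers of 1 + s.
  A bare factor g(s) is at most g(1) for s \<le> 1 and is dominated by the other terms for s >
  1.\<close>

lemma one_plus_powr_le_g:
  assumes "0 \<le> s"
  shows "(1 + s) powr (1 + \<alpha> N) \<le> 2 powr \<alpha> N / min (a 0) (a N) * (g 1 + 2 * (g s * s))"
    and "(1 + s) powr (2 + \<alpha> N) \<le> 2 powr \<alpha> N / min (a 0) (a N) * (2 * g 1 + 4 * (g s * s\<^sup>2))"
proof -
  have le1: "g s \<le> g 1 + g s * s"
  proof (cases "s \<le> 1")
    case True
    then show ?thesis using g_pos[of s] g_mono[OF assms, of 1] assms by (simp add: add_increasing2)
  next
    case False
    then have "g s * 1 \<le> g s * s" using g_pos[of s] by (intro mult_left_mono) auto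
    then show ?thesis using g_pos[of 1] by simp
  qed
  have le2: "g s \<le> g 1 + g s * s\<^sup>2"
  proof (cases "s \<le> 1")
    case True
    then show ?thesis using g_pos[of s] g_mono[OF assms, of 1] by (simp add: add_increasing2)
  next
    case False
    then have "g s * 1 \<le> g s * s\<^sup>2" using g_pos[of s] by (intro mult_left_mono) auto
    then show ?thesis using g_pos[of 1] by simp
  qed
  have low: "(1 + s) powr \<alpha> N \<le> 2 powr \<alpha> N / min (a 0) (a N) * g s"
    using g_lower[OF assms] a0_pos aN_pos by (simp add: field_simps)
  have "(1 + s) powr (1 + \<alpha> N) = (1 + s) powr \<alpha> N * (1 + s)"
    using assms by (simp add: powr_add)
  also have "\<dots> \<le> 2 powr \<alpha> N / min (a 0) (a N) * g s * (1 + s)"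
    using low assms by (intro mult_right_mono) auto
  also have "\<dots> = 2 powr \<alpha> N / min (a 0) (a N) * (g s + g s * s)" by (simp add: distrib_left mult.assoc)
  also have "\<dots> \<le> 2 powr \<alpha> N / min (a 0) (a N) * (g 1 + 2 * (g s * s))"
    using le1 a0_pos aN_pos by (intro mult_left_mono) (linarith, simp)
  finally show "(1 + s) powr (1 + \<alpha> N) \<le> 2 powr \<alpha> N / min (a 0) (a N) * (g 1 + 2 * (g s * s))" .
  have "(1 + s) powr (2 + \<alpha> N) = (1 + s) powr \<alpha> N * (1 + s)\<^sup>2"
    using assms by (simp add: powr_add powr_numeral)
  also have "\<dots> \<le> 2 powr \<alpha> N / min (a 0) (a N) * g s * (2 * (1 + s\<^sup>2))"
    using low assms g_pos[of s] a0_pos aN_pos sum_squares_bound[of 1 s]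
    by (intro mult_mono) (auto simp: power2_sum less_imp_le)
  also have "\<dots> = 2 powr \<alpha> N / min (a 0) (a N) * (2 * g s + 2 * (g s * s\<^sup>2))"
    by (simp only: distrib_left mult_1_right mult_ac)
  also have "\<dots> \<le> 2 powr \<alpha> N / min (a 0) (a N) * (2 * g 1 + 4 * (g s * s\<^sup>2))"
    using le2 a0_pos aN_pos by (intro mult_left_mono) (linarith, simp)
  finally show "(1 + s) powr (2 + \<alpha> N) \<le> 2 powr \<alpha> N / min (a 0) (a N) * (2 * g 1 + 4 * (g s * s\<^sup>2))" .
qed


lemma g_le_energy: "0 \<le> s \<Longrightarrow> g s \<le> (g 1 + 1) * (1 + g s * s\<^sup>2)"
proof -
  assume s: "0 \<le> s"
  have "g s \<le> g 1 + g s * s\<^sup>2"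
  proof (cases "s \<le> 1")
    case True
    then show ?thesis using g_pos[of s] g_mono[OF s, of 1] by (simp add: add_increasing2)
  next
    case False
    then have "g s * 1 \<le> g s * s\<^sup>2" using g_pos[of s] by (intro mult_left_mono) auto
    then show ?thesis using g_pos[of 1] by simp
  qed
  moreover have "0 \<le> g 1 * (g s * s\<^sup>2)" using g_pos[of 1] g_pos[of s] by simp
  ultimately show ?thesis by (simp add: algebra_simps)
qed

text \<open>\<open>\<kappa>0\<close> is built from the coefficients of \<open>g\<close> alone. The
  rotation number enters only where |y| or |y - y'| is bounded from above, through R |v| \<le> \<xi>
  (g / a 0) |v|, which is available because g \<ge> a 0. In the estimates obtained by testing with v
  it drops out by orthogonality.\<close>

theorem flow_law_exists:
  "\<exists>\<kappa>0. \<forall>\<kappa> R \<xi> k. \<kappa>0 \<le> \<kappa> \<and> 0 \<le> R \<and> R \<le> \<xi> \<and> 1 \<le> \<xi> \<and> norm k = 1 \<longrightarrow>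
     flow_law \<kappa> \<xi> (forch_exp N \<alpha>) (forch_X N a \<alpha> R k) (\<lambda>y. g (norm (forch_X N a \<alpha> R k y)))"
proof -
  define \<kappa>1 where "\<kappa>1 = 2 + \<alpha> N + 1 / (2 * a 0)"
  define b where "b = 1 + 1 / a 0"
  define A where "A = (\<Sum>i\<le>N. a i)"
  define c where "c = 2 powr \<alpha> N / min (a 0) (a N)"
  define \<theta> where "\<theta> = forch_exp N \<alpha>"
  define k4 where "k4 = A * (c * (g 1 + 2)) powr \<theta>"
  define k5 where "k5 = (b * (A + 1))\<^sup>2 * (c * (2 * g 1 + 4))"
  have A: "0 \<le> A" unfolding A_def using a_pos by (auto intro!: sum_nonneg intro: less_imp_le)
  have c: "0 < c" unfolding c_def using a0_pos aN_pos by simp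
  have b: "1 \<le> b" unfolding b_def using a0_pos by simp
  have g1: "0 < g 1" by (rule g_pos)
  have k4: "0 \<le> k4" and k5: "0 \<le> k5" using A c b g1 by (auto simp: k4_def k5_def)
  \<comment> \<open>The two identities explain the exponent. For large arguments |y| is comparable
    with (1 + |v|)^(1 + \<alpha> N), so the growth \<alpha> N of \<open>g\<close> becomes
    \<open>\<theta>\<close> when measured in |y|, and the growth 2 + \<alpha> N of the energy
    density becomes 2 - \<theta>.\<close>
  have \<theta>: "0 < \<theta>" "\<theta> < 1" "\<alpha> N = (1 + \<alpha> N) * \<theta>" "(1 + \<alpha> N) * (2 - \<theta>) = 2 + \<alpha> N"
    unfolding \<theta>_def forch_exp_def using alphaN_pos by (auto simp: field_simps)
  define \<kappa>0 where "\<kappa>0 = 1 + 1 / a 0 + 2 * \<kappa>1\<^sup>2 + k4 + k5 + (g 1 + 1)"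
  have "flow_law \<kappa> \<xi> \<theta> (X R k) (\<lambda>y. g (norm (X R k y)))"
    if \<kappa>0: "\<kappa>0 \<le> \<kappa>" and R: "0 \<le> R" and R\<xi>: "R \<le> \<xi>" and \<xi>: "1 \<le> \<xi>" and k: "norm k = 1" for \<kappa> R \<xi> k
  proof -
    note FX = F_X[OF R k]
    have pos: "0 \<le> 1 / a 0" "0 \<le> 2 * \<kappa>1\<^sup>2" using a0_pos by (simp_all add: less_imp_le)
    have \<kappa>: "1 \<le> \<kappa>" "1 / a 0 \<le> \<kappa>" "b \<le> \<kappa>" "2 * \<kappa>1\<^sup>2 \<le> \<kappa>" "k4 \<le> \<kappa>" "k5 \<le> \<kappa>" "g 1 + 1 \<le> \<kappa>"
      using \<kappa>0 pos k4 k5 g1 unfolding \<kappa>0_def b_def by linarith+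
    have yb: "norm y \<le> b * \<xi> * (g (norm (X R k y)) * norm (X R k y))" for y
    proof -
      define v where "v = X R k y"
      have "norm y = norm (forch_F N a \<alpha> R k v)" using FX by (simp add: v_def)
      also have "\<dots> \<le> g (norm v) * norm v + R * norm v"
        unfolding forch_F_def using norm_rotJ_le[OF k, of v] R g_pos[of "norm v"]
        by (intro order.trans[OF norm_triangle_ineq]) (auto intro!: add_mono mult_left_mono)
      also have "\<dots> \<le> \<xi> * (g (norm v) * norm v) + \<xi> * (g (norm v) / a 0 * norm v)"
      proof (intro add_mono)
        show "g (norm v) * norm v \<le> \<xi> * (g (norm v) * norm v)"
          using mult_right_mono[OF \<xi>, of "g (norm v) * norm v"] g_pos[of "norm v"] by simp
        have "1 \<le> g (norm v) / a 0" using g_ge_a0 a0_pos by simp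
        then have "1 * norm v \<le> g (norm v) / a 0 * norm v" by (intro mult_right_mono) auto
        then show "R * norm v \<le> \<xi> * (g (norm v) / a 0 * norm v)"
          using R R\<xi> by (intro mult_mono) auto
      qed
      also have "\<dots> = b * \<xi> * (g (norm v) * norm v)" by (simp add: b_def algebra_simps)
      finally show ?thesis by (simp add: v_def)
    qed
    \<comment> \<open>Testing with v removes the rotation, so this inequality is free of
      \<open>\<xi>\<close>; it keeps the upper bound of \<open>G\<close> free of
      \<open>\<xi>\<close> too.\<close>
    have gy: "g (norm (X R k y)) * norm (X R k y) \<le> norm y" for y
    proof -
      define v where "v = X R k y"
      have "g (norm v) * (norm v)\<^sup>2 = forch_F N a \<alpha> R k v \<bullet> v"
        by (simp add: forch_F_def inner_add_left rotJ_inner_self power2_norm_eq_inner)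
      also have "\<dots> \<le> norm (forch_F N a \<alpha> R k v) * norm v" by (rule norm_cauchy_schwarz)
      finally have "g (norm v) * norm v * norm v \<le> norm y * norm v"
        using FX by (simp add: v_def power2_eq_square)
      then show ?thesis by (cases "v = 0") (auto simp: v_def)
    qed
    show ?thesis
    proof
      show "1 \<le> \<kappa>" "1 \<le> \<xi>" "0 < \<theta>" "\<theta> < 1" using \<kappa> \<xi> \<theta> by auto
      fix y y' :: "real^3"
      define v where "v = X R k y"
      define v' where "v' = X R k y'"
      note vs = v_def[symmetric] v'_def[symmetric]
      have Fv: "forch_F N a \<alpha> R k v = y" "forch_F N a \<alpha> R k v' = y'" using FX by (auto simp: v_def v'_def)
      have gpos: "0 < g (norm v)" "0 < g (norm v')" by (auto intro: g_pos)
      have "1 = a 0 * (1 / a 0)" using a0_pos by simp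
      also have "\<dots> \<le> g (norm v) * \<kappa>" using g_ge_a0 \<kappa> a0_pos gpos by (intro mult_mono) auto
      finally show "1 \<le> \<kappa> * g (norm (X R k y))" by (simp add: vs mult.commute)
      have "forch_F N a \<alpha> R k v \<bullet> v = g (norm v) * (norm v)\<^sup>2"
        by (simp add: forch_F_def inner_add_left rotJ_inner_self power2_norm_eq_inner)
      then show "X R k y \<bullet> y = g (norm (X R k y)) * (norm (X R k y))\<^sup>2"
        unfolding vs Fv by (subst inner_commute)
      show "norm y \<le> \<kappa> * \<xi> * (g (norm (X R k y)) * norm (X R k y))"
        using \<kappa> \<xi> gpos by (intro order.trans[OF yb] mult_right_mono) (auto simp: vs)
      have mono: "(g (norm v) + g (norm v')) * (norm (v - v'))\<^sup>2 \<le> 2 * ((v - v') \<bullet> (y - y'))"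
        using F_monotone[OF R k, of v v'] Fv by (simp add: inner_commute)
      then show "(g (norm (X R k y)) + g (norm (X R k y'))) * (norm (X R k y - X R k y'))\<^sup>2
          \<le> 2 * ((X R k y - X R k y') \<bullet> (y - y'))" by (simp add: vs)
      define m where "m = g (norm v) + g (norm v')"
      have m: "0 < m" "2 * a 0 \<le> m"
        using gpos g_ge_a0[of "norm v"] g_ge_a0[of "norm v'"] unfolding m_def by auto
      have "norm (y - y') \<le> \<kappa>1 * \<xi> * m * norm (v - v')"
      proof -
        have "y - y' = (g (norm v) *\<^sub>R v - g (norm v') *\<^sub>R v') + R *\<^sub>R rotJ k (v - v')"
          unfolding Fv[symmetric] by (simp add: forch_F_def rotJ_diff algebra_simps)
        also have "norm \<dots> \<le> (2 + \<alpha> N) * m * norm (v - v') + R * norm (v - v')"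
          using gv_lipschitz[of v v'] norm_rotJ_le[OF k, of "v - v'"] R unfolding m_def
          by (intro order.trans[OF norm_triangle_ineq]) (auto intro!: add_mono mult_left_mono)
        also have "\<dots> \<le> (2 + \<alpha> N) * m * norm (v - v') * \<xi> + \<xi> * (m / (2 * a 0)) * norm (v - v')"
        proof (intro add_mono mult_right_mono)
          show "(2 + \<alpha> N) * m * norm (v - v') \<le> (2 + \<alpha> N) * m * norm (v - v') * \<xi>"
            using mult_left_mono[OF \<xi>, of "(2 + \<alpha> N) * m * norm (v - v')"] alphaN_pos m by simp
          have "1 \<le> m / (2 * a 0)" using m a0_pos by simp
          then have "R * 1 \<le> \<xi> * (m / (2 * a 0))" using R R\<xi> by (intro mult_mono) auto
          then show "R \<le> \<xi> * (m / (2 * a 0))" by simp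
        qed simp
        also have "\<dots> = \<kappa>1 * \<xi> * m * norm (v - v')" by (simp add: \<kappa>1_def algebra_simps)
        finally show ?thesis .
      qed
      \<comment> \<open>Squaring produces m^2 |v - v'|^2. One factor m together with |v - v'|^2 is
        traded for the inner product by monotonicity; the other survives as the weight.\<close>
      then have "(norm (y - y'))\<^sup>2 \<le> (\<kappa>1 * \<xi> * m * norm (v - v'))\<^sup>2" by (intro power_mono) auto
      also have "\<dots> = \<kappa>1\<^sup>2 * \<xi>\<^sup>2 * m * (m * (norm (v - v'))\<^sup>2)" by (simp add: power2_eq_square)
      also have "\<dots> \<le> \<kappa>1\<^sup>2 * \<xi>\<^sup>2 * m * (2 * ((v - v') \<bullet> (y - y')))"
        using mono m unfolding m_def by (intro mult_left_mono) auto
      also have "\<dots> = 2 * \<kappa>1\<^sup>2 * (\<xi>\<^sup>2 * (m * ((v - v') \<bullet> (y - y'))))" by simp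
      also have "\<dots> \<le> \<kappa> * (\<xi>\<^sup>2 * (m * ((v - v') \<bullet> (y - y'))))"
      proof (rule mult_right_mono)
        have "0 \<le> (v - v') \<bullet> (y - y')"
          using order.trans[OF mult_nonneg_nonneg mono] m unfolding m_def by auto
        then show "0 \<le> \<xi>\<^sup>2 * (m * ((v - v') \<bullet> (y - y')))" using m by simp
      qed (use \<kappa> in auto)
      finally show "(norm (y - y'))\<^sup>2 \<le> \<kappa> * \<xi>\<^sup>2 * ((g (norm (X R k y)) + g (norm (X R k y'))) * ((X R k y - X R k y') \<bullet> (y - y')))"
        by (simp add: vs m_def mult_ac)
      have up: "(1 + norm v) powr (1 + \<alpha> N) \<le> c * (g 1 + 2) * sqrt (1 + (norm y)\<^sup>2)"
      proof -
        have "1 \<le> sqrt (1 + (norm y)\<^sup>2)" "norm y \<le> sqrt (1 + (norm y)\<^sup>2)"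
          by (auto intro: real_le_rsqrt)
        then have "g 1 * 1 + 2 * (g (norm v) * norm v) \<le> g 1 * sqrt (1 + (norm y)\<^sup>2) + 2 * sqrt (1 + (norm y)\<^sup>2)"
          using gy[of y] g1 by (intro add_mono mult_left_mono) (auto simp: vs)
        then have "c * (g 1 + 2 * (g (norm v) * norm v)) \<le> c * ((g 1 + 2) * sqrt (1 + (norm y)\<^sup>2))"
          using c by (intro mult_left_mono) (auto simp: algebra_simps)
        then show ?thesis using one_plus_powr_le_g(1)[of "norm v"] unfolding c_def by simp
      qed
      have "g (norm v) \<le> A * (1 + norm v) powr \<alpha> N" unfolding A_def by (rule g_upper) simp
      also have "(1 + norm v) powr \<alpha> N = ((1 + norm v) powr (1 + \<alpha> N)) powr \<theta>"
        using \<theta>(3) by (simp add: powr_powr)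
      also have "A * \<dots> \<le> A * (c * (g 1 + 2) * sqrt (1 + (norm y)\<^sup>2)) powr \<theta>"
        using up A \<theta> by (intro mult_left_mono powr_mono2) auto
      also have "\<dots> = k4 * (sqrt (1 + (norm y)\<^sup>2)) powr \<theta>"
        unfolding k4_def using c g1 by (simp add: powr_mult)
      also have "(sqrt (1 + (norm y)\<^sup>2)) powr \<theta> = (1 + (norm y)\<^sup>2) powr (\<theta> / 2)"
          by (simp add: powr_half_sqrt[symmetric] powr_powr)
      also have "k4 * \<dots> \<le> \<kappa> * \<dots>" using \<kappa> by (intro mult_right_mono) auto
      finally show "g (norm (X R k y)) \<le> \<kappa> * (1 + (norm y)\<^sup>2) powr (\<theta> / 2)" by (simp add: vs)
      have "norm y \<le> b * (A + 1) * \<xi> * (1 + norm v) powr (1 + \<alpha> N)"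
      proof -
        have "g (norm v) * norm v \<le> (A * (1 + norm v) powr \<alpha> N) * (1 + norm v)"
          using g_upper[of "norm v"] A by (intro mult_mono) (auto simp: A_def)
        also have "\<dots> = A * (1 + norm v) powr (1 + \<alpha> N)" by (simp add: powr_add)
        also have "\<dots> \<le> (A + 1) * (1 + norm v) powr (1 + \<alpha> N)" by (intro mult_right_mono) auto
        finally have "b * \<xi> * (g (norm v) * norm v) \<le> b * \<xi> * ((A + 1) * (1 + norm v) powr (1 + \<alpha> N))"
          using b \<xi> by (intro mult_left_mono) auto
        then show ?thesis using yb[of y] by (simp add: vs mult_ac)
      qed
      then have "norm y powr (2 - \<theta>) \<le> (b * (A + 1) * \<xi> * (1 + norm v) powr (1 + \<alpha> N)) powr (2 - \<theta>)"
        using \<theta> by (intro powr_mono2) auto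
      also have "\<dots> = (b * (A + 1) * \<xi>) powr (2 - \<theta>) * ((1 + norm v) powr (1 + \<alpha> N)) powr (2 - \<theta>)"
        by (rule powr_mult)
      also have "((1 + norm v) powr (1 + \<alpha> N)) powr (2 - \<theta>) = (1 + norm v) powr (2 + \<alpha> N)"
        using \<theta>(4) by (simp add: powr_powr)
      also have "(b * (A + 1) * \<xi>) powr (2 - \<theta>) * (1 + norm v) powr (2 + \<alpha> N)
          \<le> (b * (A + 1) * \<xi>)\<^sup>2 * (c * ((2 * g 1 + 4) * (1 + g (norm v) * (norm v)\<^sup>2)))"
      proof (intro mult_mono)
        have "1 * 1 * 1 \<le> b * (A + 1) * \<xi>" using b A \<xi> by (intro mult_mono) auto
        then have "1 \<le> b * (A + 1) * \<xi>" by simp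
        then have "(b * (A + 1) * \<xi>) powr (2 - \<theta>) \<le> (b * (A + 1) * \<xi>) powr 2"
          using \<theta> by (intro powr_mono) auto
        then show "(b * (A + 1) * \<xi>) powr (2 - \<theta>) \<le> (b * (A + 1) * \<xi>)\<^sup>2"
          using b A \<xi> by (simp add: powr_numeral)
        have "(1 + norm v) powr (2 + \<alpha> N) \<le> c * (2 * g 1 + 4 * (g (norm v) * (norm v)\<^sup>2))"
          unfolding c_def by (rule one_plus_powr_le_g) simp
        also have "\<dots> \<le> c * ((2 * g 1 + 4) * (1 + g (norm v) * (norm v)\<^sup>2))"
          using c g1 gpos by (intro mult_left_mono) (auto simp: algebra_simps)
        finally show "(1 + norm v) powr (2 + \<alpha> N) \<le> c * ((2 * g 1 + 4) * (1 + g (norm v) * (norm v)\<^sup>2))" .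
      qed auto
      also have "\<dots> = k5 * (\<xi>\<^sup>2 * (1 + g (norm v) * (norm v)\<^sup>2))"
        unfolding k5_def by (simp add: power_mult_distrib mult_ac)
      also have "\<dots> \<le> \<kappa> * (\<xi>\<^sup>2 * (1 + g (norm v) * (norm v)\<^sup>2))"
        using \<kappa> gpos by (intro mult_right_mono) auto
      finally show "norm y powr (2 - \<theta>) \<le> \<kappa> * \<xi>\<^sup>2 * (1 + g (norm (X R k y)) * (norm (X R k y))\<^sup>2)"
        by (simp add: vs mult_ac)
      have "g (norm v) \<le> (g 1 + 1) * (1 + g (norm v) * (norm v)\<^sup>2)" by (rule g_le_energy) simp
      also have "\<dots> \<le> \<kappa> * (1 + g (norm v) * (norm v)\<^sup>2)"
        using \<kappa> gpos by (intro mult_right_mono) auto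
      finally show "g (norm (X R k y)) \<le> \<kappa> * (1 + g (norm (X R k y)) * (norm (X R k y))\<^sup>2)" by (simp add: vs)
      show "X R k differentiable (at y)" by (rule X_differentiable'[OF R k])
      show "continuous_on UNIV (\<lambda>y. g (norm (X R k y)))"
        by (rule continuous_on_compose2[OF g_continuous]) (auto intro!: continuous_intros X_continuous[OF R k])
    qed
  qed
  then show ?thesis unfolding \<theta>_def by blast
qed

end

section \<open>Integration by parts, cut-off functions and integration in time\<close>

text \<open>By translation invariance the difference quotients of \<open>f\<close> have integral 0,
  and dominated convergence passes to the limit. A bounded derivative along a single direction is
  the form in which derivatives are available later: \<open>dV\<close> is only known to be bounded,
  and averages over a segment are differentiated along that segment.\<close>

lemma integral_directional_derivative_zero:
  fixes f f' :: "'a::euclidean_space \<Rightarrow> real" and b :: 'a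
  assumes der: "\<And>x. ((\<lambda>s. f (x + s *\<^sub>R b)) has_real_derivative f' x) (at 0)"
    and bnd: "\<And>x. \<bar>f' x\<bar> \<le> L"
    and zero: "\<And>x. x \<notin> cbox p q \<Longrightarrow> f x = 0"
    and cont: "continuous_on UNIV f"
  shows "(f' has_integral 0) UNIV"
proof -
  define s where "s n = inverse (real (Suc n))" for n
  have s: "0 < s n" "s n \<le> 1" for n by (auto simp: s_def inverse_le_1_iff)
  have s0: "s \<longlonglongrightarrow> 0" unfolding s_def by (rule LIMSEQ_inverse_real_of_nat)
  define h where "h n x = (f (x + s n *\<^sub>R b) - f x) / s n" for n x
  have "f integrable_on cbox p q"
    by (rule integrable_continuous[OF continuous_on_subset[OF cont]]) simp
  then obtain I where I: "(f has_integral I) (cbox p q)" by blast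
  have shift: "((\<lambda>x. f (x + v)) has_integral I) UNIV" for v
  proof (rule has_integral_on_superset[OF has_integral_shift_cbox[OF I]])
    show "f (x + v) = 0" if "x \<notin> cbox (p - v) (q - v)" for x
      using that by (intro zero) (auto simp: mem_box inner_diff_left inner_add_left algebra_simps)
  qed simp
  have h0: "(h n has_integral 0) UNIV" for n
    using has_integral_divide[OF has_integral_diff[OF shift[of "s n *\<^sub>R b"] shift[of 0]], of "s n"]
    by (simp add: h_def[abs_def])
  have lip: "\<bar>f (x + t *\<^sub>R b) - f x\<bar> \<le> L * t" if "0 < t" for x t
  proof -
    have d: "((\<lambda>s. f (x + s *\<^sub>R b)) has_real_derivative f' (x + z *\<^sub>R b)) (at z)" for z
      using der[of "x + z *\<^sub>R b"] DERIV_shift[of "\<lambda>s. f (x + s *\<^sub>R b)" "f' (x + z *\<^sub>R b)" 0 z]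
      by (simp add: scaleR_add_left algebra_simps)
    have "\<exists>z>0. z < t \<and> f (x + t *\<^sub>R b) - f (x + 0 *\<^sub>R b) = (t - 0) * f' (x + z *\<^sub>R b)"
      using d by (intro MVT2 that)
    then obtain z where "f (x + t *\<^sub>R b) - f (x + 0 *\<^sub>R b) = (t - 0) * f' (x + z *\<^sub>R b)" by blast
    then show ?thesis using bnd[of "x + z *\<^sub>R b"] that by (simp add: abs_mult)
  qed
  \<comment> \<open>This provides a box containing the supports of all difference quotients with
    step at most 1: outside it no x + t b with 0 \<le> t \<le> 1 meets the support of
    \<open>f\<close>.\<close>
  have "compact ((\<lambda>(x, t). x - t *\<^sub>R b) ` (cbox p q \<times> {0..1}))"
    by (intro compact_continuous_image compact_Times compact_cbox)
       (auto intro!: continuous_intros simp: case_prod_unfold)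
  then obtain p' where p': "(\<lambda>(x, t). x - t *\<^sub>R b) ` (cbox p q \<times> {0..1}) \<subseteq> cbox (- p') p'"
    using bounded_subset_cbox_symmetric compact_imp_bounded by metis
  have dom: "norm (h n x) \<le> (if x \<in> cbox (- p') p' then L else 0)" for n x
  proof (cases "x \<in> cbox (- p') p'")
    case True
    then show ?thesis using lip[OF s(1), of x n] s(1)[of n] by (simp add: h_def field_simps)
  next
    case False
    have "x + t *\<^sub>R b \<notin> cbox p q" if "0 \<le> t" "t \<le> 1" for t
    proof
      assume "x + t *\<^sub>R b \<in> cbox p q"
      then have "(\<lambda>(x, t). x - t *\<^sub>R b) (x + t *\<^sub>R b, t) \<in> cbox (- p') p'"
        using that by (intro set_mp[OF p'] imageI) auto
      then show False using False by simp
    qed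
    from zero[OF this[of 0]] zero[OF this[of "s n"]] show ?thesis
      using s[of n] False by (simp add: h_def less_imp_le)
  qed
  have lim: "(\<lambda>n. h n x) \<longlonglongrightarrow> f' x" for x
  proof -
    have "((\<lambda>t. (f (x + t *\<^sub>R b) - f x) / t) \<longlongrightarrow> f' x) (at 0)"
      using der[of x] by (simp add: has_field_derivative_iff)
    then show ?thesis
      unfolding h_def by (rule filterlim_compose) (use s0 s(1) in \<open>auto simp: filterlim_at less_imp_neq[THEN not_sym]\<close>)
  qed
  have int: "(\<lambda>x. if x \<in> cbox (- p') p' then L else 0) integrable_on UNIV"
    by (simp only: integrable_restrict_UNIV) (rule integrable_const)
  have "f' integrable_on UNIV" "(\<lambda>n. integral UNIV (h n)) \<longlonglongrightarrow> integral UNIV f'"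
    using dominated_convergence[of h UNIV "\<lambda>x. if x \<in> cbox (- p') p' then L else 0" f'] h0 int dom lim
    by blast+
  moreover have "integral UNIV (h n) = 0" for n using h0 by (rule integral_unique)
  ultimately show ?thesis by (simp add: LIMSEQ_const_iff has_integral_iff)
qed

text \<open>Each coordinate is an instance of the preceding lemma. The product with
  \<open>\<eta>\<close> is extended by 0; this is differentiable everywhere because
  \<open>\<eta>\<close> has a full derivative at points of \<open>K\<close>, while the complement of
  \<open>K\<close> is open and the product vanishes there.\<close>

lemma integral_by_parts:
  fixes \<eta> :: "'a::euclidean_space \<Rightarrow> real" and V :: "'a \<Rightarrow> 'a"
  assumes K: "compact K" "K \<subseteq> cbox p q"
    and \<eta>: "\<And>x. x \<in> K \<Longrightarrow> GDERIV \<eta> x :> d\<eta> x" and d\<eta>: "continuous_on K d\<eta>"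
    and zero: "\<And>x. x \<notin> K \<Longrightarrow> \<eta> x = 0" "\<And>x. x \<notin> K \<Longrightarrow> d\<eta> x = 0"
    and V: "\<And>x. x \<in> K \<Longrightarrow> (V has_derivative V' x) (at x)"
    and V': "\<And>x b. x \<in> K \<Longrightarrow> b \<in> Basis \<Longrightarrow> norm (V' x b) \<le> L"
  shows "((\<lambda>x. \<eta> x * (\<Sum>b\<in>Basis. V' x b \<bullet> b) + V x \<bullet> d\<eta> x) has_integral 0) (cbox p q)"
proof -
  define f' where "f' b x = \<eta> x * (V' x b \<bullet> b) + (V x \<bullet> b) * (d\<eta> x \<bullet> b)" for b x
  have "(f' b has_integral 0) UNIV" if b: "b \<in> Basis" for b
  proof -
    define f where "f x = \<eta> x * (V x \<bullet> b)" for x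
    have der: "\<exists>D. (f has_derivative D) (at x) \<and> D b = f' b x" for x
    proof (cases "x \<in> K")
      case True
      have "(f has_derivative (\<lambda>h. \<eta> x * (V' x h \<bullet> b) + (h \<bullet> d\<eta> x) * (V x \<bullet> b))) (at x)"
        unfolding f_def using \<eta>[OF True, unfolded gderiv_def] V[OF True]
        by (intro has_derivative_mult has_derivative_inner_left)
      then show ?thesis by (intro exI, intro conjI, assumption) (simp add: f'_def inner_commute mult.commute)
    next
      case False
      have "(f has_derivative (\<lambda>h. 0)) (at x)"
        by (rule has_derivative_transform_within_open[of "\<lambda>x. 0" _ _ _ "- K"])
           (use K False zero in \<open>auto simp: f_def compact_imp_closed open_Compl\<close>)
      then show ?thesis using zero False by (auto simp: f'_def)
    qed
    have cont: "continuous_on UNIV f"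
      using der by (metis continuous_at_imp_continuous_on has_derivative_continuous)
    have bound: "\<exists>L. \<forall>x. \<bar>f' b x\<bar> \<le> L"
    proof -
      have cV: "continuous_on K V" and c\<eta>: "continuous_on K \<eta>"
        using V \<eta> unfolding gderiv_def
        by (meson continuous_at_imp_continuous_on has_derivative_continuous)+
      obtain A where A: "\<And>x. x \<in> K \<Longrightarrow> norm (\<eta> x) \<le> A"
        using compact_imp_bounded[OF compact_continuous_image[OF c\<eta> K(1)]] by (auto simp: bounded_iff)
      have "continuous_on K (\<lambda>x. (V x \<bullet> b) * (d\<eta> x \<bullet> b))"
        using cV d\<eta> by (intro continuous_intros)
      then obtain B where B: "\<And>x. x \<in> K \<Longrightarrow> norm ((V x \<bullet> b) * (d\<eta> x \<bullet> b)) \<le> B"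
        using compact_imp_bounded[OF compact_continuous_image[OF _ K(1)]] by (fastforce simp: bounded_iff)
      have "\<bar>f' b x\<bar> \<le> max 0 (\<bar>A\<bar> * \<bar>L\<bar> + B)" for x
      proof (cases "x \<in> K")
        case True
        have "\<bar>V' x b \<bullet> b\<bar> \<le> \<bar>L\<bar>"
          using V'[OF True b] Cauchy_Schwarz_ineq2[of "V' x b" b] b by auto
        then have "\<bar>\<eta> x * (V' x b \<bullet> b)\<bar> \<le> \<bar>A\<bar> * \<bar>L\<bar>"
          using A[OF True] unfolding abs_mult by (intro mult_mono) auto
        then show ?thesis using B[OF True] unfolding f'_def by auto
      next
        case False
        then show ?thesis using zero by (simp add: f'_def)
      qed
      then show ?thesis by blast
    qed
    then obtain L' where L': "\<And>x. \<bar>f' b x\<bar> \<le> L'" by blast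
    show ?thesis
    proof (rule integral_directional_derivative_zero[OF _ L' _ cont, where b = b])
      fix x
      obtain D where D: "(f has_derivative D) (at x)" "D b = f' b x" using der by blast
      have "((\<lambda>s. (f (x + s *\<^sub>R b) - f x) /\<^sub>R s) \<longlongrightarrow> D b) (at 0)"
        by (rule has_derivative_quotient[OF D(1)])
      then show "((\<lambda>s. f (x + s *\<^sub>R b)) has_real_derivative f' b x) (at 0)"
        using D by (simp add: has_field_derivative_iff divide_inverse mult.commute)
      show "f x = 0" if "x \<notin> cbox p q" using that K zero unfolding f_def by auto
    qed
  qed
  then have "((\<lambda>x. \<Sum>b\<in>Basis. f' b x) has_integral (\<Sum>b\<in>(Basis::'a set). 0)) UNIV"
    by (intro has_integral_sum) auto
  moreover have eq: "(\<Sum>b\<in>Basis. f' b x) = \<eta> x * (\<Sum>b\<in>Basis. V' x b \<bullet> b) + V x \<bullet> d\<eta> x" for x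
    unfolding f'_def sum.distrib by (simp add: sum_distrib_left euclidean_inner[of "V x" "d\<eta> x"])
  ultimately have "((\<lambda>x. \<eta> x * (\<Sum>b\<in>Basis. V' x b \<bullet> b) + V x \<bullet> d\<eta> x) has_integral 0) UNIV" by simp
  moreover have "(\<lambda>x. \<eta> x * (\<Sum>b\<in>Basis. V' x b \<bullet> b) + V x \<bullet> d\<eta> x)
      = (\<lambda>x. if x \<in> cbox p q then \<eta> x * (\<Sum>b\<in>Basis. V' x b \<bullet> b) + V x \<bullet> d\<eta> x else 0)"
  proof -
    have "\<eta> x = 0 \<and> d\<eta> x = 0" if "x \<notin> cbox p q" for x using that K zero by blast
    then show ?thesis by (auto simp: fun_eq_iff)
  qed
  ultimately have "((\<lambda>x. if x \<in> cbox p q then \<eta> x * (\<Sum>b\<in>Basis. V' x b \<bullet> b) + V x \<bullet> d\<eta> x else 0) has_integral 0) UNIV"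
    by (rule back_subst)
  then show ?thesis by (simp only: has_integral_restrict_UNIV)
qed

section \<open>Integration in time down to the initial instant\<close>

lemma nn_integral_cbox:
  fixes f :: "'a::euclidean_space \<Rightarrow> real"
  assumes "continuous_on (cbox a b) f" "\<And>x. x \<in> cbox a b \<Longrightarrow> 0 \<le> f x"
  shows "(\<integral>\<^sup>+x\<in>cbox a b. ennreal (f x) \<partial>lborel) = ennreal (integral (cbox a b) f)"
  using assms by (intro nn_integral_has_integral_lebesgue' integrable_integral integrable_continuous)

text \<open>Monotone convergence along times decreasing to 0. Estimates are derived on
  \<open>{t..T}\<close> with t > 0, where the solution is differentiable in time, while the quantity
  \<open>y\<close> on the right is continuous up to 0.\<close>

lemma nn_integral_Ioc_le:
  fixes f :: "real \<Rightarrow> real"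
  assumes T: "0 < T" and cont: "continuous_on {0<..T} f"
    and le: "\<And>t. 0 < t \<Longrightarrow> t \<le> T \<Longrightarrow> (\<integral>\<^sup>+s\<in>{t..T}. ennreal (f s) \<partial>lborel) \<le> ennreal (y t) + Q"
    and y: "(y \<longlongrightarrow> y0) (at 0 within {0..T})"
  shows "(\<integral>\<^sup>+s\<in>{0<..T}. ennreal (f s) \<partial>lborel) \<le> ennreal y0 + Q"
proof -
  define s where "s n = T * inverse (real (Suc n))" for n
  have s: "0 < s n" "s n \<le> T" for n using T by (auto simp: s_def field_simps)
  have s0: "s \<longlonglongrightarrow> 0" unfolding s_def using tendsto_mult[OF tendsto_const LIMSEQ_inverse_real_of_nat, of T] by simp
  have dec: "s n \<le> s m" if "m \<le> n" for m n
    unfolding s_def using T that by (intro mult_left_mono le_imp_inverse_le) auto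
  have "(\<lambda>n. \<integral>\<^sup>+t. ennreal (f t) * indicator {s n..T} t \<partial>lborel)
      \<longlonglongrightarrow> (\<integral>\<^sup>+t. ennreal (f t) * indicator {0<..T} t \<partial>lborel)"
  proof (rule nn_integral_LIMSEQ)
    show "incseq (\<lambda>n t. ennreal (f t) * indicator {s n..T} t)"
      using dec by (auto simp: incseq_def le_fun_def indicator_def intro: order.trans)
    show "(\<lambda>t. ennreal (f t) * indicator {s n..T} t) \<in> borel_measurable lborel" for n
    proof -
      have "(\<lambda>t. indicator {s n..T} t *\<^sub>R f t) \<in> borel_measurable borel"
        by (rule borel_measurable_continuous_on_indicator[OF _ continuous_on_subset[OF cont]])
           (use s(1)[of n] in auto)
      then have "(\<lambda>t. ennreal (indicator {s n..T} t *\<^sub>R f t)) \<in> borel_measurable borel" by measurable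
      moreover have "(\<lambda>t. ennreal (indicator {s n..T} t *\<^sub>R f t)) = (\<lambda>t. ennreal (f t) * indicator {s n..T} t)"
        by (auto simp: indicator_def)
      ultimately show ?thesis by simp
    qed
    show "(\<lambda>n. ennreal (f t) * indicator {s n..T} t) \<longlonglongrightarrow> ennreal (f t) * indicator {0<..T} t" for t
    proof (cases "0 < t")
      case True
      have "\<forall>\<^sub>F n in sequentially. s n < t" using order_tendstoD(2)[OF s0 True] .
      then have "\<forall>\<^sub>F n in sequentially. ennreal (f t) * indicator {s n..T} t = ennreal (f t) * indicator {0<..T} t"
        by eventually_elim (use True in \<open>auto simp: indicator_def\<close>)
      then show ?thesis by (rule tendsto_eventually)
    next
      case False
      then have "\<not> s n \<le> t" for n using s(1)[of n] by linarith
      then show ?thesis using False by (simp add: indicator_def)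
    qed
  qed
  moreover have "(\<lambda>n. ennreal (y (s n)) + Q) \<longlonglongrightarrow> ennreal y0 + Q"
  proof (intro tendsto_add tendsto_ennrealI tendsto_const)
    show "(\<lambda>n. y (s n)) \<longlonglongrightarrow> y0"
      by (rule filterlim_compose[OF y])
         (use s s0 in \<open>auto simp: filterlim_at less_imp_le less_imp_neq[THEN not_sym]\<close>)
  qed
  ultimately show ?thesis
    by (rule LIMSEQ_le) (use le s in auto)
qed

text \<open>The differential inequality is integrated over \<open>{t0..T}\<close>, the nonnegative
  final value of \<open>y\<close> is dropped, and t0 tends to 0. The right side is an extended
  integral, so \<open>q\<close> may be singular at 0.\<close>

lemma time_integral_bound:
  fixes y y' p q :: "real \<Rightarrow> real"
  assumes T: "0 < T" and y: "continuous_on {0..T} y" "\<And>t. 0 \<le> t \<Longrightarrow> t \<le> T \<Longrightarrow> 0 \<le> y t"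
    and der: "\<And>t0 t. 0 < t0 \<Longrightarrow> t0 \<le> t \<Longrightarrow> t \<le> T \<Longrightarrow> (y has_vector_derivative y' t) (at t within {t0..T})"
    and le: "\<And>t. 0 < t \<Longrightarrow> t \<le> T \<Longrightarrow> y' t + p t \<le> q t"
    and p: "continuous_on {0<..T} p" "\<And>t. 0 < t \<Longrightarrow> t \<le> T \<Longrightarrow> 0 \<le> p t"
    and q: "continuous_on {0<..T} q" "\<And>t. 0 < t \<Longrightarrow> t \<le> T \<Longrightarrow> 0 \<le> q t"
  shows "(\<integral>\<^sup>+t\<in>{0<..T}. ennreal (p t) \<partial>lborel)
    \<le> ennreal (y 0) + (\<integral>\<^sup>+t\<in>{0<..T}. ennreal (q t) \<partial>lborel)"
proof (rule nn_integral_Ioc_le[OF T p(1)])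
  show "(y \<longlongrightarrow> y 0) (at 0 within {0..T})" using y(1) T by (simp add: continuous_on_def)
  fix t0 assume t0: "0 < t0" "t0 \<le> T"
  have cp: "continuous_on (cbox t0 T) p" and cq: "continuous_on (cbox t0 T) q"
    using t0 by (auto intro: continuous_on_subset[OF p(1)] continuous_on_subset[OF q(1)])
  have ftc: "(y' has_integral y T - y t0) (cbox t0 T)"
    using fundamental_theorem_of_calculus[of t0 T y y'] der[OF t0(1)] t0 by simp
  have "integral (cbox t0 T) p - integral (cbox t0 T) q = integral (cbox t0 T) (\<lambda>t. p t - q t)"
    by (rule integral_diff[symmetric]) (rule integrable_continuous, fact)+
  also have "\<dots> \<le> integral (cbox t0 T) (\<lambda>t. - y' t)"
  proof (rule integral_le)
    show "(\<lambda>t. p t - q t) integrable_on cbox t0 T"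
      by (intro integrable_diff integrable_continuous cp cq)
    show "(\<lambda>t. - y' t) integrable_on cbox t0 T" using ftc by (intro integrable_neg) blast
    show "p t - q t \<le> - y' t" if "t \<in> cbox t0 T" for t using le[of t] that t0 by auto
  qed
  also have "\<dots> = y t0 - y T" using ftc by (simp add: integral_unique)
  also have "\<dots> \<le> y t0" using y(2)[of T] T by simp
  finally have le': "integral (cbox t0 T) p \<le> y t0 + integral (cbox t0 T) q" by simp
  have "(\<integral>\<^sup>+s\<in>cbox t0 T. ennreal (p s) \<partial>lborel) = ennreal (integral (cbox t0 T) p)"
    using cp p(2) t0 by (intro nn_integral_cbox) auto
  also have "\<dots> \<le> ennreal (y t0 + integral (cbox t0 T) q)" using le' by (rule ennreal_leI)
  also have "\<dots> = ennreal (y t0) + ennreal (integral (cbox t0 T) q)"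
    using y(2) t0 q(2) by (intro ennreal_plus integral_nonneg integrable_continuous cq) auto
  also have "ennreal (integral (cbox t0 T) q) = (\<integral>\<^sup>+s\<in>cbox t0 T. ennreal (q s) \<partial>lborel)"
    using cq q(2) t0 by (intro nn_integral_cbox[symmetric]) auto
  also have "\<dots> \<le> (\<integral>\<^sup>+t\<in>{0<..T}. ennreal (q t) \<partial>lborel)"
    using t0 by (intro nn_integral_mono) (auto simp: indicator_def)
  finally show "(\<integral>\<^sup>+s\<in>{t0..T}. ennreal (p s) \<partial>lborel) \<le> ennreal (y t0) + (\<integral>\<^sup>+t\<in>{0<..T}. ennreal (q t) \<partial>lborel)"
    by (simp add: add_left_mono)
qed

section \<open>Cut-off and truncation functions\<close>

lemma DERIV_max_zero_power2: "((\<lambda>z. (max 0 z)\<^sup>2) has_real_derivative 2 * max 0 z) (at z)"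
proof (cases "z = 0")
  case True
  have "((\<lambda>h. (max 0 h)\<^sup>2 / h) \<longlongrightarrow> 0) (at (0::real))"
  proof (rule Lim_null_comparison)
    show "\<forall>\<^sub>F h in at (0::real). norm ((max 0 h)\<^sup>2 / h) \<le> \<bar>h\<bar>"
      by (auto simp: eventually_at_filter max_def power2_eq_square)
  qed (auto intro!: tendsto_eq_intros)
  then show ?thesis using True by (simp add: has_field_derivative_iff)
next
  case False
  then consider "z < 0" | "0 < z" by linarith
  then show ?thesis
  proof cases
    case 1
    have "((\<lambda>z::real. 0) has_real_derivative 0) (at z)" by simp
    then have "((\<lambda>z. (max 0 z)\<^sup>2) has_real_derivative 0) (at z)"
      by (rule has_field_derivative_transform_within_open[of _ _ _ "{..<0}"]) (use 1 in auto)
    then show ?thesis using 1 by simp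
  next
    case 2
    have "((\<lambda>z::real. z\<^sup>2) has_real_derivative 2 * z) (at z)" by (auto intro!: derivative_eq_intros)
    then have "((\<lambda>z. (max 0 z)\<^sup>2) has_real_derivative 2 * z) (at z)"
      by (rule has_field_derivative_transform_within_open[of _ _ _ "{0<..}"]) (use 2 in auto)
    then show ?thesis using 2 by simp
  qed
qed

text \<open>Squaring the positive part makes the function C^1, and the explicit formula gives
  explicit constants: gradient at most 4 / \<rho> and a known lower bound on every smaller
  concentric ball.\<close>

definition cutoff :: "'a::real_inner \<Rightarrow> real \<Rightarrow> 'a \<Rightarrow> real" where
  "cutoff c \<rho> x = (max 0 (1 - (norm (x - c))\<^sup>2 / \<rho>\<^sup>2))\<^sup>2"

definition dcutoff :: "'a::real_inner \<Rightarrow> real \<Rightarrow> 'a \<Rightarrow> 'a" where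
  "dcutoff c \<rho> x = (- 4 * max 0 (1 - (norm (x - c))\<^sup>2 / \<rho>\<^sup>2) / \<rho>\<^sup>2) *\<^sub>R (x - c)"

lemma GDERIV_cutoff: "GDERIV (cutoff c \<rho>) x :> dcutoff c \<rho> x"
proof -
  have "GDERIV (\<lambda>x. (x - c) \<bullet> (x - c)) x :> 2 *\<^sub>R (x - c)"
    unfolding gderiv_def
    by (rule has_derivative_eq_rhs, rule has_derivative_inner) (auto intro!: derivative_eq_intros simp: inner_commute)
  then have "GDERIV (\<lambda>x. 1 - (norm (x - c))\<^sup>2 / \<rho>\<^sup>2) x :> (- 1 / \<rho>\<^sup>2) *\<^sub>R (2 *\<^sub>R (x - c))"
    unfolding power2_norm_eq_inner
    by (rule GDERIV_DERIV_compose)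
      (rule DERIV_cong[OF DERIV_diff[OF DERIV_const DERIV_cdivide[OF DERIV_ident]]], simp)
  then have "GDERIV (\<lambda>x. 1 - (norm (x - c))\<^sup>2 / \<rho>\<^sup>2) x :> (- 2 / \<rho>\<^sup>2) *\<^sub>R (x - c)"
    by simp
  then have "GDERIV (\<lambda>x. (max 0 (1 - (norm (x - c))\<^sup>2 / \<rho>\<^sup>2))\<^sup>2) x
      :> (2 * max 0 (1 - (norm (x - c))\<^sup>2 / \<rho>\<^sup>2)) *\<^sub>R ((- 2 / \<rho>\<^sup>2) *\<^sub>R (x - c))"
    by (rule GDERIV_DERIV_compose) (rule DERIV_max_zero_power2)
  then show ?thesis by (simp add: cutoff_def[abs_def] dcutoff_def)
qed

lemma cutoff_continuous [continuous_intros]: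
  "continuous_on S f \<Longrightarrow> continuous_on S (\<lambda>x. cutoff c \<rho> (f x))"
  unfolding cutoff_def divide_inverse by (intro continuous_intros)

lemma dcutoff_continuous [continuous_intros]:
  "continuous_on S f \<Longrightarrow> continuous_on S (\<lambda>x. dcutoff c \<rho> (f x))"
  unfolding dcutoff_def divide_inverse by (intro continuous_intros)

lemma cutoff_nonneg [simp]: "0 \<le> cutoff c \<rho> x"
  by (simp add: cutoff_def)

lemma cutoff_le_1 [simp]: "cutoff c \<rho> x \<le> 1"
  unfolding cutoff_def by (rule power_le_one) auto

lemma cutoff_eq_0: "0 < \<rho> \<Longrightarrow> x \<notin> cball c \<rho> \<Longrightarrow> cutoff c \<rho> x = 0"
  and dcutoff_eq_0: "0 < \<rho> \<Longrightarrow> x \<notin> cball c \<rho> \<Longrightarrow> dcutoff c \<rho> x = 0"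
proof -
  assume \<rho>: "0 < \<rho>" "x \<notin> cball c \<rho>"
  then have "\<rho>\<^sup>2 \<le> (norm (x - c))\<^sup>2"
    by (intro power_mono) (auto simp: dist_norm norm_minus_commute)
  then have "max 0 (1 - (norm (x - c))\<^sup>2 / \<rho>\<^sup>2) = 0" using \<rho> by (simp add: max_def)
  then show "cutoff c \<rho> x = 0" "dcutoff c \<rho> x = 0" unfolding cutoff_def dcutoff_def by simp_all
qed

lemma norm_dcutoff_le: "0 < \<rho> \<Longrightarrow> norm (dcutoff c \<rho> x) \<le> 4 / \<rho>"
proof (cases "x \<in> cball c \<rho>")
  case True
  assume \<rho>: "0 < \<rho>"
  have "norm (dcutoff c \<rho> x) = 4 * max 0 (1 - (norm (x - c))\<^sup>2 / \<rho>\<^sup>2) / \<rho>\<^sup>2 * norm (x - c)"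
    unfolding dcutoff_def by simp
  also have "\<dots> \<le> 4 * 1 / \<rho>\<^sup>2 * \<rho>"
    using True \<rho> by (intro mult_mono divide_right_mono) (auto simp: dist_norm norm_minus_commute)
  finally show ?thesis using \<rho> by (simp add: power2_eq_square)
qed (simp add: dcutoff_eq_0)

lemma cutoff_lower:
  assumes "x \<in> cball c (s * \<rho>)" "0 < \<rho>" "0 \<le> s" "s \<le> 1"
  shows "(1 - s\<^sup>2)\<^sup>2 \<le> cutoff c \<rho> x"
proof -
  have "(norm (x - c))\<^sup>2 \<le> (s * \<rho>)\<^sup>2"
    using assms by (intro power_mono) (auto simp: dist_norm norm_minus_commute)
  then have "1 - s\<^sup>2 \<le> 1 - (norm (x - c))\<^sup>2 / \<rho>\<^sup>2" using assms by (simp add: power_mult_distrib field_simps)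
  then show ?thesis unfolding cutoff_def using assms by (intro power_mono) (auto simp: power_le_one)
qed

text \<open>Since \<open>trunc M\<close> is 1-Lipschitz and fixes \<open>[-M, M]\<close>, replacing \<open>\<Psi>\<close> by \<open>trunc M \<Psi>\<close> does not
  increase \<open>|u - \<Psi>|\<close> but makes it bounded in terms of \<open>M\<close>. The arctangent keeps it \<open>C\<^sup>1\<close>.\<close>

definition trunc :: "real \<Rightarrow> real \<Rightarrow> real" where
  "trunc M s = s - (max 0 (s - M) - arctan (max 0 (s - M))) + (max 0 (- s - M) - arctan (max 0 (- s - M)))"

definition dtrunc :: "real \<Rightarrow> real \<Rightarrow> real" where
  "dtrunc M s = 1 - (max 0 (s - M))\<^sup>2 / (1 + (max 0 (s - M))\<^sup>2) - (max 0 (- s - M))\<^sup>2 / (1 + (max 0 (- s - M))\<^sup>2)"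

text \<open>At 0 the two branches fit together because arctan has derivative 1 there, so that h -
  arctan h is o(h).\<close>

lemma DERIV_max_minus_arctan:
  "((\<lambda>z. max 0 z - arctan (max 0 z)) has_real_derivative (max 0 z)\<^sup>2 / (1 + (max 0 z)\<^sup>2)) (at z)"
proof (cases "z = 0")
  case True
  have "((\<lambda>h::real. (max 0 h - arctan (max 0 h)) / h) \<longlongrightarrow> 0) (at 0)"
  proof (rule Lim_null_comparison)
    have "((\<lambda>h. (h - arctan h) / h) \<longlongrightarrow> 0) (at (0::real))"
      using DERIV_diff[OF DERIV_ident DERIV_arctan, of 0] by (simp add: has_field_derivative_iff)
    then show "((\<lambda>h. \<bar>(h - arctan h) / h\<bar>) \<longlongrightarrow> 0) (at (0::real))" by (rule tendsto_rabs_zero)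
    show "\<forall>\<^sub>F h in at (0::real). norm ((max 0 h - arctan (max 0 h)) / h) \<le> \<bar>(h - arctan h) / h\<bar>"
      by (intro always_eventually allI) (auto simp: max_def simp del: abs_divide)
  qed
  then show ?thesis using True by (simp add: has_field_derivative_iff)
next
  case False
  then consider "z < 0" | "0 < z" by linarith
  then show ?thesis
  proof cases
    case 1
    have "((\<lambda>z::real. 0) has_real_derivative 0) (at z)" by simp
    then have "((\<lambda>z. max 0 z - arctan (max 0 z)) has_real_derivative 0) (at z)"
      by (rule has_field_derivative_transform_within_open[of _ _ _ "{..<0}"]) (use 1 in auto)
    then show ?thesis using 1 by simp
  next
    case 2
    have "1 - 1 / (1 + z\<^sup>2) = z\<^sup>2 / (1 + z\<^sup>2)"
      using add_pos_nonneg[of 1 "z\<^sup>2"] by (simp add: field_simps)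
    then have "((\<lambda>z::real. z - arctan z) has_real_derivative z\<^sup>2 / (1 + z\<^sup>2)) (at z)"
      using DERIV_diff[OF DERIV_ident DERIV_arctan, of z] by (simp add: inverse_eq_divide)
    then have "((\<lambda>z. max 0 z - arctan (max 0 z)) has_real_derivative z\<^sup>2 / (1 + z\<^sup>2)) (at z)"
      by (rule has_field_derivative_transform_within_open[of _ _ _ "{0<..}"]) (use 2 in auto)
    then show ?thesis using 2 by simp
  qed
qed

lemma DERIV_trunc: "(trunc M has_real_derivative dtrunc M s) (at s)"
proof -
  define \<rho> where "\<rho> z = max 0 z - arctan (max 0 z)" for z :: real
  define \<rho>' where "\<rho>' z = (max 0 z)\<^sup>2 / (1 + (max 0 z)\<^sup>2)" for z :: real
  have \<rho>: "(\<rho> has_real_derivative \<rho>' z) (at z)" for z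
    unfolding \<rho>_def \<rho>'_def by (rule DERIV_max_minus_arctan)
  have "((\<lambda>s. s - \<rho> (s - M) + \<rho> (- s - M)) has_real_derivative 1 - \<rho>' (s - M) * 1 + \<rho>' (- s - M) * (- 1)) (at s)"
    by (intro DERIV_add DERIV_diff DERIV_ident DERIV_chain2[OF \<rho>]) (auto intro!: derivative_eq_intros)
  then show ?thesis by (simp add: trunc_def[abs_def] dtrunc_def \<rho>_def \<rho>'_def)
qed

text \<open>For M \<ge> 0 the two positive parts are never both nonzero, so at most one of the two
  fractions is subtracted, and each is at most 1.\<close>

lemma dtrunc_bounds: "0 \<le> M \<Longrightarrow> 0 \<le> dtrunc M s" "dtrunc M s \<le> 1"
proof -
  have *: "z\<^sup>2 / (1 + z\<^sup>2) \<le> 1" "0 \<le> z\<^sup>2 / (1 + z\<^sup>2)" for z :: real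
    using add_pos_nonneg[of 1 "z\<^sup>2"] by (auto simp: field_simps)
  show "dtrunc M s \<le> 1" unfolding dtrunc_def using *(2)[of "max 0 (s - M)"] *(2)[of "max 0 (- s - M)"] by linarith
  assume "0 \<le> M"
  then have "max 0 (s - M) = 0 \<or> max 0 (- s - M) = 0" by auto
  then show "0 \<le> dtrunc M s" unfolding dtrunc_def using *(1)[of "max 0 (s - M)"] *(1)[of "max 0 (- s - M)"] by auto
qed

lemma dtrunc_continuous [continuous_intros]:
  "continuous_on S f \<Longrightarrow> continuous_on S (\<lambda>x. dtrunc M (f x))"
  unfolding dtrunc_def by (intro continuous_intros) (metis add_pos_nonneg less_irrefl zero_le_power2 zero_less_one)+

lemma trunc_continuous [continuous_intros]:
  "continuous_on S f \<Longrightarrow> continuous_on S (\<lambda>x. trunc M (f x))"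
  unfolding trunc_def by (intro continuous_intros)

lemma trunc_ident: "\<bar>s\<bar> \<le> M \<Longrightarrow> trunc M s = s"
  using max_absorb1[of "s - M" 0] max_absorb1[of "- s - M" 0] unfolding trunc_def by auto

text \<open>Outside the interval from -M to M the truncation adds only an arctangent; the 2 is pi /
  2 rounded up.\<close>

lemma abs_trunc_le:
  assumes "0 \<le> M"
  shows "\<bar>trunc M s\<bar> \<le> M + 2"
proof -
  consider "\<bar>s\<bar> \<le> M" | "M < s" | "s < - M" by linarith
  then show ?thesis
  proof cases
    case 1
    then show ?thesis by (simp add: trunc_ident)
  next
    case 2
    then have "max 0 (s - M) = s - M" "max 0 (- s - M) = 0" using assms by auto
    then have "trunc M s = M + arctan (s - M)" by (simp add: trunc_def)
    then show ?thesis using arctan_bounded[of "s - M"] pi_less_4 assms by auto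
  next
    case 3
    then have "max 0 (- s - M) = - s - M" "max 0 (s - M) = 0" using assms by auto
    then have "trunc M s = - M - arctan (- s - M)" by (simp add: trunc_def)
    then show ?thesis using arctan_bounded[of "- s - M"] pi_less_4 assms by auto
  qed
qed

lemma trunc_lipschitz: "0 \<le> M \<Longrightarrow> \<bar>trunc M s - trunc M t\<bar> \<le> \<bar>s - t\<bar>"
  using field_differentiable_bound[of UNIV "trunc M" "dtrunc M" 1 s t] DERIV_trunc dtrunc_bounds
  by auto

section \<open>Difference quotients of weakly differentiable functions\<close>

text \<open>Polynomials times \<open>flat_exp 0\<close> of the distance to a sphere are test functions, and by
  Stone--Weierstrass they approximate a difference quotient well enough to test with it.\<close>

definition flat_exp :: "nat \<Rightarrow> real \<Rightarrow> real" where
  "flat_exp k s = (if 0 < s then exp (- inverse s) * inverse s ^ k else 0)"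

lemma flat_exp_tendsto_0: "(flat_exp k \<longlongrightarrow> 0) (at 0)"
proof (rule filterlim_split_at)
  have "(flat_exp k \<longlongrightarrow> 0) (at_left 0) \<longleftrightarrow> ((\<lambda>s::real. 0::real) \<longlongrightarrow> 0) (at_left 0)"
    by (intro filterlim_cong) (auto simp: eventually_at_filter flat_exp_def)
  then show "(flat_exp k \<longlongrightarrow> 0) (at_left 0)" by simp
  have "((\<lambda>s::real. inverse s ^ k / exp (inverse s)) \<longlongrightarrow> 0) (at_right 0)"
    by (rule filterlim_compose[OF tendsto_power_div_exp_0 filterlim_inverse_at_top_right])
  moreover have "\<forall>\<^sub>F s in at_right 0. inverse s ^ k / exp (inverse s) = flat_exp k s"
    by (auto simp: eventually_at_filter flat_exp_def exp_minus divide_inverse)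
  ultimately show "(flat_exp k \<longlongrightarrow> 0) (at_right 0)" by (rule Lim_transform_eventually)
qed

text \<open>The index \<open>k\<close> is there to make the family closed under differentiation:
  each derivative brings down inverse powers of s, which the exponential beats at 0.\<close>

lemma DERIV_flat_exp:
  "(flat_exp k has_real_derivative flat_exp (k + 2) s - real k * flat_exp (k + 1) s) (at s)"
proof -
  consider "s < 0" | "s = 0" | "0 < s" by linarith
  then show ?thesis
  proof cases
    case 1
    have "((\<lambda>s::real. 0) has_real_derivative 0) (at s)" by simp
    then have "(flat_exp k has_real_derivative 0) (at s)"
      by (rule has_field_derivative_transform_within_open[of _ _ _ "{..<0}"]) (use 1 in \<open>auto simp: flat_exp_def\<close>)
    then show ?thesis using 1 by (simp add: flat_exp_def)
  next
    case 2
    have "\<forall>\<^sub>F h in at 0. flat_exp (k + 1) h = flat_exp k h / h"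
      by (auto simp: eventually_at_filter flat_exp_def divide_inverse)
    with flat_exp_tendsto_0[of "k + 1"] have "((\<lambda>h. flat_exp k h / h) \<longlongrightarrow> 0) (at 0)"
      by (rule Lim_transform_eventually)
    then show ?thesis using 2 by (simp add: has_field_derivative_iff flat_exp_def)
  next
    case 3
    have "((\<lambda>s. exp (- inverse s) * inverse s ^ k) has_real_derivative
        exp (- inverse s) * inverse s ^ (k + 2) - real k * (exp (- inverse s) * inverse s ^ (k + 1))) (at s)"
    proof (cases k)
      case 0
      then show ?thesis using 3 by (auto intro!: derivative_eq_intros simp: power2_eq_square)
    next
      case (Suc j)
      have inv: "(inverse has_real_derivative - (inverse s * inverse s)) (at s)"
        using DERIV_inverse[of s] 3 by (simp add: power2_eq_square)
      have "((\<lambda>s. exp (- inverse s)) has_real_derivative exp (- inverse s) * (inverse s * inverse s)) (at s)"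
        using DERIV_chain2[OF DERIV_exp DERIV_minus[OF inv]] by simp
      from DERIV_mult[OF this DERIV_power_Suc[OF inv, of j]] show ?thesis
        unfolding Suc by (rule DERIV_cong) (simp add: algebra_simps)
    qed
    then have "(flat_exp k has_real_derivative
        exp (- inverse s) * inverse s ^ (k + 2) - real k * (exp (- inverse s) * inverse s ^ (k + 1))) (at s)"
      by (rule has_field_derivative_transform_within_open[of _ _ _ "{0<..}"]) (use 3 in \<open>auto simp: flat_exp_def\<close>)
    then show ?thesis using 3 by (simp add: flat_exp_def)
  qed
qed

lemma real_polynomial_function_derivative:
  fixes p :: "'a::euclidean_space \<Rightarrow> real"
  assumes "real_polynomial_function p"
  shows "\<exists>p'. (\<forall>x. (p has_derivative p' x) (at x)) \<and> (\<forall>b. real_polynomial_function (\<lambda>x. p' x b))"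
  using assms
proof induction
  case (linear f)
  then show ?case
    by (intro exI[of _ "\<lambda>x. f"]) (auto intro: bounded_linear_imp_has_derivative real_polynomial_function.intros(2))
next
  case (const c)
  then show ?case
    by (intro exI[of _ "\<lambda>x h. 0"]) (auto intro: real_polynomial_function.intros(2))
next
  case (add f g)
  then obtain f' g' where "\<forall>x. (f has_derivative f' x) (at x)" "\<forall>b. real_polynomial_function (\<lambda>x. f' x b)"
    "\<forall>x. (g has_derivative g' x) (at x)" "\<forall>b. real_polynomial_function (\<lambda>x. g' x b)" by blast
  then show ?case
    by (intro exI[of _ "\<lambda>x h. f' x h + g' x h"])
       (auto intro: has_derivative_add real_polynomial_function.intros(3))
next
  case (mult f g)
  then obtain f' g' where "\<forall>x. (f has_derivative f' x) (at x)" "\<forall>b. real_polynomial_function (\<lambda>x. f' x b)"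
    "\<forall>x. (g has_derivative g' x) (at x)" "\<forall>b. real_polynomial_function (\<lambda>x. g' x b)" by blast
  then show ?case using mult.hyps
    by (intro exI[of _ "\<lambda>x h. f x * g' x h + f' x h * g x"] conjI allI has_derivative_mult
        real_polynomial_function.intros(3,4)) blast+
qed

text \<open>A class closed under directional derivatives, so that smoothness in the sense of
  iterated partial derivatives follows by induction on the list of directions. The free polynomial
  factor makes it rich enough for approximation.\<close>

inductive_set bumps :: "'a::euclidean_space \<Rightarrow> real \<Rightarrow> ('a \<Rightarrow> real) set" for c \<rho> where
  prod: "real_polynomial_function p \<Longrightarrow> (\<lambda>x. p x * flat_exp k (\<rho>\<^sup>2 - (norm (x - c))\<^sup>2)) \<in> bumps c \<rho>"
| add: "f \<in> bumps c \<rho> \<Longrightarrow> g \<in> bumps c \<rho> \<Longrightarrow> (\<lambda>x. f x + g x) \<in> bumps c \<rho>"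

lemma bumps_derivative:
  assumes "f \<in> bumps c \<rho>"
  shows "\<exists>f'. (\<forall>x. (f has_derivative f' x) (at x)) \<and> (\<forall>b. (\<lambda>x. f' x b) \<in> bumps c \<rho>)"
  using assms
proof induction
  case (prod p k)
  then obtain p' where p': "\<And>x. (p has_derivative p' x) (at x)" "\<And>b. real_polynomial_function (\<lambda>x. p' x b)"
    using real_polynomial_function_derivative by blast
  define E where "E j x = flat_exp j (\<rho>\<^sup>2 - (norm (x - c))\<^sup>2)" for j and x :: 'a
  define E' where "E' x = E (k + 2) x - real k * E (k + 1) x" for x
  have q: "((\<lambda>x. \<rho>\<^sup>2 - (norm (x - c))\<^sup>2) has_derivative (\<lambda>h. - 2 * ((x - c) \<bullet> h))) (at x)" for x
    unfolding power2_norm_eq_inner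
    by (rule has_derivative_eq_rhs, (rule derivative_intros)+) (auto simp: inner_commute)
  have "(E k has_derivative (\<lambda>h. E' x * (- 2 * ((x - c) \<bullet> h)))) (at x)" for x
    unfolding E_def[abs_def] E'_def
    using has_derivative_compose[OF q DERIV_flat_exp[of k "\<rho>\<^sup>2 - (norm (x - c))\<^sup>2", THEN has_field_derivative_imp_has_derivative]]
    by simp
  then have "((\<lambda>x. p x * E k x) has_derivative (\<lambda>h. p x * (E' x * (- 2 * ((x - c) \<bullet> h))) + p' x h * E k x)) (at x)" for x
    by (intro has_derivative_mult p')
  moreover have "(\<lambda>x. p x * (E' x * (- 2 * ((x - c) \<bullet> b))) + p' x b * E k x) \<in> bumps c \<rho>" for b
  proof -
    have lin: "real_polynomial_function (\<lambda>x. (x - c) \<bullet> b)"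
    proof -
      have "real_polynomial_function (\<lambda>x. x \<bullet> b + (- (c \<bullet> b)))"
        by (intro real_polynomial_function.intros bounded_linear_inner_left)
      then show ?thesis by (simp add: inner_diff_left)
    qed
    have "(\<lambda>x. (p x * (- 2 * ((x - c) \<bullet> b)) * flat_exp (k + 2) (\<rho>\<^sup>2 - (norm (x - c))\<^sup>2)
        + p x * (2 * real k * ((x - c) \<bullet> b)) * flat_exp (k + 1) (\<rho>\<^sup>2 - (norm (x - c))\<^sup>2))
        + p' x b * flat_exp k (\<rho>\<^sup>2 - (norm (x - c))\<^sup>2)) \<in> bumps c \<rho>"
      using prod p'(2) lin
      by (intro bumps.intros real_polynomial_function.intros(4) real_polynomial_function.intros(2))
    then show ?thesis by (rule back_subst[of "\<lambda>f. f \<in> bumps c \<rho>"]) (auto simp: E_def E'_def algebra_simps)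
  qed
  ultimately show ?case unfolding E_def by (intro exI conjI allI)
next
  case (add f g)
  then obtain f' g' where "\<forall>x. (f has_derivative f' x) (at x)" "\<forall>b. (\<lambda>x. f' x b) \<in> bumps c \<rho>"
    "\<forall>x. (g has_derivative g' x) (at x)" "\<forall>b. (\<lambda>x. g' x b) \<in> bumps c \<rho>" by blast
  then show ?case
    by (intro exI[of _ "\<lambda>x h. f' x h + g' x h"]) (auto intro: has_derivative_add bumps.add)
qed

lemma smooth_bumps:
  assumes "f \<in> bumps c \<rho>"
  shows "smooth f"
proof -
  have "fold (\<lambda>b h y. frechet_derivative h (at y) b) bs f differentiable (at x)" for bs x
    using assms
  proof (induction bs arbitrary: f)
    case Nil
    then show ?case using bumps_derivative by (force simp: differentiable_def)
  next
    case (Cons b bs)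
    obtain f' where f': "\<And>x. (f has_derivative f' x) (at x)" "\<And>b. (\<lambda>x. f' x b) \<in> bumps c \<rho>"
      using bumps_derivative[OF Cons.prems] by blast
    have "frechet_derivative f (at y) = f' y" for y using frechet_derivative_at[OF f'(1)] by simp
    then have "(\<lambda>y. frechet_derivative f (at y) b) = (\<lambda>x. f' x b)" by simp
    then show ?case using Cons.IH[OF f'(2)[of b]] by simp
  qed
  then show ?thesis unfolding smooth_def by blast
qed

lemma bumps_eq_0: "f \<in> bumps c \<rho> \<Longrightarrow> 0 \<le> \<rho> \<Longrightarrow> x \<notin> cball c \<rho> \<Longrightarrow> f x = 0"
proof (induction rule: bumps.induct)
  case (prod p k)
  then have "\<rho>\<^sup>2 \<le> (norm (x - c))\<^sup>2"
    by (intro power_mono) (auto simp: dist_norm norm_minus_commute)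
  then show ?case by (simp add: flat_exp_def)
qed auto

lemma bumps_shift:
  assumes "f \<in> bumps c \<rho>"
  shows "(\<lambda>x. f (x - v)) \<in> bumps (c + v) \<rho>"
  using assms
proof induction
  case (prod p k)
  have "polynomial_function (\<lambda>x::'a. x - v)"
    by (intro polynomial_function_diff polynomial_function_id polynomial_function_const)
  then have "real_polynomial_function (\<lambda>x. p (x - v))"
    using real_polynomial_function_compose[of "\<lambda>x. x - v" p] prod by (simp add: o_def)
  then show ?case using bumps.prod[of "\<lambda>x. p (x - v)" k \<rho> "c + v"] by (simp add: algebra_simps)
qed (auto intro: bumps.add)

lemma test_function_bumps:
  assumes "f \<in> bumps c \<rho>" "0 \<le> \<rho>" "cball c \<rho> \<subseteq> U"
  shows "test_function U f"
proof -
  have "closure {x. f x \<noteq> 0} \<subseteq> cball c \<rho>"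
    using bumps_eq_0[OF assms(1,2)] by (intro closure_minimal) (blast, simp)
  then show ?thesis unfolding test_function_def using smooth_bumps[OF assms(1)] assms(3)
    by (metis bounded_cball bounded_subset closed_closure compact_eq_bounded_closed order.trans)
qed

lemma has_integral_same_support:
  fixes f :: "'a::euclidean_space \<Rightarrow> real"
  assumes "(f has_integral I) S" "\<And>x. x \<notin> S \<inter> S' \<Longrightarrow> f x = 0"
  shows "(f has_integral I) S'"
proof -
  have "(\<lambda>x. if x \<in> S then f x else 0) = (\<lambda>x. if x \<in> S' then f x else 0)" using assms(2) by (auto simp: fun_eq_iff)
  moreover have "((\<lambda>x. if x \<in> S then f x else 0) has_integral I) UNIV"
    using assms(1) by (simp only: has_integral_restrict_UNIV)
  ultimately have "((\<lambda>x. if x \<in> S' then f x else 0) has_integral I) UNIV" by simp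
  then show ?thesis by (simp only: has_integral_restrict_UNIV)
qed

text \<open>Tested with a bump \<open>\<eta>\<close>, the difference quotient becomes a mean over
  shifts of the weak gradient tested with shifted bumps; Young's inequality bounds this by half of
  \<open>W\<close> plus half of the integral of \<eta>^2. Taking \<open>\<eta>\<close> close to the
  difference quotient times the weight makes the two integrals of \<eta>^2 cancel, so no constant is
  lost. If the right side is infinite, there is nothing to prove.\<close>

lemma weak_gradient_difference_quotient:
  fixes f :: "'a::euclidean_space \<Rightarrow> real" and b c p q :: 'a
  assumes weak: "weak_gradient U f w" and f: "continuous_on U f"
    and U: "cbox p q \<subseteq> U" "\<And>x. x \<in> cbox p q \<Longrightarrow> x + h *\<^sub>R b \<in> U"
    and cball: "cball c (\<rho> + h) \<subseteq> cbox p q" and h: "0 < h" and \<rho>: "0 < \<rho>" and b: "norm b = 1"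
  shows "ennreal (integral (cbox p q) (\<lambda>x. ((f (x + h *\<^sub>R b) - f x) / h)\<^sup>2 * flat_exp 0 (\<rho>\<^sup>2 - (norm (x - c))\<^sup>2)))
    \<le> (\<integral>\<^sup>+x\<in>U. ennreal ((norm (w x))\<^sup>2) \<partial>lebesgue)"
proof (cases "(\<integral>\<^sup>+x\<in>U. ennreal ((norm (w x))\<^sup>2) \<partial>lebesgue) = \<infinity>")
  case False
  define Q where "Q = cbox p q"
  have Q: "compact Q" "Q \<subseteq> U" "Q \<in> sets lebesgue" using U by (auto simp: Q_def)
  have w: "w absolutely_integrable_on Q" using weak Q unfolding weak_gradient_def by blast
  define W where "W = enn2real (\<integral>\<^sup>+x\<in>U. ennreal ((norm (w x))\<^sup>2) \<partial>lebesgue)"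
  have W: "ennreal W = (\<integral>\<^sup>+x\<in>U. ennreal ((norm (w x))\<^sup>2) \<partial>lebesgue)"
    unfolding W_def using False by (simp add: less_top)
  have W0: "0 \<le> W" by (simp add: W_def)
  have cf: "continuous_on Q f" using f Q by (blast intro: continuous_on_subset)
  have w_meas: "w \<in> borel_measurable (lebesgue_on Q)"
    using w by (simp add: absolutely_integrable_measurable Q)
  have w2: "(\<lambda>x. (norm (w x))\<^sup>2) integrable_on Q" "integral Q (\<lambda>x. (norm (w x))\<^sup>2) \<le> W"
  proof -
    have meas: "(\<lambda>x. indicator Q x *\<^sub>R (norm (w x))\<^sup>2) \<in> borel_measurable lebesgue"
    proof -
      have "(\<lambda>x. (norm (w x))\<^sup>2) \<in> borel_measurable (lebesgue_on Q)" using w_meas by measurable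
      then show ?thesis using Q(3) by (subst (asm) borel_measurable_restrict_space_iff) auto
    qed
    have le: "(\<integral>\<^sup>+x. ennreal (norm (indicator Q x *\<^sub>R (norm (w x))\<^sup>2)) \<partial>lebesgue) \<le> ennreal W"
      unfolding W using Q(2) by (intro nn_integral_mono) (auto simp: indicator_def)
    have int: "integrable lebesgue (\<lambda>x. indicator Q x *\<^sub>R (norm (w x))\<^sup>2)"
      using meas le by (intro integrableI_bounded) (auto intro: le_less_trans)
    then have si: "set_integrable lebesgue Q (\<lambda>x. (norm (w x))\<^sup>2)" by (simp add: set_integrable_def)
    show "(\<lambda>x. (norm (w x))\<^sup>2) integrable_on Q" using set_lebesgue_integral_eq_integral(1)[OF si] .
    have "ennreal (integral Q (\<lambda>x. (norm (w x))\<^sup>2)) = ennreal (integral\<^sup>L lebesgue (\<lambda>x. indicator Q x *\<^sub>R (norm (w x))\<^sup>2))"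
      using set_lebesgue_integral_eq_integral(2)[OF si] by (simp add: set_lebesgue_integral_def)
    also have "\<dots> = (\<integral>\<^sup>+x. ennreal (indicator Q x *\<^sub>R (norm (w x))\<^sup>2) \<partial>lebesgue)"
      using int by (intro nn_integral_eq_integral[symmetric]) auto
    also have "\<dots> \<le> ennreal W" using le by simp
    finally show "integral Q (\<lambda>x. (norm (w x))\<^sup>2) \<le> W" using W0 by (simp add: ennreal_le_iff)
  qed
  define D where "D x = (f (x + h *\<^sub>R b) - f x) / h" for x
  define e where "e x = flat_exp 0 (\<rho>\<^sup>2 - (norm (x - c))\<^sup>2)" for x
  have contD: "continuous_on Q D"
    unfolding D_def using U h by (intro continuous_intros cf continuous_on_compose2[OF f]) (auto simp: Q_def)
  have e01: "0 \<le> e x" "e x \<le> 1" for x by (auto simp: e_def flat_exp_def)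
  have main: "integral Q (\<lambda>x. D x * \<eta> x) \<le> (W + integral Q (\<lambda>x. (\<eta> x)\<^sup>2)) / 2"
    if \<eta>: "\<eta> \<in> bumps c \<rho>" for \<eta>
  proof -
    obtain \<eta>' where \<eta>': "\<And>x. (\<eta> has_derivative \<eta>' x) (at x)" "\<And>b. (\<lambda>x. \<eta>' x b) \<in> bumps c \<rho>"
      using bumps_derivative[OF \<eta>] by blast
    have cont_bump: "continuous_on A g" if "g \<in> bumps c \<rho>" for g A
      using bumps_derivative[OF that] by (metis continuous_at_imp_continuous_on has_derivative_continuous)
    have cont_comp: "continuous_on A (\<lambda>x. g (k x))" if "g \<in> bumps c \<rho>" "continuous_on A k"
      for g A and k :: "_ \<Rightarrow> 'a"
      using continuous_on_compose2[OF cont_bump[OF that(1), of UNIV] that(2)] by simp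
    have bump0: "g x = 0" if "g \<in> bumps c \<rho>" "x \<notin> cball c \<rho>" for g x
      using bumps_eq_0[OF that(1) _ that(2)] \<rho> by simp
    have sub: "cball (c + s *\<^sub>R b) \<rho> \<subseteq> Q" if "0 \<le> s" "s \<le> h" for s
    proof -
      have "cball (c + s *\<^sub>R b) \<rho> \<subseteq> cball c (\<rho> + h)"
      proof
        fix x assume "x \<in> cball (c + s *\<^sub>R b) \<rho>"
        then show "x \<in> cball c (\<rho> + h)"
          using dist_triangle[of c x "c + s *\<^sub>R b"] that b by (simp add: dist_norm)
      qed
      then show ?thesis using cball Q_def by blast
    qed
    \<comment> \<open>The shift is moved from \<open>f\<close>, which is only continuous, to the
      test function; then \<open>G\<close> is differentiable in s, and its derivative is an integral
      against the gradient of a shifted bump.\<close>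
    define G where "G s = integral Q (\<lambda>x. f x * \<eta> (x - s *\<^sub>R b))" for s
    define G' where "G' s = integral Q (\<lambda>x. f x * (- \<eta>' (x - s *\<^sub>R b) b))" for s
    have G: "(G has_real_derivative G' s) (at s within {0..h})" if s: "s \<in> {0..h}" for s
      unfolding G_def G'_def Q_def
    proof (rule leibniz_rule_field_derivative[OF _ _ _ s])
      fix s x
      have "((\<lambda>s. \<eta> (x - s *\<^sub>R b)) has_derivative (\<lambda>t. \<eta>' (x - s *\<^sub>R b) (- (t *\<^sub>R b)))) (at s within {0..h})"
        by (rule has_derivative_compose[OF _ \<eta>'(1)]) (auto intro!: derivative_eq_intros)
      then have "((\<lambda>s. \<eta> (x - s *\<^sub>R b)) has_real_derivative - \<eta>' (x - s *\<^sub>R b) b) (at s within {0..h})"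
        unfolding has_field_derivative_def
        by (rule has_derivative_eq_rhs)
           (simp add: fun_eq_iff linear_simps[OF has_derivative_bounded_linear[OF \<eta>'(1)[of "x - s *\<^sub>R b"]]])
      then show "((\<lambda>s. f x * \<eta> (x - s *\<^sub>R b)) has_real_derivative f x * - \<eta>' (x - s *\<^sub>R b) b) (at s within {0..h})"
        by (rule DERIV_cmult)
    next
      show "(\<lambda>x. f x * \<eta> (x - s *\<^sub>R b)) integrable_on cbox p q" for s
        by (intro integrable_continuous continuous_on_mult cf[unfolded Q_def] cont_comp[OF \<eta>] continuous_intros)
      show "continuous_on ({0..h} \<times> cbox p q) (\<lambda>(s, x). f x * - \<eta>' (x - s *\<^sub>R b) b)"
        unfolding case_prod_unfold
        by (intro continuous_on_mult continuous_on_minus continuous_on_compose2[OF cf[unfolded Q_def]]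
            cont_comp[OF \<eta>'(2)] continuous_intros) auto
    qed auto
    have G'_le: "G' s \<le> (W + integral Q (\<lambda>x. (\<eta> x)\<^sup>2)) / 2" if s: "0 \<le> s" "s \<le> h" for s
    proof -
      define \<eta>s where "\<eta>s x = \<eta> (x - s *\<^sub>R b)" for x
      have bs: "\<eta>s \<in> bumps (c + s *\<^sub>R b) \<rho>" unfolding \<eta>s_def[abs_def] by (rule bumps_shift[OF \<eta>])
      have d: "(\<eta>s has_derivative \<eta>' (x - s *\<^sub>R b)) (at x)" for x
        unfolding \<eta>s_def[abs_def] by (rule has_derivative_compose[OF _ \<eta>'(1), where f' = "\<lambda>h. h", simplified])
          (auto intro!: derivative_eq_intros)
      have c\<eta>: "continuous_on A \<eta>s" for A
        using d by (metis continuous_at_imp_continuous_on has_derivative_continuous)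
      define gr where "gr x = (\<Sum>i\<in>Basis. \<eta>' (x - s *\<^sub>R b) i *\<^sub>R i)" for x
      have gr_inner: "gr x \<bullet> v = \<eta>' (x - s *\<^sub>R b) v" for x v
      proof -
        interpret bounded_linear "\<eta>' (x - s *\<^sub>R b)" using \<eta>'(1) by (rule has_derivative_bounded_linear)
        have "\<eta>' (x - s *\<^sub>R b) v = \<eta>' (x - s *\<^sub>R b) (\<Sum>i\<in>Basis. (v \<bullet> i) *\<^sub>R i)" by (simp add: euclidean_representation)
        also have "\<dots> = gr x \<bullet> v" unfolding gr_def inner_sum_left sum scaleR
          by (intro sum.cong) (simp_all add: inner_commute)
        finally show ?thesis by simp
      qed
      have "GDERIV \<eta>s x :> gr x" for x
        unfolding gderiv_def using d[of x] by (simp add: inner_commute[of _ "gr x"] gr_inner)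
      then have gr: "gradient \<eta>s x = gr x" for x by (rule gradient_eq)
      have zero: "\<eta>s x = 0" "gr x = 0" if "x \<notin> Q" for x
      proof -
        have "x - s *\<^sub>R b \<notin> cball c \<rho>"
          using that sub[OF s] by (auto simp: dist_norm algebra_simps)
        then show "\<eta>s x = 0" "gr x = 0" unfolding \<eta>s_def gr_def using bump0[OF \<eta>] bump0[OF \<eta>'(2)] by auto
      qed
      have cgr: "continuous_on A gr" for A
        unfolding gr_def
        by (intro continuous_on_sum continuous_on_scaleR cont_comp[OF \<eta>'(2)] continuous_intros)
      have tf: "test_function U \<eta>s"
        using sub[OF s] Q(2) \<rho> by (intro test_function_bumps[OF bs]) auto
      have eq: "(LINT x:U|lebesgue. f x *\<^sub>R gr x) = - (LINT x:U|lebesgue. \<eta>s x *\<^sub>R w x)"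
        using weak tf unfolding weak_gradient_def by (auto simp: gr)
      have r1: "(LINT x:U|lebesgue. f x *\<^sub>R gr x) = (LINT x:Q|lebesgue. f x *\<^sub>R gr x)"
        and r2: "(LINT x:U|lebesgue. \<eta>s x *\<^sub>R w x) = (LINT x:Q|lebesgue. \<eta>s x *\<^sub>R w x)"
        unfolding set_lebesgue_integral_def using Q(2) zero
        by (auto intro!: arg_cong[where f = "integral\<^sup>L lebesgue"] simp: fun_eq_iff indicator_def)
      have i1: "(\<lambda>x. f x *\<^sub>R gr x) absolutely_integrable_on Q"
        unfolding Q_def by (intro absolutely_integrable_continuous continuous_intros cgr cf[unfolded Q_def])
      have i2: "(\<lambda>x. \<eta>s x *\<^sub>R w x) absolutely_integrable_on Q"
        using compact_imp_bounded[OF compact_continuous_image[OF c\<eta> Q(1)]] Q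
        by (intro absolutely_integrable_bounded_measurable_product[OF _ _ Q(3) _ w]
            bounded_bilinear_scaleR[THEN bilinear_conv_bounded_bilinear[THEN iffD2]]
            continuous_imp_measurable_on_sets_lebesgue c\<eta>) auto
      have "integral Q (\<lambda>x. f x *\<^sub>R gr x) = - integral Q (\<lambda>x. \<eta>s x *\<^sub>R w x)"
        using eq unfolding r1 r2 using set_lebesgue_integral_eq_integral(2)[OF i1] set_lebesgue_integral_eq_integral(2)[OF i2]
        by simp
      then have "integral Q (\<lambda>x. f x *\<^sub>R gr x) \<bullet> b = - (integral Q (\<lambda>x. \<eta>s x *\<^sub>R w x) \<bullet> b)" by simp
      moreover have "integral Q (\<lambda>x. f x *\<^sub>R gr x) \<bullet> b = integral Q (\<lambda>x. (f x *\<^sub>R gr x) \<bullet> b)"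
        using integral_linear[OF set_lebesgue_integral_eq_integral(1)[OF i1] bounded_linear_inner_left[of b]]
        by (simp add: o_def)
      moreover have "integral Q (\<lambda>x. \<eta>s x *\<^sub>R w x) \<bullet> b = integral Q (\<lambda>x. (\<eta>s x *\<^sub>R w x) \<bullet> b)"
        using integral_linear[OF set_lebesgue_integral_eq_integral(1)[OF i2] bounded_linear_inner_left[of b]]
        by (simp add: o_def)
      ultimately have "G' s = integral Q (\<lambda>x. (\<eta>s x *\<^sub>R w x) \<bullet> b)"
        unfolding G'_def by (simp add: gr_inner)
      also have "\<dots> \<le> integral Q (\<lambda>x. ((norm (w x))\<^sup>2 + (\<eta>s x)\<^sup>2) / 2)"
      proof (rule integral_le)
        show "(\<lambda>x. (\<eta>s x *\<^sub>R w x) \<bullet> b) integrable_on Q"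
          using integrable_linear[OF set_lebesgue_integral_eq_integral(1)[OF i2] bounded_linear_inner_left[of b]]
          by (simp add: o_def)
        show "(\<lambda>x. ((norm (w x))\<^sup>2 + (\<eta>s x)\<^sup>2) / 2) integrable_on Q"
          unfolding Q_def by (intro integrable_on_divide integrable_add w2(1)[unfolded Q_def] integrable_continuous continuous_intros c\<eta>)
        fix x
        have "(\<eta>s x *\<^sub>R w x) \<bullet> b \<le> norm (\<eta>s x *\<^sub>R w x) * norm b" by (rule norm_cauchy_schwarz)
        then have "(\<eta>s x *\<^sub>R w x) \<bullet> b \<le> \<bar>\<eta>s x\<bar> * norm (w x)" using b by simp
        then show "(\<eta>s x *\<^sub>R w x) \<bullet> b \<le> ((norm (w x))\<^sup>2 + (\<eta>s x)\<^sup>2) / 2"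
          using sum_squares_bound[of "\<bar>\<eta>s x\<bar>" "norm (w x)"] by simp
      qed
      also have "\<dots> = (integral Q (\<lambda>x. (norm (w x))\<^sup>2) + integral Q (\<lambda>x. (\<eta>s x)\<^sup>2)) / 2"
      proof -
        have "(\<lambda>x. (\<eta>s x)\<^sup>2) integrable_on Q"
          unfolding Q_def by (intro integrable_continuous continuous_intros c\<eta>)
        with w2(1) show ?thesis by (simp add: integral_add)
      qed
      also have "integral Q (\<lambda>x. (\<eta>s x)\<^sup>2) = integral Q (\<lambda>x. (\<eta> x)\<^sup>2)"
      proof (rule integral_unique)
        have "((\<lambda>x. (\<eta> x)\<^sup>2) has_integral integral Q (\<lambda>x. (\<eta> x)\<^sup>2)) Q"
          unfolding Q_def by (intro integrable_integral integrable_continuous continuous_intros cont_bump[OF \<eta>])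
        from has_integral_shift_cbox[OF this[unfolded Q_def], of "- (s *\<^sub>R b)"]
        have "((\<lambda>x. (\<eta>s x)\<^sup>2) has_integral integral Q (\<lambda>x. (\<eta> x)\<^sup>2)) (cbox (p + s *\<^sub>R b) (q + s *\<^sub>R b))"
          by (simp add: \<eta>s_def Q_def)
        then show "((\<lambda>x. (\<eta>s x)\<^sup>2) has_integral integral Q (\<lambda>x. (\<eta> x)\<^sup>2)) Q"
        proof (rule has_integral_same_support)
          fix x assume x: "x \<notin> cbox (p + s *\<^sub>R b) (q + s *\<^sub>R b) \<inter> Q"
          show "(\<eta>s x)\<^sup>2 = 0"
          proof (cases "x \<in> Q")
            case True
            then have "x - s *\<^sub>R b \<notin> Q" using x by (auto simp: Q_def mem_box algebra_simps)
            then have "x - s *\<^sub>R b \<notin> cball c \<rho>" using sub[of 0] h by auto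
            then show ?thesis using bump0[OF \<eta>] by (simp add: \<eta>s_def)
          qed (simp add: zero)
        qed
      qed
      finally show ?thesis using w2(2) by simp
    qed
    \<comment> \<open>The quotient (G h - G 0) / h is a value of \<open>G'\<close>, so a bound on
      \<open>G'\<close> that is uniform in the shift is enough.\<close>
    have "\<exists>z\<in>{0<..<h}. G h - G 0 = G' z * (h - 0)"
      using G h by (intro mvt_simple) (auto simp: has_field_derivative_def)
    then obtain z where z: "0 < z" "z < h" "G h - G 0 = h * G' z" by auto
    have "G h - G 0 \<le> h * ((W + integral Q (\<lambda>x. (\<eta> x)\<^sup>2)) / 2)"
      unfolding z(3) using G'_le[of z] z h by (intro mult_left_mono) auto
    moreover have "G h - G 0 = h * integral Q (\<lambda>x. D x * \<eta> x)"
    proof -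
      have "((\<lambda>x. f x * \<eta> (x - h *\<^sub>R b)) has_integral G h) (cbox p q)"
        unfolding G_def Q_def
        by (intro integrable_integral integrable_continuous continuous_on_mult cf[unfolded Q_def]
            cont_comp[OF \<eta>] continuous_intros)
      from has_integral_shift_cbox[OF this, of "h *\<^sub>R b"]
      have "((\<lambda>x. f (x + h *\<^sub>R b) * \<eta> x) has_integral G h) (cbox (p - h *\<^sub>R b) (q - h *\<^sub>R b))" by simp
      then have 1: "((\<lambda>x. f (x + h *\<^sub>R b) * \<eta> x) has_integral G h) Q"
      proof (rule has_integral_same_support)
        fix x assume x: "x \<notin> cbox (p - h *\<^sub>R b) (q - h *\<^sub>R b) \<inter> Q"
        have "x \<notin> cball c \<rho>"
        proof
          assume "x \<in> cball c \<rho>"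
          then have "x \<in> Q" "x + h *\<^sub>R b \<in> Q" using sub[of 0] sub[of h] h
            by (auto simp: subset_iff dist_norm algebra_simps)
          then show False using x by (auto simp: Q_def mem_box algebra_simps)
        qed
        then show "f (x + h *\<^sub>R b) * \<eta> x = 0" using bump0[OF \<eta>] by simp
      qed
      have 2: "((\<lambda>x. f x * \<eta> x) has_integral G 0) Q"
        unfolding G_def Q_def using cf[unfolded Q_def] cont_bump[OF \<eta>]
        by (simp, intro integrable_integral integrable_continuous continuous_intros)
      have "((\<lambda>x. f (x + h *\<^sub>R b) * \<eta> x - f x * \<eta> x) has_integral G h - G 0) Q"
        by (rule has_integral_diff[OF 1 2])
      from has_integral_divide[OF this, of h]
      have "((\<lambda>x. D x * \<eta> x) has_integral (G h - G 0) / h) Q"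
        by (simp add: D_def left_diff_distrib diff_divide_distrib)
      then show ?thesis using h by (simp add: integral_unique)
    qed
    ultimately show ?thesis using h by simp
  qed
  have ce: "continuous_on A e" for A
  proof -
    have "e \<in> bumps c \<rho>" using bumps.prod[OF real_polynomial_function.intros(2)[of 1], of 0 \<rho> c] by (simp add: e_def[abs_def])
    then show ?thesis using bumps_derivative by (metis continuous_at_imp_continuous_on has_derivative_continuous)
  qed
  have int: "(\<lambda>x. (D x)\<^sup>2 * e x) integrable_on Q"
    unfolding Q_def by (intro integrable_continuous continuous_intros ce contD[unfolded Q_def])
  have "integral Q (\<lambda>x. (D x)\<^sup>2 * e x) \<le> W + \<epsilon>\<^sup>2 * measure lborel Q" if \<epsilon>: "0 < \<epsilon>" for \<epsilon>
  proof -
    obtain P where P: "real_polynomial_function P" "\<And>x. x \<in> Q \<Longrightarrow> \<bar>D x - P x\<bar> < \<epsilon>"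
      using Stone_Weierstrass_real_polynomial_function[OF Q(1) contD \<epsilon>] by blast
    define \<eta> where "\<eta> x = P x * e x" for x
    have \<eta>: "\<eta> \<in> bumps c \<rho>" unfolding \<eta>_def[abs_def] e_def by (rule bumps.prod[OF P(1)])
    have c\<eta>: "continuous_on A \<eta>" for A
      using bumps_derivative[OF \<eta>] by (metis continuous_at_imp_continuous_on has_derivative_continuous)
    have i: "(\<lambda>x. D x * \<eta> x) integrable_on Q" "(\<lambda>x. (\<eta> x)\<^sup>2) integrable_on Q"
      unfolding Q_def by (intro integrable_continuous continuous_intros c\<eta> contD[unfolded Q_def])+
    have "integral Q (\<lambda>x. (D x)\<^sup>2 * e x) \<le> integral Q (\<lambda>x. 2 * (D x * \<eta> x) - (\<eta> x)\<^sup>2 + \<epsilon>\<^sup>2)"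
    proof (rule integral_le[OF int])
      show "(\<lambda>x. 2 * (D x * \<eta> x) - (\<eta> x)\<^sup>2 + \<epsilon>\<^sup>2) integrable_on Q"
        unfolding Q_def by (intro integrable_continuous continuous_intros c\<eta> contD[unfolded Q_def])
      fix x assume x: "x \<in> Q"
      have "(D x - P x)\<^sup>2 \<le> \<epsilon>\<^sup>2" using P(2)[OF x] by (simp add: abs_le_square_iff[symmetric])
      then have "e x * (D x - P x)\<^sup>2 \<le> 1 * \<epsilon>\<^sup>2" using e01 by (intro mult_mono) auto
      \<comment> \<open>Here the weight must be at most 1: then \<eta>^2 \<le> e P^2, and the square
        left by Young's inequality can be subtracted.\<close>
      moreover have "(e x)\<^sup>2 * (P x)\<^sup>2 \<le> e x * (P x)\<^sup>2"
        using e01[of x] mult_right_mono[of "e x" 1 "e x"] by (intro mult_right_mono) (auto simp: power2_eq_square)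
      ultimately show "(D x)\<^sup>2 * e x \<le> 2 * (D x * \<eta> x) - (\<eta> x)\<^sup>2 + \<epsilon>\<^sup>2"
        unfolding \<eta>_def power_mult_distrib by (simp add: power2_diff algebra_simps)
    qed
    also have "\<dots> = 2 * integral Q (\<lambda>x. D x * \<eta> x) - integral Q (\<lambda>x. (\<eta> x)\<^sup>2) + \<epsilon>\<^sup>2 * measure lborel Q"
    proof -
      have "integral Q (\<lambda>x. 2 * (D x * \<eta> x) - (\<eta> x)\<^sup>2 + \<epsilon>\<^sup>2)
          = integral Q (\<lambda>x. 2 * (D x * \<eta> x) - (\<eta> x)\<^sup>2) + integral Q (\<lambda>x. \<epsilon>\<^sup>2)"
        using i unfolding Q_def by (intro integral_add integrable_diff integrable_on_mult_right integrable_const)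
      also have "integral Q (\<lambda>x. 2 * (D x * \<eta> x) - (\<eta> x)\<^sup>2) = integral Q (\<lambda>x. 2 * (D x * \<eta> x)) - integral Q (\<lambda>x. (\<eta> x)\<^sup>2)"
        using i by (intro integral_diff integrable_on_mult_right)
      finally show ?thesis by (simp add: Q_def mult.commute)
    qed
    also have "\<dots> \<le> W + \<epsilon>\<^sup>2 * measure lborel Q" using main[OF \<eta>] by simp
    finally show ?thesis .
  qed
  note * = this
  have "integral Q (\<lambda>x. (D x)\<^sup>2 * e x) \<le> W"
  proof -
    have "((\<lambda>\<epsilon>. W + \<epsilon>\<^sup>2 * measure lborel Q) \<longlongrightarrow> W + 0\<^sup>2 * measure lborel Q) (at_right 0)"
      by (intro tendsto_intros)
    then have "integral Q (\<lambda>x. (D x)\<^sup>2 * e x) \<le> W + 0\<^sup>2 * measure lborel Q"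
      by (rule tendsto_lowerbound) (auto simp: eventually_at_filter *)
    then show ?thesis by simp
  qed
  then show ?thesis unfolding W[symmetric] by (intro ennreal_leI) (simp add: Q_def D_def e_def)
qed simp

section \<open>Local energy estimate\<close>

text \<open>Cut-offs are supported in balls, but integrals are taken over boxes, where continuous
  functions are integrable; the cubes are boxes around those balls.\<close>

definition cube :: "real^3 \<Rightarrow> real \<Rightarrow> (real^3) set" where
  "cube c \<rho> = cbox (c - \<rho> *\<^sub>R One) (c + \<rho> *\<^sub>R One)"

lemma mem_cube: "x \<in> cube c \<rho> \<longleftrightarrow> (\<forall>b\<in>Basis. \<bar>(x - c) \<bullet> b\<bar> \<le> \<rho>)"
  unfolding cube_def mem_box by (auto simp: inner_diff_left inner_add_left abs_le_iff) (force+)?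

lemma cball_subset_cube: "cball c \<rho> \<subseteq> cube c \<rho>"
proof
  fix x assume "x \<in> cball c \<rho>"
  then have "norm (x - c) \<le> \<rho>" by (simp add: dist_norm norm_minus_commute)
  then show "x \<in> cube c \<rho>" unfolding mem_cube using Basis_le_norm[of _ "x - c"] by force
qed

text \<open>In dimension three half the diagonal is sqrt 3 times \<rho>, rounded up to 2
  \<rho>.\<close>

lemma cube_subset_cball: "0 \<le> \<rho> \<Longrightarrow> cube c \<rho> \<subseteq> cball c (2 * \<rho>)"
proof
  fix x assume \<rho>: "0 \<le> \<rho>" and x: "x \<in> cube c \<rho>"
  have "(norm (x - c))\<^sup>2 = (\<Sum>b\<in>Basis. ((x - c) \<bullet> b)\<^sup>2)"
    unfolding power2_norm_eq_inner euclidean_inner[of "x - c" "x - c"] by (simp add: power2_eq_square)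
  also have "\<dots> \<le> (\<Sum>b\<in>(Basis::(real^3) set). \<rho>\<^sup>2)"
    using x \<rho> by (intro sum_mono) (auto simp: mem_cube abs_le_square_iff[symmetric])
  also have "\<dots> = 3 * \<rho>\<^sup>2" by simp
  also have "\<dots> \<le> (2 * \<rho>)\<^sup>2" by (simp add: power2_eq_square)
  finally have "norm (x - c) \<le> 2 * \<rho>" by (rule power2_le_imp_le) (use \<rho> in simp)
  then show "x \<in> cball c (2 * \<rho>)" by (simp add: dist_norm norm_minus_commute)
qed

lemma nn_integral_Ioc_affine:
  fixes e :: "real \<Rightarrow> real"
  assumes e: "continuous_on {0<..T} e" "\<And>t. 0 < t \<Longrightarrow> t \<le> T \<Longrightarrow> 0 \<le> e t" and ac: "0 \<le> a" "0 \<le> c" and T: "0 < T"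
  shows "(\<integral>\<^sup>+t\<in>{0<..T}. ennreal (a * e t + c) \<partial>lborel)
    = ennreal a * (\<integral>\<^sup>+t\<in>{0<..T}. ennreal (e t) \<partial>lborel) + ennreal (c * T)"
proof -
  have "(\<lambda>t. indicator {0<..T} t *\<^sub>R e t) \<in> borel_measurable borel"
    by (rule borel_measurable_continuous_on_indicator[OF _ e(1)]) auto
  then have "(\<lambda>t. ennreal (indicator {0<..T} t *\<^sub>R e t)) \<in> borel_measurable borel" by measurable
  moreover have "(\<lambda>t. ennreal (indicator {0<..T} t *\<^sub>R e t)) = (\<lambda>t. ennreal (e t) * indicator {0<..T} t)"
    by (auto simp: indicator_def)
  ultimately have meas: "(\<lambda>t. ennreal (e t) * indicator {0<..T} t) \<in> borel_measurable lborel" by simp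
  have "(\<integral>\<^sup>+t\<in>{0<..T}. ennreal (a * e t + c) \<partial>lborel)
      = (\<integral>\<^sup>+t. ennreal a * (ennreal (e t) * indicator {0<..T} t) + ennreal c * indicator {0<..T} t \<partial>lborel)"
    using e ac by (intro nn_integral_cong) (auto simp: indicator_def ennreal_plus ennreal_mult)
  also have "\<dots> = ennreal a * (\<integral>\<^sup>+t\<in>{0<..T}. ennreal (e t) \<partial>lborel) + ennreal c * emeasure lborel {0<..T}"
    using meas by (simp add: nn_integral_add nn_integral_cmult nn_integral_cmult_indicator)
  finally show ?thesis using T ac by (simp add: ennreal_mult)
qed

section \<open>Consequences of the structural inequalities\<close>

context flow_law
begin

lemma kappa_pos: "0 < \<kappa>" and xi_pos: "0 < \<xi>"
  using kappa_ge_1 chi_ge_1 by auto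

lemma G_pos: "0 < G y"
proof -
  have "0 < \<kappa> * G y" using G_lower[of y] by linarith
  then show ?thesis using kappa_pos by (simp add: zero_less_mult_iff)
qed

lemma norm_X_sq_le: "(norm (X y))\<^sup>2 \<le> \<kappa> * (G y * (norm (X y))\<^sup>2)"
  using mult_right_mono[OF G_lower[of y], of "(norm (X y))\<^sup>2"] by (simp add: mult.assoc)

text \<open>Monotonicity and the lower bound of \<open>G\<close> make \<open>X\<close> cocoercive;
  the Lipschitz bound follows by Cauchy--Schwarz.\<close>

lemma norm_dX_sq_le: "(norm (X y - X y'))\<^sup>2 \<le> \<kappa> * ((X y - X y') \<bullet> (y - y'))"
proof -
  have "2 * (norm (X y - X y'))\<^sup>2 \<le> (\<kappa> * (G y + G y')) * (norm (X y - X y'))\<^sup>2"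
    using G_lower[of y] G_lower[of y'] by (intro mult_right_mono) (auto simp: distrib_left)
  also have "\<dots> = \<kappa> * ((G y + G y') * (norm (X y - X y'))\<^sup>2)" by simp
  also have "\<dots> \<le> \<kappa> * (2 * ((X y - X y') \<bullet> (y - y')))"
    using X_monotone kappa_pos by (intro mult_left_mono) auto
  finally show ?thesis by simp
qed

lemma X_lipschitz: "norm (X y - X y') \<le> \<kappa> * norm (y - y')"
proof (cases "X y = X y'")
  case False
  have "(norm (X y - X y'))\<^sup>2 \<le> \<kappa> * (norm (X y - X y') * norm (y - y'))"
    using norm_dX_sq_le[of y y'] mult_left_mono[OF norm_cauchy_schwarz[of "X y - X y'" "y - y'"], of \<kappa>] kappa_pos
    by linarith
  then show ?thesis using False by (simp add: power2_eq_square)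
qed (use kappa_pos in simp)

lemma X_continuous: "continuous_on UNIV X"
  using X_differentiable by (simp add: continuous_on_eq_continuous_at differentiable_imp_continuous_within)

lemma X_cont [continuous_intros]: "continuous_on A f \<Longrightarrow> continuous_on A (\<lambda>x. X (f x))"
  by (rule continuous_on_compose2[OF X_continuous]) auto

lemma G_cont [continuous_intros]: "continuous_on A f \<Longrightarrow> continuous_on A (\<lambda>x. G (f x))"
  by (rule continuous_on_compose2[OF G_continuous]) auto

end

text \<open>The cut-offs live on cubes of half side length \<open>2 r\<close> and \<open>6 r\<close>; the factor 13 makes room for the larger
  cube, which is contained in the ball of radius \<open>12 r\<close>, and its translates by at most \<open>r\<close>.\<close>

locale local_flow = flow_law \<kappa> \<xi> \<theta> X G
  for \<kappa> \<xi> \<theta> :: real and X :: "real^3 \<Rightarrow> real^3" and G :: "real^3 \<Rightarrow> real" +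
  fixes c :: "real^3" and r \<phi> M T :: real and U :: "(real^3) set"
    and u ut \<Psi> \<Psi>t :: "real^3 \<Rightarrow> real \<Rightarrow> real" and Du D\<Psi> :: "real^3 \<Rightarrow> real \<Rightarrow> real^3"
    and D2u :: "real^3 \<Rightarrow> real \<Rightarrow> real^3^3" and z0 :: "real \<Rightarrow> real^3" and A :: "real^3 \<Rightarrow> real^3"
  assumes r: "0 < r" and phi: "0 < \<phi>" "\<phi> \<le> 1" and T: "0 < T" and M: "0 \<le> M"
    and U: "open U" "cball c (13 * r) \<subseteq> U"
    and u_cont: "continuous_on (U \<times> {0..T}) (\<lambda>(x, t). u x t)"
    and u_bound: "\<And>x t. x \<in> U \<Longrightarrow> 0 \<le> t \<Longrightarrow> t \<le> T \<Longrightarrow> \<bar>u x t\<bar> \<le> M"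
    and Du_cont: "continuous_on (U \<times> {0<..T}) (\<lambda>(x, t). Du x t)"
    and D2u_cont: "continuous_on (U \<times> {0<..T}) (\<lambda>(x, t). D2u x t)"
    and ut_cont: "continuous_on (U \<times> {0<..T}) (\<lambda>(x, t). ut x t)"
    and Du: "\<And>x t. x \<in> U \<Longrightarrow> 0 < t \<Longrightarrow> t \<le> T \<Longrightarrow> GDERIV (\<lambda>y. u y t) x :> Du x t"
    and D2u: "\<And>x t. x \<in> U \<Longrightarrow> 0 < t \<Longrightarrow> t \<le> T \<Longrightarrow> ((\<lambda>y. Du y t) has_derivative (\<lambda>h. D2u x t *v h)) (at x)"
    and ut: "\<And>x t. x \<in> U \<Longrightarrow> 0 < t \<Longrightarrow> t \<le> T \<Longrightarrow> (u x has_vector_derivative ut x t) (at t within {0..T})"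
    and Psi_cont: "continuous_on (U \<times> {0..T}) (\<lambda>(x, t). \<Psi> x t)"
    and DPsi_cont: "continuous_on (U \<times> {0..T}) (\<lambda>(x, t). D\<Psi> x t)"
    and Psit_cont: "continuous_on (U \<times> {0..T}) (\<lambda>(x, t). \<Psi>t x t)"
    and DPsi: "\<And>x t. x \<in> U \<Longrightarrow> 0 \<le> t \<Longrightarrow> t \<le> T \<Longrightarrow> GDERIV (\<lambda>y. \<Psi> y t) x :> D\<Psi> x t"
    and Psit: "\<And>x t. x \<in> U \<Longrightarrow> 0 \<le> t \<Longrightarrow> t \<le> T \<Longrightarrow> (\<Psi> x has_vector_derivative \<Psi>t x t) (at t within {0..T})"
    and z0_cont: "continuous_on UNIV z0" and A_linear: "bounded_linear A"
    and A_bound: "\<And>v. norm (A v) \<le> \<xi>\<^sup>2 * norm v"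
    and Z_bound: "\<And>x t. x \<in> U \<Longrightarrow> norm (z0 t + A x) \<le> \<xi>\<^sup>2"
    and pde: "\<And>x t V'. x \<in> U \<Longrightarrow> 0 < t \<Longrightarrow> t \<le> T \<Longrightarrow>
      ((\<lambda>y. X (Du y t + (u y t)\<^sup>2 *\<^sub>R (z0 t + A y))) has_derivative V') (at x) \<Longrightarrow>
      \<phi> * ut x t = (\<Sum>b\<in>Basis. V' b \<bullet> b)"
    and kappa_geometry: "200 \<le> \<kappa>" "4 / r \<le> \<kappa>" "exp (1 / r\<^sup>2) \<le> \<kappa>" "measure lborel (cube c (6 * r)) \<le> \<kappa>"
begin

text \<open>Two scales are needed because difference quotients look outside the support of the inner
  cut-off. The points of \<open>B2\<close> and their shifts by at most \<open>r\<close> lie in the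
  ball of radius 5 r, where \<open>\<omega>\<close> is bounded below, so integrals of
  \<open>G\<close> at these points are controlled by the energy.\<close>

definition "\<zeta> = cutoff c (2 * r)"
definition "\<omega> = cutoff c (6 * r)"
definition "B2 = cube c (2 * r)"
definition "B6 = cube c (6 * r)"

definition Z :: "real^3 \<Rightarrow> real \<Rightarrow> real^3" where "Z x t = z0 t + A x"
definition \<Phi> :: "real^3 \<Rightarrow> real \<Rightarrow> real^3" where "\<Phi> x t = Du x t + (u x t)\<^sup>2 *\<^sub>R Z x t"
definition V :: "real^3 \<Rightarrow> real \<Rightarrow> real^3" where "V x t = X (\<Phi> x t)"
definition d\<Phi> :: "real^3 \<Rightarrow> real \<Rightarrow> real^3 \<Rightarrow> real^3" where
  "d\<Phi> x t h = D2u x t *v h + ((u x t)\<^sup>2 *\<^sub>R A h + (2 * u x t * (Du x t \<bullet> h)) *\<^sub>R Z x t)"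
definition dV :: "real^3 \<Rightarrow> real \<Rightarrow> real^3 \<Rightarrow> real^3" where
  "dV x t = frechet_derivative (\<lambda>y. V y t) (at x)"

definition energy :: "real \<Rightarrow> real" where
  "energy t = integral B6 (\<lambda>x. (\<omega> x)\<^sup>2 * (G (\<Phi> x t) * (norm (V x t))\<^sup>2))"

lemma geometry:
  shows B2_cball: "B2 \<subseteq> cball c (4 * r)" and B6_U: "B6 \<subseteq> U" and B2_U: "B2 \<subseteq> U"
    and cball2_B2: "cball c (2 * r) \<subseteq> B2" and cball6_B6: "cball c (6 * r) \<subseteq> B6"
    and B2_B6: "B2 \<subseteq> B6"
proof -
  show 1: "B2 \<subseteq> cball c (4 * r)" using cube_subset_cball[of "2 * r" c] r by (simp add: B2_def)
  have "B6 \<subseteq> cball c (12 * r)" using cube_subset_cball[of "6 * r" c] r by (simp add: B6_def)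
  also have "\<dots> \<subseteq> cball c (13 * r)" using r by auto
  finally show "B6 \<subseteq> U" using U by blast
  have "cball c (4 * r) \<subseteq> cball c (13 * r)" using r by auto
  then show "B2 \<subseteq> U" using 1 U by blast
  show "cball c (2 * r) \<subseteq> B2" "cball c (6 * r) \<subseteq> B6"
    unfolding B2_def B6_def by (rule cball_subset_cube)+
  show "B2 \<subseteq> B6" unfolding B2_def B6_def subset_iff mem_cube using r by force
qed

lemma shift_geometry:
  assumes "x \<in> B2" "0 \<le> h" "h \<le> r" "norm b = 1"
  shows "x + h *\<^sub>R b \<in> cball c (5 * r)" "x + h *\<^sub>R b \<in> B6" "x + h *\<^sub>R b \<in> U"
proof -
  have "dist c (x + h *\<^sub>R b) \<le> dist c x + h"
    using dist_triangle[of c "x + h *\<^sub>R b" x] assms by (simp add: dist_norm)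
  then show *: "x + h *\<^sub>R b \<in> cball c (5 * r)" using B2_cball assms by auto
  moreover have "cball c (5 * r) \<subseteq> cball c (6 * r)" using r by auto
  ultimately show "x + h *\<^sub>R b \<in> B6" using cball6_B6 by blast
  then show "x + h *\<^sub>R b \<in> U" using B6_U by blast
qed

lemma B_cbox: "B2 = cbox (c - (2 * r) *\<^sub>R One) (c + (2 * r) *\<^sub>R One)"
  "B6 = cbox (c - (6 * r) *\<^sub>R One) (c + (6 * r) *\<^sub>R One)"
  by (simp_all add: B2_def B6_def cube_def)

lemma cont_rules [continuous_intros]:
  fixes p :: "'i::topological_space \<Rightarrow> real^3"
  assumes "continuous_on I p" "continuous_on I s" "\<And>i. i \<in> I \<Longrightarrow> p i \<in> U"
  shows cont_u: "(\<And>i. i \<in> I \<Longrightarrow> 0 \<le> s i \<and> s i \<le> T) \<Longrightarrow> continuous_on I (\<lambda>i. u (p i) (s i))"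
    and cont_Du: "(\<And>i. i \<in> I \<Longrightarrow> 0 < s i \<and> s i \<le> T) \<Longrightarrow> continuous_on I (\<lambda>i. Du (p i) (s i))"
    and cont_D2u: "(\<And>i. i \<in> I \<Longrightarrow> 0 < s i \<and> s i \<le> T) \<Longrightarrow> continuous_on I (\<lambda>i. D2u (p i) (s i))"
    and cont_ut: "(\<And>i. i \<in> I \<Longrightarrow> 0 < s i \<and> s i \<le> T) \<Longrightarrow> continuous_on I (\<lambda>i. ut (p i) (s i))"
    and cont_Psi: "(\<And>i. i \<in> I \<Longrightarrow> 0 \<le> s i \<and> s i \<le> T) \<Longrightarrow> continuous_on I (\<lambda>i. \<Psi> (p i) (s i))"
    and cont_DPsi: "(\<And>i. i \<in> I \<Longrightarrow> 0 \<le> s i \<and> s i \<le> T) \<Longrightarrow> continuous_on I (\<lambda>i. D\<Psi> (p i) (s i))"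
    and cont_Psit: "(\<And>i. i \<in> I \<Longrightarrow> 0 \<le> s i \<and> s i \<le> T) \<Longrightarrow> continuous_on I (\<lambda>i. \<Psi>t (p i) (s i))"
    and cont_Z: "continuous_on I (\<lambda>i. Z (p i) (s i))"
proof -
  have P: "continuous_on I (\<lambda>i. (p i, s i))" by (intro continuous_intros assms)
  show "continuous_on I (\<lambda>i. u (p i) (s i))" if "\<And>i. i \<in> I \<Longrightarrow> 0 \<le> s i \<and> s i \<le> T"
    using continuous_on_compose2[OF u_cont P] assms(3) that by (auto simp: image_subset_iff)
  show "continuous_on I (\<lambda>i. Du (p i) (s i))" if "\<And>i. i \<in> I \<Longrightarrow> 0 < s i \<and> s i \<le> T"
    using continuous_on_compose2[OF Du_cont P] assms(3) that by (auto simp: image_subset_iff)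
  show "continuous_on I (\<lambda>i. D2u (p i) (s i))" if "\<And>i. i \<in> I \<Longrightarrow> 0 < s i \<and> s i \<le> T"
    using continuous_on_compose2[OF D2u_cont P] assms(3) that by (auto simp: image_subset_iff)
  show "continuous_on I (\<lambda>i. ut (p i) (s i))" if "\<And>i. i \<in> I \<Longrightarrow> 0 < s i \<and> s i \<le> T"
    using continuous_on_compose2[OF ut_cont P] assms(3) that by (auto simp: image_subset_iff)
  show "continuous_on I (\<lambda>i. \<Psi> (p i) (s i))" if "\<And>i. i \<in> I \<Longrightarrow> 0 \<le> s i \<and> s i \<le> T"
    using continuous_on_compose2[OF Psi_cont P] assms(3) that by (auto simp: image_subset_iff)
  show "continuous_on I (\<lambda>i. D\<Psi> (p i) (s i))" if "\<And>i. i \<in> I \<Longrightarrow> 0 \<le> s i \<and> s i \<le> T"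
    using continuous_on_compose2[OF DPsi_cont P] assms(3) that by (auto simp: image_subset_iff)
  show "continuous_on I (\<lambda>i. \<Psi>t (p i) (s i))" if "\<And>i. i \<in> I \<Longrightarrow> 0 \<le> s i \<and> s i \<le> T"
    using continuous_on_compose2[OF Psit_cont P] assms(3) that by (auto simp: image_subset_iff)
  show "continuous_on I (\<lambda>i. Z (p i) (s i))"
    unfolding Z_def
    by (intro continuous_on_add continuous_on_compose2[OF z0_cont] bounded_linear.continuous_on[OF A_linear] assms) auto
qed

lemma cont_Phi [continuous_intros]:
  fixes p :: "'i::topological_space \<Rightarrow> real^3"
  assumes "continuous_on I p" "continuous_on I s" "\<And>i. i \<in> I \<Longrightarrow> p i \<in> U"
    and "\<And>i. i \<in> I \<Longrightarrow> 0 < s i \<and> s i \<le> T"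
  shows "continuous_on I (\<lambda>i. \<Phi> (p i) (s i))"
  unfolding \<Phi>_def using assms by (intro continuous_intros) (auto intro: less_imp_le)

lemma cont_V [continuous_intros]:
  fixes p :: "'i::topological_space \<Rightarrow> real^3"
  assumes "continuous_on I p" "continuous_on I s" "\<And>i. i \<in> I \<Longrightarrow> p i \<in> U"
    and "\<And>i. i \<in> I \<Longrightarrow> 0 < s i \<and> s i \<le> T"
  shows "continuous_on I (\<lambda>i. V (p i) (s i))"
  unfolding V_def using assms by (intro X_cont cont_Phi)

lemma cont_dPhi [continuous_intros]:
  fixes p :: "'i::topological_space \<Rightarrow> real^3"
  assumes "continuous_on I p" "continuous_on I s" "\<And>i. i \<in> I \<Longrightarrow> p i \<in> U"
    and "\<And>i. i \<in> I \<Longrightarrow> 0 < s i \<and> s i \<le> T"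
  shows "continuous_on I (\<lambda>i. d\<Phi> (p i) (s i) b)"
proof -
  have "continuous_on I (\<lambda>i. D2u (p i) (s i) *v b)"
  proof (rule bounded_linear.continuous_on[OF _ cont_D2u[OF assms]])
    show "bounded_linear (\<lambda>B::real^3^3. B *v b)"
      unfolding linear_conv_bounded_linear[symmetric]
      by (rule linearI) (simp_all add: matrix_vector_mult_add_rdistrib scaleR_matrix_vector_assoc)
  qed auto
  then show ?thesis
    unfolding d\<Phi>_def using assms by (intro continuous_intros) (auto intro: less_imp_le)
qed

lemma cutoff_cont [continuous_intros]:
  "continuous_on I f \<Longrightarrow> continuous_on I (\<lambda>x. \<zeta> (f x))"
  "continuous_on I f \<Longrightarrow> continuous_on I (\<lambda>x. \<omega> (f x))"
  unfolding \<zeta>_def \<omega>_def by (intro continuous_intros, assumption)+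

lemma cutoff_simps [simp]: "0 \<le> \<zeta> x" "\<zeta> x \<le> 1" "0 \<le> \<omega> x" "\<omega> x \<le> 1"
  by (simp_all add: \<zeta>_def \<omega>_def)

lemma dcutoff_bounds: "norm (dcutoff c (2 * r) x) \<le> \<kappa>" "norm (dcutoff c (6 * r) x) \<le> \<kappa>"
proof -
  have "4 / (2 * r) \<le> 4 / r" "4 / (6 * r) \<le> 4 / r" using r by (simp_all add: field_simps)
  then show "norm (dcutoff c (2 * r) x) \<le> \<kappa>" "norm (dcutoff c (6 * r) x) \<le> \<kappa>"
    using norm_dcutoff_le[of "2 * r" c x] norm_dcutoff_le[of "6 * r" c x] r kappa_geometry(2) by auto
qed

lemma Phi_derivative:
  assumes "x \<in> U" "0 < t" "t \<le> T"
  shows "((\<lambda>y. \<Phi> y t) has_derivative d\<Phi> x t) (at x)"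
proof -
  have Au: "((\<lambda>y. u y t) has_derivative (\<lambda>h. Du x t \<bullet> h)) (at x)"
    using Du[OF assms] by (simp add: gderiv_def inner_commute)
  have "((\<lambda>y. (u y t)\<^sup>2) has_derivative (\<lambda>h. 2 * u x t * (Du x t \<bullet> h))) (at x)"
    by (rule has_derivative_eq_rhs[OF has_derivative_power[OF Au, of 2]]) (auto simp: mult_ac)
  moreover have "((\<lambda>y. Z y t) has_derivative A) (at x)"
    unfolding Z_def by (rule has_derivative_eq_rhs, rule has_derivative_add[OF has_derivative_const
          bounded_linear_imp_has_derivative[OF A_linear]]) simp
  ultimately have "((\<lambda>y. (u y t)\<^sup>2 *\<^sub>R Z y t) has_derivative
      (\<lambda>h. (u x t)\<^sup>2 *\<^sub>R A h + (2 * u x t * (Du x t \<bullet> h)) *\<^sub>R Z x t)) (at x)"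
    by (rule has_derivative_scaleR)
  then have "((\<lambda>y. \<Phi> y t) has_derivative (\<lambda>h. D2u x t *v h + ((u x t)\<^sup>2 *\<^sub>R A h + (2 * u x t * (Du x t \<bullet> h)) *\<^sub>R Z x t))) (at x)"
    unfolding \<Phi>_def using D2u[OF assms] by (intro has_derivative_add)
  then show ?thesis by (simp add: d\<Phi>_def[abs_def])
qed

text \<open>Chain rule. The derivative of \<open>X\<close> inherits the Lipschitz constant
  \<open>\<kappa>\<close>, and the trace identity is the differential equation itself.\<close>

lemma V_derivative:
  assumes "x \<in> U" "0 < t" "t \<le> T"
  shows "((\<lambda>y. V y t) has_derivative dV x t) (at x)"
    and "norm (dV x t h) \<le> \<kappa> * norm (d\<Phi> x t h)"
    and "(\<Sum>b\<in>Basis. dV x t b \<bullet> b) = \<phi> * ut x t"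
proof -
  obtain X' where X': "(X has_derivative X') (at (\<Phi> x t))"
    using X_differentiable differentiable_def by blast
  have "((\<lambda>y. V y t) has_derivative (\<lambda>h. X' (d\<Phi> x t h))) (at x)"
    unfolding V_def by (rule has_derivative_compose[OF Phi_derivative[OF assms] X'])
  then have eq: "dV x t = (\<lambda>h. X' (d\<Phi> x t h))" and d: "((\<lambda>y. V y t) has_derivative dV x t) (at x)"
    using frechet_derivative_at[of "\<lambda>y. V y t"] by (auto simp: dV_def)
  show "((\<lambda>y. V y t) has_derivative dV x t) (at x)" by (rule d)
  show "norm (dV x t h) \<le> \<kappa> * norm (d\<Phi> x t h)"
    unfolding eq by (rule has_derivative_lipschitz[OF X' X_lipschitz])
  show "(\<Sum>b\<in>Basis. dV x t b \<bullet> b) = \<phi> * ut x t"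
    using pde[OF assms, of "dV x t"] d by (simp add: V_def[abs_def] \<Phi>_def Z_def)
qed

text \<open>\<open>d\<Phi>\<close> is continuous on the compact set and \<open>X\<close> is
  Lipschitz. This is the bound on derivatives that \<open>integral_by_parts\<close> asks
  for.\<close>

lemma dV_bounded:
  assumes "compact K" "K \<subseteq> U" "0 < t" "t \<le> T"
  shows "\<exists>L. \<forall>x\<in>K. \<forall>b\<in>Basis. norm (dV x t b) \<le> L"
proof -
  have "\<exists>L. \<forall>x\<in>K. norm (d\<Phi> x t b) \<le> L" for b
  proof -
    have "continuous_on K (\<lambda>x. d\<Phi> x t b)" using assms by (intro continuous_intros) auto
    then have "bounded ((\<lambda>x. d\<Phi> x t b) ` K)" using assms(1) by (intro compact_imp_bounded compact_continuous_image)
    then show ?thesis by (auto simp: bounded_iff)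
  qed
  then obtain L where L: "\<And>x b. x \<in> K \<Longrightarrow> norm (d\<Phi> x t b) \<le> L b" by metis
  have "norm (dV x t b) \<le> \<kappa> * (\<Sum>b\<in>Basis. \<bar>L b\<bar>)" if "x \<in> K" "b \<in> Basis" for x b
  proof -
    have "L b \<le> (\<Sum>b\<in>Basis. \<bar>L b\<bar>)"
      using that member_le_sum[of b Basis "\<lambda>b. \<bar>L b\<bar>"] by auto
    then show ?thesis
      using V_derivative(2)[of x t b] L[OF that(1), of b] that assms kappa_pos
      by (intro order.trans[OF V_derivative(2)] mult_left_mono) auto
  qed
  then show ?thesis by blast
qed

text \<open>To be read with s = \<open>\<omega> x\<close>, y = \<open>\<Phi> x t\<close>, v the
  solution, w its difference from the truncated extension, d the slope of the truncation and e the
  gradient of the cut-off; y - v^2 Z is then the gradient of the solution. The product of X y and y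
  reproduces the energy density E. The terms with Z, P and e cost E / 8 each by Young's inequality
  and the one with Pt costs none, so at least E / 2 is left. The constant 38 is 2 + 32 + 4.\<close>

lemma energy_pointwise:
  fixes y e P Z :: "real^3" and s v w d Pt :: real
  assumes s: "0 \<le> s" "s \<le> 1" and v: "\<bar>v\<bar> \<le> M" and w: "\<bar>w\<bar> \<le> 2 * M + 2" and Z: "norm Z \<le> \<xi>\<^sup>2"
    and e: "norm e \<le> \<kappa>" and d: "0 \<le> d" "d \<le> 1"
  shows "- (X y \<bullet> (s\<^sup>2 *\<^sub>R ((y - v\<^sup>2 *\<^sub>R Z) - d *\<^sub>R P) + (2 * s * w) *\<^sub>R e)) - \<phi> * s\<^sup>2 * w * d * Pt
    \<le> - (1/2) * (s\<^sup>2 * (G y * (norm (X y))\<^sup>2)) + 2 * \<kappa> * (s\<^sup>2 * ((norm P)\<^sup>2 + \<phi> * Pt\<^sup>2)) + 38 * \<kappa>^3 * \<xi>^4 * (M + 1)^4"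
proof -
  define n where "n = norm (X y)"
  define E where "E = s\<^sup>2 * (G y * n\<^sup>2)"
  define m where "m = M + 1"
  have m: "1 \<le> m" using M by (simp add: m_def)
  have n: "0 \<le> n" by (simp add: n_def)
  have k: "1 \<le> \<kappa>" "0 < \<kappa>" using kappa_ge_1 kappa_pos .
  have sn: "(s * n)\<^sup>2 \<le> \<kappa> * E"
    using mult_left_mono[OF norm_X_sq_le[of y], of "s\<^sup>2"] by (simp add: E_def n_def power_mult_distrib mult_ac)
  have young: "(s * n) * q \<le> E / 8 + 2 * \<kappa> * q\<^sup>2" for q
  proof -
    have "0 \<le> (s * n - 4 * \<kappa> * q)\<^sup>2" by simp
    then have "8 * \<kappa> * ((s * n) * q) \<le> (s * n)\<^sup>2 + 16 * \<kappa>\<^sup>2 * q\<^sup>2"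
      by (simp add: power2_diff power_mult_distrib algebra_simps)
    also have "\<dots> \<le> \<kappa> * E + 16 * \<kappa>\<^sup>2 * q\<^sup>2" using sn by simp
    also have "\<dots> = 8 * \<kappa> * (E / 8 + 2 * \<kappa> * q\<^sup>2)" by (simp add: power2_eq_square algebra_simps)
    finally show ?thesis using k by simp
  qed
  have eq: "- (X y \<bullet> (s\<^sup>2 *\<^sub>R ((y - v\<^sup>2 *\<^sub>R Z) - d *\<^sub>R P) + (2 * s * w) *\<^sub>R e))
      = - E + s\<^sup>2 * v\<^sup>2 * (X y \<bullet> Z) + s\<^sup>2 * d * (X y \<bullet> P) - 2 * s * w * (X y \<bullet> e)"
    using X_inner[of y] by (simp add: inner_diff_right inner_add_right E_def n_def algebra_simps)
  have v2: "v\<^sup>2 \<le> m\<^sup>2" using v M by (intro power2_le_iff_abs_le[THEN iffD2]) (auto simp: m_def)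
  have t1: "s\<^sup>2 * v\<^sup>2 * (X y \<bullet> Z) \<le> E / 8 + 2 * \<kappa> * (m^4 * \<xi>^4)"
  proof -
    have "X y \<bullet> Z \<le> n * \<xi>\<^sup>2"
      using norm_cauchy_schwarz[of "X y" Z] Z mult_left_mono[of "norm Z" "\<xi>\<^sup>2" n] n by (simp add: n_def)
    then have "s\<^sup>2 * v\<^sup>2 * (X y \<bullet> Z) \<le> s\<^sup>2 * v\<^sup>2 * (n * \<xi>\<^sup>2)" by (intro mult_left_mono) auto
    also have "\<dots> \<le> s * m\<^sup>2 * (n * \<xi>\<^sup>2)"
      using s v2 n mult_right_mono[of s 1 s] by (intro mult_right_mono mult_mono) (auto simp: power2_eq_square)
    also have "\<dots> = (s * n) * (m\<^sup>2 * \<xi>\<^sup>2)" by simp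
    also have "\<dots> \<le> E / 8 + 2 * \<kappa> * (m\<^sup>2 * \<xi>\<^sup>2)\<^sup>2" by (rule young)
    finally show ?thesis by (simp add: power_mult_distrib flip: power_mult)
  qed
  have t2: "s\<^sup>2 * d * (X y \<bullet> P) \<le> E / 8 + 2 * \<kappa> * (s\<^sup>2 * (norm P)\<^sup>2)"
  proof -
    have "X y \<bullet> P \<le> n * norm P" using norm_cauchy_schwarz[of "X y" P] by (simp add: n_def)
    then have "s\<^sup>2 * d * (X y \<bullet> P) \<le> s\<^sup>2 * d * (n * norm P)" using d by (intro mult_left_mono) auto
    also have "\<dots> \<le> s\<^sup>2 * 1 * (n * norm P)" using d n by (intro mult_right_mono mult_left_mono) auto
    also have "\<dots> = (s * n) * (s * norm P)" by (simp add: power2_eq_square)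
    also have "\<dots> \<le> E / 8 + 2 * \<kappa> * (s * norm P)\<^sup>2" by (rule young)
    finally show ?thesis by (simp add: power_mult_distrib)
  qed
  have w': "\<bar>w\<bar> \<le> 2 * m" using w by (simp add: m_def)
  have t3: "- (2 * s * w * (X y \<bullet> e)) \<le> E / 8 + 32 * \<kappa>^3 * m\<^sup>2"
  proof -
    have "\<bar>X y \<bullet> e\<bar> \<le> n * \<kappa>"
      using Cauchy_Schwarz_ineq2[of "X y" e] e mult_left_mono[of "norm e" \<kappa> n] n by (simp add: n_def)
    then have "2 * s * \<bar>w\<bar> * \<bar>X y \<bullet> e\<bar> \<le> 2 * s * (2 * m) * (n * \<kappa>)"
      using s w' n m k by (intro mult_mono) auto
    also have "\<dots> = (s * n) * (4 * m * \<kappa>)" by simp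
    finally have le: "2 * s * \<bar>w\<bar> * \<bar>X y \<bullet> e\<bar> \<le> (s * n) * (4 * m * \<kappa>)" .
    have "- (2 * s * w * (X y \<bullet> e)) \<le> \<bar>2 * s * w * (X y \<bullet> e)\<bar>" by (rule abs_ge_minus_self)
    also have "\<dots> = 2 * s * \<bar>w\<bar> * \<bar>X y \<bullet> e\<bar>" using s(1) by (simp only: abs_mult)
    also have "\<dots> \<le> (s * n) * (4 * m * \<kappa>)" by (rule le)
    also have "\<dots> \<le> E / 8 + 2 * \<kappa> * (4 * m * \<kappa>)\<^sup>2" by (rule young)
    also have "2 * \<kappa> * (4 * m * \<kappa>)\<^sup>2 = 32 * \<kappa>^3 * m\<^sup>2"
      by (simp add: power_mult_distrib power3_eq_cube power2_eq_square)
    finally show ?thesis .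
  qed
  have t4: "- (\<phi> * s\<^sup>2 * w * d * Pt) \<le> 2 * \<kappa> * (s\<^sup>2 * (\<phi> * Pt\<^sup>2)) + 4 * m\<^sup>2"
  proof -
    have "- (\<phi> * s\<^sup>2 * w * d * Pt) \<le> \<bar>\<phi> * s\<^sup>2 * w * d * Pt\<bar>" by simp
    also have "\<dots> = (\<phi> * s\<^sup>2) * d * (\<bar>w\<bar> * \<bar>Pt\<bar>)" using d phi by (simp add: abs_mult)
    also have "\<dots> \<le> (\<phi> * s\<^sup>2) * 1 * (\<bar>w\<bar> * \<bar>Pt\<bar>)"
      using d phi by (intro mult_right_mono mult_left_mono) auto
    also have "\<dots> \<le> (\<phi> * s\<^sup>2) * 1 * (w\<^sup>2 + Pt\<^sup>2)"
    proof (intro mult_left_mono)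
      show "\<bar>w\<bar> * \<bar>Pt\<bar> \<le> w\<^sup>2 + Pt\<^sup>2"
        using sum_squares_bound[of "\<bar>w\<bar>" "\<bar>Pt\<bar>"] mult_nonneg_nonneg[OF abs_ge_zero abs_ge_zero, of w Pt]
        unfolding power2_abs by linarith
    qed (use phi in auto)
    also have "\<dots> \<le> 2 * \<kappa> * (s\<^sup>2 * (\<phi> * Pt\<^sup>2)) + 4 * m\<^sup>2"
    proof -
      have "\<phi> * s\<^sup>2 * w\<^sup>2 \<le> 1 * 1 * (2 * m)\<^sup>2"
        using phi s w' m by (intro mult_mono power2_le_iff_abs_le[THEN iffD2]) (auto simp: power_le_one)
      moreover have "\<phi> * s\<^sup>2 * Pt\<^sup>2 \<le> 2 * \<kappa> * (\<phi> * s\<^sup>2 * Pt\<^sup>2)"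
        using k phi mult_right_mono[of 1 "2 * \<kappa>" "\<phi> * s\<^sup>2 * Pt\<^sup>2"] by simp
      ultimately show ?thesis by (simp add: power_mult_distrib algebra_simps)
    qed
    finally show ?thesis .
  qed
  have m24: "m\<^sup>2 \<le> \<xi>^4 * m^4"
  proof -
    have "1 * m\<^sup>2 \<le> \<xi>^4 * m^4"
      using m chi_ge_1 by (intro mult_mono power_increasing) (auto simp: one_le_power)
    then show ?thesis by simp
  qed
  have "2 * \<kappa> * (m^4 * \<xi>^4) + 32 * \<kappa>^3 * m\<^sup>2 + 4 * m\<^sup>2 \<le> 38 * \<kappa>^3 * (\<xi>^4 * m^4)"
  proof -
    have k3: "\<kappa> \<le> \<kappa>^3" "1 \<le> \<kappa>^3" using k power_increasing[of 1 3 \<kappa>] by (auto simp: one_le_power)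
    have "2 * \<kappa> * (m^4 * \<xi>^4) \<le> 2 * \<kappa>^3 * (\<xi>^4 * m^4)"
      using k3 by (simp add: mult.commute[of "m^4"] mult_right_mono)
    moreover have "32 * \<kappa>^3 * m\<^sup>2 \<le> 32 * \<kappa>^3 * (\<xi>^4 * m^4)" using m24 k by (intro mult_left_mono) auto
    moreover have "4 * m\<^sup>2 \<le> 4 * \<kappa>^3 * (\<xi>^4 * m^4)"
      using m24 k k3 m mult_mono[of 1 "\<kappa>^3" "m\<^sup>2" "\<xi>^4 * m^4"] by simp
    ultimately show ?thesis by (simp add: algebra_simps)
  qed
  moreover have "- (1/2) * E = - E + 3 * (E / 8) + E / 8" by simp
  moreover have "0 \<le> E" using G_pos[of y] by (simp add: E_def less_imp_le)
  ultimately show ?thesis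
    unfolding eq using t1 t2 t3 t4 unfolding E_def[symmetric] n_def[symmetric] m_def[symmetric]
    by (simp add: distrib_left mult_ac)
qed

section \<open>Testing with the truncated difference\<close>

lemma cont_dtrunc_expr [continuous_intros]:
  fixes p :: "'i::topological_space \<Rightarrow> real^3"
  assumes "continuous_on I p" "continuous_on I s" "\<And>i. i \<in> I \<Longrightarrow> p i \<in> U"
    and "\<And>i. i \<in> I \<Longrightarrow> 0 \<le> s i \<and> s i \<le> T"
  shows "continuous_on I (\<lambda>i. dtrunc M (\<Psi> (p i) (s i)))"
  using assms by (auto intro!: dtrunc_continuous cont_Psi)

definition w :: "real^3 \<Rightarrow> real \<Rightarrow> real" where "w x t = u x t - trunc M (\<Psi> x t)"
definition wt :: "real^3 \<Rightarrow> real \<Rightarrow> real" where "wt x t = ut x t - dtrunc M (\<Psi> x t) * \<Psi>t x t"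
definition Dw :: "real^3 \<Rightarrow> real \<Rightarrow> real^3" where "Dw x t = Du x t - dtrunc M (\<Psi> x t) *\<^sub>R D\<Psi> x t"

lemma abs_w: "x \<in> U \<Longrightarrow> 0 \<le> t \<Longrightarrow> t \<le> T \<Longrightarrow> \<bar>w x t\<bar> \<le> 2 * M + 2"
  using u_bound[of x t] abs_trunc_le[OF M, of "\<Psi> x t"] by (auto simp: w_def)

text \<open>\<open>u\<close> takes values in the interval fixed by the truncation, so
  \<open>w\<close> is a difference of two truncated values and the Lipschitz bound applies. This is
  what lets the initial value of the energy functional be measured by u0 - \<Psi>.\<close>

lemma abs_w_le: "x \<in> U \<Longrightarrow> 0 \<le> t \<Longrightarrow> t \<le> T \<Longrightarrow> \<bar>w x t\<bar> \<le> \<bar>u x t - \<Psi> x t\<bar>"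
  using u_bound[of x t] trunc_lipschitz[OF M, of "u x t" "\<Psi> x t"] trunc_ident[of "u x t" M] by (simp add: w_def)

lemma w_time: "x \<in> U \<Longrightarrow> 0 < t \<Longrightarrow> t \<le> T \<Longrightarrow> (w x has_vector_derivative wt x t) (at t within {0..T})"
proof -
  assume x: "x \<in> U" "0 < t" "t \<le> T"
  have "((\<lambda>t. trunc M (\<Psi> x t)) has_real_derivative \<Psi>t x t * dtrunc M (\<Psi> x t)) (at t within {0..T})"
    using Psit[of x t] x
    by (intro DERIV_chain2[OF DERIV_trunc, THEN DERIV_cong]) (auto simp: has_real_derivative_iff_has_vector_derivative)
  then show ?thesis
    using ut[OF x] unfolding w_def wt_def has_real_derivative_iff_has_vector_derivative
    by (auto intro!: has_vector_derivative_diff simp: mult.commute)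
qed

lemma w_grad: "x \<in> U \<Longrightarrow> 0 < t \<Longrightarrow> t \<le> T \<Longrightarrow> GDERIV (\<lambda>y. w y t) x :> Dw x t"
  unfolding w_def Dw_def
  by (intro GDERIV_diff Du GDERIV_DERIV_compose[OF DPsi DERIV_trunc]) auto

text \<open>The equation is tested with \<omega>^2 w; no boundary term appears because
  \<open>\<omega>\<close> vanishes outside the ball of radius 6 r. Integrating
  \<open>energy_pointwise\<close> over \<open>B6\<close> costs one factor \<open>\<kappa>\<close>
  for its measure, and the result is doubled so that \<open>energy\<close> has coefficient
  1.\<close>

lemma energy_inequality:
  assumes t: "0 < t" "t \<le> T"
  shows "2 * \<phi> * integral B6 (\<lambda>x. (\<omega> x)\<^sup>2 * (w x t * wt x t)) + energy t
    \<le> 4 * \<kappa> * integral B6 (\<lambda>x. (\<omega> x)\<^sup>2 * ((norm (D\<Psi> x t))\<^sup>2 + \<phi> * (\<Psi>t x t)\<^sup>2)) + 76 * \<kappa>^4 * \<xi>^4 * (M + 1)^4"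
proof -
  define \<eta> where "\<eta> x = (\<omega> x)\<^sup>2 * w x t" for x
  define d\<eta> where "d\<eta> x = (\<omega> x)\<^sup>2 *\<^sub>R Dw x t + (2 * \<omega> x * w x t) *\<^sub>R dcutoff c (6 * r) x" for x
  have xU: "x \<in> U" if "x \<in> B6" for x using that B6_U by blast
  have cont_w: "continuous_on B6 (\<lambda>x. w x t)" "continuous_on B6 (\<lambda>x. wt x t)" "continuous_on B6 (\<lambda>x. Dw x t)"
    unfolding w_def wt_def Dw_def using t xU by (auto intro!: continuous_intros)
  have "cball c (6 * r) \<subseteq> U" using cball6_B6 B6_U by blast
  then obtain L where L: "\<And>x b. x \<in> cball c (6 * r) \<Longrightarrow> b \<in> Basis \<Longrightarrow> norm (dV x t b) \<le> L"
    using dV_bounded[OF compact_cball _ t] by meson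
  have "((\<lambda>x. \<eta> x * (\<Sum>b\<in>Basis. dV x t b \<bullet> b) + V x t \<bullet> d\<eta> x) has_integral 0) B6"
    unfolding B_cbox(2)
  proof (rule integral_by_parts[of "cball c (6 * r)" _ _ \<eta> d\<eta> "\<lambda>y. V y t" "\<lambda>x. dV x t" L])
    show "cball c (6 * r) \<subseteq> cbox (c - (6 * r) *\<^sub>R One) (c + (6 * r) *\<^sub>R One)"
      using cball6_B6 by (simp add: B_cbox)
    show "continuous_on (cball c (6 * r)) d\<eta>"
      unfolding d\<eta>_def using cball6_B6 cont_w by (auto intro!: continuous_intros elim: continuous_on_subset)
    fix x assume x: "x \<in> cball c (6 * r)"
    then have xU': "x \<in> U" using cball6_B6 B6_U by blast
    have "GDERIV (\<lambda>x. (\<omega> x)\<^sup>2) x :> (2 * \<omega> x) *\<^sub>R dcutoff c (6 * r) x"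
      unfolding \<omega>_def by (rule GDERIV_DERIV_compose[OF GDERIV_cutoff]) (auto intro!: derivative_eq_intros)
    from GDERIV_mult[OF this w_grad[OF xU' t]]
    show "GDERIV \<eta> x :> d\<eta> x" unfolding \<eta>_def[abs_def] d\<eta>_def by (simp add: mult_ac)
    show "((\<lambda>y. V y t) has_derivative dV x t) (at x)" by (rule V_derivative[OF xU' t])
  next
    fix x assume "x \<notin> cball c (6 * r)"
    then show "\<eta> x = 0" "d\<eta> x = 0" using r by (simp_all add: \<eta>_def d\<eta>_def \<omega>_def cutoff_eq_0)
  qed (use L in auto)
  then have ibp: "((\<lambda>x. \<eta> x * (\<phi> * ut x t) + V x t \<bullet> d\<eta> x) has_integral 0) B6"
    by (rule has_integral_eq[rotated]) (use V_derivative(3) xU t in auto)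
  define e where "e x = (\<omega> x)\<^sup>2 * ((norm (D\<Psi> x t))\<^sup>2 + \<phi> * (\<Psi>t x t)\<^sup>2)" for x
  define P where "P x = (\<omega> x)\<^sup>2 * (G (\<Phi> x t) * (norm (V x t))\<^sup>2)" for x
  define C where "C = 38 * \<kappa>^3 * \<xi>^4 * (M + 1)^4"
  have ci: "e integrable_on B6" "P integrable_on B6" "(\<lambda>x. (\<omega> x)\<^sup>2 * (w x t * wt x t)) integrable_on B6"
    unfolding e_def P_def B_cbox
    using t xU cont_w unfolding B_cbox by (auto intro!: integrable_continuous continuous_intros)
  have "((\<lambda>x. \<phi> * ((\<omega> x)\<^sup>2 * (w x t * wt x t)) - (\<eta> x * (\<phi> * ut x t) + V x t \<bullet> d\<eta> x)) has_integral
      \<phi> * integral B6 (\<lambda>x. (\<omega> x)\<^sup>2 * (w x t * wt x t)) - 0) B6"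
    by (intro has_integral_diff ibp has_integral_mult_right integrable_integral ci)
  moreover have "((\<lambda>x. - (1/2) * P x + 2 * \<kappa> * e x + C) has_integral
      - (1/2) * integral B6 P + 2 * \<kappa> * integral B6 e + measure lborel B6 * C) B6"
    using has_integral_const[of C] unfolding B_cbox
    by (intro has_integral_add has_integral_mult_right integrable_integral ci[unfolded B_cbox]) (auto simp: B_cbox)
  ultimately have "\<phi> * integral B6 (\<lambda>x. (\<omega> x)\<^sup>2 * (w x t * wt x t)) - 0
      \<le> - (1/2) * integral B6 P + 2 * \<kappa> * integral B6 e + measure lborel B6 * C"
  proof (rule has_integral_le)
    fix x assume x: "x \<in> B6"
    have "- (X (\<Phi> x t) \<bullet> ((\<omega> x)\<^sup>2 *\<^sub>R ((\<Phi> x t - (u x t)\<^sup>2 *\<^sub>R Z x t) - dtrunc M (\<Psi> x t) *\<^sub>R D\<Psi> x t)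
          + (2 * \<omega> x * w x t) *\<^sub>R dcutoff c (6 * r) x)) - \<phi> * (\<omega> x)\<^sup>2 * w x t * dtrunc M (\<Psi> x t) * \<Psi>t x t
      \<le> - (1/2) * ((\<omega> x)\<^sup>2 * (G (\<Phi> x t) * (norm (X (\<Phi> x t)))\<^sup>2))
        + 2 * \<kappa> * ((\<omega> x)\<^sup>2 * ((norm (D\<Psi> x t))\<^sup>2 + \<phi> * (\<Psi>t x t)\<^sup>2)) + 38 * \<kappa>^3 * \<xi>^4 * (M + 1)^4"
      using xU[OF x] t u_bound[of x t] abs_w[of x t] Z_bound[of x t] dcutoff_bounds(2) dtrunc_bounds(1)[OF M]
        dtrunc_bounds(2) by (intro energy_pointwise) (auto simp: Z_def)
    then show "\<phi> * ((\<omega> x)\<^sup>2 * (w x t * wt x t)) - (\<eta> x * (\<phi> * ut x t) + V x t \<bullet> d\<eta> x)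
        \<le> - (1/2) * P x + 2 * \<kappa> * e x + C"
      by (simp add: \<eta>_def d\<eta>_def P_def e_def C_def V_def \<Phi>_def Dw_def wt_def algebra_simps)
  qed
  moreover have "measure lborel B6 * C \<le> \<kappa> * C"
    using kappa_geometry(4) kappa_pos xi_pos M by (intro mult_right_mono) (auto simp: B6_def C_def)
  moreover have "2 * (\<kappa> * C) = 76 * \<kappa>^4 * \<xi>^4 * (M + 1)^4"
    by (simp add: C_def power_numeral_reduce)
  ultimately show ?thesis unfolding energy_def P_def[symmetric] e_def[symmetric] by linarith
qed

text \<open>The functional is \<open>\<phi>\<close> times the integral of \<omega>^2 w^2. Its
  initial value is at most the first summand of \<open>N_star\<close> by \<open>abs_w_le\<close>,
  and the constant in the energy inequality integrates to a multiple of \<open>T\<close>, which is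
  another summand.\<close>

theorem energy_bound:
  "(\<integral>\<^sup>+t\<in>{0<..T}. ennreal (energy t) \<partial>lborel)
    \<le> ennreal (76 * \<kappa>^4 * \<xi>^4 * (M + 1)^4) * N_star U T \<phi> (\<lambda>x. u x 0) \<Psi>"
proof -
  define C where "C = 76 * \<kappa>^4 * \<xi>^4 * (M + 1)^4"
  define y where "y t = \<phi> * integral B6 (\<lambda>x. (\<omega> x)\<^sup>2 * (w x t)\<^sup>2)" for t
  define y' where "y' t = 2 * \<phi> * integral B6 (\<lambda>x. (\<omega> x)\<^sup>2 * (w x t * wt x t))" for t
  define e where "e t = integral B6 (\<lambda>x. (\<omega> x)\<^sup>2 * ((norm (D\<Psi> x t))\<^sup>2 + \<phi> * (\<Psi>t x t)\<^sup>2))" for t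
  have xU: "x \<in> U" if "x \<in> B6" for x using that B6_U by blast
  note xU' = xU[unfolded B_cbox]
  have C: "1 \<le> C" "4 * \<kappa> \<le> C"
  proof -
    have 1: "1 \<le> \<kappa>^3" "1 \<le> \<xi>^4" "1 \<le> (M + 1)^4"
      using kappa_ge_1 chi_ge_1 M by (auto simp: one_le_power)
    have "76 * \<kappa> * (1 * 1 * 1) \<le> 76 * \<kappa> * (\<kappa>^3 * \<xi>^4 * (M + 1)^4)"
      using 1 kappa_pos by (intro mult_left_mono mult_mono) auto
    also have "\<dots> = C" by (simp add: C_def power_numeral_reduce)
    finally show "1 \<le> C" "4 * \<kappa> \<le> C" using kappa_ge_1 by auto
  qed
  have ce: "continuous_on {0<..T} e" and cE: "continuous_on {0<..T} energy" and cy: "continuous_on {0..T} y"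
    unfolding e_def energy_def y_def w_def B_cbox
    by (intro integral_continuous_on_param continuous_on_mult continuous_on_const;
        auto simp: case_prod_unfold intro!: continuous_intros xU')+
  have e0: "0 \<le> e t" if "0 < t" "t \<le> T" for t
    unfolding e_def B_cbox using phi that
    by (intro integral_nonneg integrable_continuous) (auto intro!: continuous_intros xU')
  have E0: "0 \<le> energy t" if "0 < t" "t \<le> T" for t
    unfolding energy_def B_cbox using that less_imp_le[OF G_pos]
    by (intro integral_nonneg integrable_continuous) (auto intro!: continuous_intros xU')
  have "(\<integral>\<^sup>+t\<in>{0<..T}. ennreal (energy t) \<partial>lborel)
      \<le> ennreal (y 0) + (\<integral>\<^sup>+t\<in>{0<..T}. ennreal (4 * \<kappa> * e t + C) \<partial>lborel)"
  proof (rule time_integral_bound[OF T cy _ _ _ cE E0])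
    show "0 \<le> y t" if "0 \<le> t" "t \<le> T" for t
      unfolding y_def w_def B_cbox using phi that
      by (intro mult_nonneg_nonneg integral_nonneg integrable_continuous) (auto intro!: continuous_intros xU')
    show "continuous_on {0<..T} (\<lambda>t. 4 * \<kappa> * e t + C)" by (intro continuous_intros ce)
    show "0 \<le> 4 * \<kappa> * e t + C" if "0 < t" "t \<le> T" for t
      using e0[OF that] C kappa_pos by (auto intro!: add_nonneg_nonneg)
    show "y' t + energy t \<le> 4 * \<kappa> * e t + C" if "0 < t" "t \<le> T" for t
      unfolding y'_def e_def C_def by (rule energy_inequality[OF that])
    fix t0 t :: real assume t: "0 < t0" "t0 \<le> t" "t \<le> T"
    \<comment> \<open>Differentiation under the integral sign is confined to \<open>{t0..T}\<close>
      with t0 > 0, where \<open>ut\<close> is continuous up to both end points.\<close>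
    have "((\<lambda>t. integral B6 (\<lambda>x. (\<omega> x)\<^sup>2 * (w x t)\<^sup>2)) has_vector_derivative
        integral B6 (\<lambda>x. (\<omega> x)\<^sup>2 * (2 * (w x t * wt x t)))) (at t within {t0..T})"
      unfolding B_cbox
    proof (rule leibniz_rule_vector_derivative)
      show "((\<lambda>t. (\<omega> x)\<^sup>2 * (w x t)\<^sup>2) has_vector_derivative (\<omega> x)\<^sup>2 * (2 * (w x s * wt x s))) (at s within {t0..T})"
        if "s \<in> {t0..T}" "x \<in> cbox (c - (6 * r) *\<^sub>R One) (c + (6 * r) *\<^sub>R One)" for s x
      proof -
        have "(w x has_vector_derivative wt x s) (at s within {t0..T})"
          using w_time[of x s] that t xU' by (auto intro: has_vector_derivative_within_subset)
        then have "(w x has_real_derivative wt x s) (at s within {t0..T})"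
          by (simp add: has_real_derivative_iff_has_vector_derivative)
        from DERIV_cmult[OF DERIV_power[OF this, of 2], of "(\<omega> x)\<^sup>2"] show ?thesis
          by (simp add: has_real_derivative_iff_has_vector_derivative mult_ac)
      qed
      show "(\<lambda>x. (\<omega> x)\<^sup>2 * (w x s)\<^sup>2) integrable_on cbox (c - (6 * r) *\<^sub>R One) (c + (6 * r) *\<^sub>R One)"
        if "s \<in> {t0..T}" for s
        unfolding w_def using that t by (intro integrable_continuous) (auto intro!: continuous_intros xU')
      show "continuous_on ({t0..T} \<times> cbox (c - (6 * r) *\<^sub>R One) (c + (6 * r) *\<^sub>R One))
          (\<lambda>(s, x). (\<omega> x)\<^sup>2 * (2 * (w x s * wt x s)))"
        unfolding w_def wt_def case_prod_unfold using t by (auto intro!: continuous_intros xU')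
    qed (use t in auto)
    from has_vector_derivative_mult_right[OF this, of \<phi>]
    show "(y has_vector_derivative y' t) (at t within {t0..T})"
      unfolding y_def y'_def by (simp add: mult_ac)
  qed
  also have "(\<integral>\<^sup>+t\<in>{0<..T}. ennreal (4 * \<kappa> * e t + C) \<partial>lborel)
      = ennreal (4 * \<kappa>) * (\<integral>\<^sup>+t\<in>{0<..T}. ennreal (e t) \<partial>lborel) + ennreal (C * T)"
    using ce e0 C kappa_pos T by (intro nn_integral_Ioc_affine) auto
  also have "(\<integral>\<^sup>+t\<in>{0<..T}. ennreal (e t) \<partial>lborel) \<le> E_star U T \<phi> \<Psi>"
    unfolding E_star_def nn_integral_completion
  proof (intro nn_integral_mono)
    fix t
    show "ennreal (e t) * indicator {0<..T} t \<le> (\<integral>\<^sup>+x\<in>U. ennreal ((norm (gradient (\<lambda>y. \<Psi> y t) x))\<^sup>2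
          + \<phi> * \<bar>vector_derivative (\<Psi> x) (at t within {0..T})\<bar>\<^sup>2 + \<phi> * (\<Psi> x t)\<^sup>2) \<partial>lborel) * indicator {0..T} t"
    proof (cases "t \<in> {0<..T}")
      case True
      have "ennreal (e t) = (\<integral>\<^sup>+x\<in>B6. ennreal ((\<omega> x)\<^sup>2 * ((norm (D\<Psi> x t))\<^sup>2 + \<phi> * (\<Psi>t x t)\<^sup>2)) \<partial>lborel)"
        unfolding e_def B_cbox using True phi
        by (intro nn_integral_cbox[symmetric]) (auto intro!: continuous_intros xU')
      also have "\<dots> \<le> (\<integral>\<^sup>+x\<in>U. ennreal ((norm (gradient (\<lambda>y. \<Psi> y t) x))\<^sup>2
          + \<phi> * \<bar>vector_derivative (\<Psi> x) (at t within {0..T})\<bar>\<^sup>2 + \<phi> * (\<Psi> x t)\<^sup>2) \<partial>lborel)"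
      proof (intro nn_integral_mono)
        fix x
        show "ennreal ((\<omega> x)\<^sup>2 * ((norm (D\<Psi> x t))\<^sup>2 + \<phi> * (\<Psi>t x t)\<^sup>2)) * indicator B6 x
          \<le> ennreal ((norm (gradient (\<lambda>y. \<Psi> y t) x))\<^sup>2
          + \<phi> * \<bar>vector_derivative (\<Psi> x) (at t within {0..T})\<bar>\<^sup>2 + \<phi> * (\<Psi> x t)\<^sup>2) * indicator U x"
        proof (cases "x \<in> B6")
          case xB: True
          have g: "gradient (\<lambda>y. \<Psi> y t) x = D\<Psi> x t"
            using DPsi[of x t] xU[OF xB] True by (intro gradient_eq) auto
          have v: "vector_derivative (\<Psi> x) (at t within {0..T}) = \<Psi>t x t"
            using vector_derivative_within_cbox[of 0 T t "\<Psi> x" "\<Psi>t x t"] Psit[of x t] xU[OF xB] True T by simp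
          have "(\<omega> x)\<^sup>2 * ((norm (D\<Psi> x t))\<^sup>2 + \<phi> * (\<Psi>t x t)\<^sup>2) \<le> 1 * ((norm (D\<Psi> x t))\<^sup>2 + \<phi> * (\<Psi>t x t)\<^sup>2)"
            using phi by (intro mult_right_mono power_le_one) auto
          also have "\<dots> \<le> (norm (D\<Psi> x t))\<^sup>2 + \<phi> * (\<Psi>t x t)\<^sup>2 + \<phi> * (\<Psi> x t)\<^sup>2" using phi by simp
          finally show ?thesis using xB xU[OF xB] by (simp add: g v ennreal_leI)
        qed simp
      qed
      finally show ?thesis using True by simp
    qed simp
  qed
  also have "ennreal (y 0) \<le> ennreal \<phi> * L2_norm_sq U (\<lambda>x. u x 0 - \<Psi> x 0)"
  proof -
    have "ennreal (y 0) = ennreal \<phi> * ennreal (integral B6 (\<lambda>x. (\<omega> x)\<^sup>2 * (w x 0)\<^sup>2))"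
      unfolding y_def w_def B_cbox using phi T
      by (intro ennreal_mult integral_nonneg integrable_continuous) (auto intro!: continuous_intros xU')
    also have "ennreal (integral B6 (\<lambda>x. (\<omega> x)\<^sup>2 * (w x 0)\<^sup>2)) = (\<integral>\<^sup>+x\<in>B6. ennreal ((\<omega> x)\<^sup>2 * (w x 0)\<^sup>2) \<partial>lborel)"
      unfolding w_def B_cbox using T by (intro nn_integral_cbox[symmetric]) (auto intro!: continuous_intros xU')
    also have "\<dots> \<le> L2_norm_sq U (\<lambda>x. u x 0 - \<Psi> x 0)"
      unfolding L2_norm_sq_def nn_integral_completion
    proof (intro nn_integral_mono)
      fix x
      show "ennreal ((\<omega> x)\<^sup>2 * (w x 0)\<^sup>2) * indicator B6 x \<le> ennreal ((norm (u x 0 - \<Psi> x 0))\<^sup>2) * indicator U x"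
      proof (cases "x \<in> B6")
        case True
        have "(\<omega> x)\<^sup>2 * (w x 0)\<^sup>2 \<le> 1 * (u x 0 - \<Psi> x 0)\<^sup>2"
          using abs_w_le[of x 0] xU[OF True] T
          by (intro mult_mono power_le_one) (auto simp: abs_le_square_iff)
        then show ?thesis using True xU[OF True] by (simp add: ennreal_leI)
      qed simp
    qed
    finally show ?thesis by (simp add: mult_left_mono)
  qed
  finally have "(\<integral>\<^sup>+t\<in>{0<..T}. ennreal (energy t) \<partial>lborel) \<le> ennreal \<phi> * L2_norm_sq U (\<lambda>x. u x 0 - \<Psi> x 0)
      + (ennreal (4 * \<kappa>) * E_star U T \<phi> \<Psi> + ennreal (C * T))"
    by (simp add: add_mono mult_left_mono)
  also have "\<dots> \<le> ennreal C * (ennreal \<phi> * L2_norm_sq U (\<lambda>x. u x 0 - \<Psi> x 0))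
      + (ennreal C * E_star U T \<phi> \<Psi> + ennreal C * ennreal T)"
  proof (intro add_mono)
    show "ennreal \<phi> * L2_norm_sq U (\<lambda>x. u x 0 - \<Psi> x 0) \<le> ennreal C * (ennreal \<phi> * L2_norm_sq U (\<lambda>x. u x 0 - \<Psi> x 0))"
      using mult_right_mono[of 1 "ennreal C"] C by simp
    show "ennreal (4 * \<kappa>) * E_star U T \<phi> \<Psi> \<le> ennreal C * E_star U T \<phi> \<Psi>"
      using C by (intro mult_right_mono ennreal_leI) auto
    show "ennreal (C * T) \<le> ennreal C * ennreal T" using C T by (simp add: ennreal_mult)
  qed
  also have "\<dots> = ennreal C * N_star U T \<phi> (\<lambda>x. u x 0) \<Psi>"
    unfolding N_star_def by (simp add: distrib_left add_ac)
  finally show ?thesis by (simp add: C_def)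
qed

end

section \<open>Estimates for difference quotients\<close>

text \<open>Difference quotients are needed because the equation cannot be differentiated: \<open>u\<close> has only two
  spatial derivatives.\<close>

locale flow_step = local_flow +
  fixes b :: "real^3" and h :: real
  assumes b: "b \<in> Basis" and h: "0 < h" "h \<le> r"
begin

definition "m1 = M + 1"
definition \<delta> :: "real^3 \<Rightarrow> real \<Rightarrow> real" where "\<delta> x t = (u (x + h *\<^sub>R b) t - u x t) / h"
definition \<delta>t :: "real^3 \<Rightarrow> real \<Rightarrow> real" where "\<delta>t x t = (ut (x + h *\<^sub>R b) t - ut x t) / h"
definition Dd :: "real^3 \<Rightarrow> real \<Rightarrow> real^3" where "Dd x t = (Du (x + h *\<^sub>R b) t - Du x t) /\<^sub>R h"
definition \<Phi>d :: "real^3 \<Rightarrow> real \<Rightarrow> real^3" where "\<Phi>d x t = (\<Phi> (x + h *\<^sub>R b) t - \<Phi> x t) /\<^sub>R h"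
definition Vd :: "real^3 \<Rightarrow> real \<Rightarrow> real^3" where "Vd x t = (V (x + h *\<^sub>R b) t - V x t) /\<^sub>R h"
text \<open>Discrete form of the dissipation, that is, of the derivative of X applied to d\<Phi> and
  paired with d\<Phi>. Monotonicity of \<open>X\<close> makes it nonnegative; it controls |Vd|^2
  and, with the weight \<open>1 / m\<close>, also |\<Phi>d|^2.\<close>

definition E :: "real^3 \<Rightarrow> real \<Rightarrow> real" where "E x t = Vd x t \<bullet> \<Phi>d x t"
text \<open>The two values of \<open>G\<close> in the coercivity inequality for the shifted and the
  unshifted point; for small h the sum is close to 2 G.\<close>

definition m :: "real^3 \<Rightarrow> real \<Rightarrow> real" where "m x t = G (\<Phi> (x + h *\<^sub>R b) t) + G (\<Phi> x t)"
definition "P t = integral B2 (\<lambda>x. \<zeta> x ^ 4 * E x t)"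

lemma norm_b: "norm b = 1" using b by simp

lemma m1: "1 \<le> m1" "M \<le> m1" using M by (auto simp: m1_def)

lemma in_U: assumes "x \<in> B2" shows "x \<in> U" "x + h *\<^sub>R b \<in> U"
  using B2_U shift_geometry(3)[OF assms _ _ norm_b] assms h by auto

lemma cont_step [continuous_intros]:
  fixes p :: "'i::topological_space \<Rightarrow> real^3"
  assumes "continuous_on I p" "continuous_on I s" "\<And>i. i \<in> I \<Longrightarrow> p i \<in> B2"
  shows cont_delta: "(\<And>i. i \<in> I \<Longrightarrow> 0 \<le> s i \<and> s i \<le> T) \<Longrightarrow> continuous_on I (\<lambda>i. \<delta> (p i) (s i))"
    and cont_deltat: "(\<And>i. i \<in> I \<Longrightarrow> 0 < s i \<and> s i \<le> T) \<Longrightarrow> continuous_on I (\<lambda>i. \<delta>t (p i) (s i))"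
    and cont_Dd: "(\<And>i. i \<in> I \<Longrightarrow> 0 < s i \<and> s i \<le> T) \<Longrightarrow> continuous_on I (\<lambda>i. Dd (p i) (s i))"
    and cont_Phid: "(\<And>i. i \<in> I \<Longrightarrow> 0 < s i \<and> s i \<le> T) \<Longrightarrow> continuous_on I (\<lambda>i. \<Phi>d (p i) (s i))"
    and cont_Vd: "(\<And>i. i \<in> I \<Longrightarrow> 0 < s i \<and> s i \<le> T) \<Longrightarrow> continuous_on I (\<lambda>i. Vd (p i) (s i))"
    and cont_E: "(\<And>i. i \<in> I \<Longrightarrow> 0 < s i \<and> s i \<le> T) \<Longrightarrow> continuous_on I (\<lambda>i. E (p i) (s i))"
    and cont_m: "(\<And>i. i \<in> I \<Longrightarrow> 0 < s i \<and> s i \<le> T) \<Longrightarrow> continuous_on I (\<lambda>i. m (p i) (s i))"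
proof -
  have h0: "h \<noteq> 0" using h by simp
  have q: "continuous_on I (\<lambda>i. p i + h *\<^sub>R b)" by (intro continuous_intros assms)
  have U: "\<And>i. i \<in> I \<Longrightarrow> p i \<in> U" "\<And>i. i \<in> I \<Longrightarrow> p i + h *\<^sub>R b \<in> U" using assms(3) in_U by blast+
  show "continuous_on I (\<lambda>i. \<delta> (p i) (s i))" if "\<And>i. i \<in> I \<Longrightarrow> 0 \<le> s i \<and> s i \<le> T"
    unfolding \<delta>_def by (intro continuous_on_divide continuous_on_diff continuous_on_const cont_u q assms U that ballI h0)
  assume t: "\<And>i. i \<in> I \<Longrightarrow> 0 < s i \<and> s i \<le> T"
  show "continuous_on I (\<lambda>i. \<delta>t (p i) (s i))"
    unfolding \<delta>t_def by (intro continuous_on_divide continuous_on_diff continuous_on_const cont_ut q assms U t ballI h0)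
  show "continuous_on I (\<lambda>i. Dd (p i) (s i))"
    unfolding Dd_def by (intro continuous_on_scaleR continuous_on_diff continuous_on_const cont_Du q assms U t)
  show 1: "continuous_on I (\<lambda>i. \<Phi>d (p i) (s i))"
    unfolding \<Phi>d_def by (intro continuous_on_scaleR continuous_on_diff continuous_on_const cont_Phi q assms U t)
  show 2: "continuous_on I (\<lambda>i. Vd (p i) (s i))"
    unfolding Vd_def by (intro continuous_on_scaleR continuous_on_diff continuous_on_const cont_V q assms U t)
  show "continuous_on I (\<lambda>i. E (p i) (s i))" unfolding E_def by (intro continuous_on_inner 1 2)
  show "continuous_on I (\<lambda>i. m (p i) (s i))"
    unfolding m_def by (intro continuous_on_add G_cont cont_Phi q assms U t)
qed

lemma E_bounds:
  shows norm_Vd_sq: "(norm (Vd x t))\<^sup>2 \<le> \<kappa> * E x t"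
    and norm_Phid_sq: "(norm (\<Phi>d x t))\<^sup>2 \<le> \<kappa> * \<xi>\<^sup>2 * (m x t * E x t)"
    and E_nonneg: "0 \<le> E x t" and m_pos: "0 < m x t"
proof -
  define y y' where "y = \<Phi> (x + h *\<^sub>R b) t" and "y' = \<Phi> x t"
  have Eq: "E x t = (inverse h)\<^sup>2 * ((X y - X y') \<bullet> (y - y'))"
    unfolding E_def Vd_def \<Phi>d_def V_def y_def y'_def by (simp add: power2_eq_square)
  have "(norm (Vd x t))\<^sup>2 = (inverse h)\<^sup>2 * (norm (X y - X y'))\<^sup>2"
    unfolding Vd_def V_def y_def y'_def using h by (simp add: power_mult_distrib)
  also have "\<dots> \<le> (inverse h)\<^sup>2 * (\<kappa> * ((X y - X y') \<bullet> (y - y')))"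
    by (intro mult_left_mono norm_dX_sq_le) auto
  finally show 1: "(norm (Vd x t))\<^sup>2 \<le> \<kappa> * E x t" unfolding Eq by (simp add: mult_ac)
  have "(norm (\<Phi>d x t))\<^sup>2 = (inverse h)\<^sup>2 * (norm (y - y'))\<^sup>2"
    unfolding \<Phi>d_def y_def y'_def using h by (simp add: power_mult_distrib)
  also have "\<dots> \<le> (inverse h)\<^sup>2 * (\<kappa> * \<xi>\<^sup>2 * ((G y + G y') * ((X y - X y') \<bullet> (y - y'))))"
    by (intro mult_left_mono X_coercive) auto
  also have "\<dots> = \<kappa> * \<xi>\<^sup>2 * (m x t * E x t)"
    unfolding Eq by (simp add: m_def y_def y'_def mult_ac)
  finally show "(norm (\<Phi>d x t))\<^sup>2 \<le> \<kappa> * \<xi>\<^sup>2 * (m x t * E x t)" .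
  have "0 \<le> \<kappa> * E x t" using 1 by (rule order.trans[OF zero_le_power2])
  then show "0 \<le> E x t" using kappa_pos by (simp add: zero_le_mult_iff)
  show "0 < m x t" unfolding m_def using G_pos by (intro add_pos_pos)
qed

definition Rd :: "real^3 \<Rightarrow> real \<Rightarrow> real^3" where
  "Rd x t = ((u (x + h *\<^sub>R b) t)\<^sup>2 *\<^sub>R Z (x + h *\<^sub>R b) t - (u x t)\<^sup>2 *\<^sub>R Z x t) /\<^sub>R h"

lemma Dd_eq: "Dd x t = \<Phi>d x t - Rd x t"
  unfolding Dd_def \<Phi>d_def Rd_def \<Phi>_def by (simp add: algebra_simps)

text \<open>Discrete product rule: v^2 - v'^2 is h (v + v') \<delta>, and since \<open>Z\<close> is
  affine in x its difference is h A b. This gives a part linear in \<open>\<delta>\<close> and a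
  bounded part.\<close>

lemma norm_Rd:
  assumes "x \<in> B2" "0 \<le> t" "t \<le> T"
  shows "norm (Rd x t) \<le> 2 * m1 * \<xi>\<^sup>2 * \<bar>\<delta> x t\<bar> + m1\<^sup>2 * \<xi>\<^sup>2"
proof -
  define v v' Zv Zv' where "v = u (x + h *\<^sub>R b) t" and "v' = u x t" and "Zv = Z (x + h *\<^sub>R b) t" and "Zv' = Z x t"
  have v: "\<bar>v\<bar> \<le> m1" "\<bar>v'\<bar> \<le> m1"
    using u_bound[OF in_U(1)[OF assms(1)] assms(2,3)] u_bound[OF in_U(2)[OF assms(1)] assms(2,3)] m1
    by (auto simp: v_def v'_def)
  have Zv: "norm Zv \<le> \<xi>\<^sup>2" using Z_bound[OF in_U(2)[OF assms(1)]] by (simp add: Zv_def Z_def)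
  have Ab: "Zv - Zv' = h *\<^sub>R A b"
    unfolding Zv_def Zv'_def Z_def by (simp add: linear_simps[OF A_linear])
  have "Rd x t = ((v + v') * \<delta> x t) *\<^sub>R Zv + v'\<^sup>2 *\<^sub>R A b"
  proof -
    have "v\<^sup>2 *\<^sub>R Zv - v'\<^sup>2 *\<^sub>R Zv' = (v\<^sup>2 - v'\<^sup>2) *\<^sub>R Zv + v'\<^sup>2 *\<^sub>R (Zv - Zv')"
      by (simp add: algebra_simps)
    also have "v\<^sup>2 - v'\<^sup>2 = h * ((v + v') * \<delta> x t)"
    proof -
      have "h * \<delta> x t = v - v'" using h by (simp add: \<delta>_def v_def v'_def)
      then have "(v + v') * (h * \<delta> x t) = v\<^sup>2 - v'\<^sup>2"
        by (simp only:) (simp add: power2_eq_square algebra_simps)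
      then show ?thesis by (simp add: mult_ac)
    qed
    finally have "v\<^sup>2 *\<^sub>R Zv - v'\<^sup>2 *\<^sub>R Zv' = h *\<^sub>R (((v + v') * \<delta> x t) *\<^sub>R Zv + v'\<^sup>2 *\<^sub>R A b)"
      unfolding Ab by (simp add: algebra_simps)
    then show ?thesis unfolding Rd_def v_def v'_def Zv_def Zv'_def using h by simp
  qed
  also have "norm \<dots> \<le> \<bar>(v + v') * \<delta> x t\<bar> * norm Zv + v'\<^sup>2 * norm (A b)"
    by (rule order.trans[OF norm_triangle_ineq]) simp
  also have "\<dots> \<le> (2 * m1 * \<bar>\<delta> x t\<bar>) * \<xi>\<^sup>2 + m1\<^sup>2 * \<xi>\<^sup>2"
  proof (intro add_mono mult_mono)
    show "\<bar>(v + v') * \<delta> x t\<bar> \<le> 2 * m1 * \<bar>\<delta> x t\<bar>"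
      unfolding abs_mult using v by (intro mult_right_mono) auto
    show "v'\<^sup>2 \<le> m1\<^sup>2" using v m1 by (intro power2_le_iff_abs_le[THEN iffD2]) auto
    show "norm (A b) \<le> \<xi>\<^sup>2" using A_bound[of b] norm_b by simp
  qed (use Zv m1 in auto)
  finally show ?thesis by (simp add: mult_ac)
qed

lemma norm_Rd_sq:
  assumes "x \<in> B2" "0 \<le> t" "t \<le> T"
  shows "(norm (Rd x t))\<^sup>2 \<le> 8 * m1\<^sup>2 * \<xi>^4 * (\<delta> x t)\<^sup>2 + 2 * m1^4 * \<xi>^4"
proof -
  define p q where "p = 2 * m1 * \<xi>\<^sup>2 * \<bar>\<delta> x t\<bar>" and "q = m1\<^sup>2 * \<xi>\<^sup>2"
  have "(norm (Rd x t))\<^sup>2 \<le> (p + q)\<^sup>2"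
    using norm_Rd[OF assms] unfolding p_def q_def by (intro power_mono) auto
  also have "\<dots> \<le> 2 * p\<^sup>2 + 2 * q\<^sup>2"
    using sum_squares_bound[of p q] by (simp add: power2_sum)
  also have "\<dots> = 8 * m1\<^sup>2 * \<xi>^4 * (\<delta> x t)\<^sup>2 + 2 * m1^4 * \<xi>^4"
    by (simp add: p_def q_def power_mult_distrib flip: power_mult)
  finally show ?thesis .
qed

text \<open>The fourth power of the cut-off is deliberate: its gradient carries \<zeta>^3, and after
  Young's inequality against \<zeta>^4 E the square of \<open>\<delta>\<close> still has the weight
  \<zeta>^2, the one that occurs in \<open>embedding\<close>. The field \<open>Rd\<close> and the
  gradient of the cut-off take a quarter of the dissipation each. The coefficient 24 is 8 +
  16.\<close>

lemma step_pointwise: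
  assumes x: "x \<in> B2" "0 < t" "t \<le> T"
  shows "- (Vd x t \<bullet> (\<zeta> x ^ 4 *\<^sub>R Dd x t + (4 * \<zeta> x ^ 3 * \<delta> x t) *\<^sub>R dcutoff c (2 * r) x))
    \<le> - (1/2) * (\<zeta> x ^ 4 * E x t) + 24 * \<kappa>^3 * \<xi>^4 * m1\<^sup>2 * ((\<zeta> x)\<^sup>2 * (\<delta> x t)\<^sup>2) + 2 * \<kappa> * m1^4 * \<xi>^4"
proof -
  define s where "s = \<zeta> x"
  define n where "n = norm (Vd x t)"
  define R where "R = norm (Rd x t)"
  define d where "d = \<bar>\<delta> x t\<bar>"
  define e where "e = dcutoff c (2 * r) x"
  have s: "0 \<le> s" "s \<le> 1" by (simp_all add: s_def)
  have k: "1 \<le> \<kappa>" "0 < \<kappa>" using kappa_ge_1 kappa_pos .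
  have nn: "0 \<le> n" "0 \<le> R" "0 \<le> d" by (simp_all add: n_def R_def d_def)
  have s42: "s^4 \<le> s\<^sup>2" and s4: "s^4 \<le> 1"
    using s power_decreasing[of 2 4 s] by (auto simp: power_le_one)
  have n2: "n\<^sup>2 \<le> \<kappa> * E x t" using norm_Vd_sq by (simp add: n_def)
  have young: "n * q \<le> E x t / 4 + \<kappa> * q\<^sup>2" for q
  proof -
    have "0 \<le> (n - 2 * \<kappa> * q)\<^sup>2" by simp
    then have "4 * \<kappa> * (n * q) \<le> n\<^sup>2 + 4 * \<kappa>\<^sup>2 * q\<^sup>2"
      by (simp add: power2_diff power_mult_distrib algebra_simps)
    also have "\<dots> \<le> \<kappa> * E x t + 4 * \<kappa>\<^sup>2 * q\<^sup>2" using n2 by simp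
    also have "\<dots> = 4 * \<kappa> * (E x t / 4 + \<kappa> * q\<^sup>2)" by (simp add: power2_eq_square algebra_simps)
    finally show ?thesis using k by simp
  qed
  have eq: "- (Vd x t \<bullet> (s^4 *\<^sub>R Dd x t + (4 * s^3 * \<delta> x t) *\<^sub>R e))
      = - (s^4 * E x t) + s^4 * (Vd x t \<bullet> Rd x t) - 4 * s^3 * \<delta> x t * (Vd x t \<bullet> e)"
    unfolding Dd_eq E_def by (simp add: inner_diff_right inner_add_right algebra_simps)
  have t1: "s^4 * (Vd x t \<bullet> Rd x t) \<le> s^4 * (E x t) / 4 + \<kappa> * (8 * m1\<^sup>2 * \<xi>^4 * (s\<^sup>2 * d\<^sup>2) + 2 * m1^4 * \<xi>^4)"
  proof -
    have "Vd x t \<bullet> Rd x t \<le> n * R" using norm_cauchy_schwarz[of "Vd x t" "Rd x t"] by (simp add: n_def R_def)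
    also have "\<dots> \<le> E x t / 4 + \<kappa> * R\<^sup>2" by (rule young)
    finally have "s^4 * (Vd x t \<bullet> Rd x t) \<le> s^4 * (E x t / 4 + \<kappa> * R\<^sup>2)" by (intro mult_left_mono) auto
    moreover have "s^4 * R\<^sup>2 \<le> 8 * m1\<^sup>2 * \<xi>^4 * (s\<^sup>2 * d\<^sup>2) + 2 * m1^4 * \<xi>^4"
    proof -
      have "s^4 * R\<^sup>2 \<le> s^4 * (8 * m1\<^sup>2 * \<xi>^4 * d\<^sup>2 + 2 * m1^4 * \<xi>^4)"
        using norm_Rd_sq[OF x(1) less_imp_le[OF x(2)] x(3)] by (intro mult_left_mono) (auto simp: R_def d_def)
      also have "\<dots> = 8 * m1\<^sup>2 * \<xi>^4 * (s^4 * d\<^sup>2) + s^4 * (2 * m1^4 * \<xi>^4)" by (simp add: algebra_simps)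
      also have "\<dots> \<le> 8 * m1\<^sup>2 * \<xi>^4 * (s\<^sup>2 * d\<^sup>2) + 1 * (2 * m1^4 * \<xi>^4)"
        using s42 s4 m1 xi_pos by (intro add_mono mult_left_mono mult_right_mono) auto
      finally show ?thesis by simp
    qed
    then have "\<kappa> * (s^4 * R\<^sup>2) \<le> \<kappa> * (8 * m1\<^sup>2 * \<xi>^4 * (s\<^sup>2 * d\<^sup>2) + 2 * m1^4 * \<xi>^4)"
      using k by (intro mult_left_mono) auto
    ultimately show ?thesis by (simp add: algebra_simps)
  qed
  have t2: "- (4 * s^3 * \<delta> x t * (Vd x t \<bullet> e)) \<le> s^4 * (E x t) / 4 + 16 * \<kappa>^3 * (s\<^sup>2 * d\<^sup>2)"
  proof -
    have "\<bar>Vd x t \<bullet> e\<bar> \<le> n * \<kappa>"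
      using Cauchy_Schwarz_ineq2[of "Vd x t" e] dcutoff_bounds(1)[of x] mult_left_mono[of "norm e" \<kappa> n] nn
      by (simp add: n_def e_def)
    then have le: "4 * s^3 * d * \<bar>Vd x t \<bullet> e\<bar> \<le> 4 * s^3 * d * (n * \<kappa>)"
      using s nn by (intro mult_left_mono) auto
    have "- (4 * s^3 * \<delta> x t * (Vd x t \<bullet> e)) \<le> \<bar>4 * s^3 * \<delta> x t * (Vd x t \<bullet> e)\<bar>" by (rule abs_ge_minus_self)
    also have "\<dots> = 4 * s^3 * d * \<bar>Vd x t \<bullet> e\<bar>" using s by (simp add: abs_mult d_def)
    also have "\<dots> \<le> 4 * s^3 * d * (n * \<kappa>)" by (rule le)
    also have "\<dots> = s\<^sup>2 * (s * n * (4 * d * \<kappa>))" by (simp add: power2_eq_square power3_eq_cube)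
    also have "s * n * (4 * d * \<kappa>) \<le> s\<^sup>2 * (E x t) / 4 + 16 * \<kappa>^3 * d\<^sup>2"
    proof -
      have "0 \<le> (s * n - 8 * \<kappa>\<^sup>2 * d)\<^sup>2" by simp
      then have "4 * \<kappa> * (s * n * (4 * d * \<kappa>)) \<le> s\<^sup>2 * n\<^sup>2 + 64 * \<kappa>^4 * d\<^sup>2"
        by (simp add: power2_diff power_mult_distrib power_numeral_reduce algebra_simps)
      also have "\<dots> \<le> s\<^sup>2 * (\<kappa> * E x t) + 64 * \<kappa>^4 * d\<^sup>2" using n2 by (intro add_right_mono mult_left_mono) auto
      also have "\<dots> = 4 * \<kappa> * (s\<^sup>2 * (E x t) / 4 + 16 * \<kappa>^3 * d\<^sup>2)" by (simp add: power_numeral_reduce algebra_simps)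
      finally show ?thesis using k by simp
    qed
    then have "s\<^sup>2 * (s * n * (4 * d * \<kappa>)) \<le> s\<^sup>2 * (s\<^sup>2 * (E x t) / 4 + 16 * \<kappa>^3 * d\<^sup>2)" by (intro mult_left_mono) auto
    also have "\<dots> = s^4 * (E x t) / 4 + 16 * \<kappa>^3 * (s\<^sup>2 * d\<^sup>2)" by (simp add: power_numeral_reduce algebra_simps)
    finally show ?thesis .
  qed
  have "\<kappa> * (8 * m1\<^sup>2 * \<xi>^4 * (s\<^sup>2 * d\<^sup>2)) + 16 * \<kappa>^3 * (s\<^sup>2 * d\<^sup>2) \<le> 24 * \<kappa>^3 * \<xi>^4 * m1\<^sup>2 * (s\<^sup>2 * d\<^sup>2)"
  proof -
    have "\<kappa> \<le> \<kappa>^3" using k power_increasing[of 1 3 \<kappa>] by auto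
    then have "\<kappa> * (8 * m1\<^sup>2 * \<xi>^4) \<le> \<kappa>^3 * (8 * m1\<^sup>2 * \<xi>^4)" by (intro mult_right_mono) auto
    moreover have "1 * 1 \<le> m1\<^sup>2 * \<xi>^4" using m1 chi_ge_1 by (intro mult_mono) (auto simp: one_le_power)
    then have "16 * \<kappa>^3 * 1 \<le> 16 * \<kappa>^3 * (m1\<^sup>2 * \<xi>^4)" using k by (intro mult_left_mono) auto
    ultimately have "\<kappa> * (8 * m1\<^sup>2 * \<xi>^4) + 16 * \<kappa>^3 \<le> 24 * \<kappa>^3 * \<xi>^4 * m1\<^sup>2" by (simp add: algebra_simps)
    then have "(\<kappa> * (8 * m1\<^sup>2 * \<xi>^4) + 16 * \<kappa>^3) * (s\<^sup>2 * d\<^sup>2) \<le> 24 * \<kappa>^3 * \<xi>^4 * m1\<^sup>2 * (s\<^sup>2 * d\<^sup>2)"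
      by (intro mult_right_mono) auto
    then show ?thesis by (simp only: distrib_right mult.assoc)
  qed
  then show ?thesis
    unfolding s_def[symmetric] e_def[symmetric] eq using t1 t2
    by (simp add: distrib_left d_def)
qed

text \<open>The difference of the equations at x + h b and at x is tested with \<zeta>^4 \<delta>.
  The divergence of \<open>Vd\<close> equals \<phi> \<delta>t pointwise, so the equation itself is
  never differentiated.\<close>

lemma step_identity:
  assumes t: "0 < t" "t \<le> T"
  shows "\<phi> * integral B2 (\<lambda>x. \<zeta> x ^ 4 * (\<delta> x t * \<delta>t x t))
    \<le> - (1/2) * P t + 24 * \<kappa>^3 * \<xi>^4 * m1\<^sup>2 * integral B2 (\<lambda>x. (\<zeta> x)\<^sup>2 * (\<delta> x t)\<^sup>2) + 2 * \<kappa>\<^sup>2 * m1^4 * \<xi>^4"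
proof -
  define \<eta> where "\<eta> x = \<zeta> x ^ 4 * \<delta> x t" for x
  define d\<eta> where "d\<eta> x = \<zeta> x ^ 4 *\<^sub>R Dd x t + (4 * \<zeta> x ^ 3 * \<delta> x t) *\<^sub>R dcutoff c (2 * r) x" for x
  define K where "K = cball c (2 * r)"
  define V' where "V' x v = (dV (x + h *\<^sub>R b) t v - dV x t v) /\<^sub>R h" for x v
  have KB: "K \<subseteq> B2" using cball2_B2 by (simp add: K_def)
  have c1: "continuous_on B2 (\<lambda>x. \<delta> x t)" "continuous_on B2 (\<lambda>x. \<delta>t x t)" "continuous_on B2 (\<lambda>x. Dd x t)"
    "continuous_on B2 (\<lambda>x. E x t)" "continuous_on B2 (\<lambda>x. \<zeta> x)"
    using t by (auto intro!: continuous_intros)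
  have "\<exists>L. \<forall>x\<in>B2. \<forall>b\<in>Basis. norm (dV x t b) \<le> L"
    using B2_U t by (intro dV_bounded) (auto simp: B_cbox)
  then obtain L1 where L1: "\<And>x b. x \<in> B2 \<Longrightarrow> b \<in> Basis \<Longrightarrow> norm (dV x t b) \<le> L1" by blast
  \<comment> \<open>The shifted points may leave \<open>B2\<close> but stay in \<open>B6\<close>,
    hence a second bound.\<close>
  have "\<exists>L. \<forall>x\<in>B6. \<forall>b\<in>Basis. norm (dV x t b) \<le> L"
    using B6_U t by (intro dV_bounded) (auto simp: B_cbox)
  then obtain L2 where L2: "\<And>x b. x \<in> B6 \<Longrightarrow> b \<in> Basis \<Longrightarrow> norm (dV x t b) \<le> L2" by blast
  have "((\<lambda>x. \<eta> x * (\<Sum>b\<in>Basis. V' x b \<bullet> b) + Vd x t \<bullet> d\<eta> x) has_integral 0) B2"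
    unfolding B_cbox(1)
  proof (rule integral_by_parts[of K _ _ \<eta> d\<eta> "\<lambda>y. Vd y t" V' "(L2 + L1) / h"])
    show "compact K" by (simp add: K_def)
    show "K \<subseteq> cbox (c - (2 * r) *\<^sub>R One) (c + (2 * r) *\<^sub>R One)" using KB by (simp add: B_cbox)
    show "continuous_on K d\<eta>"
      unfolding d\<eta>_def using t KB by (auto intro!: continuous_intros)
    fix x assume x: "x \<in> K"
    then have xB: "x \<in> B2" using KB by blast
    have d\<zeta>: "GDERIV (\<lambda>x. \<zeta> x ^ 4) x :> (4 * \<zeta> x ^ 3) *\<^sub>R dcutoff c (2 * r) x"
      unfolding \<zeta>_def by (rule GDERIV_DERIV_compose[OF GDERIV_cutoff]) (auto intro!: derivative_eq_intros)
    have shift: "(f has_derivative f') (at (x + h *\<^sub>R b)) \<Longrightarrow> ((\<lambda>y. f (y + h *\<^sub>R b)) has_derivative f') (at x)"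
      for f :: "real^3 \<Rightarrow> 'e::real_normed_vector" and f'
    proof -
      assume f: "(f has_derivative f') (at (x + h *\<^sub>R b))"
      have "((\<lambda>y. y + h *\<^sub>R b) has_derivative (\<lambda>v. v)) (at x)" by (auto intro!: derivative_eq_intros)
      from has_derivative_compose[OF this f] show ?thesis .
    qed
    have "GDERIV (\<lambda>y. u (y + h *\<^sub>R b) t) x :> Du (x + h *\<^sub>R b) t"
      using Du[OF in_U(2)[OF xB] t] unfolding gderiv_def by (rule shift)
    from GDERIV_diff[OF this Du[OF in_U(1)[OF xB] t]]
    have "((\<lambda>y. u (y + h *\<^sub>R b) t - u y t) has_derivative (\<lambda>v. v \<bullet> (Du (x + h *\<^sub>R b) t - Du x t))) (at x)"
      by (simp add: gderiv_def)
    from has_derivative_mult_right[OF this, of "inverse h"]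
    have "GDERIV (\<lambda>y. \<delta> y t) x :> Dd x t"
      unfolding gderiv_def \<delta>_def Dd_def by (simp add: divide_inverse mult.commute)
    from GDERIV_mult[OF d\<zeta> this]
    show "GDERIV \<eta> x :> d\<eta> x" unfolding \<eta>_def[abs_def] d\<eta>_def by (simp add: mult_ac)
    have "((\<lambda>y. V (y + h *\<^sub>R b) t) has_derivative dV (x + h *\<^sub>R b) t) (at x)"
      by (rule shift[OF V_derivative(1)[OF in_U(2)[OF xB] t]])
    from has_derivative_scaleR_right[OF has_derivative_diff[OF this V_derivative(1)[OF in_U(1)[OF xB] t]], of "inverse h"]
    show "((\<lambda>y. Vd y t) has_derivative V' x) (at x)"
      unfolding Vd_def V'_def[abs_def] by simp
    fix i :: "real^3" assume i: "i \<in> Basis"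
    have "norm (V' x i) \<le> (norm (dV (x + h *\<^sub>R b) t i) + norm (dV x t i)) / h"
      unfolding V'_def using h norm_triangle_ineq4[of "dV (x + h *\<^sub>R b) t i" "dV x t i"]
      by (simp add: divide_inverse mult.commute)
    also have "\<dots> \<le> (L2 + L1) / h"
      using L1[OF xB i] L2[OF shift_geometry(2)[OF xB _ _ norm_b] i] h by (intro divide_right_mono add_mono) auto
    finally show "norm (V' x i) \<le> (L2 + L1) / h" .
  next
    fix x assume "x \<notin> K"
    then show "\<eta> x = 0" "d\<eta> x = 0" using r by (simp_all add: \<eta>_def d\<eta>_def \<zeta>_def K_def cutoff_eq_0)
  qed
  then have ibp: "((\<lambda>x. \<eta> x * (\<phi> * \<delta>t x t) + Vd x t \<bullet> d\<eta> x) has_integral 0) B2"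
  proof (rule has_integral_eq[rotated])
    fix x assume x: "x \<in> B2"
    have "(\<Sum>b\<in>Basis. V' x b \<bullet> b) = (\<phi> * ut (x + h *\<^sub>R b) t - \<phi> * ut x t) / h"
      using V_derivative(3)[OF in_U(1)[OF x] t] V_derivative(3)[OF in_U(2)[OF x] t]
      unfolding V'_def by (simp add: inner_diff_left sum_subtractf sum_divide_distrib[symmetric] divide_inverse
          sum_distrib_left[symmetric] mult.commute)
    then show "\<eta> x * (\<Sum>b\<in>Basis. V' x b \<bullet> b) + Vd x t \<bullet> d\<eta> x = \<eta> x * (\<phi> * \<delta>t x t) + Vd x t \<bullet> d\<eta> x"
      by (simp add: \<delta>t_def right_diff_distrib)
  qed
  define C where "C = 2 * \<kappa> * m1^4 * \<xi>^4"
  define C2 where "C2 = 24 * \<kappa>^3 * \<xi>^4 * m1\<^sup>2"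
  have ci: "(\<lambda>x. \<zeta> x ^ 4 * (\<delta> x t * \<delta>t x t)) integrable_on B2" "(\<lambda>x. \<zeta> x ^ 4 * E x t) integrable_on B2"
    "(\<lambda>x. (\<zeta> x)\<^sup>2 * (\<delta> x t)\<^sup>2) integrable_on B2"
    using c1 unfolding B_cbox by (auto intro!: integrable_continuous continuous_intros)
  have "((\<lambda>x. \<phi> * (\<zeta> x ^ 4 * (\<delta> x t * \<delta>t x t)) - (\<eta> x * (\<phi> * \<delta>t x t) + Vd x t \<bullet> d\<eta> x)) has_integral
      \<phi> * integral B2 (\<lambda>x. \<zeta> x ^ 4 * (\<delta> x t * \<delta>t x t)) - 0) B2"
    by (intro has_integral_diff ibp has_integral_mult_right integrable_integral ci)
  moreover have "((\<lambda>x. - (1/2) * (\<zeta> x ^ 4 * E x t) + C2 * ((\<zeta> x)\<^sup>2 * (\<delta> x t)\<^sup>2) + C) has_integral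
      - (1/2) * P t + C2 * integral B2 (\<lambda>x. (\<zeta> x)\<^sup>2 * (\<delta> x t)\<^sup>2) + measure lborel B2 * C) B2"
    using has_integral_const[of C] unfolding P_def B_cbox
    by (intro has_integral_add has_integral_mult_right integrable_integral ci[unfolded B_cbox]) (auto simp: B_cbox)
  ultimately have "\<phi> * integral B2 (\<lambda>x. \<zeta> x ^ 4 * (\<delta> x t * \<delta>t x t)) - 0
      \<le> - (1/2) * P t + C2 * integral B2 (\<lambda>x. (\<zeta> x)\<^sup>2 * (\<delta> x t)\<^sup>2) + measure lborel B2 * C"
  proof (rule has_integral_le)
    fix x assume x: "x \<in> B2"
    from step_pointwise[OF x t]
    show "\<phi> * (\<zeta> x ^ 4 * (\<delta> x t * \<delta>t x t)) - (\<eta> x * (\<phi> * \<delta>t x t) + Vd x t \<bullet> d\<eta> x)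
        \<le> - (1/2) * (\<zeta> x ^ 4 * E x t) + C2 * ((\<zeta> x)\<^sup>2 * (\<delta> x t)\<^sup>2) + C"
      unfolding \<eta>_def d\<eta>_def C_def C2_def by (simp add: mult_ac)
  qed
  moreover have "measure lborel B2 * C \<le> \<kappa> * C"
  proof (rule mult_right_mono)
    have "measure lborel B2 \<le> measure lborel B6"
      using B2_B6 by (intro measure_mono_fmeasurable) (auto simp: B_cbox)
    then show "measure lborel B2 \<le> \<kappa>" using kappa_geometry(4) by (simp add: B6_def)
  qed (use kappa_pos xi_pos m1 in \<open>auto simp: C_def\<close>)
  moreover have "\<kappa> * C = 2 * \<kappa>\<^sup>2 * m1^4 * \<xi>^4" by (simp add: C_def power2_eq_square)
  ultimately show ?thesis unfolding C2_def by linarith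
qed

text \<open>The difference quotient of \<open>u\<close> is the derivative of the average \<open>ubar\<close> of \<open>u\<close> over a
  segment, and \<open>ubar\<close> is still bounded by \<open>M\<close>.\<close>

lemma embedding_identity:
  assumes t: "0 < t" "t \<le> T"
  obtains ubar where "\<And>x. x \<in> B2 \<Longrightarrow> \<zeta> x \<noteq> 0 \<Longrightarrow> \<bar>ubar x\<bar> \<le> M"
    and "((\<lambda>x. (\<zeta> x)\<^sup>2 * (\<delta> x t)\<^sup>2 +
      ubar x * ((\<zeta> x)\<^sup>2 * (Dd x t \<bullet> b) + (2 * \<zeta> x * \<delta> x t) * (dcutoff c (2 * r) x \<bullet> b))) has_integral 0) B2"
proof -
  define K where "K = cball c (2 * r)"
  define O1 where "O1 = ball c (3 * r)"
  define ubar where "ubar x = inverse h * integral (cbox 0 h) (\<lambda>s. u (x + s *\<^sub>R b) t)" for x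
  define g where "g x = (\<zeta> x)\<^sup>2 * (Dd x t \<bullet> b) + (2 * \<zeta> x * \<delta> x t) * (dcutoff c (2 * r) x \<bullet> b)" for x
  \<comment> \<open>Along \<open>b\<close> the derivative of \<open>ubar\<close> is
    \<open>\<delta>\<close>, so the derivative of \<open>f\<close> contains the square \<zeta>^2
    \<delta>^2, and everything else in it has the bounded factor \<open>ubar\<close>. Its integral
    vanishes by compact support.\<close>
  define f where "f x = ubar x * ((\<zeta> x)\<^sup>2 * \<delta> x t)" for x
  define f' where "f' x = (\<zeta> x)\<^sup>2 * (\<delta> x t)\<^sup>2 + ubar x * g x" for x
  have KB: "K \<subseteq> B2" using cball2_B2 by (simp add: K_def)
  have KO: "K \<subseteq> O1" unfolding K_def O1_def using r by (simp add: subset_iff)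
  have inU: "x + s *\<^sub>R b \<in> U" if "x \<in> O1" "- r \<le> s" "s \<le> 2 * r" for x s
  proof -
    have "dist c (x + s *\<^sub>R b) \<le> dist c x + \<bar>s\<bar>"
      using dist_triangle[of c "x + s *\<^sub>R b" x] norm_b by (simp add: dist_norm)
    then have "x + s *\<^sub>R b \<in> cball c (13 * r)" using that r by (auto simp: O1_def)
    then show ?thesis using U(2) by blast
  qed
  have zero: "\<zeta> x = 0" "dcutoff c (2 * r) x = 0" if "x \<notin> K" for x
    using that r by (simp_all add: \<zeta>_def K_def cutoff_eq_0 dcutoff_eq_0)
  have ubar_le: "\<bar>ubar x\<bar> \<le> M" if x: "x \<in> O1" for x
  proof -
    have cu: "continuous_on (cbox 0 h) (\<lambda>s. u (x + s *\<^sub>R b) t)"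
      using t h inU[OF x] by (auto intro!: continuous_intros)
    have "norm (integral (cbox 0 h) (\<lambda>s. u (x + s *\<^sub>R b) t)) \<le> M * measure lborel (cbox 0 h)"
      by (rule integrable_bound[OF M integrable_continuous[OF cu]])
         (use inU[OF x] u_bound t h in auto)
    then have "\<bar>integral (cbox 0 h) (\<lambda>s. u (x + s *\<^sub>R b) t)\<bar> \<le> M * h" using h by simp
    then have le: "inverse h * \<bar>integral (cbox 0 h) (\<lambda>s. u (x + s *\<^sub>R b) t)\<bar> \<le> inverse h * (M * h)"
      using h by (intro mult_left_mono) auto
    have "\<bar>ubar x\<bar> = inverse h * \<bar>integral (cbox 0 h) (\<lambda>s. u (x + s *\<^sub>R b) t)\<bar>"
      using h by (simp add: ubar_def abs_mult)
    also note le
    also have "inverse h * (M * h) = M" using h by simp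
    finally show ?thesis .
  qed
  have ubar_der: "((\<lambda>\<sigma>. ubar (x + \<sigma> *\<^sub>R b)) has_real_derivative \<delta> x t) (at 0)" if x: "x \<in> O1" for x
  proof -
    have line: "((\<lambda>\<sigma>. u (x + \<sigma> *\<^sub>R b) t) has_real_derivative Du (x + \<sigma> *\<^sub>R b) t \<bullet> b) (at \<sigma> within S)"
      if \<sigma>: "- r \<le> \<sigma>" "\<sigma> \<le> 2 * r" for \<sigma> S
    proof -
      have "((\<lambda>\<sigma>. u (x + \<sigma> *\<^sub>R b) t) has_derivative (\<lambda>v. (v *\<^sub>R b) \<bullet> Du (x + \<sigma> *\<^sub>R b) t)) (at \<sigma> within S)"
        by (rule has_derivative_compose[of "\<lambda>\<sigma>. x + \<sigma> *\<^sub>R b" _ \<sigma> S "\<lambda>y. u y t" "\<lambda>k. k \<bullet> Du (x + \<sigma> *\<^sub>R b) t"])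
           (use Du[OF inU[OF x \<sigma>] t] in \<open>auto simp: gderiv_def intro!: derivative_eq_intros\<close>)
      then show ?thesis unfolding has_field_derivative_def
        by (rule has_derivative_eq_rhs) (simp add: fun_eq_iff inner_commute)
    qed
    \<comment> \<open>The parameter runs over an interval with 0 in its interior, so the derivative
      obtained there is the full one. The total shifts lie between -r and 2 r, which keeps the
      segment inside \<open>U\<close>.\<close>
    have "((\<lambda>\<sigma>. integral (cbox 0 h) (\<lambda>s. u (x + (\<sigma> + s) *\<^sub>R b) t)) has_real_derivative
        integral (cbox 0 h) (\<lambda>s. Du (x + (0 + s) *\<^sub>R b) t \<bullet> b)) (at 0 within {- r..r})"
    proof (rule leibniz_rule_field_derivative)
      fix \<sigma> s assume s: "\<sigma> \<in> {- r..r}" "s \<in> cbox 0 h"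
      have "((\<lambda>\<sigma>. u (x + (\<sigma> + s) *\<^sub>R b) t) has_real_derivative (Du (x + (\<sigma> + s) *\<^sub>R b) t \<bullet> b) * 1) (at \<sigma> within {- r..r})"
        by (rule DERIV_chain'[where f = "\<lambda>\<sigma>. \<sigma> + s" and g = "\<lambda>\<sigma>. u (x + \<sigma> *\<^sub>R b) t", THEN DERIV_cong])
           (use s h r in \<open>auto intro!: derivative_eq_intros line\<close>)
      then show "((\<lambda>\<sigma>. u (x + (\<sigma> + s) *\<^sub>R b) t) has_real_derivative Du (x + (\<sigma> + s) *\<^sub>R b) t \<bullet> b) (at \<sigma> within {- r..r})"
        by simp
    next
      show "(\<lambda>s. u (x + (\<sigma> + s) *\<^sub>R b) t) integrable_on cbox 0 h" if "\<sigma> \<in> {- r..r}" for \<sigma>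
        using t that h inU[OF x] by (intro integrable_continuous) (auto intro!: continuous_intros)
      show "continuous_on ({- r..r} \<times> cbox 0 h) (\<lambda>(\<sigma>, s). Du (x + (\<sigma> + s) *\<^sub>R b) t \<bullet> b)"
        unfolding case_prod_unfold using t h inU[OF x] by (auto intro!: continuous_intros)
    qed (use r in auto)
    moreover have "integral (cbox 0 h) (\<lambda>s. Du (x + (0 + s) *\<^sub>R b) t \<bullet> b) = u (x + h *\<^sub>R b) t - u x t"
    proof (rule integral_unique)
      have "((\<lambda>s. Du (x + s *\<^sub>R b) t \<bullet> b) has_integral u (x + h *\<^sub>R b) t - u (x + 0 *\<^sub>R b) t) {0..h}"
        by (rule fundamental_theorem_of_calculus)
           (use h r line in \<open>auto simp: has_real_derivative_iff_has_vector_derivative[symmetric]\<close>)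
      then show "((\<lambda>s. Du (x + (0 + s) *\<^sub>R b) t \<bullet> b) has_integral u (x + h *\<^sub>R b) t - u x t) (cbox 0 h)" by simp
    qed
    moreover have "at 0 within {- r..r} = at (0::real)" by (rule at_within_interior) (use r in auto)
    ultimately have "((\<lambda>\<sigma>. integral (cbox 0 h) (\<lambda>s. u (x + (\<sigma> + s) *\<^sub>R b) t)) has_real_derivative
        u (x + h *\<^sub>R b) t - u x t) (at 0)" by simp
    from DERIV_cmult[OF this, of "inverse h"] show ?thesis
      unfolding ubar_def \<delta>_def by (simp add: scaleR_add_left add.assoc divide_inverse mult.commute)
  qed
  have der: "((\<lambda>s. f (x + s *\<^sub>R b)) has_real_derivative f' x) (at 0)" for x
  proof (cases "x \<in> K")
    case True
    then have xO: "x \<in> O1" and xB: "x \<in> B2" using KO KB by auto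
    have dir: "((\<lambda>s. F (x + s *\<^sub>R b)) has_real_derivative D \<bullet> b) (at 0)" if "GDERIV F x :> D" for F and D :: "real^3"
    proof -
      have "((\<lambda>s. F (x + s *\<^sub>R b)) has_derivative (\<lambda>v. (v *\<^sub>R b) \<bullet> D)) (at 0)"
        by (rule has_derivative_compose[of "\<lambda>s. x + s *\<^sub>R b" _ 0 UNIV F "\<lambda>h. h \<bullet> D"])
           (use that in \<open>auto simp: gderiv_def intro!: derivative_eq_intros\<close>)
      then show ?thesis unfolding has_field_derivative_def
        by (rule has_derivative_eq_rhs) (simp add: fun_eq_iff inner_commute)
    qed
    have d\<zeta>: "GDERIV (\<lambda>x. (\<zeta> x)\<^sup>2) x :> (2 * \<zeta> x) *\<^sub>R dcutoff c (2 * r) x"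
      unfolding \<zeta>_def by (rule GDERIV_DERIV_compose[OF GDERIV_cutoff]) (auto intro!: derivative_eq_intros)
    have d1: "((\<lambda>s. u ((x + s *\<^sub>R b) + h *\<^sub>R b) t) has_real_derivative Du (x + h *\<^sub>R b) t \<bullet> b) (at 0)"
    proof -
      have "((\<lambda>s. u ((x + s *\<^sub>R b) + h *\<^sub>R b) t) has_derivative (\<lambda>v. (v *\<^sub>R b) \<bullet> Du (x + h *\<^sub>R b) t)) (at 0)"
        by (rule has_derivative_compose[of "\<lambda>s. (x + s *\<^sub>R b) + h *\<^sub>R b" _ 0 UNIV "\<lambda>y. u y t" "\<lambda>k. k \<bullet> Du (x + h *\<^sub>R b) t"])
           (use Du[OF in_U(2)[OF xB] t] in \<open>auto simp: gderiv_def intro!: derivative_eq_intros\<close>)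
      then show ?thesis unfolding has_field_derivative_def
        by (rule has_derivative_eq_rhs) (simp add: fun_eq_iff inner_commute)
    qed
    have d2: "((\<lambda>s. u (x + s *\<^sub>R b) t) has_real_derivative Du x t \<bullet> b) (at 0)"
      by (rule dir[OF Du[OF in_U(1)[OF xB] t]])
    have d\<delta>: "((\<lambda>s. \<delta> (x + s *\<^sub>R b) t) has_real_derivative Dd x t \<bullet> b) (at 0)"
      using DERIV_cmult[OF DERIV_diff[OF d1 d2], of "inverse h"]
      unfolding \<delta>_def Dd_def by (simp add: divide_inverse mult.commute inner_diff_left)
    from DERIV_mult[OF ubar_der[OF xO] DERIV_mult[OF dir[OF d\<zeta>] d\<delta>]]
    show ?thesis unfolding f_def f'_def g_def by (rule DERIV_cong) (simp add: power2_eq_square algebra_simps)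
  next
    case False
    have "open (- K)" unfolding K_def by (rule open_Compl[OF closed_cball])
    have "(f has_derivative (\<lambda>h. 0)) (at x)"
      by (rule has_derivative_transform_within_open[of "\<lambda>x. 0" _ _ _ "- K"])
         (use False zero \<open>open (- K)\<close> in \<open>auto simp: f_def\<close>)
    then have "((\<lambda>s. (f (x + s *\<^sub>R b) - f x) /\<^sub>R s) \<longlongrightarrow> 0) (at 0)" by (rule has_derivative_quotient)
    then have "((\<lambda>s. f (x + s *\<^sub>R b)) has_real_derivative 0) (at 0)"
      by (simp add: has_field_derivative_iff divide_inverse mult.commute)
    then show ?thesis using zero[OF False] by (simp add: f'_def g_def)
  qed
  have cg: "continuous_on K (\<lambda>x. (\<zeta> x)\<^sup>2 * (\<delta> x t)\<^sup>2)" "continuous_on K g"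
    unfolding g_def using t KB by (auto intro!: continuous_intros)
  have "compact K" by (simp add: K_def)
  obtain L1 where L1: "\<And>x. x \<in> K \<Longrightarrow> norm ((\<zeta> x)\<^sup>2 * (\<delta> x t)\<^sup>2) \<le> L1"
    using compact_imp_bounded[OF compact_continuous_image[OF cg(1) \<open>compact K\<close>]] by (fastforce simp: bounded_iff)
  obtain L2 where L2: "\<And>x. x \<in> K \<Longrightarrow> norm (g x) \<le> L2"
    using compact_imp_bounded[OF compact_continuous_image[OF cg(2) \<open>compact K\<close>]] by (fastforce simp: bounded_iff)
  have bound: "\<bar>f' x\<bar> \<le> \<bar>L1\<bar> + M * \<bar>L2\<bar>" for x
  proof (cases "x \<in> K")
    case True
    have "\<bar>ubar x * g x\<bar> \<le> M * \<bar>L2\<bar>"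
      unfolding abs_mult using ubar_le[of x] L2[OF True] KO True M by (intro mult_mono) auto
    then show ?thesis using L1[OF True] unfolding f'_def by (auto intro: order.trans[OF abs_triangle_ineq])
  next
    case False
    then show ?thesis using zero M by (simp add: f'_def g_def)
  qed
  \<comment> \<open>Continuity of \<open>ubar\<close> is established on \<open>O1\<close>;
    \<open>f\<close> is glued from this open neighbourhood of the support and the complement of
    \<open>K\<close>, where it is 0.\<close>
  have cont: "continuous_on UNIV f"
  proof -
    have cO: "continuous_on O1 ubar"
    proof -
      have "continuous_on O1 (\<lambda>x. integral (cbox 0 h) (\<lambda>s. u (x + s *\<^sub>R b) t))"
        by (rule integral_continuous_on_param)
           (use t h inU in \<open>auto simp: case_prod_unfold intro!: continuous_intros\<close>)
      then show ?thesis unfolding ubar_def by (intro continuous_intros)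
    qed
    have "continuous_on O1 (\<lambda>x. u (x + h *\<^sub>R b) t)" "continuous_on O1 (\<lambda>x. u x t)"
      using t h r inU inU[of _ 0] by (auto intro!: continuous_intros)
    then have "continuous_on O1 f"
      unfolding f_def \<delta>_def using h
      by (intro continuous_on_mult continuous_on_power continuous_on_divide continuous_on_diff
          continuous_on_const cutoff_cont continuous_on_id cO) auto
    moreover have "continuous_on (- K) f"
      by (rule continuous_on_cong[THEN iffD1, OF refl _ continuous_on_const[of _ 0]]) (auto simp: f_def zero)
    ultimately have "continuous_on (O1 \<union> - K) f"
      by (intro continuous_on_open_Un) (auto simp: O1_def K_def intro: open_Compl)
    moreover have "O1 \<union> - K = UNIV" using KO by auto
    ultimately show ?thesis by simp
  qed
  have "(f' has_integral 0) UNIV"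
  proof (rule integral_directional_derivative_zero[OF der bound _ cont])
    show "f x = 0" if "x \<notin> cbox (c - (2 * r) *\<^sub>R One) (c + (2 * r) *\<^sub>R One)" for x
      using that KB zero unfolding B_cbox f_def by auto
  qed
  then have "(f' has_integral 0) B2"
  proof (rule has_integral_same_support)
    fix x assume "x \<notin> UNIV \<inter> B2"
    then have "x \<notin> K" using KB by auto
    then show "f' x = 0" using zero[of x] by (simp add: f'_def g_def)
  qed
  moreover have "\<bar>ubar x\<bar> \<le> M" if "\<zeta> x \<noteq> 0" for x
    using ubar_le[of x] zero[of x] that KO by auto
  ultimately show ?thesis using that[of ubar] unfolding f'_def[abs_def] g_def by blast
qed

text \<open>The preceding identity bounds the integral of \<zeta>^2 \<delta>^2 by \<open>M\<close>
  times integrals of \<zeta>^2 |Dd| and \<zeta> |\<delta>|. Since \<open>Dd\<close> is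
  \<open>\<Phi>d\<close> minus a field linear in \<open>\<delta>\<close>, two applications of
  Young's inequality return half of the left side, and only the first power of
  \<open>\<Phi>d\<close> remains.\<close>

lemma embedding:
  assumes t: "0 < t" "t \<le> T"
  shows "integral B2 (\<lambda>x. (\<zeta> x)\<^sup>2 * (\<delta> x t)\<^sup>2)
    \<le> 2 * m1 * integral B2 (\<lambda>x. (\<zeta> x)\<^sup>2 * norm (\<Phi>d x t)) + 18 * \<kappa>^3 * m1^4 * \<xi>^4"
proof -
  obtain ubar where ubar: "\<And>x. x \<in> B2 \<Longrightarrow> \<zeta> x \<noteq> 0 \<Longrightarrow> \<bar>ubar x\<bar> \<le> M"
    and I: "((\<lambda>x. (\<zeta> x)\<^sup>2 * (\<delta> x t)\<^sup>2 +
      ubar x * ((\<zeta> x)\<^sup>2 * (Dd x t \<bullet> b) + (2 * \<zeta> x * \<delta> x t) * (dcutoff c (2 * r) x \<bullet> b))) has_integral 0) B2"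
    using embedding_identity[OF t] by blast
  define C where "C = 9 * \<kappa>\<^sup>2 * m1^4 * \<xi>^4"
  define e where "e x = (\<zeta> x)\<^sup>2 * (\<delta> x t)\<^sup>2" for x
  define q where "q x = (\<zeta> x)\<^sup>2 * norm (\<Phi>d x t)" for x
  have ci: "e integrable_on B2" "q integrable_on B2"
    unfolding e_def q_def B_cbox using t by (auto simp: B_cbox[symmetric] intro!: integrable_continuous[where a = "c - (2 * r) *\<^sub>R One" and b = "c + (2 * r) *\<^sub>R One", folded B_cbox] continuous_intros)
  have "((\<lambda>x. e x - ((\<zeta> x)\<^sup>2 * (\<delta> x t)\<^sup>2 + ubar x * ((\<zeta> x)\<^sup>2 * (Dd x t \<bullet> b) + (2 * \<zeta> x * \<delta> x t) * (dcutoff c (2 * r) x \<bullet> b)))) has_integral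
      integral B2 e - 0) B2"
    by (intro has_integral_diff I integrable_integral ci)
  moreover have "((\<lambda>x. (1/2) * e x + m1 * q x + C) has_integral
      (1/2) * integral B2 e + m1 * integral B2 q + measure lborel B2 * C) B2"
    using has_integral_const[of C] unfolding B_cbox
    by (intro has_integral_add has_integral_mult_right integrable_integral ci[unfolded B_cbox]) (auto simp: B_cbox)
  ultimately have "integral B2 e - 0 \<le> (1/2) * integral B2 e + m1 * integral B2 q + measure lborel B2 * C"
  proof (rule has_integral_le)
    fix x assume x: "x \<in> B2"
    define s where "s = \<zeta> x"
    define d where "d = \<bar>\<delta> x t\<bar>"
    have s: "0 \<le> s" "s \<le> 1" by (simp_all add: s_def)
    have s2: "s\<^sup>2 \<le> 1" using s by (simp add: power_le_one)
    have d: "0 \<le> d" by (simp add: d_def)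
    have k: "1 \<le> \<kappa>" "1 \<le> \<xi>" "1 \<le> m1" using kappa_ge_1 chi_ge_1 m1 by auto
    have young: "p * y \<le> y\<^sup>2 / 4 + p\<^sup>2" for p y :: real
      using zero_le_power2[of "y / 2 - p"] by (simp add: power2_diff power_divide mult_ac)
    have "\<bar>ubar x * (s\<^sup>2 * (Dd x t \<bullet> b) + (2 * s * \<delta> x t) * (dcutoff c (2 * r) x \<bullet> b))\<bar>
      \<le> m1 * (s\<^sup>2 * norm (Dd x t) + 2 * s * d * \<kappa>)"
    proof (cases "s = 0")
      case False
      have "\<bar>Dd x t \<bullet> b\<bar> \<le> norm (Dd x t)" "\<bar>dcutoff c (2 * r) x \<bullet> b\<bar> \<le> \<kappa>"
        using Cauchy_Schwarz_ineq2[of "Dd x t" b] Cauchy_Schwarz_ineq2[of "dcutoff c (2 * r) x" b]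
          norm_b dcutoff_bounds(1)[of x] by auto
      then have "\<bar>s\<^sup>2 * (Dd x t \<bullet> b)\<bar> \<le> s\<^sup>2 * norm (Dd x t)"
        "\<bar>(2 * s * \<delta> x t) * (dcutoff c (2 * r) x \<bullet> b)\<bar> \<le> 2 * s * d * \<kappa>"
        using s d by (auto simp: abs_mult d_def intro!: mult_left_mono)
      then have "\<bar>s\<^sup>2 * (Dd x t \<bullet> b) + (2 * s * \<delta> x t) * (dcutoff c (2 * r) x \<bullet> b)\<bar> \<le> s\<^sup>2 * norm (Dd x t) + 2 * s * d * \<kappa>"
        by linarith
      then show ?thesis unfolding abs_mult[of "ubar x"] using ubar[OF x] False m1
        by (intro mult_mono) (auto simp: s_def)
    qed simp
    also have "\<dots> = m1 * (s\<^sup>2 * norm (Dd x t)) + (2 * m1 * \<kappa>) * (s * d)" by (simp add: algebra_simps)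
    also have "s\<^sup>2 * norm (Dd x t) \<le> s\<^sup>2 * norm (\<Phi>d x t) + (2 * m1 * \<xi>\<^sup>2) * (s * d) + m1\<^sup>2 * \<xi>\<^sup>2"
    proof -
      have "norm (Dd x t) \<le> norm (\<Phi>d x t) + (2 * m1 * \<xi>\<^sup>2 * d + m1\<^sup>2 * \<xi>\<^sup>2)"
        using norm_triangle_ineq4[of "\<Phi>d x t" "Rd x t"] norm_Rd[OF x less_imp_le[OF t(1)] t(2)]
        unfolding Dd_eq d_def by linarith
      then have "s\<^sup>2 * norm (Dd x t) \<le> s\<^sup>2 * (norm (\<Phi>d x t) + (2 * m1 * \<xi>\<^sup>2 * d + m1\<^sup>2 * \<xi>\<^sup>2))"
        by (intro mult_left_mono) auto
      also have "\<dots> = s\<^sup>2 * norm (\<Phi>d x t) + s * (2 * m1 * \<xi>\<^sup>2 * (s * d)) + s\<^sup>2 * (m1\<^sup>2 * \<xi>\<^sup>2)"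
        by (simp add: power2_eq_square algebra_simps)
      also have "\<dots> \<le> s\<^sup>2 * norm (\<Phi>d x t) + 1 * (2 * m1 * \<xi>\<^sup>2 * (s * d)) + 1 * (m1\<^sup>2 * \<xi>\<^sup>2)"
        using s s2 d k by (intro add_mono mult_right_mono) auto
      finally show ?thesis by simp
    qed
    then have "m1 * (s\<^sup>2 * norm (Dd x t)) \<le> m1 * (s\<^sup>2 * norm (\<Phi>d x t) + (2 * m1 * \<xi>\<^sup>2) * (s * d) + m1\<^sup>2 * \<xi>\<^sup>2)"
      using k by (intro mult_left_mono) auto
    also have "\<dots> = m1 * (s\<^sup>2 * norm (\<Phi>d x t)) + (2 * m1\<^sup>2 * \<xi>\<^sup>2) * (s * d) + m1^3 * \<xi>\<^sup>2"
      by (simp add: power2_eq_square power3_eq_cube algebra_simps)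
    also have "(2 * m1\<^sup>2 * \<xi>\<^sup>2) * (s * d) \<le> (s * d)\<^sup>2 / 4 + (2 * m1\<^sup>2 * \<xi>\<^sup>2)\<^sup>2" by (rule young)
    also have "(2 * m1 * \<kappa>) * (s * d) \<le> (s * d)\<^sup>2 / 4 + (2 * m1 * \<kappa>)\<^sup>2" by (rule young)
    finally have *: "\<bar>ubar x * (s\<^sup>2 * (Dd x t \<bullet> b) + (2 * s * \<delta> x t) * (dcutoff c (2 * r) x \<bullet> b))\<bar>
      \<le> (1/2) * (s * d)\<^sup>2 + m1 * (s\<^sup>2 * norm (\<Phi>d x t)) + ((2 * m1\<^sup>2 * \<xi>\<^sup>2)\<^sup>2 + m1^3 * \<xi>\<^sup>2 + (2 * m1 * \<kappa>)\<^sup>2)"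
      by (simp add: add_ac)
    \<comment> \<open>The three remainders contribute 4, 1 and 4, which is the 9 in
      \<open>C\<close>; it becomes 18 when half of the left side is absorbed.\<close>
    have "(2 * m1\<^sup>2 * \<xi>\<^sup>2)\<^sup>2 + m1^3 * \<xi>\<^sup>2 + (2 * m1 * \<kappa>)\<^sup>2 \<le> C"
    proof -
      have k2: "1 \<le> \<kappa>\<^sup>2" "1 \<le> \<xi>^4" using k by (auto simp: one_le_power)
      have "(2 * m1\<^sup>2 * \<xi>\<^sup>2)\<^sup>2 = 1 * (4 * (m1^4 * \<xi>^4))" by (simp add: power_mult_distrib flip: power_mult)
      also have "\<dots> \<le> \<kappa>\<^sup>2 * (4 * (m1^4 * \<xi>^4))" using k2 k by (intro mult_right_mono) auto
      finally have 1: "(2 * m1\<^sup>2 * \<xi>\<^sup>2)\<^sup>2 \<le> \<kappa>\<^sup>2 * (4 * (m1^4 * \<xi>^4))" .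
      have "1 * (m1^3 * \<xi>\<^sup>2) \<le> \<kappa>\<^sup>2 * (m1^4 * \<xi>^4)"
        using k k2 by (intro mult_mono power_increasing) auto
      moreover have "(2 * m1 * \<kappa>)\<^sup>2 \<le> \<kappa>\<^sup>2 * (4 * (m1^4 * \<xi>^4))"
      proof -
        have "m1\<^sup>2 * 1 \<le> m1^4 * \<xi>^4" using k k2 by (intro mult_mono power_increasing) auto
        then have "4 * \<kappa>\<^sup>2 * (m1\<^sup>2 * 1) \<le> 4 * \<kappa>\<^sup>2 * (m1^4 * \<xi>^4)" by (intro mult_left_mono) auto
        then show ?thesis by (simp add: power_mult_distrib mult_ac)
      qed
      ultimately show ?thesis using 1 by (simp add: C_def mult_ac)
    qed
    moreover have "(s * d)\<^sup>2 = e x" by (simp add: e_def s_def d_def power_mult_distrib)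
    ultimately show "e x - ((\<zeta> x)\<^sup>2 * (\<delta> x t)\<^sup>2 + ubar x * ((\<zeta> x)\<^sup>2 * (Dd x t \<bullet> b) + (2 * \<zeta> x * \<delta> x t) * (dcutoff c (2 * r) x \<bullet> b)))
        \<le> (1/2) * e x + m1 * q x + C"
      using * unfolding s_def[symmetric] q_def e_def by linarith
  qed
  moreover have "measure lborel B2 * C \<le> \<kappa> * C"
  proof (rule mult_right_mono)
    have "measure lborel B2 \<le> measure lborel B6"
      using B2_B6 by (intro measure_mono_fmeasurable) (auto simp: B_cbox)
    then show "measure lborel B2 \<le> \<kappa>" using kappa_geometry(4) by (simp add: B6_def)
  qed (use m1 xi_pos in \<open>auto simp: C_def\<close>)
  moreover have "2 * (\<kappa> * C) = 18 * \<kappa>^3 * m1^4 * \<xi>^4" by (simp add: C_def power2_eq_square power3_eq_cube)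
  ultimately show ?thesis unfolding e_def[symmetric] q_def[symmetric] by linarith
qed

text \<open>On the ball of radius 5 r the cut-off of radius 6 r is at least (11/36)^2, and 200
  (11/36)^4 exceeds 1. This is a source of the requirement 200 \<le> \<kappa>.\<close>

lemma G_le_cutoff_energy:
  assumes "y \<in> cball c (5 * r)"
  shows "G (\<Phi> y t) \<le> \<kappa> * (1 + \<kappa> * ((\<omega> y)\<^sup>2 * (G (\<Phi> y t) * (norm (V y t))\<^sup>2)))"
proof -
  have "(1 - (5 / 6)\<^sup>2)\<^sup>2 \<le> \<omega> y"
    unfolding \<omega>_def using assms r by (intro cutoff_lower) auto
  then have "((1 - (5 / 6)\<^sup>2)\<^sup>2)\<^sup>2 \<le> (\<omega> y)\<^sup>2" by (intro power_mono) auto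
  then have "200 * ((1 - (5 / 6)\<^sup>2)\<^sup>2)\<^sup>2 \<le> \<kappa> * (\<omega> y)\<^sup>2"
    using kappa_geometry(1) by (intro mult_mono) auto
  then have "1 \<le> \<kappa> * (\<omega> y)\<^sup>2" by (rule order.trans[rotated]) (simp add: power2_eq_square)
  then have "1 * (G (\<Phi> y t) * (norm (V y t))\<^sup>2) \<le> \<kappa> * (\<omega> y)\<^sup>2 * (G (\<Phi> y t) * (norm (V y t))\<^sup>2)"
    using less_imp_le[OF G_pos] by (intro mult_right_mono) auto
  then have "\<kappa> * (1 + G (\<Phi> y t) * (norm (V y t))\<^sup>2) \<le> \<kappa> * (1 + \<kappa> * ((\<omega> y)\<^sup>2 * (G (\<Phi> y t) * (norm (V y t))\<^sup>2)))"
    using kappa_pos by (intro mult_left_mono) auto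
  then show ?thesis using G_le_energy[of "\<Phi> y t"] unfolding V_def by linarith
qed

text \<open>Both values of \<open>G\<close> in \<open>m\<close> are taken in the ball of radius 5 r.
  After a translation the two integrals run over subsets of \<open>B6\<close>, so the bound is
  uniform in \<open>h\<close>.\<close>

lemma m_integral:
  assumes t: "0 < t" "t \<le> T"
  shows "integral B2 (\<lambda>x. m x t) \<le> 2 * \<kappa>\<^sup>2 * (1 + energy t)"
proof -
  define q where "q y = \<kappa> * (1 + \<kappa> * ((\<omega> y)\<^sup>2 * (G (\<Phi> y t) * (norm (V y t))\<^sup>2)))" for y
  have cq: "continuous_on B6 q" unfolding q_def using t B6_U by (auto intro!: continuous_intros)
  have qi: "q integrable_on cbox l u" if "cbox l u \<subseteq> B6" for l u
    by (rule integrable_continuous[OF continuous_on_subset[OF cq that]])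
  have q0: "0 \<le> q y" for y
    unfolding q_def using kappa_pos less_imp_le[OF G_pos] by (intro mult_nonneg_nonneg add_nonneg_nonneg) auto
  have qB6: "integral B6 q \<le> \<kappa>\<^sup>2 * (1 + energy t)"
  proof -
    define p where "p y = (\<omega> y)\<^sup>2 * (G (\<Phi> y t) * (norm (V y t))\<^sup>2)" for y
    have "continuous_on B6 p" unfolding p_def using t B6_U by (auto intro!: continuous_intros)
    then have pi: "p integrable_on B6" unfolding B_cbox by (rule integrable_continuous)
    have "((\<lambda>y. \<kappa> * (1 + \<kappa> * p y)) has_integral \<kappa> * (measure lborel B6 * 1 + \<kappa> * integral B6 p)) B6"
      using has_integral_const[of "1::real"] unfolding B_cbox
      by (intro has_integral_mult_right has_integral_add integrable_integral pi[unfolded B_cbox]) (auto simp: B_cbox)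
    then have "integral B6 (\<lambda>y. \<kappa> * (1 + \<kappa> * p y)) = \<kappa> * (measure lborel B6 * 1 + \<kappa> * integral B6 p)"
      by (rule integral_unique)
    then have "integral B6 q = \<kappa> * (measure lborel B6 + \<kappa> * energy t)"
      unfolding q_def p_def energy_def mult_1_right .
    also have "\<dots> \<le> \<kappa> * (\<kappa> + \<kappa> * energy t)"
      using kappa_geometry(4) kappa_pos by (intro mult_left_mono) (auto simp: B6_def)
    finally show ?thesis by (simp add: power2_eq_square algebra_simps)
  qed
  define lo hi where "lo = c - (2 * r) *\<^sub>R One" and "hi = c + (2 * r) *\<^sub>R One"
  have B2: "B2 = cbox lo hi" by (simp add: B_cbox lo_def hi_def)
  have sub: "cbox (lo + h *\<^sub>R b) (hi + h *\<^sub>R b) \<subseteq> B6"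
  proof
    fix y assume "y \<in> cbox (lo + h *\<^sub>R b) (hi + h *\<^sub>R b)"
    then have "y - h *\<^sub>R b \<in> B2" unfolding B2 by (auto simp: mem_box algebra_simps)
    from shift_geometry(2)[OF this _ h(2) norm_b] show "y \<in> B6" using h by simp
  qed
  have mi: "(\<lambda>x. m x t) integrable_on B2"
    unfolding B2 by (intro integrable_continuous) (use t in \<open>auto simp: B2[symmetric] intro!: continuous_intros\<close>)
  have q1: "q integrable_on B2" using qi[of lo hi] B2_B6 by (simp add: B2)
  have q2: "(\<lambda>x. q (x + h *\<^sub>R b)) integrable_on B2"
    using integrable_shift_cbox[OF qi[OF sub], of "h *\<^sub>R b"] by (simp add: B2)
  have "integral B2 (\<lambda>x. m x t) \<le> integral B2 (\<lambda>x. q (x + h *\<^sub>R b) + q x)"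
  proof (rule integral_le[OF mi integrable_add[OF q2 q1]])
    fix x assume x: "x \<in> B2"
    have "x \<in> cball c (5 * r)" using B2_cball x r by force
    then show "m x t \<le> q (x + h *\<^sub>R b) + q x"
      unfolding m_def q_def using shift_geometry(1)[OF x _ h(2) norm_b] h by (intro add_mono G_le_cutoff_energy) auto
  qed
  also have "\<dots> = integral B2 (\<lambda>x. q (x + h *\<^sub>R b)) + integral B2 q" by (rule integral_add[OF q2 q1])
  also have "integral B2 (\<lambda>x. q (x + h *\<^sub>R b)) = integral (cbox (lo + h *\<^sub>R b) (hi + h *\<^sub>R b)) q"
    using integral_shift_cbox[of "lo + h *\<^sub>R b" "h *\<^sub>R b" "hi + h *\<^sub>R b" q] by (simp add: B2)
  also have "\<dots> \<le> integral B6 q"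
    using sub qi q0 by (intro integral_subset_le) (auto simp: B_cbox)
  also have "integral B2 q \<le> integral B6 q"
    using B2_B6 q1 qi q0 by (intro integral_subset_le) (auto simp: B_cbox)
  finally show ?thesis using qB6 by linarith
qed

text \<open>All terms quadratic in \<open>\<delta>\<close> are collected with a single factor
  \<open>\<sigma>\<close> and the coefficient \<open>\<Lambda>\<close>, using \<sigma>^2 \<le>
  \<sigma>. A single factor suffices because \<open>embedding\<close> makes them linear in
  \<open>\<Phi>d\<close>: Young's inequality with weight \<open>m\<close> turns \<sigma> |\<Phi>d|
  into \<sigma>^2 E, of which a quarter is spent, and the integral of \<open>m\<close>, which
  \<open>m_integral\<close> bounds by the energy.\<close>

lemma step_inequality:
  assumes t: "0 < t" "t \<le> T" and \<sigma>: "0 \<le> \<sigma>" "\<sigma> \<le> 1" and \<sigma>': "0 \<le> \<sigma>'" "\<sigma>' \<le> L"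
    and \<Lambda>: "\<Lambda> = 24 * \<kappa>^3 * \<xi>^4 * m1\<^sup>2 + L"
  shows "\<phi> * \<sigma> * \<sigma>' * integral B2 (\<lambda>x. \<zeta> x ^ 4 * (\<delta> x t)\<^sup>2)
      + \<phi> * \<sigma>\<^sup>2 * integral B2 (\<lambda>x. \<zeta> x ^ 4 * (\<delta> x t * \<delta>t x t)) + \<sigma>\<^sup>2 * P t / 4
    \<le> 8 * \<kappa>^3 * \<xi>\<^sup>2 * m1\<^sup>2 * \<Lambda>\<^sup>2 * (1 + energy t) + 20 * \<kappa>^3 * \<Lambda> * m1^4 * \<xi>^4"
proof -
  define Bq where "Bq = integral B2 (\<lambda>x. (\<zeta> x)\<^sup>2 * (\<delta> x t)\<^sup>2)"
  define Aq where "Aq = integral B2 (\<lambda>x. \<zeta> x ^ 4 * (\<delta> x t)\<^sup>2)"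
  define I where "I = integral B2 (\<lambda>x. (\<zeta> x)\<^sup>2 * norm (\<Phi>d x t))"
  define C2 where "C2 = 24 * \<kappa>^3 * \<xi>^4 * m1\<^sup>2"
  have k: "1 \<le> \<kappa>" "1 \<le> \<xi>" "1 \<le> m1" using kappa_ge_1 chi_ge_1 m1 by auto
  have C2: "1 \<le> C2"
  proof -
    have "1 * 1 * 1 * 1 \<le> C2" unfolding C2_def using k by (intro mult_mono) (auto simp: one_le_power)
    then show ?thesis by simp
  qed
  have L: "0 \<le> L" using \<sigma>' by simp
  have \<Lambda>': "\<Lambda> = C2 + L" "1 \<le> \<Lambda>" using \<Lambda> C2 L by (auto simp: C2_def)
  have int: "f integrable_on B2" if "continuous_on B2 f" for f :: "real^3 \<Rightarrow> real"
    using that unfolding B_cbox by (rule integrable_continuous)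
  have cs: "continuous_on B2 (\<lambda>x. \<delta> x t)" "continuous_on B2 (\<lambda>x. E x t)" "continuous_on B2 (\<lambda>x. m x t)"
    "continuous_on B2 (\<lambda>x. \<Phi>d x t)" using t by (auto intro!: continuous_intros)
  have Aq: "0 \<le> Aq" "Aq \<le> Bq"
    unfolding Aq_def Bq_def
    using cs power_decreasing[of 2 4 "\<zeta> _"]
    by (auto intro!: integral_nonneg integral_le int continuous_intros mult_right_mono)
  have "\<phi> * \<sigma> * \<sigma>' * Aq \<le> 1 * \<sigma> * L * Bq"
    using phi \<sigma> \<sigma>' Aq L by (intro mult_mono) auto
  moreover have "\<sigma>\<^sup>2 * (\<phi> * integral B2 (\<lambda>x. \<zeta> x ^ 4 * (\<delta> x t * \<delta>t x t)))
      \<le> \<sigma>\<^sup>2 * (- (1/2) * P t + C2 * Bq + 2 * \<kappa>\<^sup>2 * m1^4 * \<xi>^4)"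
    using step_identity[OF t] by (intro mult_left_mono) (auto simp: C2_def Bq_def)
  moreover have "\<sigma>\<^sup>2 * (C2 * Bq) \<le> \<sigma> * (C2 * Bq)"
    using \<sigma> C2 Aq mult_right_mono[of \<sigma> 1 \<sigma>] by (intro mult_right_mono) (auto simp: power2_eq_square)
  moreover have "\<sigma>\<^sup>2 * (2 * \<kappa>\<^sup>2 * m1^4 * \<xi>^4) \<le> 1 * (2 * \<kappa>^3 * \<Lambda> * m1^4 * \<xi>^4)"
  proof (rule mult_mono)
    show "\<sigma>\<^sup>2 \<le> 1" using \<sigma> by (simp add: power_le_one)
    have "2 * \<kappa>\<^sup>2 * 1 \<le> 2 * \<kappa>^3 * \<Lambda>" using k \<Lambda>' by (intro mult_mono power_increasing) auto
    then show "2 * \<kappa>\<^sup>2 * m1^4 * \<xi>^4 \<le> 2 * \<kappa>^3 * \<Lambda> * m1^4 * \<xi>^4"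
      using k by (intro mult_right_mono) auto
  qed (use k in auto)
  moreover have "\<sigma> * \<Lambda> * Bq \<le> 2 * m1 * \<Lambda> * (\<sigma> * I) + 18 * \<kappa>^3 * \<Lambda> * m1^4 * \<xi>^4"
  proof -
    have "\<sigma> * \<Lambda> * Bq \<le> \<sigma> * \<Lambda> * (2 * m1 * I + 18 * \<kappa>^3 * m1^4 * \<xi>^4)"
      using embedding[OF t] \<sigma> \<Lambda>' by (intro mult_left_mono) (auto simp: Bq_def I_def)
    also have "\<dots> = 2 * m1 * \<Lambda> * (\<sigma> * I) + \<sigma> * (18 * \<kappa>^3 * \<Lambda> * m1^4 * \<xi>^4)" by (simp add: algebra_simps)
    also have "\<dots> \<le> 2 * m1 * \<Lambda> * (\<sigma> * I) + 1 * (18 * \<kappa>^3 * \<Lambda> * m1^4 * \<xi>^4)"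
      using \<sigma> k \<Lambda>' by (intro add_left_mono mult_right_mono) auto
    finally show ?thesis by simp
  qed
  moreover have "2 * m1 * \<Lambda> * (\<sigma> * I) \<le> \<sigma>\<^sup>2 * P t / 4 + 4 * \<kappa> * \<xi>\<^sup>2 * m1\<^sup>2 * \<Lambda>\<^sup>2 * integral B2 (\<lambda>x. m x t)"
  proof -
    have i1: "(\<lambda>x. (\<zeta> x)\<^sup>2 * norm (\<Phi>d x t)) integrable_on B2" "(\<lambda>x. \<zeta> x ^ 4 * E x t) integrable_on B2"
      "(\<lambda>x. m x t) integrable_on B2" using cs by (auto intro!: int continuous_intros)
    have "((\<lambda>x. 2 * m1 * \<Lambda> * (\<sigma> * ((\<zeta> x)\<^sup>2 * norm (\<Phi>d x t)))) has_integral 2 * m1 * \<Lambda> * (\<sigma> * I)) B2"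
      unfolding I_def by (intro has_integral_mult_right integrable_integral i1)
    moreover have "((\<lambda>x. \<sigma>\<^sup>2 / 4 * (\<zeta> x ^ 4 * E x t) + 4 * \<kappa> * \<xi>\<^sup>2 * m1\<^sup>2 * \<Lambda>\<^sup>2 * m x t) has_integral
        \<sigma>\<^sup>2 / 4 * P t + 4 * \<kappa> * \<xi>\<^sup>2 * m1\<^sup>2 * \<Lambda>\<^sup>2 * integral B2 (\<lambda>x. m x t)) B2"
      unfolding P_def by (intro has_integral_add has_integral_mult_right integrable_integral i1)
    ultimately have "2 * m1 * \<Lambda> * (\<sigma> * I) \<le> \<sigma>\<^sup>2 / 4 * P t + 4 * \<kappa> * \<xi>\<^sup>2 * m1\<^sup>2 * \<Lambda>\<^sup>2 * integral B2 (\<lambda>x. m x t)"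
    proof (rule has_integral_le)
      fix x
      define a where "a = \<sigma> * ((\<zeta> x)\<^sup>2 * norm (\<Phi>d x t))"
      define q where "q = \<kappa> * \<xi>\<^sup>2 * m x t"
      have q: "0 < q" unfolding q_def using kappa_pos xi_pos m_pos by simp
      have "a\<^sup>2 = \<sigma>\<^sup>2 * \<zeta> x ^ 4 * (norm (\<Phi>d x t))\<^sup>2"
        by (simp add: a_def power_mult_distrib flip: power_mult)
      also have "\<dots> \<le> \<sigma>\<^sup>2 * \<zeta> x ^ 4 * (q * E x t)"
        using norm_Phid_sq[of x t] by (intro mult_left_mono) (auto simp: q_def mult_ac)
      finally have a2: "a\<^sup>2 \<le> q * (\<sigma>\<^sup>2 * (\<zeta> x ^ 4 * E x t))" by (simp add: mult_ac)
      \<comment> \<open>The square is completed with the coercivity weight q, so that exactly a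
        quarter of the weighted dissipation appears.\<close>
      have "0 \<le> (a - 4 * q * (m1 * \<Lambda>))\<^sup>2" by simp
      then have "4 * q * (2 * m1 * \<Lambda> * a) \<le> a\<^sup>2 + 16 * q\<^sup>2 * (m1 * \<Lambda>)\<^sup>2"
        by (simp add: power2_diff power_mult_distrib algebra_simps)
      also have "\<dots> \<le> q * (\<sigma>\<^sup>2 * (\<zeta> x ^ 4 * E x t)) + 16 * q\<^sup>2 * (m1 * \<Lambda>)\<^sup>2" using a2 by simp
      also have "\<dots> = 4 * q * (\<sigma>\<^sup>2 / 4 * (\<zeta> x ^ 4 * E x t) + 4 * q * (m1 * \<Lambda>)\<^sup>2)"
        by (simp add: power2_eq_square algebra_simps)
      finally have "2 * m1 * \<Lambda> * a \<le> \<sigma>\<^sup>2 / 4 * (\<zeta> x ^ 4 * E x t) + 4 * q * (m1 * \<Lambda>)\<^sup>2" using q by simp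
      then show "2 * m1 * \<Lambda> * (\<sigma> * ((\<zeta> x)\<^sup>2 * norm (\<Phi>d x t)))
          \<le> \<sigma>\<^sup>2 / 4 * (\<zeta> x ^ 4 * E x t) + 4 * \<kappa> * \<xi>\<^sup>2 * m1\<^sup>2 * \<Lambda>\<^sup>2 * m x t"
        by (simp add: a_def q_def power_mult_distrib mult_ac)
    qed
    then show ?thesis by simp
  qed
  moreover have "4 * \<kappa> * \<xi>\<^sup>2 * m1\<^sup>2 * \<Lambda>\<^sup>2 * integral B2 (\<lambda>x. m x t)
      \<le> 4 * \<kappa> * \<xi>\<^sup>2 * m1\<^sup>2 * \<Lambda>\<^sup>2 * (2 * \<kappa>\<^sup>2 * (1 + energy t))"
    using m_integral[OF t] kappa_pos by (intro mult_left_mono) auto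
  moreover have "4 * \<kappa> * \<xi>\<^sup>2 * m1\<^sup>2 * \<Lambda>\<^sup>2 * (2 * \<kappa>\<^sup>2 * (1 + energy t)) = 8 * \<kappa>^3 * \<xi>\<^sup>2 * m1\<^sup>2 * \<Lambda>\<^sup>2 * (1 + energy t)"
    by (simp add: power2_eq_square power3_eq_cube)
  moreover have "\<sigma> * \<Lambda> * Bq = \<sigma> * (C2 * Bq) + 1 * \<sigma> * L * Bq" by (simp add: \<Lambda>' algebra_simps)
  moreover have "\<sigma>\<^sup>2 * (- (1/2) * P t + C2 * Bq + 2 * \<kappa>\<^sup>2 * m1^4 * \<xi>^4)
      = - (\<sigma>\<^sup>2 * P t / 2) + \<sigma>\<^sup>2 * (C2 * Bq) + \<sigma>\<^sup>2 * (2 * \<kappa>\<^sup>2 * m1^4 * \<xi>^4)" by (simp add: algebra_simps)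
  moreover have "\<phi> * \<sigma>\<^sup>2 * integral B2 (\<lambda>x. \<zeta> x ^ 4 * (\<delta> x t * \<delta>t x t))
      = \<sigma>\<^sup>2 * (\<phi> * integral B2 (\<lambda>x. \<zeta> x ^ 4 * (\<delta> x t * \<delta>t x t)))" by simp
  ultimately show ?thesis unfolding Aq_def[symmetric] by linarith
qed

text \<open>The bound on \<open>\<sigma>'\<close> is what allows the weight \<open>\<sigma>\<^sup>2\<close>: its derivative \<open>2 \<sigma> \<sigma>'\<close> is at most \<open>2 L \<sigma>\<close>, the root of
  the weight, and can be absorbed.\<close>

theorem step_bound:
  assumes \<sigma>: "\<And>t. 0 \<le> t \<Longrightarrow> t \<le> T \<Longrightarrow> 0 \<le> \<sigma> t \<and> \<sigma> t \<le> 1" and L: "0 \<le> L"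
    and \<sigma>': "\<And>t. 0 \<le> t \<Longrightarrow> t \<le> T \<Longrightarrow> (\<sigma> has_real_derivative \<sigma>' t) (at t within {0..T}) \<and> 0 \<le> \<sigma>' t \<and> \<sigma>' t \<le> L"
  shows "(\<integral>\<^sup>+t\<in>{0<..T}. ennreal ((\<sigma> t)\<^sup>2 * P t) \<partial>lborel)
    \<le> ennreal (2 * \<phi> * (\<sigma> 0)\<^sup>2 * integral B2 (\<lambda>x. \<zeta> x ^ 4 * (\<delta> x 0)\<^sup>2))
      + ennreal (1600000 * \<kappa>^13 * \<xi>^14 * m1^10 * (1 + L)\<^sup>2) * N_star U T \<phi> (\<lambda>x. u x 0) \<Psi>"
proof -
  define \<Lambda> where "\<Lambda> = 24 * \<kappa>^3 * \<xi>^4 * m1\<^sup>2 + L"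
  define Aq where "Aq t = integral B2 (\<lambda>x. \<zeta> x ^ 4 * (\<delta> x t)\<^sup>2)" for t
  define Aq' where "Aq' t = integral B2 (\<lambda>x. \<zeta> x ^ 4 * (\<delta> x t * \<delta>t x t))" for t
  \<comment> \<open>\<open>a\<close> and \<open>k\<close> collect the coefficients of
    \<open>step_inequality\<close> multiplied by 4, so that the weighted dissipation enters with
    coefficient 1.\<close>
  define a where "a = 32 * \<kappa>^3 * \<xi>\<^sup>2 * m1\<^sup>2 * \<Lambda>\<^sup>2"
  define k where "k = a + 80 * \<kappa>^3 * \<Lambda> * m1^4 * \<xi>^4"
  define y where "y t = 2 * \<phi> * ((\<sigma> t)\<^sup>2 * Aq t)" for t
  define y' where "y' t = 4 * (\<phi> * \<sigma> t * \<sigma>' t * Aq t + \<phi> * (\<sigma> t)\<^sup>2 * Aq' t)" for t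
  have k1: "1 \<le> \<kappa>" "1 \<le> \<xi>" "1 \<le> m1" using kappa_ge_1 chi_ge_1 m1 by auto
  have \<Lambda>0: "0 \<le> \<Lambda>" unfolding \<Lambda>_def using k1 L by simp
  have ak: "0 \<le> a" "0 \<le> k" unfolding k_def a_def using k1 \<Lambda>0 by auto
  have c\<sigma>: "continuous_on {0..T} \<sigma>"
    by (rule DERIV_continuous_on[where D = \<sigma>']) (use \<sigma>' in auto)
  have c\<sigma>': "continuous_on {0<..T} \<sigma>" by (rule continuous_on_subset[OF c\<sigma>]) auto
  have cA: "continuous_on {0..T} Aq" unfolding Aq_def B_cbox
    by (rule integral_continuous_on_param) (auto simp: case_prod_unfold B_cbox[symmetric] intro!: continuous_intros)
  have cP: "continuous_on {0<..T} P" unfolding P_def B_cbox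
    by (rule integral_continuous_on_param) (auto simp: case_prod_unfold B_cbox[symmetric] intro!: continuous_intros)
  have cE: "continuous_on {0<..T} energy" unfolding energy_def B_cbox
    by (rule integral_continuous_on_param)
       (use B6_U in \<open>auto simp: case_prod_unfold B_cbox[symmetric] intro!: continuous_intros\<close>)
  have int2: "f integrable_on B2" if "continuous_on B2 f" for f :: "real^3 \<Rightarrow> real"
    using that unfolding B_cbox by (rule integrable_continuous)
  have int6: "f integrable_on B6" if "continuous_on B6 f" for f :: "real^3 \<Rightarrow> real"
    using that unfolding B_cbox by (rule integrable_continuous)
  have E0: "0 \<le> energy t" if "0 < t" "t \<le> T" for t
    unfolding energy_def using that B6_U less_imp_le[OF G_pos]
    by (intro integral_nonneg int6) (auto intro!: continuous_intros)
  have P0: "0 \<le> P t" if "0 < t" "t \<le> T" for t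
    unfolding P_def using that E_nonneg
    by (intro integral_nonneg int2) (auto intro!: continuous_intros)
  have "(\<integral>\<^sup>+t\<in>{0<..T}. ennreal ((\<sigma> t)\<^sup>2 * P t) \<partial>lborel)
      \<le> ennreal (y 0) + (\<integral>\<^sup>+t\<in>{0<..T}. ennreal (a * energy t + k) \<partial>lborel)"
  proof (rule time_integral_bound[OF T])
    show "continuous_on {0..T} y" unfolding y_def by (intro continuous_intros c\<sigma> cA)
    show "continuous_on {0<..T} (\<lambda>t. (\<sigma> t)\<^sup>2 * P t)" by (intro continuous_intros c\<sigma>' cP)
    show "continuous_on {0<..T} (\<lambda>t. a * energy t + k)" by (intro continuous_intros cE)
    show "0 \<le> y t" if "0 \<le> t" "t \<le> T" for t
      unfolding y_def Aq_def using phi that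
      by (intro mult_nonneg_nonneg integral_nonneg int2) (auto intro!: continuous_intros)
    show "0 \<le> (\<sigma> t)\<^sup>2 * P t" if "0 < t" "t \<le> T" for t using P0[OF that] by simp
    show "0 \<le> a * energy t + k" if "0 < t" "t \<le> T" for t using E0[OF that] ak by simp
    show "y' t + (\<sigma> t)\<^sup>2 * P t \<le> a * energy t + k" if "0 < t" "t \<le> T" for t
    proof -
      have "4 * (\<phi> * \<sigma> t * \<sigma>' t * Aq t + \<phi> * (\<sigma> t)\<^sup>2 * Aq' t + (\<sigma> t)\<^sup>2 * P t / 4)
          \<le> 4 * (8 * \<kappa>^3 * \<xi>\<^sup>2 * m1\<^sup>2 * \<Lambda>\<^sup>2 * (1 + energy t) + 20 * \<kappa>^3 * \<Lambda> * m1^4 * \<xi>^4)"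
        unfolding Aq_def Aq'_def using that \<sigma>[of t] \<sigma>'[of t] \<Lambda>_def
        by (intro mult_left_mono step_inequality[where L = L]) auto
      then show ?thesis unfolding y'_def a_def k_def by (simp add: algebra_simps)
    qed
    fix t0 t :: real assume t: "0 < t0" "t0 \<le> t" "t \<le> T"
    have "(Aq has_vector_derivative integral B2 (\<lambda>x. \<zeta> x ^ 4 * (2 * (\<delta> x t * \<delta>t x t)))) (at t within {t0..T})"
      unfolding Aq_def B_cbox
    proof (rule leibniz_rule_vector_derivative, unfold B_cbox[symmetric])
      show "((\<lambda>t. \<zeta> x ^ 4 * (\<delta> x t)\<^sup>2) has_vector_derivative \<zeta> x ^ 4 * (2 * (\<delta> x s * \<delta>t x s))) (at s within {t0..T})"
        if s: "s \<in> {t0..T}" and x: "x \<in> B2" for s x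
      proof -
        have "(u z has_real_derivative ut z s) (at s within {t0..T})" if "z \<in> U" for z
          using ut[of z s] that s t
          by (auto simp: has_real_derivative_iff_has_vector_derivative intro: has_vector_derivative_within_subset)
        from DERIV_cdivide[OF DERIV_diff[OF this[OF in_U(2)[OF x]] this[OF in_U(1)[OF x]]], of h]
        have "((\<lambda>t. \<delta> x t) has_real_derivative \<delta>t x s) (at s within {t0..T})"
          unfolding \<delta>_def \<delta>t_def .
        from DERIV_cmult[OF DERIV_power[OF this, of 2], of "\<zeta> x ^ 4"] show ?thesis
          by (simp add: has_real_derivative_iff_has_vector_derivative mult_ac)
      qed
      show "(\<lambda>x. \<zeta> x ^ 4 * (\<delta> x s)\<^sup>2) integrable_on B2" if "s \<in> {t0..T}" for s
        using that t by (intro int2) (auto intro!: continuous_intros)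
      show "continuous_on ({t0..T} \<times> B2) (\<lambda>(s, x). \<zeta> x ^ 4 * (2 * (\<delta> x s * \<delta>t x s)))"
        unfolding case_prod_unfold using t by (auto intro!: continuous_intros)
    qed (use t in auto)
    moreover have "integral B2 (\<lambda>x. \<zeta> x ^ 4 * (2 * (\<delta> x t * \<delta>t x t))) = 2 * Aq' t"
      unfolding Aq'_def by (subst integral_mult_right[symmetric]) (simp add: mult_ac)
    ultimately have A': "(Aq has_real_derivative 2 * Aq' t) (at t within {t0..T})"
      by (simp add: has_real_derivative_iff_has_vector_derivative)
    have s': "(\<sigma> has_real_derivative \<sigma>' t) (at t within {t0..T})"
      using \<sigma>'[of t] t by (auto intro: has_field_derivative_subset)
    from DERIV_cmult[OF DERIV_mult[OF DERIV_power[OF s', of 2] A'], of "2 * \<phi>"]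
    show "(y has_vector_derivative y' t) (at t within {t0..T})"
      unfolding has_real_derivative_iff_has_vector_derivative[symmetric] y_def y'_def
      by (rule DERIV_cong) (simp add: power2_eq_square algebra_simps)
  qed
  also have "(\<integral>\<^sup>+t\<in>{0<..T}. ennreal (a * energy t + k) \<partial>lborel)
      = ennreal a * (\<integral>\<^sup>+t\<in>{0<..T}. ennreal (energy t) \<partial>lborel) + ennreal (k * T)"
    using cE E0 ak T by (intro nn_integral_Ioc_affine) auto
  also have "\<dots> \<le> ennreal a * (ennreal (76 * \<kappa>^4 * \<xi>^4 * m1^4) * N_star U T \<phi> (\<lambda>x. u x 0) \<Psi>)
      + ennreal k * N_star U T \<phi> (\<lambda>x. u x 0) \<Psi>"
  proof (intro add_mono mult_left_mono)
    show "(\<integral>\<^sup>+t\<in>{0<..T}. ennreal (energy t) \<partial>lborel) \<le> ennreal (76 * \<kappa>^4 * \<xi>^4 * m1^4) * N_star U T \<phi> (\<lambda>x. u x 0) \<Psi>"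
      unfolding m1_def by (rule energy_bound)
    have "ennreal T \<le> N_star U T \<phi> (\<lambda>x. u x 0) \<Psi>"
      unfolding N_star_def by (metis add.commute add.left_commute le_iff_add)
    then show "ennreal (k * T) \<le> ennreal k * N_star U T \<phi> (\<lambda>x. u x 0) \<Psi>"
      using ak T by (simp add: ennreal_mult mult_left_mono)
  qed auto
  also have "\<dots> = ennreal (a * (76 * \<kappa>^4 * \<xi>^4 * m1^4) + k) * N_star U T \<phi> (\<lambda>x. u x 0) \<Psi>"
    using ak k1 by (simp add: ennreal_plus ennreal_mult distrib_right mult.assoc)
  also have "\<dots> \<le> ennreal (1600000 * \<kappa>^13 * \<xi>^14 * m1^10 * (1 + L)\<^sup>2) * N_star U T \<phi> (\<lambda>x. u x 0) \<Psi>"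
  proof (intro mult_right_mono ennreal_leI)
    define S where "S = \<kappa>^3 * \<xi>^4 * m1\<^sup>2"
    define S2 where "S2 = \<kappa>^6 * \<xi>^8 * m1^4"
    have S1: "1 \<le> S" unfolding S_def using k1 mult_mono[of 1 "\<kappa>^3 * \<xi>^4" 1 "m1\<^sup>2"] mult_mono[of 1 "\<kappa>^3" 1 "\<xi>^4"]
      by (simp add: one_le_power)
    have SS: "S\<^sup>2 = S2" by (simp add: S_def S2_def power_mult_distrib flip: power_mult)
    have "\<Lambda> = 24 * S + L" by (simp add: \<Lambda>_def S_def)
    moreover have "1 * L \<le> S * L" using S1 L by (intro mult_right_mono) auto
    ultimately have "\<Lambda> \<le> 24 * (S * (1 + L))" using L by (simp add: algebra_simps)
    then have "\<Lambda>\<^sup>2 \<le> (24 * (S * (1 + L)))\<^sup>2" using \<Lambda>0 by (intro power_mono)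
    also have "\<dots> = 576 * (S2 * (1 + L)\<^sup>2)" by (simp add: power_mult_distrib SS)
    finally have \<Lambda>2: "\<Lambda>\<^sup>2 \<le> 576 * (S2 * (1 + L)\<^sup>2)" .
    have \<Lambda>1: "1 \<le> \<Lambda>" using \<open>\<Lambda> = 24 * S + L\<close> S1 L by linarith
    \<comment> \<open>A common majorant of the factors in front of \<Lambda>^2: 2432, 32 and 80
      copies of W \<Lambda>^2 make 2544. Multiplying \<open>W\<close> by \<open>S2\<close> yields
      the exponents 13, 14 and 10.\<close>
    define W where "W = \<kappa>^7 * \<xi>^6 * m1^6"
    have W: "\<kappa>^3 * \<xi>\<^sup>2 * m1\<^sup>2 \<le> W" "\<kappa>^3 * (m1^4 * \<xi>^4) \<le> W" "0 \<le> W"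
    proof -
      show "\<kappa>^3 * \<xi>\<^sup>2 * m1\<^sup>2 \<le> W" unfolding W_def using k1 by (intro mult_mono power_increasing) auto
      have "\<kappa>^3 * (m1^4 * \<xi>^4) = \<kappa>^3 * \<xi>^4 * m1^4" by simp
      also have "\<dots> \<le> W" unfolding W_def using k1 by (intro mult_mono power_increasing) auto
      finally show "\<kappa>^3 * (m1^4 * \<xi>^4) \<le> W" .
      show "0 \<le> W" using k1 by (simp add: W_def)
    qed
    have "a * (76 * \<kappa>^4 * \<xi>^4 * m1^4) = 2432 * (W * \<Lambda>\<^sup>2)"
      by (simp add: a_def W_def power_numeral_reduce)
    moreover have "a \<le> 32 * (W * \<Lambda>\<^sup>2)"
      using mult_right_mono[OF W(1), of "\<Lambda>\<^sup>2"] by (simp add: a_def mult_ac)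
    moreover have "80 * \<kappa>^3 * \<Lambda> * m1^4 * \<xi>^4 \<le> 80 * (W * \<Lambda>\<^sup>2)"
    proof -
      have "\<Lambda> \<le> \<Lambda>\<^sup>2" using \<Lambda>1 mult_left_mono[of 1 \<Lambda> \<Lambda>] by (simp add: power2_eq_square)
      then have "(\<kappa>^3 * (m1^4 * \<xi>^4)) * \<Lambda> \<le> W * \<Lambda>\<^sup>2" using W \<Lambda>0 by (intro mult_mono) auto
      then show ?thesis by (simp add: mult_ac)
    qed
    ultimately have "a * (76 * \<kappa>^4 * \<xi>^4 * m1^4) + k \<le> 2544 * (W * \<Lambda>\<^sup>2)" unfolding k_def by linarith
    also have "\<dots> \<le> 2544 * (W * (576 * (S2 * (1 + L)\<^sup>2)))"
      using \<Lambda>2 W by (intro mult_left_mono) auto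
    also have "\<dots> = 1465344 * (\<kappa>^13 * \<xi>^14 * m1^10 * (1 + L)\<^sup>2)"
      by (simp add: W_def S2_def power_add[symmetric] mult_ac) (simp add: power_numeral_reduce mult_ac)?
    also have "\<dots> \<le> 1600000 * (\<kappa>^13 * \<xi>^14 * m1^10 * (1 + L)\<^sup>2)"
      using k1 by (intro mult_right_mono) auto
    finally show "a * (76 * \<kappa>^4 * \<xi>^4 * m1^4) + k \<le> 1600000 * \<kappa>^13 * \<xi>^14 * m1^10 * (1 + L)\<^sup>2"
      by (simp add: mult_ac)
  qed simp
  finally show ?thesis unfolding y_def Aq_def by (simp add: mult_ac add_left_mono)
qed

end

section \<open>Hessian bound and interior gradient estimates on a ball\<close>

lemma borel_measurable_ennreal_indicator_continuous:
  fixes f :: "'a::euclidean_space \<Rightarrow> real"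
  assumes "S \<in> sets borel" "continuous_on S f"
  shows "(\<lambda>t. ennreal (f t) * indicator S t) \<in> borel_measurable lborel"
proof -
  have "(\<lambda>t. indicator S t *\<^sub>R f t) \<in> borel_measurable borel"
    by (rule borel_measurable_continuous_on_indicator[OF assms])
  then have "(\<lambda>t. ennreal (indicator S t *\<^sub>R f t)) \<in> borel_measurable borel" by measurable
  moreover have "(\<lambda>t. ennreal (indicator S t *\<^sub>R f t)) = (\<lambda>t. ennreal (f t) * indicator S t)"
    by (auto simp: indicator_def)
  ultimately show ?thesis by simp
qed

lemma liminf_le_bound:
  fixes X :: "nat \<Rightarrow> ennreal"
  assumes "\<And>n. X n \<le> B"
  shows "liminf X \<le> B"
proof -
  have "liminf X \<le> liminf (\<lambda>n. B)" by (rule Liminf_mono) (use assms in auto)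
  then show ?thesis by (simp add: Liminf_const)
qed

context local_flow
begin

text \<open>The denominator tends to 2 G as h tends to 0; the factor 2 makes the limit equal to the
  integral \<open>Q\<close>.\<close>

definition Qh :: "real^3 \<Rightarrow> real \<Rightarrow> real \<Rightarrow> real" where
  "Qh b h t = integral B2 (\<lambda>x. 2 * (\<zeta> x ^ 4 * ((norm ((\<Phi> (x + h *\<^sub>R b) t - \<Phi> x t) /\<^sub>R h))\<^sup>2
      / (G (\<Phi> (x + h *\<^sub>R b) t) + G (\<Phi> x t)))))"

definition Q :: "real^3 \<Rightarrow> real \<Rightarrow> real" where
  "Q b t = integral B2 (\<lambda>x. \<zeta> x ^ 4 * ((norm (d\<Phi> x t b))\<^sup>2 / G (\<Phi> x t)))"

text \<open>Initial value of the functional for the difference quotient. The gradient of the initial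
  data enters the estimates through this quantity.\<close>

definition A0 :: "real^3 \<Rightarrow> real \<Rightarrow> real" where
  "A0 b h = integral B2 (\<lambda>x. \<zeta> x ^ 4 * ((u (x + h *\<^sub>R b) 0 - u x 0) / h)\<^sup>2)"

lemma int2: "continuous_on B2 f \<Longrightarrow> f integrable_on B2" for f :: "real^3 \<Rightarrow> real"
  unfolding B_cbox by (rule integrable_continuous)

lemma int6: "continuous_on B6 f \<Longrightarrow> f integrable_on B6" for f :: "real^3 \<Rightarrow> real"
  unfolding B_cbox by (rule integrable_continuous)

end

section \<open>Weighted difference quotients\<close>

context flow_step
begin

lemma Qh_eq: "Qh b h t = integral B2 (\<lambda>x. 2 * (\<zeta> x ^ 4 * ((norm (\<Phi>d x t))\<^sup>2 / m x t)))"
  unfolding Qh_def \<Phi>d_def m_def ..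

lemma cont_Qh_integrand:
  assumes "0 < t" "t \<le> T"
  shows "continuous_on B2 (\<lambda>x. 2 * (\<zeta> x ^ 4 * ((norm (\<Phi>d x t))\<^sup>2 / m x t)))"
  using assms m_pos by (intro continuous_on_mult continuous_on_divide continuous_on_power continuous_on_norm
      cont_Phid cont_m cutoff_cont continuous_on_id continuous_on_const) (auto simp: less_imp_neq[THEN not_sym])

lemma Qh_le_P:
  assumes t: "0 < t" "t \<le> T"
  shows "Qh b h t \<le> 2 * \<kappa> * \<xi>\<^sup>2 * P t" and "0 \<le> P t"
proof -
  have i: "(\<lambda>x. \<zeta> x ^ 4 * E x t) integrable_on B2"
    using t by (intro int2) (auto intro!: continuous_intros)
  show "0 \<le> P t" unfolding P_def using E_nonneg by (intro integral_nonneg i) auto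
  have "Qh b h t \<le> integral B2 (\<lambda>x. (2 * \<kappa> * \<xi>\<^sup>2) * (\<zeta> x ^ 4 * E x t))"
    unfolding Qh_eq
  proof (rule integral_le[OF int2[OF cont_Qh_integrand[OF t]]])
    show "(\<lambda>x. (2 * \<kappa> * \<xi>\<^sup>2) * (\<zeta> x ^ 4 * E x t)) integrable_on B2" by (intro integrable_on_mult_right i)
    fix x
    have "(norm (\<Phi>d x t))\<^sup>2 / m x t \<le> \<kappa> * \<xi>\<^sup>2 * E x t"
      using norm_Phid_sq[of x t] m_pos[of x t] by (simp add: divide_le_eq mult_ac)
    then have "2 * (\<zeta> x ^ 4 * ((norm (\<Phi>d x t))\<^sup>2 / m x t)) \<le> 2 * (\<zeta> x ^ 4 * (\<kappa> * \<xi>\<^sup>2 * E x t))"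
      by (intro mult_left_mono) auto
    then show "2 * (\<zeta> x ^ 4 * ((norm (\<Phi>d x t))\<^sup>2 / m x t)) \<le> (2 * \<kappa> * \<xi>\<^sup>2) * (\<zeta> x ^ 4 * E x t)"
      by (simp add: mult_ac)
  qed
  also have "\<dots> = 2 * \<kappa> * \<xi>\<^sup>2 * P t" unfolding P_def by (rule integral_mult_right)
  finally show "Qh b h t \<le> 2 * \<kappa> * \<xi>\<^sup>2 * P t" .
qed

theorem Qh_bound:
  assumes \<sigma>: "\<And>t. 0 \<le> t \<Longrightarrow> t \<le> T \<Longrightarrow> 0 \<le> \<sigma> t \<and> \<sigma> t \<le> 1" and L: "0 \<le> L"
    and \<sigma>': "\<And>t. 0 \<le> t \<Longrightarrow> t \<le> T \<Longrightarrow> (\<sigma> has_real_derivative \<sigma>' t) (at t within {0..T}) \<and> 0 \<le> \<sigma>' t \<and> \<sigma>' t \<le> L"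
  shows "(\<integral>\<^sup>+t\<in>{0<..T}. ennreal ((\<sigma> t)\<^sup>2 * Qh b h t) \<partial>lborel)
    \<le> ennreal (2 * \<kappa> * \<xi>\<^sup>2) * (ennreal (2 * \<phi> * (\<sigma> 0)\<^sup>2 * A0 b h)
      + ennreal (1600000 * \<kappa>^13 * \<xi>^14 * (M + 1)^10 * (1 + L)\<^sup>2) * N_star U T \<phi> (\<lambda>x. u x 0) \<Psi>)"
    and "continuous_on {0<..T} (\<lambda>t. (\<sigma> t)\<^sup>2 * Qh b h t)"
proof -
  have "continuous_on {0..T} \<sigma>" by (rule DERIV_continuous_on[where D = \<sigma>']) (use \<sigma>' in auto)
  then have c\<sigma>: "continuous_on {0<..T} \<sigma>" by (rule continuous_on_subset) auto
  have cP: "continuous_on {0<..T} P" unfolding P_def B_cbox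
    by (rule integral_continuous_on_param) (auto simp: case_prod_unfold B_cbox[symmetric] intro!: continuous_intros)
  have "continuous_on {0<..T} (\<lambda>t. Qh b h t)" unfolding Qh_eq B_cbox
  proof (rule integral_continuous_on_param, unfold B_cbox[symmetric] case_prod_unfold)
    show "continuous_on ({0<..T} \<times> B2) (\<lambda>p. 2 * (\<zeta> (snd p) ^ 4 * ((norm (\<Phi>d (snd p) (fst p)))\<^sup>2 / m (snd p) (fst p))))"
      using m_pos by (intro continuous_on_mult continuous_on_divide continuous_on_power continuous_on_norm
      cont_Phid cont_m cutoff_cont continuous_on_snd continuous_on_fst continuous_on_id continuous_on_const)
      (auto simp: less_imp_neq[THEN not_sym])
  qed
  then show "continuous_on {0<..T} (\<lambda>t. (\<sigma> t)\<^sup>2 * Qh b h t)" by (intro continuous_intros c\<sigma>)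
  have "(\<integral>\<^sup>+t\<in>{0<..T}. ennreal ((\<sigma> t)\<^sup>2 * Qh b h t) \<partial>lborel)
      \<le> (\<integral>\<^sup>+t\<in>{0<..T}. ennreal (2 * \<kappa> * \<xi>\<^sup>2 * ((\<sigma> t)\<^sup>2 * P t) + 0) \<partial>lborel)"
  proof (intro nn_integral_mono)
    fix t
    show "ennreal ((\<sigma> t)\<^sup>2 * Qh b h t) * indicator {0<..T} t
        \<le> ennreal (2 * \<kappa> * \<xi>\<^sup>2 * ((\<sigma> t)\<^sup>2 * P t) + 0) * indicator {0<..T} t"
    proof (cases "t \<in> {0<..T}")
      case True
      then have "(\<sigma> t)\<^sup>2 * Qh b h t \<le> (\<sigma> t)\<^sup>2 * (2 * \<kappa> * \<xi>\<^sup>2 * P t)"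
        using Qh_le_P(1)[of t] by (intro mult_left_mono) auto
      then show ?thesis by (intro mult_right_mono ennreal_leI) (auto simp: mult_ac)
    qed simp
  qed
  also have "\<dots> = ennreal (2 * \<kappa> * \<xi>\<^sup>2) * (\<integral>\<^sup>+t\<in>{0<..T}. ennreal ((\<sigma> t)\<^sup>2 * P t) \<partial>lborel) + ennreal (0 * T)"
    using Qh_le_P(2) T kappa_pos by (intro nn_integral_Ioc_affine continuous_intros c\<sigma> cP) auto
  also have "\<dots> = ennreal (2 * \<kappa> * \<xi>\<^sup>2) * (\<integral>\<^sup>+t\<in>{0<..T}. ennreal ((\<sigma> t)\<^sup>2 * P t) \<partial>lborel)" by simp
  also have "\<dots> \<le> ennreal (2 * \<kappa> * \<xi>\<^sup>2) * (ennreal (2 * \<phi> * (\<sigma> 0)\<^sup>2 * A0 b h)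
      + ennreal (1600000 * \<kappa>^13 * \<xi>^14 * (M + 1)^10 * (1 + L)\<^sup>2) * N_star U T \<phi> (\<lambda>x. u x 0) \<Psi>)"
    using step_bound[OF \<sigma> L \<sigma>'] unfolding A0_def \<delta>_def m1_def by (intro mult_left_mono) auto
  finally show "(\<integral>\<^sup>+t\<in>{0<..T}. ennreal ((\<sigma> t)\<^sup>2 * Qh b h t) \<partial>lborel)
    \<le> ennreal (2 * \<kappa> * \<xi>\<^sup>2) * (ennreal (2 * \<phi> * (\<sigma> 0)\<^sup>2 * A0 b h)
      + ennreal (1600000 * \<kappa>^13 * \<xi>^14 * (M + 1)^10 * (1 + L)\<^sup>2) * N_star U T \<phi> (\<lambda>x. u x 0) \<Psi>)" .
qed

end

section \<open>The Hessian bound as a limit of difference quotients\<close>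

context local_flow
begin

text \<open>The difference quotients of \<open>\<Phi>\<close> converge pointwise because
  \<open>\<Phi>\<close> is differentiable in x, and the denominators converge because
  \<open>G\<close> is continuous; Fatou's lemma does the rest. The factor \<open>s\<close> is a
  place holder for the weight in time.\<close>

lemma Q_le_liminf:
  assumes t: "0 < t" "t \<le> T" and b: "b \<in> Basis" and s: "0 \<le> s"
  shows "ennreal (s * Q b t) \<le> liminf (\<lambda>n. ennreal (s * Qh b (r / real (Suc n)) t))"
proof -
  define h where "h n = r / real (Suc n)" for n
  have h: "0 < h n" "h n \<le> r" for n using r by (auto simp: h_def divide_le_eq)
  have h0: "h \<longlonglongrightarrow> 0"
    unfolding h_def using tendsto_mult[OF tendsto_const LIMSEQ_inverse_real_of_nat, of r] by (simp add: divide_inverse)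
  define q where "q n x = s * (2 * (\<zeta> x ^ 4 * ((norm ((\<Phi> (x + h n *\<^sub>R b) t - \<Phi> x t) /\<^sub>R h n))\<^sup>2
      / (G (\<Phi> (x + h n *\<^sub>R b) t) + G (\<Phi> x t)))))" for n x
  define q0 where "q0 x = s * (\<zeta> x ^ 4 * ((norm (d\<Phi> x t b))\<^sup>2 / G (\<Phi> x t)))" for x
  have cq: "continuous_on B2 (q n)" for n
  proof -
    interpret flow_step \<kappa> \<xi> \<theta> X G c r \<phi> M T U u ut \<Psi> \<Psi>t Du D\<Psi> D2u z0 A b "h n"
      by unfold_locales (use b h in auto)
    show ?thesis using cont_Qh_integrand[OF t] unfolding q_def \<Phi>d_def m_def by (rule continuous_on_mult_left)
  qed
  have q_nonneg: "0 \<le> q n x" for n x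
    unfolding q_def using s G_pos by (intro mult_nonneg_nonneg divide_nonneg_pos add_pos_pos) auto
  have q0_nonneg: "0 \<le> q0 x" for x
    unfolding q0_def using s G_pos by (intro mult_nonneg_nonneg divide_nonneg_pos) auto
  have cq0: "continuous_on B2 q0"
    unfolding q0_def using t B2_U G_pos
    by (intro continuous_on_mult continuous_on_divide continuous_on_power continuous_on_norm continuous_on_const
        cont_dPhi cont_Phi G_cont cutoff_cont continuous_on_id) (auto simp: less_imp_neq[THEN not_sym])
  have lim: "(\<lambda>n. q n x) \<longlonglongrightarrow> q0 x" if x: "x \<in> B2" for x
  proof -
    have xU: "x \<in> U" using x B2_U by blast
    have d: "((\<lambda>y. \<Phi> y t) has_derivative d\<Phi> x t) (at x)" by (rule Phi_derivative[OF xU t])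
    have "filterlim h (at 0) sequentially" using h h0 by (auto simp: filterlim_at less_imp_neq[THEN not_sym])
    from filterlim_compose[OF has_derivative_quotient[OF d, of b] this]
    have 1: "(\<lambda>n. (\<Phi> (x + h n *\<^sub>R b) t - \<Phi> x t) /\<^sub>R h n) \<longlonglongrightarrow> d\<Phi> x t b" .
    have "(\<lambda>n. x + h n *\<^sub>R b) \<longlonglongrightarrow> x + 0 *\<^sub>R b" by (intro tendsto_intros h0)
    then have "(\<lambda>n. \<Phi> (x + h n *\<^sub>R b) t) \<longlonglongrightarrow> \<Phi> x t"
      using isCont_tendsto_compose[OF has_derivative_continuous[OF d]] by simp
    then have "(\<lambda>n. G (\<Phi> (x + h n *\<^sub>R b) t)) \<longlonglongrightarrow> G (\<Phi> x t)"
      using isCont_tendsto_compose[of "\<Phi> x t" G] G_continuous by (simp add: continuous_on_eq_continuous_at)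
    then have "(\<lambda>n. q n x) \<longlonglongrightarrow> s * (2 * (\<zeta> x ^ 4 * ((norm (d\<Phi> x t b))\<^sup>2 / (G (\<Phi> x t) + G (\<Phi> x t)))))"
      unfolding q_def using G_pos[of "\<Phi> x t"] by (intro tendsto_intros 1) auto
    moreover have "s * (2 * (\<zeta> x ^ 4 * ((norm (d\<Phi> x t b))\<^sup>2 / (G (\<Phi> x t) + G (\<Phi> x t))))) = q0 x"
      unfolding q0_def using G_pos[of "\<Phi> x t"] by (simp add: field_simps)
    ultimately show ?thesis by simp
  qed
  have "ennreal (s * Q b t) = ennreal (integral B2 q0)"
    unfolding Q_def q0_def by (simp only: integral_mult_right)
  also have "\<dots> = (\<integral>\<^sup>+x\<in>B2. ennreal (q0 x) \<partial>lborel)"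
    using cq0 q0_nonneg unfolding B_cbox by (intro nn_integral_cbox[symmetric]) auto
  also have "\<dots> \<le> (\<integral>\<^sup>+x. liminf (\<lambda>n. ennreal (q n x) * indicator B2 x) \<partial>lborel)"
  proof (intro nn_integral_mono)
    fix x
    have "(\<lambda>n. ennreal (q n x) * indicator B2 x) \<longlonglongrightarrow> ennreal (q0 x) * indicator B2 x"
      using lim[of x] by (cases "x \<in> B2") (auto intro!: tendsto_ennrealI)
    then show "ennreal (q0 x) * indicator B2 x \<le> liminf (\<lambda>n. ennreal (q n x) * indicator B2 x)"
      by (simp add: lim_imp_Liminf)
  qed
  also have "\<dots> \<le> liminf (\<lambda>n. \<integral>\<^sup>+x. ennreal (q n x) * indicator B2 x \<partial>lborel)"
    using cq by (intro nn_integral_liminf borel_measurable_ennreal_indicator_continuous) (auto simp: B_cbox)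
  also have "(\<lambda>n. \<integral>\<^sup>+x. ennreal (q n x) * indicator B2 x \<partial>lborel) = (\<lambda>n. ennreal (s * Qh b (r / real (Suc n)) t))"
  proof
    fix n
    have "(\<integral>\<^sup>+x. ennreal (q n x) * indicator B2 x \<partial>lborel) = ennreal (integral B2 (q n))"
      using cq q_nonneg unfolding B_cbox by (intro nn_integral_cbox) auto
    also have "integral B2 (q n) = s * Qh b (r / real (Suc n)) t"
      unfolding Qh_def q_def h_def by (rule integral_mult_right)
    finally show "(\<integral>\<^sup>+x. ennreal (q n x) * indicator B2 x \<partial>lborel) = ennreal (s * Qh b (r / real (Suc n)) t)" .
  qed
  finally show ?thesis .
qed

text \<open>Fatou's lemma once more, now in time, along steps r / (n + 1). \<open>I0\<close> is a
  bound of the initial term uniform in the step: a multiple of the gradient norm of the initial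
  data, or 0 if the weight vanishes at time 0.\<close>

theorem Q_bound:
  assumes b: "b \<in> Basis" and \<sigma>: "\<And>t. 0 \<le> t \<Longrightarrow> t \<le> T \<Longrightarrow> 0 \<le> \<sigma> t \<and> \<sigma> t \<le> 1" and L: "0 \<le> L"
    and \<sigma>': "\<And>t. 0 \<le> t \<Longrightarrow> t \<le> T \<Longrightarrow> (\<sigma> has_real_derivative \<sigma>' t) (at t within {0..T}) \<and> 0 \<le> \<sigma>' t \<and> \<sigma>' t \<le> L"
    and I0: "\<And>h. 0 < h \<Longrightarrow> h \<le> r \<Longrightarrow> ennreal (2 * \<phi> * (\<sigma> 0)\<^sup>2 * A0 b h) \<le> I0"
  shows "(\<integral>\<^sup>+t\<in>{0<..T}. ennreal ((\<sigma> t)\<^sup>2 * Q b t) \<partial>lborel)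
    \<le> ennreal (2 * \<kappa> * \<xi>\<^sup>2) * (I0
      + ennreal (1600000 * \<kappa>^13 * \<xi>^14 * (M + 1)^10 * (1 + L)\<^sup>2) * N_star U T \<phi> (\<lambda>x. u x 0) \<Psi>)"
    (is "_ \<le> ?B")
proof -
  define h where "h n = r / real (Suc n)" for n
  have h: "0 < h n" "h n \<le> r" for n using r by (auto simp: h_def divide_le_eq)
  have bd: "(\<integral>\<^sup>+t\<in>{0<..T}. ennreal ((\<sigma> t)\<^sup>2 * Qh b (h n) t) \<partial>lborel) \<le> ?B"
    and ct: "continuous_on {0<..T} (\<lambda>t. (\<sigma> t)\<^sup>2 * Qh b (h n) t)" for n
  proof -
    interpret flow_step \<kappa> \<xi> \<theta> X G c r \<phi> M T U u ut \<Psi> \<Psi>t Du D\<Psi> D2u z0 A b "h n"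
      by unfold_locales (use b h in auto)
    show "continuous_on {0<..T} (\<lambda>t. (\<sigma> t)\<^sup>2 * Qh b (h n) t)" by (rule Qh_bound(2)[OF \<sigma> L \<sigma>'])
    show "(\<integral>\<^sup>+t\<in>{0<..T}. ennreal ((\<sigma> t)\<^sup>2 * Qh b (h n) t) \<partial>lborel) \<le> ?B"
      by (rule order.trans[OF Qh_bound(1)[OF \<sigma> L \<sigma>']]) (auto intro!: mult_left_mono add_right_mono I0 h)
  qed
  have "(\<integral>\<^sup>+t\<in>{0<..T}. ennreal ((\<sigma> t)\<^sup>2 * Q b t) \<partial>lborel)
      \<le> (\<integral>\<^sup>+t. liminf (\<lambda>n. ennreal ((\<sigma> t)\<^sup>2 * Qh b (h n) t) * indicator {0<..T} t) \<partial>lborel)"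
  proof (intro nn_integral_mono)
    fix t
    show "ennreal ((\<sigma> t)\<^sup>2 * Q b t) * indicator {0<..T} t
        \<le> liminf (\<lambda>n. ennreal ((\<sigma> t)\<^sup>2 * Qh b (h n) t) * indicator {0<..T} t)"
      using Q_le_liminf[OF _ _ b, of t "(\<sigma> t)\<^sup>2"] by (cases "t \<in> {0<..T}") (auto simp: h_def)
  qed
  also have "\<dots> \<le> liminf (\<lambda>n. \<integral>\<^sup>+t. ennreal ((\<sigma> t)\<^sup>2 * Qh b (h n) t) * indicator {0<..T} t \<partial>lborel)"
    using ct by (intro nn_integral_liminf borel_measurable_ennreal_indicator_continuous) auto
  also have "\<dots> \<le> ?B" using bd by (rule liminf_le_bound)
  finally show ?thesis .
qed

text \<open>\<open>K\<close> is a differentiable substitute for \<open>1 / G\<close>.\<close>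

definition K :: "real^3 \<Rightarrow> real" where "K y = (1 + y \<bullet> y) powr (- \<theta> / 2)"

lemma K_bounds: "0 < K y" "K y \<le> 1" "K y \<le> \<kappa> / G y"
proof -
  have 1: "0 < 1 + y \<bullet> y" by (simp add: add_pos_nonneg)
  then show "0 < K y" by (simp add: K_def)
  have "(1 + y \<bullet> y) powr (- \<theta> / 2) \<le> (1 + y \<bullet> y) powr 0" using theta_pos by (intro powr_mono) auto
  then show "K y \<le> 1" using 1 by (simp add: K_def)
  have "G y * K y \<le> \<kappa> * (1 + (norm y)\<^sup>2) powr (\<theta> / 2) * K y"
    using G_upper[of y] \<open>0 < K y\<close> by (intro mult_right_mono) auto
  also have "\<dots> = \<kappa>" using 1 unfolding K_def power2_norm_eq_inner by (simp add: powr_add[symmetric])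
  finally show "K y \<le> \<kappa> / G y" using G_pos[of y] by (simp add: pos_le_divide_eq mult.commute)
qed

text \<open>The field is cubic up to the weight, so that its product with y is K |y|^4, of order
  |y|^(4 - \<theta>) for large y. Its derivative is of order K |y|^2, which Young's inequality
  splits between K |y|^4 and K |d\<Phi>|^2.\<close>

definition H :: "real^3 \<Rightarrow> real^3" where "H y = (K y * (y \<bullet> y)) *\<^sub>R y"
definition dH :: "real^3 \<Rightarrow> real^3 \<Rightarrow> real^3" where
  "dH y v = (K y * (y \<bullet> y)) *\<^sub>R v
    + ((K y - \<theta> / 2 * (y \<bullet> y) * (1 + y \<bullet> y) powr (- \<theta> / 2 - 1)) * (2 * (y \<bullet> v))) *\<^sub>R y"

lemma H_derivative: "(H has_derivative dH y) (at y)"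
proof -
  have 1: "0 < 1 + y \<bullet> y" by (simp add: add_pos_nonneg)
  have "((\<lambda>y. y \<bullet> y) has_derivative (\<lambda>v. 2 * (y \<bullet> v))) (at y)"
    by (rule has_derivative_eq_rhs, rule has_derivative_inner) (auto intro!: derivative_eq_intros simp: inner_commute)
  moreover have "((\<lambda>s. (1 + s) powr (- \<theta> / 2) * s) has_real_derivative
      K y - \<theta> / 2 * (y \<bullet> y) * (1 + y \<bullet> y) powr (- \<theta> / 2 - 1)) (at (y \<bullet> y))"
    using 1 by (auto intro!: derivative_eq_intros simp: K_def)
  ultimately have "((\<lambda>y. K y * (y \<bullet> y)) has_derivative
      (\<lambda>v. (K y - \<theta> / 2 * (y \<bullet> y) * (1 + y \<bullet> y) powr (- \<theta> / 2 - 1)) * (2 * (y \<bullet> v)))) (at y)"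
    unfolding K_def has_field_derivative_def by (rule has_derivative_compose)
  from has_derivative_scaleR[OF this has_derivative_ident]
  show ?thesis unfolding H_def[abs_def] dH_def[abs_def] by simp
qed

text \<open>Differentiating the weight only lowers the radial coefficient: that coefficient is K (1
  - (\<theta> / 2) q) with q between 0 and 1, hence at most \<open>K\<close> in absolute value. The
  3 is 1 for the scalar factor in front of v plus 2 from the derivative of the square of
  |y|.\<close>

lemma norm_dH: "norm (dH y v) \<le> 3 * (K y * (norm y)\<^sup>2) * norm v"
proof -
  define s where "s = y \<bullet> y"
  have s: "0 \<le> s" "s = (norm y)\<^sup>2" by (simp_all add: s_def power2_norm_eq_inner)
  define k where "k = K y - \<theta> / 2 * s * (1 + s) powr (- \<theta> / 2 - 1)"
  have "(1 + s) powr (- \<theta> / 2 - 1) = K y / (1 + s)" using s by (simp add: K_def s_def powr_diff)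
  then have "k = K y * (1 - \<theta> / 2 * (s / (1 + s)))" unfolding k_def by (simp add: algebra_simps)
  moreover have "\<bar>1 - \<theta> / 2 * (s / (1 + s))\<bar> \<le> 1"
  proof -
    define q where "q = s / (1 + s)"
    have "0 \<le> q" "q \<le> 1" using s(1) by (auto simp: q_def divide_le_eq)
    then have "0 \<le> \<theta> / 2 * q" "\<theta> / 2 * q \<le> 1 * 1"
      using theta_pos theta_less_1 by (intro mult_nonneg_nonneg mult_mono; simp)+
    then show ?thesis unfolding q_def by linarith
  qed
  ultimately have k: "\<bar>k\<bar> \<le> K y" using K_bounds(1)[of y] by (simp add: abs_mult mult_le_cancel_left1)
  have "norm (dH y v) \<le> K y * s * norm v + \<bar>k\<bar> * (2 * \<bar>y \<bullet> v\<bar>) * norm y"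
    unfolding dH_def s_def[symmetric] k_def[symmetric] using K_bounds(1)[of y] s
    by (intro order.trans[OF norm_triangle_ineq]) (simp add: abs_mult)
  also have "\<dots> \<le> K y * s * norm v + K y * (2 * (norm y * norm v)) * norm y"
    using k Cauchy_Schwarz_ineq2[of y v] K_bounds(1)[of y]
    by (intro add_left_mono mult_right_mono mult_mono) auto
  also have "\<dots> = 3 * (K y * (norm y)\<^sup>2) * norm v" unfolding s(2) by (simp add: power2_eq_square)
  finally show ?thesis .
qed

text \<open>The scheme of \<open>energy_pointwise\<close> with quartic Young inequalities. The
  divergence \<open>dv\<close> costs a quarter of the quartic term, the terms with \<open>Zv\<close>
  and \<open>e\<close> an eighth each, so half of it is left. The constant remainders use K \<le> 1,
  and 131584 is 512 + 512 * 256.\<close>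

lemma J_pointwise:
  fixes y Zv e :: "real^3" and s v dv S :: real
  assumes s: "0 \<le> s" "s \<le> 1" and v: "\<bar>v\<bar> \<le> M" and Z: "norm Zv \<le> \<xi>\<^sup>2" and e: "norm e \<le> \<kappa>"
    and dv: "\<bar>dv\<bar> \<le> 3 * (K y * (norm y)\<^sup>2) * S" and S: "0 \<le> S"
  shows "s^4 * (K y * norm y ^ 4) - (s^4 * v * dv + H y \<bullet> (s^4 *\<^sub>R (y - v\<^sup>2 *\<^sub>R Zv) + (4 * s^3 * v) *\<^sub>R e))
    \<le> (1/2) * (s^4 * (K y * norm y ^ 4)) + 9 * (M + 1)\<^sup>2 * (s^4 * (K y * S\<^sup>2)) + 131584 * \<kappa>^4 * (M + 1)^8 * \<xi>^8"
proof -
  define n where "n = norm y"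
  define k where "k = K y"
  define m where "m = M + 1"
  define a where "a = s * n"
  have m: "1 \<le> m" "\<bar>v\<bar> \<le> m" using M v by (auto simp: m_def)
  have k: "0 \<le> k" "k \<le> 1" using K_bounds[of y] by (auto simp: k_def)
  have n: "0 \<le> n" and a: "0 \<le> a" using s by (auto simp: n_def a_def)
  have kx: "1 \<le> \<kappa>" "1 \<le> \<xi>" using kappa_ge_1 chi_ge_1 .
  have yy: "y \<bullet> y = n\<^sup>2" by (simp add: n_def power2_norm_eq_inner)
  \<comment> \<open>Young's inequality with exponents 4/3 and 4, by comparing a with 8 q; the ratio
    8 is what gives the coefficient 1/8.\<close>
  have quart: "a^3 * q \<le> a^4 / 8 + 512 * q^4" if q: "0 \<le> q" for q
  proof (cases "8 * q \<le> a")
    case True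
    then have "a^3 * (8 * q) \<le> a^3 * a" using a by (intro mult_left_mono) auto
    then have "a^3 * q \<le> a^4 / 8" by (simp add: power_numeral_reduce)
    then show ?thesis using q by (simp add: add_increasing2)
  next
    case False
    then have "a^3 \<le> (8 * q)^3" using a by (intro power_mono) auto
    then have "a^3 * q \<le> (8 * q)^3 * q" using q by (rule mult_right_mono)
    also have "\<dots> = 512 * q^4" by (simp add: power_mult_distrib power_numeral_reduce)
    finally show ?thesis using a by (simp add: add_increasing)
  qed
  have H1: "H y \<bullet> y = k * n^4" and H2: "\<bar>H y \<bullet> w\<bar> \<le> k * n^3 * norm w" for w
  proof -
    show "H y \<bullet> y = k * n^4" by (simp add: H_def yy k_def power_numeral_reduce)
    have "\<bar>H y \<bullet> w\<bar> = k * n\<^sup>2 * \<bar>y \<bullet> w\<bar>" using k by (simp add: H_def yy k_def[symmetric] abs_mult)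
    also have "\<dots> \<le> k * n\<^sup>2 * (n * norm w)"
      using k Cauchy_Schwarz_ineq2[of y w] by (intro mult_left_mono) (auto simp: n_def)
    finally show "\<bar>H y \<bullet> w\<bar> \<le> k * n^3 * norm w" by (simp add: power_numeral_reduce mult_ac)
  qed
  have eq: "s^4 * (k * n^4) - (s^4 * v * dv + H y \<bullet> (s^4 *\<^sub>R (y - v\<^sup>2 *\<^sub>R Zv) + (4 * s^3 * v) *\<^sub>R e))
      = - (s^4 * v * dv) + s^4 * v\<^sup>2 * (H y \<bullet> Zv) - 4 * s^3 * v * (H y \<bullet> e)"
    unfolding inner_add_right inner_scaleR_right inner_diff_right H1 by (simp add: algebra_simps)
  have t1: "- (s^4 * v * dv) \<le> k * a^4 / 4 + 9 * m\<^sup>2 * (s^4 * (k * S\<^sup>2))"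
  proof -
    have "- (s^4 * v * dv) \<le> \<bar>s^4 * v * dv\<bar>" by (rule abs_ge_minus_self)
    also have "\<dots> = s^4 * (\<bar>v\<bar> * \<bar>dv\<bar>)" using s by (simp add: abs_mult)
    also have "\<dots> \<le> s^4 * (m * (3 * (k * n\<^sup>2) * S))"
      using m dv by (intro mult_left_mono mult_mono) (auto simp: k_def n_def)
    also have "\<dots> = s^4 * k * (n\<^sup>2 * (3 * m * S))" by (simp add: mult_ac)
    also have "\<dots> \<le> s^4 * k * (n^4 / 4 + 9 * m\<^sup>2 * S\<^sup>2)"
    proof (rule mult_left_mono)
      have "0 \<le> (n\<^sup>2 / 2 - 3 * m * S)\<^sup>2" by simp
      then show "n\<^sup>2 * (3 * m * S) \<le> n^4 / 4 + 9 * m\<^sup>2 * S\<^sup>2"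
        by (simp add: power2_diff power_mult_distrib power_divide flip: power_mult)
    qed (use k in simp)
    also have "\<dots> = k * a^4 / 4 + 9 * m\<^sup>2 * (s^4 * (k * S\<^sup>2))"
      by (simp add: a_def power_mult_distrib algebra_simps)
    finally show ?thesis .
  qed
  have t2: "s^4 * v\<^sup>2 * (H y \<bullet> Zv) \<le> k * a^4 / 8 + 512 * (m\<^sup>2 * \<xi>\<^sup>2)^4"
  proof -
    have "H y \<bullet> Zv \<le> k * n^3 * \<xi>\<^sup>2"
      using H2[of Zv] mult_left_mono[OF Z, of "k * n^3"] k n by auto
    then have "s^4 * v\<^sup>2 * (H y \<bullet> Zv) \<le> s^4 * v\<^sup>2 * (k * n^3 * \<xi>\<^sup>2)" by (intro mult_left_mono) auto
    also have "\<dots> \<le> s^3 * m\<^sup>2 * (k * n^3 * \<xi>\<^sup>2)"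
      using s m k n power_decreasing[of 3 4 s]
      by (intro mult_right_mono mult_mono power2_le_iff_abs_le[THEN iffD2]) auto
    also have "\<dots> = k * (a^3 * (m\<^sup>2 * \<xi>\<^sup>2))" by (simp add: a_def power_mult_distrib mult_ac)
    also have "\<dots> \<le> k * (a^4 / 8 + 512 * (m\<^sup>2 * \<xi>\<^sup>2)^4)" using k by (intro mult_left_mono quart) auto
    also have "\<dots> = k * a^4 / 8 + k * (512 * (m\<^sup>2 * \<xi>\<^sup>2)^4)" by (simp add: algebra_simps)
    also have "\<dots> \<le> k * a^4 / 8 + 1 * (512 * (m\<^sup>2 * \<xi>\<^sup>2)^4)" using k by (intro add_left_mono mult_right_mono) auto
    finally show ?thesis by simp
  qed
  have t3: "- (4 * s^3 * v * (H y \<bullet> e)) \<le> k * a^4 / 8 + 512 * (4 * m * \<kappa>)^4"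
  proof -
    have He: "\<bar>H y \<bullet> e\<bar> \<le> k * n^3 * \<kappa>"
      using H2[of e] mult_left_mono[OF e, of "k * n^3"] k n by auto
    have "- (4 * s^3 * v * (H y \<bullet> e)) \<le> \<bar>4 * s^3 * v * (H y \<bullet> e)\<bar>" by (rule abs_ge_minus_self)
    also have "\<dots> = 4 * s^3 * (\<bar>v\<bar> * \<bar>H y \<bullet> e\<bar>)" using s by (simp add: abs_mult)
    also have "\<dots> \<le> 4 * s^3 * (m * (k * n^3 * \<kappa>))"
      using m He s by (intro mult_left_mono mult_mono) auto
    also have "\<dots> = k * (a^3 * (4 * m * \<kappa>))" by (simp add: a_def power_mult_distrib mult_ac)
    also have "\<dots> \<le> k * (a^4 / 8 + 512 * (4 * m * \<kappa>)^4)" using k m kx by (intro mult_left_mono quart) auto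
    also have "\<dots> = k * a^4 / 8 + k * (512 * (4 * m * \<kappa>)^4)" by (simp add: algebra_simps)
    also have "\<dots> \<le> k * a^4 / 8 + 1 * (512 * (4 * m * \<kappa>)^4)" using k by (intro add_left_mono mult_right_mono) auto
    finally show ?thesis by simp
  qed
  have "512 * (m\<^sup>2 * \<xi>\<^sup>2)^4 + 512 * (4 * m * \<kappa>)^4 \<le> 131584 * (\<kappa>^4 * m^8 * \<xi>^8)"
  proof -
    have "1 * m^8 * \<xi>^8 \<le> \<kappa>^4 * m^8 * \<xi>^8" using kx m by (intro mult_right_mono) (auto simp: one_le_power)
    moreover have "\<kappa>^4 * m^4 * 1 \<le> \<kappa>^4 * m^8 * \<xi>^8"
      using kx m by (intro mult_mono power_increasing) (auto simp: one_le_power)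
    ultimately show ?thesis by (simp add: power_mult_distrib mult_ac flip: power_mult)
  qed
  moreover have "s^4 * (k * n^4) = k * a^4" by (simp add: a_def power_mult_distrib)
  ultimately show ?thesis
    unfolding n_def[symmetric] k_def[symmetric] m_def[symmetric] eq using t1 t2 t3 by linarith
qed

definition J :: "real \<Rightarrow> real" where
  "J t = integral B2 (\<lambda>x. \<zeta> x ^ 4 * (K (\<Phi> x t) * norm (\<Phi> x t) ^ 4))"

lemma measure_B2: "measure lborel B2 \<le> \<kappa>"
proof -
  have "measure lborel B2 \<le> measure lborel B6"
    using B2_B6 by (intro measure_mono_fmeasurable) (auto simp: B_cbox)
  then show ?thesis using kappa_geometry(4) by (simp add: B6_def)
qed

lemma K_cont [continuous_intros]: "continuous_on S f \<Longrightarrow> continuous_on S (\<lambda>x. K (f x))"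
  unfolding K_def by (intro continuous_on_powr' continuous_intros ballI)
    (auto simp: add_pos_nonneg intro: less_imp_le, metis add_pos_nonneg inner_ge_zero less_irrefl zero_less_one)

text \<open>The divergence of H(\<Phi>) is tested with \<zeta>^4 u. The gradient of \<open>u\<close>
  is \<Phi> - u^2 Z, so it reproduces the quartic integrand, while the Hessian appears with the
  bounded factor \<open>u\<close> and, after Young's inequality, with the weight \<open>K\<close>,
  which is at most \<kappa> / G. Passing from the square of a sum to a sum of squares costs the
  dimension 3.\<close>

lemma J_bound:
  assumes t: "0 < t" "t \<le> T"
  shows "J t \<le> 54 * \<kappa> * (M + 1)\<^sup>2 * (\<Sum>b\<in>Basis. Q b t) + 263168 * \<kappa>^5 * (M + 1)^8 * \<xi>^8"
proof -
  define Kb where "Kb = cball c (2 * r)"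
  define \<eta> where "\<eta> x = \<zeta> x ^ 4 * u x t" for x
  define d\<eta> where "d\<eta> x = \<zeta> x ^ 4 *\<^sub>R Du x t + (4 * \<zeta> x ^ 3 * u x t) *\<^sub>R dcutoff c (2 * r) x" for x
  define W where "W x = H (\<Phi> x t)" for x
  define W' where "W' x v = dH (\<Phi> x t) (d\<Phi> x t v)" for x v
  define C where "C = 131584 * \<kappa>^4 * (M + 1)^8 * \<xi>^8"
  define S where "S x = (\<Sum>b\<in>Basis. norm (d\<Phi> x t b))" for x
  have KB: "Kb \<subseteq> B2" using cball2_B2 by (simp add: Kb_def)
  have xU: "x \<in> U" if "x \<in> B2" for x using that B2_U by blast
  have cS: "continuous_on B2 S" unfolding S_def using t xU by (auto intro!: continuous_intros)
  have W'_le: "norm (W' x b) \<le> 3 * (K (\<Phi> x t) * (norm (\<Phi> x t))\<^sup>2) * norm (d\<Phi> x t b)" for x b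
    unfolding W'_def by (rule norm_dH)
  have "\<exists>L. \<forall>x\<in>B2. norm (3 * (K (\<Phi> x t) * (norm (\<Phi> x t))\<^sup>2) * S x) \<le> L"
  proof -
    have "continuous_on B2 (\<lambda>x. 3 * (K (\<Phi> x t) * (norm (\<Phi> x t))\<^sup>2) * S x)"
      using t xU by (auto intro!: continuous_intros cS)
    then have "bounded ((\<lambda>x. 3 * (K (\<Phi> x t) * (norm (\<Phi> x t))\<^sup>2) * S x) ` B2)"
      by (intro compact_imp_bounded compact_continuous_image) (auto simp: B_cbox)
    then show ?thesis by (auto simp: bounded_iff)
  qed
  then obtain L where L: "\<And>x. x \<in> B2 \<Longrightarrow> norm (3 * (K (\<Phi> x t) * (norm (\<Phi> x t))\<^sup>2) * S x) \<le> L" by blast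
  have ibp: "((\<lambda>x. \<eta> x * (\<Sum>b\<in>Basis. W' x b \<bullet> b) + W x \<bullet> d\<eta> x) has_integral 0) B2"
    unfolding B_cbox(1)
  proof (rule integral_by_parts[of Kb _ _ \<eta> d\<eta> W W' L])
    show "compact Kb" by (simp add: Kb_def)
    show "Kb \<subseteq> cbox (c - (2 * r) *\<^sub>R One) (c + (2 * r) *\<^sub>R One)" using KB by (simp add: B_cbox)
    show "continuous_on Kb d\<eta>"
      unfolding d\<eta>_def using t KB xU by (auto intro!: continuous_intros)
    fix x assume x: "x \<in> Kb"
    then have xB: "x \<in> B2" using KB by blast
    have "GDERIV (\<lambda>x. \<zeta> x ^ 4) x :> (4 * \<zeta> x ^ 3) *\<^sub>R dcutoff c (2 * r) x"
      unfolding \<zeta>_def by (rule GDERIV_DERIV_compose[OF GDERIV_cutoff]) (auto intro!: derivative_eq_intros)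
    from GDERIV_mult[OF this Du[OF xU[OF xB] t]]
    show "GDERIV \<eta> x :> d\<eta> x" unfolding \<eta>_def[abs_def] d\<eta>_def by (simp add: mult_ac)
    show "(W has_derivative W' x) (at x)"
      unfolding W_def[abs_def] W'_def[abs_def]
      by (rule has_derivative_compose[OF Phi_derivative[OF xU[OF xB] t] H_derivative])
    fix b :: "real^3" assume b: "b \<in> Basis"
    have "norm (W' x b) \<le> 3 * (K (\<Phi> x t) * (norm (\<Phi> x t))\<^sup>2) * norm (d\<Phi> x t b)" by (rule W'_le)
    also have "\<dots> \<le> 3 * (K (\<Phi> x t) * (norm (\<Phi> x t))\<^sup>2) * S x"
      unfolding S_def using b K_bounds(1)[of "\<Phi> x t"] by (intro mult_left_mono member_le_sum) auto
    also have "\<dots> \<le> L" using L[OF xB] by simp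
    finally show "norm (W' x b) \<le> L" .
  next
    fix x assume "x \<notin> Kb"
    then show "\<eta> x = 0" "d\<eta> x = 0" using r by (simp_all add: \<eta>_def d\<eta>_def \<zeta>_def Kb_def cutoff_eq_0)
  qed
  define j where "j x = \<zeta> x ^ 4 * (K (\<Phi> x t) * norm (\<Phi> x t) ^ 4)" for x
  define q where "q x = \<zeta> x ^ 4 * (K (\<Phi> x t) * (S x)\<^sup>2)" for x
  have ci: "j integrable_on B2" "q integrable_on B2"
    unfolding j_def q_def using t xU by (auto intro!: int2 continuous_intros cS)
  have "((\<lambda>x. j x - (\<eta> x * (\<Sum>b\<in>Basis. W' x b \<bullet> b) + W x \<bullet> d\<eta> x)) has_integral integral B2 j - 0) B2"
    by (intro has_integral_diff ibp integrable_integral ci)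
  moreover have "((\<lambda>x. (1/2) * j x + 9 * (M + 1)\<^sup>2 * q x + C) has_integral
      (1/2) * integral B2 j + 9 * (M + 1)\<^sup>2 * integral B2 q + measure lborel B2 * C) B2"
    using has_integral_const[of C] unfolding B_cbox
    by (intro has_integral_add has_integral_mult_right integrable_integral ci[unfolded B_cbox]) (auto simp: B_cbox)
  ultimately have "integral B2 j - 0 \<le> (1/2) * integral B2 j + 9 * (M + 1)\<^sup>2 * integral B2 q + measure lborel B2 * C"
  proof (rule has_integral_le)
    fix x assume x: "x \<in> B2"
    have "\<bar>\<Sum>b\<in>Basis. W' x b \<bullet> b\<bar> \<le> (\<Sum>b\<in>Basis. norm (W' x b))"
      by (rule order.trans[OF sum_abs]) (auto intro!: sum_mono order.trans[OF Cauchy_Schwarz_ineq2])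
    also have "\<dots> \<le> (\<Sum>b\<in>Basis. 3 * (K (\<Phi> x t) * (norm (\<Phi> x t))\<^sup>2) * norm (d\<Phi> x t b))"
      by (intro sum_mono W'_le)
    also have "\<dots> = 3 * (K (\<Phi> x t) * (norm (\<Phi> x t))\<^sup>2) * S x" unfolding S_def by (rule sum_distrib_left[symmetric])
    finally have dv: "\<bar>\<Sum>b\<in>Basis. W' x b \<bullet> b\<bar> \<le> 3 * (K (\<Phi> x t) * (norm (\<Phi> x t))\<^sup>2) * S x" .
    have "0 \<le> S x" unfolding S_def by (intro sum_nonneg) auto
    from J_pointwise[OF _ _ u_bound[OF xU[OF x] less_imp_le[OF t(1)] t(2)] Z_bound[OF xU[OF x], of t] dcutoff_bounds(1) dv this,
        of "\<zeta> x" x]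
    show "j x - (\<eta> x * (\<Sum>b\<in>Basis. W' x b \<bullet> b) + W x \<bullet> d\<eta> x) \<le> (1/2) * j x + 9 * (M + 1)\<^sup>2 * q x + C"
      unfolding j_def q_def \<eta>_def d\<eta>_def W_def C_def by (simp add: \<Phi>_def Z_def mult_ac)
  qed
  then have J: "J t \<le> 18 * (M + 1)\<^sup>2 * integral B2 q + 2 * (measure lborel B2 * C)"
    unfolding J_def j_def[symmetric] by linarith
  have mC: "2 * (measure lborel B2 * C) \<le> 2 * (\<kappa> * C)"
    using measure_B2 M by (intro mult_left_mono mult_right_mono) (auto simp: C_def)
  have kC: "2 * (\<kappa> * C) = 263168 * \<kappa>^5 * (M + 1)^8 * \<xi>^8" by (simp add: C_def power_numeral_reduce)
  have "integral B2 q \<le> integral B2 (\<lambda>x. \<Sum>b\<in>Basis. 3 * \<kappa> * (\<zeta> x ^ 4 * ((norm (d\<Phi> x t b))\<^sup>2 / G (\<Phi> x t))))"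
  proof (rule integral_le[OF ci(2)])
    show "(\<lambda>x. \<Sum>b\<in>Basis. 3 * \<kappa> * (\<zeta> x ^ 4 * ((norm (d\<Phi> x t b))\<^sup>2 / G (\<Phi> x t)))) integrable_on B2"
      using t xU less_imp_neq[OF G_pos, THEN not_sym] by (auto intro!: int2 continuous_intros)
    fix x
    have "(S x)\<^sup>2 \<le> 3 * (\<Sum>b\<in>Basis. (norm (d\<Phi> x t b))\<^sup>2)"
      using sum_squared_le_sum_of_squares[of "\<lambda>b. norm (d\<Phi> x t b)" "Basis :: (real^3) set"]
      by (simp add: S_def mult.commute)
    then have "K (\<Phi> x t) * (S x)\<^sup>2 \<le> \<kappa> / G (\<Phi> x t) * (3 * (\<Sum>b\<in>Basis. (norm (d\<Phi> x t b))\<^sup>2))"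
      using K_bounds[of "\<Phi> x t"] by (intro mult_mono) auto
    then have "q x \<le> \<zeta> x ^ 4 * (\<kappa> / G (\<Phi> x t) * (3 * (\<Sum>b\<in>Basis. (norm (d\<Phi> x t b))\<^sup>2)))"
      unfolding q_def by (intro mult_left_mono) auto
    also have "\<dots> = (\<Sum>b\<in>Basis. 3 * \<kappa> * (\<zeta> x ^ 4 * ((norm (d\<Phi> x t b))\<^sup>2 / G (\<Phi> x t))))"
      by (simp add: sum_distrib_left mult_ac)
    finally show "q x \<le> (\<Sum>b\<in>Basis. 3 * \<kappa> * (\<zeta> x ^ 4 * ((norm (d\<Phi> x t b))\<^sup>2 / G (\<Phi> x t))))" .
  qed
  also have "\<dots> = 3 * \<kappa> * (\<Sum>b\<in>Basis. Q b t)"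
  proof -
    have i: "(\<lambda>x. \<zeta> x ^ 4 * ((norm (d\<Phi> x t b))\<^sup>2 / G (\<Phi> x t))) integrable_on B2" for b
      using t xU less_imp_neq[OF G_pos, THEN not_sym] by (auto intro!: int2 continuous_intros)
    have "integral B2 (\<lambda>x. \<Sum>b\<in>Basis. 3 * \<kappa> * (\<zeta> x ^ 4 * ((norm (d\<Phi> x t b))\<^sup>2 / G (\<Phi> x t))))
        = (\<Sum>b\<in>Basis. integral B2 (\<lambda>x. 3 * \<kappa> * (\<zeta> x ^ 4 * ((norm (d\<Phi> x t b))\<^sup>2 / G (\<Phi> x t)))))"
      by (intro integral_sum integrable_on_mult_right i) auto
    also have "\<dots> = (\<Sum>b\<in>Basis. 3 * \<kappa> * Q b t)" unfolding Q_def by (simp only: integral_mult_right)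
    finally show ?thesis by (simp add: sum_distrib_left)
  qed
  finally have "18 * (M + 1)\<^sup>2 * integral B2 q \<le> 18 * (M + 1)\<^sup>2 * (3 * \<kappa> * (\<Sum>b\<in>Basis. Q b t))"
    by (intro mult_left_mono) auto
  also have "\<dots> = 54 * \<kappa> * (M + 1)\<^sup>2 * (\<Sum>b\<in>Basis. Q b t)" by simp
  finally show ?thesis using J mC kC by linarith
qed

end

section \<open>Gradient estimates on a ball\<close>

context local_flow
begin

text \<open>The bound for weak gradients is applied with the weight of the ball of radius 5 r. Where
  \<open>\<zeta>\<close> is nonzero the argument of \<open>flat_exp\<close> is at least r^2, so the
  weight is at least exp(-1 / r^2); this is why exp(1 / r^2) \<le> \<kappa> is required. Continuity
  of \<open>u0\<close> in \<open>U\<close> is inherited from \<open>u\<close>.\<close>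

lemma A0_bound:
  assumes weak: "weak_gradient U u0 du0" and u0: "\<And>x. x \<in> U \<Longrightarrow> u0 x = u x 0"
    and b: "b \<in> Basis" and h: "0 < h" "h \<le> r"
  shows "ennreal (A0 b h) \<le> ennreal \<kappa> * L2_norm_sq U du0"
proof -
  have norm_b: "norm b = 1" using b by simp
  define D where "D x = (u0 (x + h *\<^sub>R b) - u0 x) / h" for x
  define e where "e x = flat_exp 0 ((5 * r)\<^sup>2 - (norm (x - c))\<^sup>2)" for x
  have cu0: "continuous_on U u0"
    using continuous_on_cong[THEN iffD2, OF refl u0 cont_u[of U "\<lambda>x. x" "\<lambda>_. 0"]] T by (auto intro!: continuous_intros)
  have shiftU: "x + h *\<^sub>R b \<in> U" if "x \<in> B6" for x
  proof -
    have "x \<in> cball c (12 * r)" using cube_subset_cball[of "6 * r" c] that r by (auto simp: B6_def)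
    then have "x + h *\<^sub>R b \<in> cball c (13 * r)"
      using dist_triangle[of c "x + h *\<^sub>R b" x] norm_b h by (simp add: dist_norm)
    then show ?thesis using U(2) by blast
  qed
  have W: "ennreal (integral B6 (\<lambda>x. (D x)\<^sup>2 * e x)) \<le> L2_norm_sq U du0"
    unfolding L2_norm_sq_def D_def e_def B_cbox
  proof (rule weak_gradient_difference_quotient[OF weak cu0])
    show "cbox (c - (6 * r) *\<^sub>R One) (c + (6 * r) *\<^sub>R One) \<subseteq> U" using B6_U by (simp add: B_cbox)
    show "x + h *\<^sub>R b \<in> U" if "x \<in> cbox (c - (6 * r) *\<^sub>R One) (c + (6 * r) *\<^sub>R One)" for x
      using shiftU that by (simp add: B_cbox)
    have "cball c (5 * r + h) \<subseteq> cball c (6 * r)" using h by auto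
    then show "cball c (5 * r + h) \<subseteq> cbox (c - (6 * r) *\<^sub>R One) (c + (6 * r) *\<^sub>R One)"
      using cball6_B6 by (simp add: B_cbox)
  qed (use h r norm_b in auto)
  have ce: "continuous_on B e" for B
  proof -
    have "e \<in> bumps c (5 * r)"
      using bumps.prod[OF real_polynomial_function.intros(2)[of 1], of 0 "5 * r" c] by (simp add: e_def[abs_def])
    then obtain e' where e': "\<And>x. (e has_derivative e' x) (at x)" using bumps_derivative by blast
    show ?thesis
      by (rule continuous_at_imp_continuous_on) (use has_derivative_continuous[OF e'] in auto)
  qed
  have cD: "continuous_on B6 D"
    unfolding D_def using shiftU B6_U h
    by (intro continuous_on_divide continuous_on_diff continuous_on_compose2[OF cu0] continuous_on_const)
       (auto intro!: continuous_intros)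
  have e0: "0 \<le> e x" for x by (simp add: e_def flat_exp_def)
  have le: "\<zeta> x ^ 4 \<le> \<kappa> * e x" if "x \<in> B2" for x
  proof (cases "x \<in> cball c (2 * r)")
    case True
    then have n2: "(norm (x - c))\<^sup>2 \<le> (2 * r)\<^sup>2"
      by (intro power_mono) (auto simp: dist_norm norm_minus_commute)
    define q where "q = (5 * r)\<^sup>2 - (norm (x - c))\<^sup>2"
    have "0 < r\<^sup>2" using r by simp
    have "(2 * r)\<^sup>2 = 4 * r\<^sup>2" "(5 * r)\<^sup>2 = 25 * r\<^sup>2" by (simp_all add: power_mult_distrib)
    then have r2: "r\<^sup>2 \<le> q" and "0 < q" using n2 \<open>0 < r\<^sup>2\<close> unfolding q_def by linarith+
    have "inverse q \<le> inverse (r\<^sup>2)" by (rule le_imp_inverse_le[OF r2 \<open>0 < r\<^sup>2\<close>])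
    then have "exp (- (1 / r\<^sup>2)) \<le> e x"
      unfolding e_def flat_exp_def q_def[symmetric] using \<open>0 < q\<close> by (simp add: inverse_eq_divide)
    then have "exp (1 / r\<^sup>2) * exp (- (1 / r\<^sup>2)) \<le> \<kappa> * e x"
      using kappa_geometry(3) kappa_pos by (intro mult_mono) auto
    then have "1 \<le> \<kappa> * e x" by (simp add: exp_minus)
    then show ?thesis using power_le_one[of "\<zeta> x" 4] by simp
  next
    case False
    then show ?thesis using r e0[of x] kappa_pos by (simp add: \<zeta>_def cutoff_eq_0)
  qed
  have i6: "(\<lambda>x. \<kappa> * ((D x)\<^sup>2 * e x)) integrable_on B6" by (intro int6 continuous_intros cD ce)
  have i2: "(\<lambda>x. \<kappa> * ((D x)\<^sup>2 * e x)) integrable_on B2"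
    by (intro int2 continuous_intros ce continuous_on_subset[OF cD B2_B6])
  have D: "(u (x + h *\<^sub>R b) 0 - u x 0) / h = D x" if "x \<in> B2" for x
  proof -
    have "x \<in> U" "x + h *\<^sub>R b \<in> U" using that shiftU B2_B6 B2_U by blast+
    then show ?thesis by (simp add: D_def u0)
  qed
  have "A0 b h = integral B2 (\<lambda>x. \<zeta> x ^ 4 * (D x)\<^sup>2)"
    unfolding A0_def by (intro integral_cong) (simp add: D)
  also have "\<dots> \<le> integral B2 (\<lambda>x. \<kappa> * ((D x)\<^sup>2 * e x))"
  proof (rule integral_le[OF int2 i2])
    show "continuous_on B2 (\<lambda>x. \<zeta> x ^ 4 * (D x)\<^sup>2)"
      by (intro continuous_intros continuous_on_subset[OF cD B2_B6])
    show "\<zeta> x ^ 4 * (D x)\<^sup>2 \<le> \<kappa> * ((D x)\<^sup>2 * e x)" if "x \<in> B2" for x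
      using mult_right_mono[OF le[OF that], of "(D x)\<^sup>2"] by (simp add: mult_ac)
  qed
  also have "\<dots> \<le> integral B6 (\<lambda>x. \<kappa> * ((D x)\<^sup>2 * e x))"
    using e0 kappa_pos by (intro integral_subset_le B2_B6 i2 i6) auto
  also have "\<dots> = \<kappa> * integral B6 (\<lambda>x. (D x)\<^sup>2 * e x)" by (rule integral_mult_right)
  finally have "ennreal (A0 b h) \<le> ennreal (\<kappa> * integral B6 (\<lambda>x. (D x)\<^sup>2 * e x))" by (rule ennreal_leI)
  also have "\<dots> = ennreal \<kappa> * ennreal (integral B6 (\<lambda>x. (D x)\<^sup>2 * e x))"
    using kappa_pos e0 by (intro ennreal_mult integral_nonneg int6 continuous_intros cD ce) auto
  finally show ?thesis using W by (meson mult_left_mono order.trans zero_le)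
qed

lemma cball_r_B2: "cball c r \<subseteq> B2"
proof -
  have "cball c r \<subseteq> cball c (2 * r)" using r by auto
  then show ?thesis using cball2_B2 by blast
qed

lemma norm_Du_le:
  assumes "x \<in> U" "0 \<le> t" "t \<le> T"
  shows "norm (Du x t) \<le> 2 * max (norm (\<Phi> x t)) ((M + 1)\<^sup>2 * \<xi>\<^sup>2)"
proof -
  have "norm ((u x t)\<^sup>2 *\<^sub>R Z x t) \<le> (M + 1)\<^sup>2 * \<xi>\<^sup>2"
    using u_bound[OF assms] Z_bound[OF assms(1), of t] M
    unfolding norm_scaleR Z_def by (intro mult_mono) (auto intro!: power2_le_iff_abs_le[THEN iffD2])
  moreover have "Du x t = \<Phi> x t - (u x t)\<^sup>2 *\<^sub>R Z x t" by (simp add: \<Phi>_def)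
  ultimately show ?thesis using norm_triangle_ineq4[of "\<Phi> x t" "(u x t)\<^sup>2 *\<^sub>R Z x t"] by simp
qed

text \<open>For |\<Phi>| > 1 the weight \<open>K\<close> is at least half of |\<Phi>|^(-\<theta>),
  so K |\<Phi>|^4 controls the power 4 - \<theta>; for |\<Phi>| \<le> 1 that power is at most 1. On
  the ball of radius r the cut-off \<open>\<zeta>\<close> is at least 9/16, and 200 (9/16)^4 exceeds
  1.\<close>

lemma high_pointwise:
  assumes x: "x \<in> cball c r" and t: "0 < t" "t \<le> T"
  shows "norm (Du x t) powr (4 - \<theta>) \<le> 32 * \<kappa> * (\<zeta> x ^ 4 * (K (\<Phi> x t) * norm (\<Phi> x t) ^ 4)) + 32 * (M + 1)^8 * \<xi>^8"
proof -
  define n where "n = norm (\<Phi> x t)"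
  define y where "y = (M + 1)\<^sup>2 * \<xi>\<^sup>2"
  define k where "k = K (\<Phi> x t)"
  have n: "0 \<le> n" by (simp add: n_def)
  have k: "0 < k" using K_bounds(1) by (simp add: k_def)
  have "1 * 1 \<le> y" unfolding y_def using M chi_ge_1 by (intro mult_mono) (auto simp: one_le_power)
  then have y: "1 \<le> y" by simp
  have xU: "x \<in> U" using x cball_r_B2 B2_U by blast
  have "norm (Du x t) powr (4 - \<theta>) \<le> (2 * max n y) powr (4 - \<theta>)"
    using norm_Du_le[OF xU less_imp_le[OF t(1)] t(2)] theta_less_1 unfolding n_def y_def
    by (intro powr_mono2) auto
  also have "\<dots> = 2 powr (4 - \<theta>) * max n y powr (4 - \<theta>)" using n y by (simp add: powr_mult)
  also have "\<dots> \<le> 16 * (n powr (4 - \<theta>) + y^4)"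
  proof (rule mult_mono)
    have "(2::real) powr (4 - \<theta>) \<le> 2 powr 4" using theta_pos by (intro powr_mono) auto
    then show "(2::real) powr (4 - \<theta>) \<le> 16" by simp
    have "y powr (4 - \<theta>) \<le> y powr 4" using theta_pos y by (intro powr_mono) auto
    then have "y powr (4 - \<theta>) \<le> y^4" using y by simp
    then show "max n y powr (4 - \<theta>) \<le> n powr (4 - \<theta>) + y^4"
      using y by (auto simp: max_def intro: add_increasing add_increasing2)
  qed auto
  also have "n powr (4 - \<theta>) \<le> 1 + 2 * (k * n^4)"
  proof (cases "n \<le> 1")
    case True
    then have "n powr (4 - \<theta>) \<le> 1" using n theta_less_1 by (intro powr_le1) auto
    then show ?thesis using k n by (simp add: add_increasing2)
  next
    case False
    then have n1: "1 < n" by simp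
    have "(1 + n\<^sup>2) powr (\<theta> / 2) \<le> (2 * n\<^sup>2) powr (\<theta> / 2)"
      using n1 theta_pos by (intro powr_mono2) (auto simp: one_le_power)
    also have "\<dots> = 2 powr (\<theta> / 2) * n powr \<theta>"
    proof -
      have "n\<^sup>2 = n powr 2" using n1 by simp
      then have "(n\<^sup>2) powr (\<theta> / 2) = n powr \<theta>" by (simp only: powr_powr) simp
      then show ?thesis by (simp add: powr_mult)
    qed
    also have "\<dots> \<le> 2 * n powr \<theta>"
    proof (rule mult_right_mono)
      have "(2::real) powr (\<theta> / 2) \<le> 2 powr 1" using theta_less_1 by (intro powr_mono) auto
      then show "(2::real) powr (\<theta> / 2) \<le> 2" by simp
    qed simp
    finally have le: "(1 + n\<^sup>2) powr (\<theta> / 2) \<le> 2 * n powr \<theta>" .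
    have kk: "k * (1 + n\<^sup>2) powr (\<theta> / 2) = 1"
    proof -
      have "0 < 1 + n\<^sup>2" by (simp add: add_pos_nonneg)
      then show ?thesis unfolding k_def K_def n_def power2_norm_eq_inner[symmetric] by (simp add: powr_add[symmetric])
    qed
    have "n powr (4 - \<theta>) = (k * (1 + n\<^sup>2) powr (\<theta> / 2)) * n powr (4 - \<theta>)" by (simp add: kk)
    also have "\<dots> \<le> (k * (2 * n powr \<theta>)) * n powr (4 - \<theta>)"
      using le k by (intro mult_right_mono mult_left_mono) auto
    also have "\<dots> = 2 * (k * (n powr \<theta> * n powr (4 - \<theta>)))" by simp
    also have "n powr \<theta> * n powr (4 - \<theta>) = n^4" using n1 by (simp add: powr_add[symmetric])
    finally show ?thesis by simp
  qed
  also have "16 * (1 + 2 * (k * n^4) + y^4) \<le> 32 * (k * n^4) + 32 * y^4"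
    using one_le_power[OF y, of 4] by simp
  also have "k * n^4 \<le> \<kappa> * (\<zeta> x ^ 4 * (k * n^4))"
  proof -
    have "(1 - (1 / 2)\<^sup>2)\<^sup>2 \<le> \<zeta> x"
      unfolding \<zeta>_def using x r by (intro cutoff_lower) auto
    then have "((1 - (1 / 2)\<^sup>2)\<^sup>2)^4 \<le> \<zeta> x ^ 4" by (intro power_mono) auto
    then have "200 * ((1 - (1 / 2)\<^sup>2)\<^sup>2)^4 \<le> \<kappa> * \<zeta> x ^ 4"
      using kappa_geometry(1) by (intro mult_mono) auto
    then have "1 \<le> \<kappa> * \<zeta> x ^ 4" by (rule order.trans[rotated]) (simp add: power_numeral_reduce)
    then have "1 * (k * n^4) \<le> \<kappa> * \<zeta> x ^ 4 * (k * n^4)" using k by (intro mult_right_mono) auto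
    then show ?thesis by simp
  qed
  also have "y^4 = (M + 1)^8 * \<xi>^8" by (simp add: y_def power_mult_distrib flip: power_mult)
  finally show ?thesis unfolding k_def n_def by simp
qed

text \<open>The structural inequality \<open>norm_powr_le\<close> at \<Phi>, with the factor
  \<open>\<omega>\<close> inserted at the cost of a further \<open>\<kappa>\<close>, since
  \<open>\<omega>\<close> is bounded below on the small ball. The term u^2 Z accounts for the
  constant.\<close>

lemma low_pointwise:
  assumes x: "x \<in> cball c r" and t: "0 < t" "t \<le> T"
  shows "norm (Du x t) powr (2 - \<theta>) \<le> 4 * \<kappa>\<^sup>2 * \<xi>\<^sup>2 * ((\<omega> x)\<^sup>2 * (G (\<Phi> x t) * (norm (V x t))\<^sup>2)) + 8 * \<kappa> * (M + 1)^4 * \<xi>^4"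
proof -
  define n where "n = norm (\<Phi> x t)"
  define y where "y = (M + 1)\<^sup>2 * \<xi>\<^sup>2"
  define p where "p = G (\<Phi> x t) * (norm (V x t))\<^sup>2"
  have n: "0 \<le> n" by (simp add: n_def)
  have p: "0 \<le> p" using G_pos[of "\<Phi> x t"] by (simp add: p_def)
  have mx: "1 \<le> M + 1" "1 \<le> \<xi>" "1 \<le> \<kappa>" using M chi_ge_1 kappa_ge_1 by auto
  have "1 * 1 \<le> y" unfolding y_def using mx by (intro mult_mono) (auto simp: one_le_power)
  then have y: "1 \<le> y" by simp
  have xU: "x \<in> U" using x cball_r_B2 B2_U by blast
  have "norm (Du x t) powr (2 - \<theta>) \<le> (2 * max n y) powr (2 - \<theta>)"
    using norm_Du_le[OF xU less_imp_le[OF t(1)] t(2)] theta_less_1 unfolding n_def y_def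
    by (intro powr_mono2) auto
  also have "\<dots> = 2 powr (2 - \<theta>) * max n y powr (2 - \<theta>)" using n y by (simp add: powr_mult)
  also have "\<dots> \<le> 4 * (n powr (2 - \<theta>) + y\<^sup>2)"
  proof (rule mult_mono)
    have "(2::real) powr (2 - \<theta>) \<le> 2 powr 2" using theta_pos by (intro powr_mono) auto
    then show "(2::real) powr (2 - \<theta>) \<le> 4" by simp
    have "y powr (2 - \<theta>) \<le> y powr 2" using theta_pos y by (intro powr_mono) auto
    then have "y powr (2 - \<theta>) \<le> y\<^sup>2" using y by simp
    then show "max n y powr (2 - \<theta>) \<le> n powr (2 - \<theta>) + y\<^sup>2"
      using y by (auto simp: max_def intro: add_increasing add_increasing2)
  qed auto
  also have "n powr (2 - \<theta>) \<le> \<kappa> * \<xi>\<^sup>2 * (1 + \<kappa> * ((\<omega> x)\<^sup>2 * p))"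
  proof -
    have "n powr (2 - \<theta>) \<le> \<kappa> * \<xi>\<^sup>2 * (1 + p)"
      using norm_powr_le[of "\<Phi> x t"] by (simp add: n_def p_def V_def)
    have "cball c r \<subseteq> cball c (1/2 * (6 * r))" using r by auto
    then have "(1 - (1 / 2)\<^sup>2)\<^sup>2 \<le> \<omega> x"
      unfolding \<omega>_def using x r by (intro cutoff_lower) auto
    then have "((1 - (1 / 2)\<^sup>2)\<^sup>2)\<^sup>2 \<le> (\<omega> x)\<^sup>2" by (intro power_mono) auto
    then have "200 * ((1 - (1 / 2)\<^sup>2)\<^sup>2)\<^sup>2 \<le> \<kappa> * (\<omega> x)\<^sup>2"
      using kappa_geometry(1) by (intro mult_mono) auto
    then have "1 \<le> \<kappa> * (\<omega> x)\<^sup>2" by (rule order.trans[rotated]) (simp add: power_numeral_reduce)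
    then have "1 * p \<le> \<kappa> * (\<omega> x)\<^sup>2 * p" using p by (intro mult_right_mono) auto
    then have "\<kappa> * \<xi>\<^sup>2 * (1 + p) \<le> \<kappa> * \<xi>\<^sup>2 * (1 + \<kappa> * ((\<omega> x)\<^sup>2 * p))"
      using mx by (intro mult_left_mono) auto
    with \<open>n powr (2 - \<theta>) \<le> \<kappa> * \<xi>\<^sup>2 * (1 + p)\<close> show ?thesis by linarith
  qed
  also have "4 * (\<kappa> * \<xi>\<^sup>2 * (1 + \<kappa> * ((\<omega> x)\<^sup>2 * p)) + y\<^sup>2)
      = 4 * \<kappa>\<^sup>2 * \<xi>\<^sup>2 * ((\<omega> x)\<^sup>2 * p) + (4 * (\<kappa> * (1 * \<xi>\<^sup>2)) + 4 * (1 * y\<^sup>2))"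
    by (simp add: power2_eq_square algebra_simps)
  also have "4 * (\<kappa> * (1 * \<xi>\<^sup>2)) + 4 * (1 * y\<^sup>2) \<le> 4 * (\<kappa> * ((M + 1)^4 * \<xi>^4)) + 4 * (\<kappa> * ((M + 1)^4 * \<xi>^4))"
  proof (intro add_mono mult_left_mono)
    show "1 * \<xi>\<^sup>2 \<le> (M + 1)^4 * \<xi>^4" using mx by (intro mult_mono power_increasing one_le_power) auto
    show "1 * y\<^sup>2 \<le> \<kappa> * ((M + 1)^4 * \<xi>^4)"
      using mx by (intro mult_mono) (auto simp: y_def power_mult_distrib simp flip: power_mult)
  qed (use mx in auto)
  finally have "norm (Du x t) powr (2 - \<theta>) \<le> 4 * \<kappa>\<^sup>2 * \<xi>\<^sup>2 * ((\<omega> x)\<^sup>2 * p)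
      + (4 * (\<kappa> * ((M + 1)^4 * \<xi>^4)) + 4 * (\<kappa> * ((M + 1)^4 * \<xi>^4)))" by simp
  then show ?thesis unfolding p_def by (simp only: mult.assoc)
qed

abbreviation "Nst \<equiv> N_star U T \<phi> (\<lambda>x. u x 0) \<Psi>"

lemma T_le_Nst: "ennreal T \<le> Nst"
  unfolding N_star_def by (metis add.commute add.left_commute le_iff_add)

lemma ball_nn_integral_le:
  assumes "continuous_on B2 f" "\<And>x. 0 \<le> f x" "\<And>x. x \<in> ball c r \<Longrightarrow> g x \<le> f x"
  shows "(\<integral>\<^sup>+x\<in>ball c r. ennreal (g x) \<partial>lborel) \<le> ennreal (integral B2 f)"
proof -
  have "(\<integral>\<^sup>+x\<in>ball c r. ennreal (g x) \<partial>lborel) \<le> (\<integral>\<^sup>+x\<in>B2. ennreal (f x) \<partial>lborel)"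
  proof (intro nn_integral_mono)
    fix x
    have "x \<in> B2" if "x \<in> ball c r" using that cball_r_B2 by auto
    then show "ennreal (g x) * indicator (ball c r) x \<le> ennreal (f x) * indicator B2 x"
      using assms(3)[of x] by (auto simp: indicator_def intro: ennreal_leI)
  qed
  also have "\<dots> = ennreal (integral B2 f)"
    using assms(1,2) unfolding B_cbox by (intro nn_integral_cbox) auto
  finally show ?thesis .
qed

text \<open>The density in \<open>low_pointwise\<close> integrates to the energy and the constant to
  a multiple of \<open>T\<close>, a summand of \<open>N_star\<close>. The coefficient 400 is 304 + 8
  rounded up.\<close>

theorem low_bound:
  "(\<integral>\<^sup>+t\<in>{0<..T}. (\<integral>\<^sup>+x\<in>ball c r. ennreal (norm (Du x t) powr (2 - \<theta>)) \<partial>lborel) \<partial>lborel)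
    \<le> ennreal (400 * \<kappa>^6 * \<xi>^6 * (M + 1)^4) * Nst"
proof -
  define a where "a = 4 * \<kappa>\<^sup>2 * \<xi>\<^sup>2"
  define k where "k = 8 * \<kappa>\<^sup>2 * (M + 1)^4 * \<xi>^4"
  have mx: "1 \<le> M + 1" "1 \<le> \<xi>" "1 \<le> \<kappa>" using M chi_ge_1 kappa_ge_1 by auto
  have ak: "0 \<le> a" "0 \<le> k" using mx by (auto simp: a_def k_def)
  have E0: "0 \<le> energy t" if "0 < t" "t \<le> T" for t
    unfolding energy_def using that B6_U less_imp_le[OF G_pos]
    by (intro integral_nonneg int6) (auto intro!: continuous_intros)
  have cE: "continuous_on {0<..T} energy" unfolding energy_def B_cbox
    by (rule integral_continuous_on_param)
       (use B6_U in \<open>auto simp: case_prod_unfold B_cbox[symmetric] intro!: continuous_intros\<close>)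
  have "(\<integral>\<^sup>+t\<in>{0<..T}. (\<integral>\<^sup>+x\<in>ball c r. ennreal (norm (Du x t) powr (2 - \<theta>)) \<partial>lborel) \<partial>lborel)
      \<le> (\<integral>\<^sup>+t\<in>{0<..T}. ennreal (a * energy t + k) \<partial>lborel)"
  proof (intro nn_integral_mono)
    fix t
    show "(\<integral>\<^sup>+x\<in>ball c r. ennreal (norm (Du x t) powr (2 - \<theta>)) \<partial>lborel) * indicator {0<..T} t
        \<le> ennreal (a * energy t + k) * indicator {0<..T} t"
    proof (cases "t \<in> {0<..T}")
      case True
      then have t: "0 < t" "t \<le> T" by auto
      define p where "p x = (\<omega> x)\<^sup>2 * (G (\<Phi> x t) * (norm (V x t))\<^sup>2)" for x
      define C where "C = 8 * \<kappa> * (M + 1)^4 * \<xi>^4"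
      have cp: "continuous_on B6 p" unfolding p_def using t B6_U by (auto intro!: continuous_intros)
      have p0: "0 \<le> p x" for x unfolding p_def using less_imp_le[OF G_pos] by simp
      have i2: "p integrable_on B2" by (rule int2[OF continuous_on_subset[OF cp B2_B6]])
      have "(\<integral>\<^sup>+x\<in>ball c r. ennreal (norm (Du x t) powr (2 - \<theta>)) \<partial>lborel) \<le> ennreal (integral B2 (\<lambda>x. a * p x + C))"
      proof (rule ball_nn_integral_le)
        show "continuous_on B2 (\<lambda>x. a * p x + C)" by (intro continuous_intros continuous_on_subset[OF cp B2_B6])
        show "0 \<le> a * p x + C" for x using p0[of x] ak mx by (auto simp: C_def intro!: add_nonneg_nonneg)
        show "norm (Du x t) powr (2 - \<theta>) \<le> a * p x + C" if "x \<in> ball c r" for x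
          using low_pointwise[OF _ t, of x] that unfolding a_def C_def p_def by auto
      qed
      also have "integral B2 (\<lambda>x. a * p x + C) \<le> a * energy t + k"
      proof -
        have "((\<lambda>x. a * p x + C) has_integral a * integral B2 p + measure lborel B2 * C) B2"
          using has_integral_const[of C] unfolding B_cbox
          by (intro has_integral_add has_integral_mult_right integrable_integral i2[unfolded B_cbox]) (auto simp: B_cbox)
        then have "integral B2 (\<lambda>x. a * p x + C) = a * integral B2 p + measure lborel B2 * C" by (rule integral_unique)
        also have "\<dots> \<le> a * integral B6 p + \<kappa> * C"
        proof (intro add_mono mult_left_mono mult_right_mono)
          show "integral B2 p \<le> integral B6 p" using p0 by (intro integral_subset_le B2_B6 i2 int6 cp) auto
        qed (use ak measure_B2 mx in \<open>auto simp: C_def\<close>)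
        also have "\<kappa> * C = k" by (simp add: C_def k_def power2_eq_square)
        finally show ?thesis unfolding energy_def p_def .
      qed
      finally show ?thesis using True by (simp add: ennreal_leI)
    qed simp
  qed
  also have "\<dots> = ennreal a * (\<integral>\<^sup>+t\<in>{0<..T}. ennreal (energy t) \<partial>lborel) + ennreal (k * T)"
    using cE E0 ak T by (intro nn_integral_Ioc_affine) auto
  also have "\<dots> \<le> ennreal a * (ennreal (76 * \<kappa>^4 * \<xi>^4 * (M + 1)^4) * Nst) + ennreal k * Nst"
    using energy_bound T_le_Nst ak T by (intro add_mono mult_left_mono) (auto simp: ennreal_mult mult_left_mono)
  also have "\<dots> = ennreal (a * (76 * \<kappa>^4 * \<xi>^4 * (M + 1)^4) + k) * Nst"
    using ak mx by (simp add: ennreal_plus ennreal_mult distrib_right mult.assoc)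
  also have "\<dots> \<le> ennreal (400 * \<kappa>^6 * \<xi>^6 * (M + 1)^4) * Nst"
  proof (intro mult_right_mono ennreal_leI)
    have "\<kappa>\<^sup>2 * \<xi>^4 * (M + 1)^4 \<le> \<kappa>^6 * \<xi>^6 * (M + 1)^4"
      using mx by (intro mult_right_mono mult_mono power_increasing) auto
    moreover have "a * (76 * \<kappa>^4 * \<xi>^4 * (M + 1)^4) = 304 * (\<kappa>^6 * \<xi>^6 * (M + 1)^4)"
      by (simp add: a_def power_numeral_reduce)
    moreover have "k = 8 * (\<kappa>\<^sup>2 * \<xi>^4 * (M + 1)^4)" by (simp add: k_def)
    moreover have "0 \<le> \<kappa>^6 * \<xi>^6 * (M + 1)^4" using mx by simp
    ultimately have "a * (76 * \<kappa>^4 * \<xi>^4 * (M + 1)^4) + k \<le> 400 * (\<kappa>^6 * \<xi>^6 * (M + 1)^4)" by linarith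
    then show "a * (76 * \<kappa>^4 * \<xi>^4 * (M + 1)^4) + k \<le> 400 * \<kappa>^6 * \<xi>^6 * (M + 1)^4"
      by (simp only: mult.assoc)
  qed simp
  finally show ?thesis .
qed

lemma Q_nonneg: "0 < t \<Longrightarrow> t \<le> T \<Longrightarrow> 0 \<le> Q b t"
  and J_nonneg: "0 < t \<Longrightarrow> t \<le> T \<Longrightarrow> 0 \<le> J t"
  unfolding Q_def J_def using B2_U G_pos less_imp_le[OF K_bounds(1)]
  by (intro integral_nonneg int2; auto intro!: continuous_intros divide_nonneg_pos simp: less_imp_neq[THEN not_sym])+

lemma Q_continuous: "continuous_on {0<..T} (Q b)"
proof -
  have "continuous_on {0<..T} (\<lambda>t. Q b t)" unfolding Q_def B_cbox
    by (rule integral_continuous_on_param)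
       (use B2_U G_pos in \<open>auto simp: case_prod_unfold B_cbox[symmetric] less_imp_neq[THEN not_sym] intro!: continuous_intros\<close>)
  then show ?thesis by simp
qed

text \<open>On \<open>S\<close> the weight is at least 1/2, so it can be inserted at the cost of 4
  \<sigma>^2 \<ge> 1. Then \<open>J_bound\<close> reduces the claim to \<open>Q_bound\<close>,
  summed over the three coordinate directions.\<close>

theorem high_bound:
  assumes \<sigma>: "\<And>t. 0 \<le> t \<Longrightarrow> t \<le> T \<Longrightarrow> 0 \<le> \<sigma> t \<and> \<sigma> t \<le> 1" and L: "0 \<le> L"
    and \<sigma>': "\<And>t. 0 \<le> t \<Longrightarrow> t \<le> T \<Longrightarrow> (\<sigma> has_real_derivative \<sigma>' t) (at t within {0..T}) \<and> 0 \<le> \<sigma>' t \<and> \<sigma>' t \<le> L"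
    and I0: "\<And>b h. b \<in> Basis \<Longrightarrow> 0 < h \<Longrightarrow> h \<le> r \<Longrightarrow> ennreal (2 * \<phi> * (\<sigma> 0)\<^sup>2 * A0 b h) \<le> I0"
    and S: "S \<subseteq> {0<..T}" "\<And>t. t \<in> S \<Longrightarrow> 1 / 2 \<le> \<sigma> t"
  shows "(\<integral>\<^sup>+t\<in>S. (\<integral>\<^sup>+x\<in>ball c r. ennreal (norm (Du x t) powr (4 - \<theta>)) \<partial>lborel) \<partial>lborel)
    \<le> ennreal (100000000000 * \<kappa>^16 * \<xi>^16 * (M + 1)^12 * (1 + L)\<^sup>2) * (I0 + Nst)"
proof -
  define m where "m = M + 1"
  define a where "a = 6912 * \<kappa>\<^sup>2 * m\<^sup>2"
  define k where "k = 33685632 * \<kappa>^6 * m^8 * \<xi>^8"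
  define e where "e t = (\<Sum>b\<in>Basis. (\<sigma> t)\<^sup>2 * Q b t)" for t
  define D where "D = 1600000 * \<kappa>^13 * \<xi>^14 * m^10 * (1 + L)\<^sup>2"
  have mx: "1 \<le> m" "1 \<le> \<xi>" "1 \<le> \<kappa>" using M chi_ge_1 kappa_ge_1 by (auto simp: m_def)
  have ak: "0 \<le> a" "0 \<le> k" "0 \<le> D" using mx by (auto simp: a_def k_def D_def)
  have "continuous_on {0..T} \<sigma>" by (rule DERIV_continuous_on[where D = \<sigma>']) (use \<sigma>' in auto)
  then have c\<sigma>: "continuous_on {0<..T} \<sigma>" by (rule continuous_on_subset) auto
  have cq: "continuous_on {0<..T} (\<lambda>t. (\<sigma> t)\<^sup>2 * Q b t)" for b by (intro continuous_intros c\<sigma> Q_continuous)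
  have ce: "continuous_on {0<..T} e" unfolding e_def by (intro continuous_intros cq)
  have e0: "0 \<le> e t" if "0 < t" "t \<le> T" for t
    unfolding e_def using Q_nonneg[OF that] by (intro sum_nonneg mult_nonneg_nonneg) auto
  have "(\<integral>\<^sup>+t\<in>S. (\<integral>\<^sup>+x\<in>ball c r. ennreal (norm (Du x t) powr (4 - \<theta>)) \<partial>lborel) \<partial>lborel)
      \<le> (\<integral>\<^sup>+t\<in>{0<..T}. ennreal (a * e t + k) \<partial>lborel)"
  proof (intro nn_integral_mono)
    fix t
    show "(\<integral>\<^sup>+x\<in>ball c r. ennreal (norm (Du x t) powr (4 - \<theta>)) \<partial>lborel) * indicator S t
        \<le> ennreal (a * e t + k) * indicator {0<..T} t"
    proof (cases "t \<in> S")
      case True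
      then have t: "0 < t" "t \<le> T" and s: "1 / 2 \<le> \<sigma> t" using S by auto
      define j where "j x = \<zeta> x ^ 4 * (K (\<Phi> x t) * norm (\<Phi> x t) ^ 4)" for x
      have cj: "continuous_on B2 j" unfolding j_def using t B2_U by (auto intro!: continuous_intros)
      have j0: "0 \<le> j x" for x unfolding j_def using less_imp_le[OF K_bounds(1)] by simp
      define C where "C = 32 * m^8 * \<xi>^8"
      have "(\<integral>\<^sup>+x\<in>ball c r. ennreal (norm (Du x t) powr (4 - \<theta>)) \<partial>lborel) \<le> ennreal (integral B2 (\<lambda>x. 32 * \<kappa> * j x + C))"
      proof (rule ball_nn_integral_le)
        show "continuous_on B2 (\<lambda>x. 32 * \<kappa> * j x + C)" by (intro continuous_intros cj)
        show "0 \<le> 32 * \<kappa> * j x + C" for x using j0[of x] mx by (auto simp: C_def intro!: add_nonneg_nonneg)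
        show "norm (Du x t) powr (4 - \<theta>) \<le> 32 * \<kappa> * j x + C" if "x \<in> ball c r" for x
          using high_pointwise[OF _ t, of x] that unfolding C_def j_def m_def by auto
      qed
      also have "integral B2 (\<lambda>x. 32 * \<kappa> * j x + C) \<le> a * e t + k"
      proof -
        have "((\<lambda>x. 32 * \<kappa> * j x + C) has_integral 32 * \<kappa> * integral B2 j + measure lborel B2 * C) B2"
          using has_integral_const[of C] unfolding B_cbox
          by (intro has_integral_add has_integral_mult_right integrable_integral int2[OF cj, unfolded B_cbox]) (auto simp: B_cbox)
        then have "integral B2 (\<lambda>x. 32 * \<kappa> * j x + C) = 32 * \<kappa> * J t + measure lborel B2 * C"
          unfolding J_def j_def by (rule integral_unique)
        also have "\<dots> \<le> 32 * \<kappa> * (54 * \<kappa> * m\<^sup>2 * (\<Sum>b\<in>Basis. Q b t) + 263168 * \<kappa>^5 * m^8 * \<xi>^8) + \<kappa> * C"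
          using J_bound[OF t] measure_B2 mx unfolding m_def[symmetric]
          by (intro add_mono mult_left_mono mult_right_mono) (auto simp: C_def)
        also have "\<dots> = 1 * (1728 * \<kappa>\<^sup>2 * m\<^sup>2 * (\<Sum>b\<in>Basis. Q b t)) + (8421376 * \<kappa>^6 * m^8 * \<xi>^8 + 32 * \<kappa> * m^8 * \<xi>^8)"
          by (simp add: C_def power_numeral_reduce algebra_simps)
        also have "\<dots> \<le> (4 * (\<sigma> t)\<^sup>2) * (1728 * \<kappa>\<^sup>2 * m\<^sup>2 * (\<Sum>b\<in>Basis. Q b t)) + k"
        proof (intro add_mono mult_right_mono)
          have "(1 / 2)\<^sup>2 \<le> (\<sigma> t)\<^sup>2" using s by (intro power_mono) auto
          then show "1 \<le> 4 * (\<sigma> t)\<^sup>2" by (simp add: power2_eq_square)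
          show "0 \<le> 1728 * \<kappa>\<^sup>2 * m\<^sup>2 * (\<Sum>b\<in>Basis. Q b t)" using Q_nonneg[OF t] by (simp add: sum_nonneg)
          have "\<kappa> * m^8 * \<xi>^8 \<le> \<kappa>^6 * m^8 * \<xi>^8"
            using mx power_increasing[of 1 6 \<kappa>] by (intro mult_right_mono) auto
          moreover have "0 \<le> \<kappa>^6 * m^8 * \<xi>^8" using mx by simp
          ultimately show "8421376 * \<kappa>^6 * m^8 * \<xi>^8 + 32 * \<kappa> * m^8 * \<xi>^8 \<le> k" unfolding k_def by linarith
        qed
        also have "(4 * (\<sigma> t)\<^sup>2) * (1728 * \<kappa>\<^sup>2 * m\<^sup>2 * (\<Sum>b\<in>Basis. Q b t)) = a * e t"
          by (simp add: a_def e_def sum_distrib_left mult_ac)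
        finally show ?thesis .
      qed
      finally show ?thesis using True t by (simp add: ennreal_leI)
    qed simp
  qed
  also have "\<dots> = ennreal a * (\<integral>\<^sup>+t\<in>{0<..T}. ennreal (e t) \<partial>lborel) + ennreal (k * T)"
    using ce e0 ak T by (intro nn_integral_Ioc_affine) auto
  also have "(\<integral>\<^sup>+t\<in>{0<..T}. ennreal (e t) \<partial>lborel)
      = (\<Sum>b\<in>Basis. (\<integral>\<^sup>+t\<in>{0<..T}. ennreal ((\<sigma> t)\<^sup>2 * Q b t) \<partial>lborel))"
  proof -
    have "(\<integral>\<^sup>+t\<in>{0<..T}. ennreal (e t) \<partial>lborel)
        = (\<integral>\<^sup>+t. (\<Sum>b\<in>Basis. ennreal ((\<sigma> t)\<^sup>2 * Q b t) * indicator {0<..T} t) \<partial>lborel)"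
    proof (intro nn_integral_cong)
      fix t
      show "ennreal (e t) * indicator {0<..T} t = (\<Sum>b\<in>Basis. ennreal ((\<sigma> t)\<^sup>2 * Q b t) * indicator {0<..T} t)"
        using Q_nonneg[of t] by (cases "t \<in> {0<..T}") (auto simp: e_def intro!: sum_ennreal[symmetric])
    qed
    also have "\<dots> = (\<Sum>b\<in>Basis. (\<integral>\<^sup>+t\<in>{0<..T}. ennreal ((\<sigma> t)\<^sup>2 * Q b t) \<partial>lborel))"
      by (intro nn_integral_sum borel_measurable_ennreal_indicator_continuous cq) auto
    finally show ?thesis .
  qed
  also have "\<dots> \<le> (\<Sum>b\<in>(Basis::(real^3) set). ennreal (2 * \<kappa> * \<xi>\<^sup>2) * (I0 + ennreal D * Nst))"
    unfolding D_def m_def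
    by (intro sum_mono) (rule Q_bound[OF _ \<sigma> L \<sigma>']; (assumption | rule I0)?; auto)
  also have "\<dots> = 3 * (ennreal (2 * \<kappa> * \<xi>\<^sup>2) * (I0 + ennreal D * Nst))" by simp
  also have "\<dots> = ennreal (6 * \<kappa> * \<xi>\<^sup>2) * (I0 + ennreal D * Nst)"
  proof -
    have "ennreal (6 * \<kappa> * \<xi>\<^sup>2) = ennreal 3 * ennreal (2 * \<kappa> * \<xi>\<^sup>2)"
      using mx by (subst ennreal_mult[symmetric]) auto
    then show ?thesis by (simp add: mult.assoc)
  qed
  finally have "(\<integral>\<^sup>+t\<in>S. (\<integral>\<^sup>+x\<in>ball c r. ennreal (norm (Du x t) powr (4 - \<theta>)) \<partial>lborel) \<partial>lborel)
      \<le> ennreal a * (ennreal (6 * \<kappa> * \<xi>\<^sup>2) * (I0 + ennreal D * Nst)) + ennreal (k * T)"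
    by (simp add: mult_left_mono)
  also have "\<dots> \<le> ennreal a * (ennreal (6 * \<kappa> * \<xi>\<^sup>2) * (ennreal D * I0 + ennreal D * Nst)) + ennreal k * (I0 + Nst)"
  proof (intro add_mono mult_left_mono)
    have "1 * 1 * 1 * 1 \<le> \<kappa>^13 * \<xi>^14 * m^10 * (1 + L)\<^sup>2"
      using mx L by (intro mult_mono) (auto simp: one_le_power)
    then have "1 \<le> D" unfolding D_def by simp
    then show "I0 \<le> ennreal D * I0" using mult_right_mono[of 1 "ennreal D" I0] by simp
    have "ennreal (k * T) = ennreal k * ennreal T" using ak T by (simp add: ennreal_mult)
    also have "\<dots> \<le> ennreal k * (I0 + Nst)"
      using T_le_Nst by (intro mult_left_mono) (auto intro: add_increasing)
    finally show "ennreal (k * T) \<le> ennreal k * (I0 + Nst)" .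
  qed auto
  also have "\<dots> = ennreal (a * (6 * \<kappa> * \<xi>\<^sup>2) * D + k) * (I0 + Nst)"
    using ak mx by (simp add: ennreal_plus ennreal_mult distrib_right distrib_left mult.assoc)
  also have "\<dots> \<le> ennreal (100000000000 * \<kappa>^16 * \<xi>^16 * (M + 1)^12 * (1 + L)\<^sup>2) * (I0 + Nst)"
  proof (intro mult_right_mono ennreal_leI)
    \<comment> \<open>The leading coefficient is 6912 * 6 * 1600000; the final constant rounds up
      its sum with the coefficient of \<open>k\<close>.\<close>
    define W where "W = \<kappa>^16 * \<xi>^16 * m^12 * (1 + L)\<^sup>2"
    have "a * (6 * \<kappa> * \<xi>\<^sup>2) * D = 66355200000 * W"
      by (simp add: a_def D_def W_def power_numeral_reduce)
    moreover have "\<kappa>^6 * \<xi>^8 * m^8 * 1 \<le> W"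
      unfolding W_def using mx L by (intro mult_mono power_increasing) (auto simp: one_le_power)
    then have "k \<le> 33685632 * W" unfolding k_def by (simp add: mult_ac)
    moreover have "0 \<le> W" using mx by (simp add: W_def)
    ultimately have "a * (6 * \<kappa> * \<xi>\<^sup>2) * D + k \<le> 100000000000 * W" by linarith
    then show "a * (6 * \<kappa> * \<xi>\<^sup>2) * D + k \<le> 100000000000 * \<kappa>^16 * \<xi>^16 * (M + 1)^12 * (1 + L)\<^sup>2"
      by (simp add: W_def m_def mult.assoc)
  qed simp
  finally show ?thesis .
qed

text \<open>The constant weight 1 has derivative 0, so L = 0; the price is the initial term, which
  \<open>A0_bound\<close> controls uniformly in the step.\<close>

theorem high_bound_initial:
  assumes weak: "weak_gradient U u0 du0" and u0: "\<And>x. x \<in> U \<Longrightarrow> u0 x = u x 0"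
  shows "(\<integral>\<^sup>+t\<in>{0<..T}. (\<integral>\<^sup>+x\<in>ball c r. ennreal (norm (Du x t) powr (4 - \<theta>)) \<partial>lborel) \<partial>lborel)
    \<le> ennreal (200000000000 * \<kappa>^17 * \<xi>^16 * (M + 1)^12) * (ennreal \<phi> * L2_norm_sq U du0 + Nst)"
proof -
  define C where "C = 100000000000 * \<kappa>^16 * \<xi>^16 * (M + 1)^12"
  have C: "0 \<le> C" using kappa_ge_1 chi_ge_1 M by (auto simp: C_def)
  have I0: "ennreal (2 * \<phi> * 1\<^sup>2 * A0 b h) \<le> ennreal (2 * \<kappa>) * (ennreal \<phi> * L2_norm_sq U du0)"
    if "b \<in> Basis" "0 < h" "h \<le> r" for b h
  proof -
    have "ennreal (2 * \<phi> * 1\<^sup>2 * A0 b h) = ennreal (2 * \<phi>) * ennreal (A0 b h)"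
      using phi by (subst ennreal_mult'[symmetric]) auto
    also have "\<dots> \<le> ennreal (2 * \<phi>) * (ennreal \<kappa> * L2_norm_sq U du0)"
      using A0_bound[OF weak u0 that] by (intro mult_left_mono) auto
    also have "\<dots> = ennreal (2 * \<kappa>) * (ennreal \<phi> * L2_norm_sq U du0)"
      using phi kappa_pos by (simp add: ennreal_mult mult_ac)
    finally show ?thesis .
  qed
  have "(\<integral>\<^sup>+t\<in>{0<..T}. (\<integral>\<^sup>+x\<in>ball c r. ennreal (norm (Du x t) powr (4 - \<theta>)) \<partial>lborel) \<partial>lborel)
      \<le> ennreal (100000000000 * \<kappa>^16 * \<xi>^16 * (M + 1)^12 * (1 + 0)\<^sup>2) * (ennreal (2 * \<kappa>) * (ennreal \<phi> * L2_norm_sq U du0) + Nst)"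
    by (rule high_bound[where \<sigma> = "\<lambda>_. 1" and \<sigma>' = "\<lambda>_. 0"]) (use I0 in auto)
  also have "\<dots> \<le> ennreal C * (ennreal (2 * \<kappa>) * (ennreal \<phi> * L2_norm_sq U du0) + ennreal (2 * \<kappa>) * Nst)"
  proof -
    have "1 * Nst \<le> ennreal (2 * \<kappa>) * Nst" using kappa_ge_1 by (intro mult_right_mono) auto
    then show ?thesis unfolding C_def by (intro mult_mono add_left_mono) auto
  qed
  also have "\<dots> = ennreal (C * (2 * \<kappa>)) * (ennreal \<phi> * L2_norm_sq U du0 + Nst)"
    using C kappa_pos by (simp add: ennreal_mult distrib_left mult.assoc)
  also have "C * (2 * \<kappa>) = 200000000000 * \<kappa>^17 * \<xi>^16 * (M + 1)^12" by (simp add: C_def power_numeral_reduce)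
  finally show ?thesis .
qed

text \<open>The weight t / (t + T0) vanishes at 0, which removes the initial term, is at least 1/2
  from \<open>T0\<close> on, and has derivative at most 1 / T0; the last property is the origin of
  the factor (1 + 1 / T0)^2.\<close>

theorem high_bound_interior:
  assumes T0: "0 < T0" "T0 < T"
  shows "(\<integral>\<^sup>+t\<in>{T0..T}. (\<integral>\<^sup>+x\<in>ball c r. ennreal (norm (Du x t) powr (4 - \<theta>)) \<partial>lborel) \<partial>lborel)
    \<le> ennreal (200000000000 * \<kappa>^17 * (1 + 1 / T0)\<^sup>2 * \<xi>^16 * (M + 1)^12) * Nst"
proof -
  have "(\<integral>\<^sup>+t\<in>{T0..T}. (\<integral>\<^sup>+x\<in>ball c r. ennreal (norm (Du x t) powr (4 - \<theta>)) \<partial>lborel) \<partial>lborel)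
    \<le> ennreal (100000000000 * \<kappa>^16 * \<xi>^16 * (M + 1)^12 * (1 + 1 / T0)\<^sup>2) * (0 + Nst)"
  proof (rule high_bound[where \<sigma> = "\<lambda>t. t / (t + T0)" and \<sigma>' = "\<lambda>t. T0 / (t + T0)\<^sup>2"])
    show "0 \<le> t / (t + T0) \<and> t / (t + T0) \<le> 1" if "0 \<le> t" "t \<le> T" for t using that T0 by (simp add: divide_le_eq)
    show "((\<lambda>t. t / (t + T0)) has_real_derivative T0 / (t + T0)\<^sup>2) (at t within {0..T}) \<and> 0 \<le> T0 / (t + T0)\<^sup>2 \<and> T0 / (t + T0)\<^sup>2 \<le> 1 / T0"
      if "0 \<le> t" "t \<le> T" for t
    proof (intro conjI)
      show "((\<lambda>t. t / (t + T0)) has_real_derivative T0 / (t + T0)\<^sup>2) (at t within {0..T})"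
        using that T0 by (auto intro!: derivative_eq_intros simp: power2_eq_square)
      show "0 \<le> T0 / (t + T0)\<^sup>2" using T0 by simp
      have "T0\<^sup>2 \<le> (t + T0)\<^sup>2" using that T0 by (intro power_mono) auto
      moreover have "0 < (t + T0)\<^sup>2" using that T0 by (intro zero_less_power) auto
      ultimately show "T0 / (t + T0)\<^sup>2 \<le> 1 / T0" using T0 by (simp add: field_simps power2_eq_square)
    qed
    show "1 / 2 \<le> t / (t + T0)" if "t \<in> {T0..T}" for t using that T0 by (simp add: field_simps)
  qed (use T0 in auto)
  also have "\<dots> \<le> ennreal (200000000000 * \<kappa>^17 * (1 + 1 / T0)\<^sup>2 * \<xi>^16 * (M + 1)^12) * Nst"
  proof -
    define W where "W = \<xi>^16 * (M + 1)^12 * (1 + 1 / T0)\<^sup>2"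
    have "0 \<le> W" using chi_ge_1 M by (simp add: W_def)
    have "100000000000 * \<kappa>^16 \<le> 200000000000 * \<kappa>^17"
      using kappa_ge_1 by (intro mult_mono power_increasing) auto
    from mult_right_mono[OF this \<open>0 \<le> W\<close>]
    have "100000000000 * \<kappa>^16 * \<xi>^16 * (M + 1)^12 * (1 + 1 / T0)\<^sup>2
        \<le> 200000000000 * \<kappa>^17 * (1 + 1 / T0)\<^sup>2 * \<xi>^16 * (M + 1)^12"
      by (simp only: W_def mult_ac)
    then show ?thesis unfolding add_0 by (rule mult_right_mono[OF ennreal_leI]) simp
  qed
  finally show ?thesis .
qed

end

section \<open>From balls to relatively compact subsets\<close>

lemma norm_le_r0:
  assumes "bounded U" "x \<in> closure U"
  shows "norm x \<le> r0 U"
  unfolding r0_def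
proof (rule cSUP_upper)
  have "bounded (closure U)"
    using assms(1) by (rule bounded_closure)
  then show "bdd_above (norm ` closure U)"
    by (meson bdd_above.I2 bounded_iff)
qed (fact assms(2))

text \<open>A nonempty open set contains a point other than the origin.\<close>

lemma r0_pos:
  assumes "U \<noteq> {}" "open U" "bounded U"
  shows "0 < r0 U"
proof -
  obtain x e where x: "x \<in> U" and e: "0 < e" "cball x e \<subseteq> U"
    using assms(1,2) open_contains_cball by (metis ex_in_conv)
  have "\<exists>y\<in>cball x e. y \<noteq> 0"
  proof (cases "x = 0")
    case True
    have "norm (e *\<^sub>R (axis 1 1 :: real^3)) = e"
      using e(1) by (simp add: norm_axis_1)
    then show ?thesis
      using True e(1) by (intro bexI[of _ "e *\<^sub>R axis 1 1"]) auto
  next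
    case False
    then show ?thesis
      using e(1) by (intro bexI[of _ x]) auto
  qed
  then obtain y where y: "y \<in> U" "y \<noteq> 0"
    using e(2) by blast
  then have "norm y \<le> r0 U"
    using closure_subset norm_le_r0[OF assms(3)] by blast
  then show ?thesis
    using y(2) by (smt (verit) zero_less_norm_iff)
qed

text \<open>With q = sqrt(r0 / G) the product of \<open>d_star\<close> and q is the maximum in the
  definition of \<open>d_star\<close>, and its three entries each have a purpose. The entry 2 \<rho>
  / \<phi> bounds the rotation number; sqrt r0 bounds the gravitational part, in the form sqrt G
  \<le> \<open>d_star\<close>, and the centrifugal part; 2^(1/4) \<ge> 1 gives \<Omega> \<le> \<xi>.
  The last claim uses that a sum of two squares is at most the square of the sum.\<close>

lemma chi_star_bounds:
  fixes \<phi> G \<Omega> \<rho> :: real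
  assumes U: "U \<noteq> {}" "open U" "bounded U" and pos: "0 < \<phi>" "0 < G" "0 \<le> \<Omega>" "0 \<le> \<rho>"
  defines "\<xi> \<equiv> chi_star U \<phi> G \<Omega> \<rho>"
  shows "1 \<le> \<xi>" "rot_number \<phi> \<Omega> \<rho> \<le> \<xi>" "\<Omega>\<^sup>2 \<le> \<xi>\<^sup>2" "G + \<Omega>\<^sup>2 * r0 U \<le> \<xi>\<^sup>2"
proof -
  define q where "q = sqrt (r0 U / G)"
  define d where "d = d_star U \<phi> G \<rho>"
  have r0: "0 < r0 U"
    using U by (rule r0_pos)
  have q: "0 < q"
    using r0 pos by (simp add: q_def)
  have "sqrt (G / r0 U) = 1 / q"
    by (simp add: q_def real_sqrt_divide)
  then have dq: "d * q = Max {2 * \<rho> / \<phi>, sqrt (r0 U), 2 powr (1/4)}"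
    using q by (simp add: d_def d_star_def)
  have le: "2 * \<rho> / \<phi> \<le> d * q" "sqrt (r0 U) \<le> d * q" "2 powr (1/4) \<le> d * q"
    unfolding dq by simp_all
  have one: "1 \<le> d * q"
    using le(3) ge_one_powr_ge_zero[of 2 "1/4"] by linarith
  have "sqrt (r0 U) = sqrt G * q"
    using pos by (simp add: q_def real_sqrt_divide)
  then have dG: "sqrt G \<le> d"
    using le(2) q by (metis mult_le_cancel_right_pos)
  have \<xi>: "d + \<Omega> * (d * q) \<le> \<xi>"
    unfolding \<xi>_def chi_star_def Omega_star_def d_def q_def by (simp add: algebra_simps)
  have G0: "0 < sqrt G"
    using pos by simp
  show "1 \<le> \<xi>"
    by (simp add: \<xi>_def chi_star_def)
  have "\<Omega> * (2 * \<rho> / \<phi>) \<le> \<Omega> * (d * q)"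
    using le(1) pos(3) by (rule mult_left_mono)
  then have "\<Omega> * (2 * \<rho> / \<phi>) \<le> \<xi>"
    using \<xi> dG G0 by linarith
  then show "rot_number \<phi> \<Omega> \<rho> \<le> \<xi>"
    by (simp add: rot_number_def mult.commute)
  have "\<Omega> * 1 \<le> \<Omega> * (d * q)"
    using one pos(3) by (rule mult_left_mono)
  then have "\<Omega> \<le> \<xi>"
    using \<xi> dG G0 by linarith
  then show "\<Omega>\<^sup>2 \<le> \<xi>\<^sup>2"
    using pos(3) by (rule power_mono)
  have "\<Omega> * sqrt (r0 U) \<le> \<Omega> * (d * q)"
    using le(2) pos(3) by (rule mult_left_mono)
  then have s: "sqrt G + \<Omega> * sqrt (r0 U) \<le> \<xi>"
    using \<xi> dG by linarith
  have n: "0 \<le> \<Omega> * sqrt (r0 U)"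
    using pos(3) r0 by simp
  have "G + \<Omega>\<^sup>2 * r0 U = (sqrt G)\<^sup>2 + (\<Omega> * sqrt (r0 U))\<^sup>2"
    using pos r0 by (simp add: power_mult_distrib)
  also have "\<dots> \<le> (sqrt G + \<Omega> * sqrt (r0 U))\<^sup>2"
    using n G0 by (simp add: power2_sum)
  also have "\<dots> \<le> \<xi>\<^sup>2"
    using s n G0 by (intro power_mono) auto
  finally show "G + \<Omega>\<^sup>2 * r0 U \<le> \<xi>\<^sup>2" .
qed

lemma body_Z_bound:
  assumes U: "bounded U" "x \<in> U" and G: "0 < G" and k: "norm k = 1" and e: "norm (e0 t) = 1"
  shows "norm (body_Z G \<Omega> k e0 x t) \<le> G + \<Omega>\<^sup>2 * r0 U"
proof -
  have "norm (rotJ k (rotJ k x)) \<le> norm x"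
    using norm_rotJ_le[OF k] order_trans by blast
  also have "\<dots> \<le> r0 U"
    using U closure_subset by (intro norm_le_r0) auto
  finally have "\<Omega>\<^sup>2 * norm (rotJ k (rotJ k x)) \<le> \<Omega>\<^sup>2 * r0 U"
    by (rule mult_left_mono) simp
  moreover have "norm (body_Z G \<Omega> k e0 x t) \<le> norm (G *\<^sub>R e0 t) + norm (\<Omega>\<^sup>2 *\<^sub>R rotJ k (rotJ k x))"
    unfolding body_Z_def by (metis norm_minus_cancel norm_triangle_ineq)
  ultimately show ?thesis
    using G e by simp
qed

lemma smooth_imp_continuous:
  assumes "smooth f"
  shows "continuous_on UNIV f"
proof -
  have "f differentiable (at x)" for x
    using assms[unfolded smooth_def, rule_format, of "[]" x] by simp
  then show ?thesis
    by (simp add: continuous_at_imp_continuous_on differentiable_imp_continuous_within)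
qed

text \<open>A real supremum bounds its set only if the set is bounded above; this comes from
  continuity on the compact closed cylinder.\<close>

lemma abs_le_M_star:
  assumes "bounded U" "continuous_on (closure U \<times> {0..T}) (\<lambda>(x, t). u x t)"
    and "x \<in> U" "0 \<le> t" "t \<le> T"
  shows "\<bar>u x t\<bar> \<le> M_star U T u"
proof -
  have "compact (closure U \<times> {0..T})"
    using assms(1) by (simp add: compact_Times)
  then have "bounded ((\<lambda>(x, t). u x t) ` (closure U \<times> {0..T}))"
    using assms(2) compact_continuous_image compact_imp_bounded by blast
  then obtain B where B: "\<And>y. y \<in> (\<lambda>(x, t). u x t) ` (closure U \<times> {0..T}) \<Longrightarrow> norm y \<le> B"
    unfolding bounded_iff by blast
  have "bdd_above ((\<lambda>(x, t). \<bar>u x t\<bar>) ` (U \<times> {0..T}))"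
  proof (rule bdd_aboveI2)
    fix p assume "p \<in> U \<times> {0..T}"
    then have "p \<in> closure U \<times> {0..T}"
      using closure_subset by auto
    then show "(case p of (x, t) \<Rightarrow> \<bar>u x t\<bar>) \<le> B"
      using B[of "(\<lambda>(x, t). u x t) p"] by (auto split: prod.splits)
  qed
  then have "(case (x, t) of (x, t) \<Rightarrow> \<bar>u x t\<bar>) \<le> M_star U T u"
    unfolding M_star_def by (rule cSUP_upper2[where x = "(x, t)"]) (use assms in auto)
  then show ?thesis
    by simp
qed

lemma M_star_nonneg:
  assumes "U \<noteq> {}" "bounded U" "0 < T" "continuous_on (closure U \<times> {0..T}) (\<lambda>(x, t). u x t)"
  shows "0 \<le> M_star U T u"
proof -
  obtain x where "x \<in> U"
    using assms(1) by blast
  then show ?thesis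
    using abs_le_M_star[OF assms(2,4), of x 0] assms(3) by linarith
qed

section \<open>From the flow problem to the local setting\<close>

lemma divergence_eq_sum:
  assumes V: "(V has_derivative V') (at x)"
  shows "divergence V x = (\<Sum>b\<in>Basis. V' b \<bullet> b)"
proof -
  have "frechet_derivative V (at x) = V'"
    using frechet_derivative_at[OF V] by simp
  then have "divergence V x = (\<Sum>i\<in>UNIV. V' (axis i 1) $ i)"
    by (simp add: divergence_def trace_def jacobian_def matrix_def)
  also have "\<dots> = (\<Sum>i\<in>UNIV. V' (axis i 1) \<bullet> axis i 1)"
    by (simp add: inner_axis)
  also have "\<dots> = (\<Sum>b\<in>Basis. V' b \<bullet> b)"
  proof -
    have B: "(Basis :: (real^3) set) = range (\<lambda>i. axis i 1)"
      by (auto simp: Basis_vec_def)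
    have "inj (\<lambda>i::3. axis i (1::real))"
      by (auto simp: inj_on_def axis_eq_axis)
    then show ?thesis
      unfolding B by (subst sum.reindex) auto
  qed
  finally show ?thesis .
qed

text \<open>The equation is stated with \<open>gradient\<close>, a definite description. On the open
  set \<open>U\<close> it coincides with the classical gradient, so the two fluxes agree near every
  point of \<open>U\<close> and have the same derivative there.\<close>

lemma flow_setting_local_flow:
  assumes U: "U \<noteq> {}" "open U" "bounded U"
    and S: "flow_setting N a \<alpha> U \<phi> G \<Omega> \<rho> k e0 T u0 \<psi> u \<Psi>"
    and law: "flow_law \<kappa> (chi_star U \<phi> G \<Omega> \<rho>) \<theta> (forch_X N a \<alpha> (rot_number \<phi> \<Omega> \<rho>) k) \<Gamma>"
    and c: "0 < r" "cball c (13 * r) \<subseteq> U"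
    and geo: "200 \<le> \<kappa>" "4 / r \<le> \<kappa>" "exp (1 / r\<^sup>2) \<le> \<kappa>" "measure lborel (cube c (6 * r)) \<le> \<kappa>"
  obtains ut \<Psi>t Du D\<Psi> D2u z0 A where
    "local_flow \<kappa> (chi_star U \<phi> G \<Omega> \<rho>) \<theta> (forch_X N a \<alpha> (rot_number \<phi> \<Omega> \<rho>) k) \<Gamma> c r \<phi>
       (M_star U T u) T U u ut \<Psi> \<Psi>t Du D\<Psi> D2u z0 A"
proof -
  define \<xi> where "\<xi> = chi_star U \<phi> G \<Omega> \<rho>"
  define X where "X = forch_X N a \<alpha> (rot_number \<phi> \<Omega> \<rho>) k"
  have pos: "0 < \<phi>" "\<phi> \<le> 1" "0 < G" "0 \<le> \<Omega>" "0 \<le> \<rho>" and k: "norm k = 1" and e0: "smooth e0"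
    and e1: "\<And>t. norm (e0 t) = 1" and T: "0 < T" and Psi: "C1_cylinder U T \<Psi>"
    and sol: "C21_cylinder U T u" "continuous_on (closure U \<times> {0..T}) (\<lambda>(x, t). u x t)"
    and pde: "\<And>x t. x \<in> U \<Longrightarrow> t \<in> {0<..T} \<Longrightarrow> \<phi> * vector_derivative (u x) (at t within {0..T})
          = divergence (\<lambda>y. X (gradient (\<lambda>z. u z t) y + (u y t)\<^sup>2 *\<^sub>R body_Z G \<Omega> k e0 y t)) x"
    using S unfolding flow_setting_def ibvp_solution_def X_def by auto
  have cU: "U \<times> I \<subseteq> closure U \<times> I" for I :: "real set"
    using closure_subset by blast
  obtain Du D2u ut where
    Du_c: "continuous_on (closure U \<times> {0<..T}) (\<lambda>(x, t). Du x t)" and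
    D2u_c: "continuous_on (closure U \<times> {0<..T}) (\<lambda>(x, t). D2u x t)" and
    ut_c: "continuous_on (closure U \<times> {0<..T}) (\<lambda>(x, t). ut x t)" and
    D: "\<forall>x\<in>U. \<forall>t\<in>{0<..T}. (GDERIV (\<lambda>y. u y t) x :> Du x t) \<and>
           ((\<lambda>y. Du y t) has_derivative (\<lambda>h. D2u x t *v h)) (at x) \<and>
           (u x has_vector_derivative ut x t) (at t within {0..T})"
    using sol(1) unfolding C21_cylinder_def by blast
  obtain D\<Psi> \<Psi>t where
    Psi_c: "continuous_on (closure U \<times> {0..T}) (\<lambda>(x, t). \<Psi> x t)" and
    DPsi_c: "continuous_on (closure U \<times> {0..T}) (\<lambda>(x, t). D\<Psi> x t)" and
    Psit_c: "continuous_on (closure U \<times> {0..T}) (\<lambda>(x, t). \<Psi>t x t)" and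
    DPsi: "\<forall>x\<in>U. \<forall>t\<in>{0..T}. (GDERIV (\<lambda>y. \<Psi> y t) x :> D\<Psi> x t) \<and>
           (\<Psi> x has_vector_derivative \<Psi>t x t) (at t within {0..T})"
    using Psi unfolding C1_cylinder_def by blast
  define z0 where "z0 t = - (G *\<^sub>R e0 t)" for t
  define A where "A x = \<Omega>\<^sup>2 *\<^sub>R rotJ k (rotJ k x)" for x
  have Z: "body_Z G \<Omega> k e0 x t = z0 t + A x" for x t
    by (simp add: body_Z_def z0_def A_def)
  note chi = chi_star_bounds[OF U pos(1,3,4,5), folded \<xi>_def]
  have M0: "0 \<le> M_star U T u"
    using U(1,3) T sol(2) by (rule M_star_nonneg)
  have A_le: "norm (A v) \<le> \<xi>\<^sup>2 * norm v" for v
  proof -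
    have "norm (rotJ k (rotJ k v)) \<le> norm v"
      using norm_rotJ_le[OF k] order_trans by blast
    then have "\<Omega>\<^sup>2 * norm (rotJ k (rotJ k v)) \<le> \<xi>\<^sup>2 * norm v"
      using chi(3) by (intro mult_mono) auto
    then show ?thesis
      by (simp add: A_def)
  qed
  have Z_le: "norm (z0 t + A x) \<le> \<xi>\<^sup>2" if "x \<in> U" for x t
    using body_Z_bound[of U x G k e0 t \<Omega>, OF U(3) that pos(3) k e1] chi(4) unfolding Z by linarith
  have A_lin: "bounded_linear A"
    unfolding A_def
    by (intro bounded_linear_const_scaleR bounded_linear_compose[OF bounded_linear_rotJ bounded_linear_rotJ])
  have z0_c: "continuous_on UNIV z0"
    unfolding z0_def by (intro continuous_intros smooth_imp_continuous e0)
  have pde': "\<phi> * ut x t = (\<Sum>b\<in>Basis. V' b \<bullet> b)"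
    if x: "x \<in> U" and t: "0 < t" "t \<le> T"
      and V: "((\<lambda>y. X (Du y t + (u y t)\<^sup>2 *\<^sub>R (z0 t + A y))) has_derivative V') (at x)" for x t V'
  proof -
    have "((\<lambda>y. X (gradient (\<lambda>z. u z t) y + (u y t)\<^sup>2 *\<^sub>R body_Z G \<Omega> k e0 y t)) has_derivative V') (at x)"
    proof (rule has_derivative_transform_within_open[OF V U(2) x])
      fix y assume "y \<in> U"
      then have "gradient (\<lambda>z. u z t) y = Du y t"
        using D t by (intro gradient_eq) auto
      then show "X (Du y t + (u y t)\<^sup>2 *\<^sub>R (z0 t + A y))
          = X (gradient (\<lambda>z. u z t) y + (u y t)\<^sup>2 *\<^sub>R body_Z G \<Omega> k e0 y t)"
        by (simp add: Z)
    qed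
    then have "divergence (\<lambda>y. X (gradient (\<lambda>z. u z t) y + (u y t)\<^sup>2 *\<^sub>R body_Z G \<Omega> k e0 y t)) x
        = (\<Sum>b\<in>Basis. V' b \<bullet> b)"
      by (rule divergence_eq_sum)
    moreover have "vector_derivative (u x) (at t within {0..T}) = ut x t"
      using D x t T by (intro vector_derivative_within_closed_interval) auto
    ultimately show ?thesis
      using pde[OF x, of t] t by simp
  qed
  have "local_flow \<kappa> \<xi> \<theta> X \<Gamma> c r \<phi> (M_star U T u) T U u ut \<Psi> \<Psi>t Du D\<Psi> D2u z0 A"
    unfolding local_flow_def local_flow_axioms_def
  proof (intro conjI allI impI)
    show "flow_law \<kappa> \<xi> \<theta> X \<Gamma>"
      using law by (simp add: \<xi>_def X_def)
    show "\<bar>u x t\<bar> \<le> M_star U T u" if "x \<in> U" "0 \<le> t" "t \<le> T" for x t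
      using abs_le_M_star[OF U(3) sol(2) that] .
    show "\<phi> * ut x t = (\<Sum>b\<in>Basis. V' b \<bullet> b)"
      if "x \<in> U" "0 < t" "t \<le> T" "((\<lambda>y. X (Du y t + (u y t)\<^sup>2 *\<^sub>R (z0 t + A y))) has_derivative V') (at x)" for x t V'
      using pde'[OF that] .
    show "continuous_on (U \<times> {0..T}) (\<lambda>(x, t). u x t)"
      using sol(2) cU by (rule continuous_on_subset)
    show "continuous_on (U \<times> {0<..T}) (\<lambda>(x, t). Du x t)"
      using Du_c cU by (rule continuous_on_subset)
    show "continuous_on (U \<times> {0<..T}) (\<lambda>(x, t). D2u x t)"
      using D2u_c cU by (rule continuous_on_subset)
    show "continuous_on (U \<times> {0<..T}) (\<lambda>(x, t). ut x t)"
      using ut_c cU by (rule continuous_on_subset)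
    show "continuous_on (U \<times> {0..T}) (\<lambda>(x, t). \<Psi> x t)"
      using Psi_c cU by (rule continuous_on_subset)
    show "continuous_on (U \<times> {0..T}) (\<lambda>(x, t). D\<Psi> x t)"
      using DPsi_c cU by (rule continuous_on_subset)
    show "continuous_on (U \<times> {0..T}) (\<lambda>(x, t). \<Psi>t x t)"
      using Psit_c cU by (rule continuous_on_subset)
  qed (use c geo pos T M0 U(2) D DPsi z0_c A_lin A_le Z_le in auto)
  then show thesis
    using that unfolding \<xi>_def X_def by blast
qed

text \<open>The continuous gradient is extended by 0 outside \<open>U \<times> {0<..T}\<close>, a
  Borel set. Joint measurability is what makes iterated integrals additive in the interpolation and
  covering arguments.\<close>

lemma C21_gradient_measurable:
  assumes U: "open U" and u: "C21_cylinder U T u"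
  obtains D :: "real^3 \<Rightarrow> real \<Rightarrow> real^3" where
    "(\<lambda>(x, t). D x t) \<in> borel_measurable (borel \<Otimes>\<^sub>M borel)"
    "\<And>x t. x \<in> U \<Longrightarrow> 0 < t \<Longrightarrow> t \<le> T \<Longrightarrow> gradient (\<lambda>y. u y t) x = D x t"
proof -
  obtain Du where
    Du_c: "continuous_on (closure U \<times> {0<..T}) (\<lambda>(x, t). Du x t)" and
    D: "\<forall>x\<in>U. \<forall>t\<in>{0<..T}. GDERIV (\<lambda>y. u y t) x :> Du x t"
    using u unfolding C21_cylinder_def by blast
  define D' where "D' x t = indicator (U \<times> {0<..T}) (x, t) *\<^sub>R Du x t" for x t
  have "U \<times> {0<..T} \<in> sets borel"
    using U by (intro borel_Times) auto
  moreover have "continuous_on (U \<times> {0<..T}) (\<lambda>(x, t). Du x t)"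
    using Du_c by (rule continuous_on_subset) (use closure_subset in blast)
  ultimately have "(\<lambda>p. indicator (U \<times> {0<..T}) p *\<^sub>R (case p of (x, t) \<Rightarrow> Du x t)) \<in> borel_measurable borel"
    by (rule borel_measurable_continuous_on_indicator)
  moreover have "(\<lambda>p. indicator (U \<times> {0<..T}) p *\<^sub>R (case p of (x, t) \<Rightarrow> Du x t)) = (\<lambda>(x, t). D' x t)"
    by (auto simp: D'_def fun_eq_iff)
  ultimately have "(\<lambda>(x, t). D' x t) \<in> borel_measurable (borel \<Otimes>\<^sub>M borel)"
    by (simp add: borel_prod)
  moreover have "gradient (\<lambda>y. u y t) x = D' x t" if "x \<in> U" "0 < t" "t \<le> T" for x t
    using D that gradient_eq[of "\<lambda>y. u y t" x "Du x t"] by (simp add: D'_def)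
  ultimately show thesis
    by (rule that)
qed

text \<open>The time 0, at which \<open>u\<close> need not be differentiable, is a null set.\<close>

lemma grad_integral_eq:
  assumes V: "V \<in> sets borel" "V \<subseteq> U" and t: "0 \<le> t1" "t2 \<le> T"
    and D: "(\<lambda>(x, t). D x t) \<in> borel_measurable (borel \<Otimes>\<^sub>M borel)"
    and eq: "\<And>x t. x \<in> U \<Longrightarrow> 0 < t \<Longrightarrow> t \<le> T \<Longrightarrow> gradient (\<lambda>y. u y t) x = D x t"
  shows "grad_integral V t1 t2 s u
    = (\<integral>\<^sup>+t\<in>{t1..t2}. (\<integral>\<^sup>+x\<in>V. ennreal (norm (D x t) powr s) \<partial>lborel) \<partial>lborel)"
proof -
  note [measurable] = D V(1)
  have inner: "(\<integral>\<^sup>+x\<in>V. ennreal (norm (gradient (\<lambda>y. u y t) x) powr s) \<partial>lebesgue)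
      = (\<integral>\<^sup>+x\<in>V. ennreal (norm (D x t) powr s) \<partial>lborel)" if "0 < t" "t \<le> T" for t
  proof -
    have "(\<integral>\<^sup>+x\<in>V. ennreal (norm (gradient (\<lambda>y. u y t) x) powr s) \<partial>lebesgue)
        = (\<integral>\<^sup>+x\<in>V. ennreal (norm (D x t) powr s) \<partial>lebesgue)"
      using eq V(2) that by (intro nn_integral_cong) (auto simp: indicator_def)
    also have "\<dots> = (\<integral>\<^sup>+x\<in>V. ennreal (norm (D x t) powr s) \<partial>lborel)"
      by (rule nn_integral_completion) measurable
    finally show ?thesis .
  qed
  have "grad_integral V t1 t2 s u
      = (\<integral>\<^sup>+t\<in>{t1..t2}. (\<integral>\<^sup>+x\<in>V. ennreal (norm (D x t) powr s) \<partial>lborel) \<partial>lebesgue)"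
    unfolding grad_integral_def
  proof (rule nn_integral_cong_AE, rule AE_mp)
    show "AE t in lebesgue. t \<noteq> (0::real)"
      by (rule AE_completion) (rule AE_lborel_singleton)
    show "AE t in lebesgue. t \<noteq> 0 \<longrightarrow>
      (\<integral>\<^sup>+x\<in>V. ennreal (norm (gradient (\<lambda>y. u y t) x) powr s) \<partial>lebesgue) * indicator {t1..t2} t
      = (\<integral>\<^sup>+x\<in>V. ennreal (norm (D x t) powr s) \<partial>lborel) * indicator {t1..t2} t"
    proof (rule AE_I2, rule impI)
      fix t :: real assume "t \<noteq> 0"
      then show "(\<integral>\<^sup>+x\<in>V. ennreal (norm (gradient (\<lambda>y. u y t) x) powr s) \<partial>lebesgue) * indicator {t1..t2} t
        = (\<integral>\<^sup>+x\<in>V. ennreal (norm (D x t) powr s) \<partial>lborel) * indicator {t1..t2} t"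
        using inner[of t] t by (cases "t \<in> {t1..t2}") auto
    qed
  qed
  also have "\<dots> = (\<integral>\<^sup>+t\<in>{t1..t2}. (\<integral>\<^sup>+x\<in>V. ennreal (norm (D x t) powr s) \<partial>lborel) \<partial>lborel)"
    by (rule nn_integral_completion) measurable
  finally show ?thesis .
qed

text \<open>Pointwise the power s is dominated by the first term where the gradient is at most \<mu>
  and by the second where it exceeds \<mu>. Keeping \<mu> free gives a multiplicative interpolation
  inequality once \<mu> is adapted to the two endpoint bounds.\<close>

lemma grad_integral_interpolation:
  assumes U: "open U" and u: "C21_cylinder U T u" and V: "V \<in> sets borel" "V \<subseteq> U"
    and t: "0 \<le> t1" "t2 \<le> T" and s: "p < s" "s < q" and \<mu>: "0 < \<mu>"
  shows "grad_integral V t1 t2 s u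
    \<le> ennreal (\<mu> powr (s - p)) * grad_integral V t1 t2 p u + ennreal (\<mu> powr (s - q)) * grad_integral V t1 t2 q u"
proof -
  obtain D where D[measurable]: "(\<lambda>(x, t). D x t) \<in> borel_measurable (borel \<Otimes>\<^sub>M borel)"
    and eq: "\<And>x t. x \<in> U \<Longrightarrow> 0 < t \<Longrightarrow> t \<le> T \<Longrightarrow> gradient (\<lambda>y. u y t) x = D x t"
    using C21_gradient_measurable[OF U u] by metis
  have gi: "grad_integral V t1 t2 s' u
      = (\<integral>\<^sup>+t\<in>{t1..t2}. (\<integral>\<^sup>+x\<in>V. ennreal (norm (D x t) powr s') \<partial>lborel) \<partial>lborel)" for s'
    by (rule grad_integral_eq[OF V t D eq])
  note [measurable] = V(1)
  define P where "P = ennreal (\<mu> powr (s - p))"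
  define Q where "Q = ennreal (\<mu> powr (s - q))"
  have pt: "ennreal (y powr s) \<le> P * ennreal (y powr p) + Q * ennreal (y powr q)" if "0 \<le> y" for y
  proof (cases "y = 0")
    case True
    then show ?thesis by simp
  next
    case False
    then have y: "0 < y" using that by simp
    have "y powr s \<le> \<mu> powr (s - p) * y powr p + \<mu> powr (s - q) * y powr q"
    proof (cases "y \<le> \<mu>")
      case True
      have "y powr s = y powr (s - p) * y powr p"
        by (simp flip: powr_add)
      also have "\<dots> \<le> \<mu> powr (s - p) * y powr p"
        using True y s by (intro mult_right_mono powr_mono2) auto
      finally show ?thesis
        by (smt (verit) mult_nonneg_nonneg powr_ge_zero)
    next
      case False
      have "y powr s = y powr (s - q) * y powr q"
        by (simp flip: powr_add)
      also have "\<dots> \<le> \<mu> powr (s - q) * y powr q"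
        using False \<mu> s by (intro mult_right_mono powr_mono2') auto
      finally show ?thesis
        by (smt (verit) mult_nonneg_nonneg powr_ge_zero)
    qed
    then have "ennreal (y powr s) \<le> ennreal (\<mu> powr (s - p) * y powr p + \<mu> powr (s - q) * y powr q)"
      by (rule ennreal_leI)
    then show ?thesis
      by (simp add: P_def Q_def ennreal_mult)
  qed
  have "grad_integral V t1 t2 s u
      \<le> (\<integral>\<^sup>+t\<in>{t1..t2}. (\<integral>\<^sup>+x\<in>V. (P * ennreal (norm (D x t) powr p) + Q * ennreal (norm (D x t) powr q)) \<partial>lborel) \<partial>lborel)"
    unfolding gi by (intro nn_integral_mono mult_right_mono pt) auto
  also have "\<dots> = (\<integral>\<^sup>+t\<in>{t1..t2}. (P * (\<integral>\<^sup>+x\<in>V. ennreal (norm (D x t) powr p) \<partial>lborel)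
      + Q * (\<integral>\<^sup>+x\<in>V. ennreal (norm (D x t) powr q) \<partial>lborel)) \<partial>lborel)"
    by (simp add: nn_integral_add nn_integral_cmult distrib_right mult.assoc)
  also have "\<dots> = P * grad_integral V t1 t2 p u + Q * grad_integral V t1 t2 q u"
    unfolding gi by (simp add: nn_integral_add nn_integral_cmult distrib_right mult.assoc)
  finally show ?thesis
    by (simp add: P_def Q_def)
qed

text \<open>The indicator of \<open>V\<close> is at most the sum of the indicators of the covering
  sets; overlaps only increase the right side.\<close>

lemma grad_integral_cover:
  assumes U: "open U" and u: "C21_cylinder U T u"
    and V: "V \<in> sets borel" "V \<subseteq> (\<Union>i\<in>F. B i)" "V \<subseteq> U" and F: "finite F"
    and B: "\<And>i. i \<in> F \<Longrightarrow> B i \<in> sets borel" "\<And>i. i \<in> F \<Longrightarrow> B i \<subseteq> U"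
    and t: "0 \<le> t1" "t2 \<le> T"
  shows "grad_integral V t1 t2 s u \<le> (\<Sum>i\<in>F. grad_integral (B i) t1 t2 s u)"
proof -
  obtain D where D[measurable]: "(\<lambda>(x, t). D x t) \<in> borel_measurable (borel \<Otimes>\<^sub>M borel)"
    and eq: "\<And>x t. x \<in> U \<Longrightarrow> 0 < t \<Longrightarrow> t \<le> T \<Longrightarrow> gradient (\<lambda>y. u y t) x = D x t"
    using C21_gradient_measurable[OF U u] by metis
  note [measurable] = V(1) B(1)
  have ind: "indicator V x \<le> (\<Sum>i\<in>F. indicator (B i) x :: ennreal)" for x
  proof (cases "x \<in> V")
    case True
    then obtain i where i: "i \<in> F" "x \<in> B i"
      using V(2) by blast
    then have "indicator V x = (indicator (B i) x :: ennreal)"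
      using True by simp
    also have "\<dots> \<le> (\<Sum>i\<in>F. indicator (B i) x)"
      using F i(1) by (intro member_le_sum) auto
    finally show ?thesis .
  qed simp
  have "grad_integral V t1 t2 s u
      = (\<integral>\<^sup>+t\<in>{t1..t2}. (\<integral>\<^sup>+x\<in>V. ennreal (norm (D x t) powr s) \<partial>lborel) \<partial>lborel)"
    by (rule grad_integral_eq[OF V(1,3) t D eq])
  also have "\<dots> \<le> (\<integral>\<^sup>+t\<in>{t1..t2}. (\<integral>\<^sup>+x. ennreal (norm (D x t) powr s) * (\<Sum>i\<in>F. indicator (B i) x) \<partial>lborel) \<partial>lborel)"
    by (intro nn_integral_mono mult_right_mono mult_left_mono ind) auto
  also have "\<dots> = (\<integral>\<^sup>+t\<in>{t1..t2}. (\<Sum>i\<in>F. \<integral>\<^sup>+x\<in>B i. ennreal (norm (D x t) powr s) \<partial>lborel) \<partial>lborel)"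
    unfolding sum_distrib_left by (subst nn_integral_sum) auto
  also have "\<dots> = (\<Sum>i\<in>F. \<integral>\<^sup>+t\<in>{t1..t2}. (\<integral>\<^sup>+x\<in>B i. ennreal (norm (D x t) powr s) \<partial>lborel) \<partial>lborel)"
    unfolding sum_distrib_right by (subst nn_integral_sum) auto
  also have "\<dots> = (\<Sum>i\<in>F. grad_integral (B i) t1 t2 s u)"
    by (rule sum.cong[OF refl]) (rule grad_integral_eq[OF B t D eq, symmetric])
  finally show ?thesis .
qed

lemma grad_integral_eq_classical:
  assumes U: "open U" and u: "C21_cylinder U T u" and V: "V \<in> sets borel" "V \<subseteq> U"
    and t: "0 \<le> t1" "t2 \<le> T"
    and Du: "\<And>x t. x \<in> U \<Longrightarrow> 0 < t \<Longrightarrow> t \<le> T \<Longrightarrow> GDERIV (\<lambda>y. u y t) x :> Du x t"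
  shows "grad_integral V t1 t2 s u
    = (\<integral>\<^sup>+t\<in>{t1..t2} - {0}. (\<integral>\<^sup>+x\<in>V. ennreal (norm (Du x t) powr s) \<partial>lborel) \<partial>lborel)"
proof -
  obtain D where D: "(\<lambda>(x, t). D x t) \<in> borel_measurable (borel \<Otimes>\<^sub>M borel)"
    and eq: "\<And>x t. x \<in> U \<Longrightarrow> 0 < t \<Longrightarrow> t \<le> T \<Longrightarrow> gradient (\<lambda>y. u y t) x = D x t"
    using C21_gradient_measurable[OF U u] by metis
  have DD: "D x t = Du x t" if "x \<in> U" "0 < t" "t \<le> T" for x t
    using eq[OF that] gradient_eq[OF Du[OF that]] by simp
  have "grad_integral V t1 t2 s u
      = (\<integral>\<^sup>+t\<in>{t1..t2}. (\<integral>\<^sup>+x\<in>V. ennreal (norm (D x t) powr s) \<partial>lborel) \<partial>lborel)"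
    by (rule grad_integral_eq[OF V t D eq])
  also have "\<dots> = (\<integral>\<^sup>+t\<in>{t1..t2} - {0}. (\<integral>\<^sup>+x\<in>V. ennreal (norm (Du x t) powr s) \<partial>lborel) \<partial>lborel)"
  proof (rule nn_integral_cong_AE, rule AE_mp[OF AE_lborel_singleton[of 0]], rule AE_I2, rule impI)
    fix t' :: real assume "t' \<noteq> 0"
    moreover have "(\<integral>\<^sup>+x\<in>V. ennreal (norm (D x t') powr s) \<partial>lborel) = (\<integral>\<^sup>+x\<in>V. ennreal (norm (Du x t') powr s) \<partial>lborel)"
      if "0 < t'" "t' \<le> T"
      using DD V(2) that by (intro nn_integral_cong) (auto simp: indicator_def)
    ultimately show "(\<integral>\<^sup>+x\<in>V. ennreal (norm (D x t') powr s) \<partial>lborel) * indicator {t1..t2} t'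
        = (\<integral>\<^sup>+x\<in>V. ennreal (norm (Du x t') powr s) \<partial>lborel) * indicator ({t1..t2} - {0}) t'"
      using t by (cases "t' \<in> {t1..t2}") auto
  qed
  finally show ?thesis .
qed

lemma ball_grad_integral_bounds:
  assumes U: "U \<noteq> {}" "open U" "bounded U"
    and S: "flow_setting N a \<alpha> U \<phi> G \<Omega> \<rho> k e0 T u0 \<psi> u \<Psi>"
    and law: "flow_law \<kappa> (chi_star U \<phi> G \<Omega> \<rho>) \<theta> (forch_X N a \<alpha> (rot_number \<phi> \<Omega> \<rho>) k) \<Gamma>"
    and c: "0 < r" "cball c (13 * r) \<subseteq> U"
    and geo: "200 \<le> \<kappa>" "4 / r \<le> \<kappa>" "exp (1 / r\<^sup>2) \<le> \<kappa>" "measure lborel (cube c (6 * r)) \<le> \<kappa>"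
  defines "\<xi> \<equiv> chi_star U \<phi> G \<Omega> \<rho>" and "m \<equiv> M_star U T u + 1"
  shows "grad_integral (ball c r) 0 T (2 - \<theta>) u \<le> ennreal (400 * \<kappa>^6 * \<xi>^6 * m^4) * N_star U T \<phi> u0 \<Psi>"
    and "weak_gradient U u0 w \<Longrightarrow> grad_integral (ball c r) 0 T (4 - \<theta>) u
      \<le> ennreal (200000000000 * \<kappa>^17 * \<xi>^16 * m^12) * N_2 U T \<phi> u0 w \<Psi>"
    and "0 < T0 \<Longrightarrow> T0 < T \<Longrightarrow> grad_integral (ball c r) T0 T (4 - \<theta>) u
      \<le> ennreal (200000000000 * \<kappa>^17 * (1 + 1 / T0)\<^sup>2 * \<xi>^16 * m^12) * N_star U T \<phi> u0 \<Psi>"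
proof -
  obtain ut \<Psi>t Du D\<Psi> D2u z0 A where lf:
    "local_flow \<kappa> \<xi> \<theta> (forch_X N a \<alpha> (rot_number \<phi> \<Omega> \<rho>) k) \<Gamma> c r \<phi>
       (M_star U T u) T U u ut \<Psi> \<Psi>t Du D\<Psi> D2u z0 A"
    using flow_setting_local_flow[OF U S law c geo] unfolding \<xi>_def by blast
  note Du = local_flow.Du[OF lf]
  have sol: "C21_cylinder U T u" and u0: "\<And>x. x \<in> U \<Longrightarrow> u0 x = u x 0" and T: "0 < T" and phi: "0 < \<phi>"
    using S unfolding flow_setting_def ibvp_solution_def by auto
  have "cball c r \<subseteq> cball c (13 * r)"
    using c(1) by (intro subset_cball) simp
  then have b: "ball c r \<subseteq> U"
    using c(2) ball_subset_cball by blast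
  have N: "N_star U T \<phi> (\<lambda>x. u x 0) \<Psi> = N_star U T \<phi> u0 \<Psi>"
  proof -
    have "L2_norm_sq U (\<lambda>x. u x 0 - \<Psi> x 0) = L2_norm_sq U (\<lambda>x. u0 x - \<Psi> x 0)"
      unfolding L2_norm_sq_def by (intro nn_integral_cong) (simp add: u0 indicator_def)
    then show ?thesis
      by (simp add: N_star_def)
  qed
  have N2: "N_2 U T \<phi> u0 w \<Psi> = ennreal \<phi> * L2_norm_sq U w + N_star U T \<phi> u0 \<Psi>"
    by (simp add: N_2_def N_star_def distrib_left algebra_simps)
  have gi: "grad_integral (ball c r) t1 T s u
      = (\<integral>\<^sup>+t\<in>{t1..T} - {0}. (\<integral>\<^sup>+x\<in>ball c r. ennreal (norm (Du x t) powr s) \<partial>lborel) \<partial>lborel)" if "0 \<le> t1" for t1 s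
    by (rule grad_integral_eq_classical[OF U(2) sol _ b that _ Du]) auto
  have I0: "{0..T} - {0} = {0<..T}"
    by auto
  show "grad_integral (ball c r) 0 T (2 - \<theta>) u \<le> ennreal (400 * \<kappa>^6 * \<xi>^6 * m^4) * N_star U T \<phi> u0 \<Psi>"
    using local_flow.low_bound[OF lf] unfolding gi[OF order_refl] I0 N m_def .
  show "grad_integral (ball c r) 0 T (4 - \<theta>) u
      \<le> ennreal (200000000000 * \<kappa>^17 * \<xi>^16 * m^12) * N_2 U T \<phi> u0 w \<Psi>" if "weak_gradient U u0 w"
    using local_flow.high_bound_initial[OF lf that u0] unfolding gi[OF order_refl] I0 N N2 m_def .
  show "grad_integral (ball c r) T0 T (4 - \<theta>) u
      \<le> ennreal (200000000000 * \<kappa>^17 * (1 + 1 / T0)\<^sup>2 * \<xi>^16 * m^12) * N_star U T \<phi> u0 \<Psi>"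
    if T0: "0 < T0" "T0 < T"
  proof -
    have "{T0..T} - {0} = {T0..T}"
      using T0(1) by auto
    then show ?thesis
      using local_flow.high_bound_interior[OF lf T0] unfolding gi[OF less_imp_le[OF T0(1)]] N m_def by simp
  qed
qed

section \<open>Covering and interpolation\<close>

lemma sum_le_ennreal_mult:
  fixes f :: "'i \<Rightarrow> ennreal" and K :: "'i \<Rightarrow> real"
  assumes "\<And>i. i \<in> F \<Longrightarrow> f i \<le> ennreal (K i * q) * n" and "\<And>i. i \<in> F \<Longrightarrow> 0 \<le> K i" and "0 \<le> q" and "(\<Sum>i\<in>F. K i) \<le> C"
  shows "(\<Sum>i\<in>F. f i) \<le> ennreal (C * q) * n"
proof -
  have "(\<Sum>i\<in>F. f i) \<le> (\<Sum>i\<in>F. ennreal (K i * q) * n)"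
    by (rule sum_mono) (rule assms(1))
  also have "\<dots> = ennreal (\<Sum>i\<in>F. K i * q) * n"
    using assms(2,3) by (simp flip: sum_distrib_right add: sum_ennreal)
  also have "\<dots> \<le> ennreal (C * q) * n"
    unfolding sum_distrib_right[symmetric]
    using assms(3,4) by (intro mult_right_mono ennreal_leI) auto
  finally show ?thesis .
qed

text \<open>The balls, each with its 13-fold enlargement inside \<open>U\<close>, and the constants
  \<open>\<kappa>\<close> attached to them are fixed before any solution is considered. Hence
  \<open>C\<close> depends only on \<open>U\<close>, \<open>U'\<close> and the coefficients of
  \<open>g\<close>; compactness of the closure of \<open>U'\<close> leaves a finite sum.\<close>

lemma local_grad_integral_bounds:
  fixes N :: nat and a \<alpha> :: "nat \<Rightarrow> real"
  assumes forch: "N \<ge> 1" "\<alpha> 0 = 0" "strict_mono_on {0..N} \<alpha>" "\<forall>i\<le>N. a i > 0"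
    and U: "U \<noteq> {}" "open U" "bounded U"
    and U': "open U'" "compact (closure U')" "closure U' \<subseteq> U"
  defines "\<theta> \<equiv> forch_exp N \<alpha>"
  obtains C where "0 < C"
    and "\<And>\<phi> G \<Omega> \<rho> k e0 T u0 \<psi> u \<Psi>. flow_setting N a \<alpha> U \<phi> G \<Omega> \<rho> k e0 T u0 \<psi> u \<Psi> \<Longrightarrow>
      grad_integral U' 0 T (2 - \<theta>) u
        \<le> ennreal (C * (chi_star U \<phi> G \<Omega> \<rho> ^ 6 * (M_star U T u + 1) ^ 4)) * N_star U T \<phi> u0 \<Psi>"
    and "\<And>\<phi> G \<Omega> \<rho> k e0 T u0 \<psi> u \<Psi> w. flow_setting N a \<alpha> U \<phi> G \<Omega> \<rho> k e0 T u0 \<psi> u \<Psi> \<Longrightarrow> weak_gradient U u0 w \<Longrightarrow>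
      grad_integral U' 0 T (4 - \<theta>) u
        \<le> ennreal (C * (chi_star U \<phi> G \<Omega> \<rho> ^ 16 * (M_star U T u + 1) ^ 12)) * N_2 U T \<phi> u0 w \<Psi>"
    and "\<And>\<phi> G \<Omega> \<rho> k e0 T u0 \<psi> u \<Psi> T0. flow_setting N a \<alpha> U \<phi> G \<Omega> \<rho> k e0 T u0 \<psi> u \<Psi> \<Longrightarrow> 0 < T0 \<Longrightarrow> T0 < T \<Longrightarrow>
      grad_integral U' T0 T (4 - \<theta>) u
        \<le> ennreal (C * ((1 + 1 / T0)\<^sup>2 * chi_star U \<phi> G \<Omega> \<rho> ^ 16 * (M_star U T u + 1) ^ 12)) * N_star U T \<phi> u0 \<Psi>"
proof -
  interpret forchheimer N a \<alpha>
    using forch by unfold_locales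
  obtain \<kappa>0 where \<kappa>0: "\<And>\<kappa> R \<xi> k. \<kappa>0 \<le> \<kappa> \<Longrightarrow> 0 \<le> R \<Longrightarrow> R \<le> \<xi> \<Longrightarrow> 1 \<le> \<xi> \<Longrightarrow> norm k = 1 \<Longrightarrow>
      flow_law \<kappa> \<xi> \<theta> (forch_X N a \<alpha> R k) (\<lambda>y. g (norm (forch_X N a \<alpha> R k y)))"
    using flow_law_exists unfolding \<theta>_def by blast
  have "\<exists>r>0. cball c (13 * r) \<subseteq> U" if c: "c \<in> closure U'" for c
  proof -
    obtain e where "0 < e" "cball c e \<subseteq> U"
      using c U'(3) U(2) open_contains_cball by blast
    then show ?thesis
      by (intro exI[of _ "e / 13"]) simp
  qed
  then obtain r where r: "\<And>c. c \<in> closure U' \<Longrightarrow> 0 < r c" "\<And>c. c \<in> closure U' \<Longrightarrow> cball c (13 * r c) \<subseteq> U"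
    by metis
  have "closure U' \<subseteq> (\<Union>c\<in>closure U'. ball c (r c))"
    using r(1) by force
  then obtain F where F: "F \<subseteq> closure U'" "finite F" "closure U' \<subseteq> (\<Union>c\<in>F. ball c (r c))"
    using compactE_image[OF U'(2), of "closure U'" "\<lambda>c. ball c (r c)"] by auto
  \<comment> \<open>A sum of nonnegative terms, so that it dominates each requirement:
    \<open>\<kappa>0\<close> from the flow law, 200 for the lower bounds of the cut-offs, and the
    three quantities of the ball.\<close>
  define \<kappa> where "\<kappa> c = \<bar>\<kappa>0\<bar> + 200 + 4 / r c + exp (1 / (r c)\<^sup>2) + measure lborel (cube c (6 * r c))" for c
  define K where "K c = 200000000000 * \<kappa> c ^ 17" for c
  \<comment> \<open>The summand 1 keeps \<open>C\<close> positive when the cover is empty, that is,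
    when \<open>U'\<close> is empty.\<close>
  define C where "C = 1 + (\<Sum>c\<in>F. K c)"
  have rF: "0 < r c" "cball c (13 * r c) \<subseteq> U" "ball c (r c) \<subseteq> U" if "c \<in> F" for c
  proof -
    show "0 < r c" "cball c (13 * r c) \<subseteq> U"
      using r F(1) that by blast+
    then show "ball c (r c) \<subseteq> U"
      by (meson ball_subset_cball mult_le_cancel_right1 order_trans subset_cball less_le_not_le one_le_numeral)
  qed
  have \<kappa>: "\<kappa>0 \<le> \<kappa> c" "200 \<le> \<kappa> c" "4 / r c \<le> \<kappa> c" "exp (1 / (r c)\<^sup>2) \<le> \<kappa> c" "measure lborel (cube c (6 * r c)) \<le> \<kappa> c"
    if "c \<in> F" for c
  proof -
    have "0 < 4 / r c" "0 < exp (1 / (r c)\<^sup>2)" "0 \<le> measure lborel (cube c (6 * r c))"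
      using rF(1)[OF that] by simp_all
    then show "\<kappa>0 \<le> \<kappa> c" "200 \<le> \<kappa> c" "4 / r c \<le> \<kappa> c" "exp (1 / (r c)\<^sup>2) \<le> \<kappa> c" "measure lborel (cube c (6 * r c)) \<le> \<kappa> c"
      unfolding \<kappa>_def by linarith+
  qed
  have K0: "0 \<le> K c" if "c \<in> F" for c
    using \<kappa>(2)[OF that] by (simp add: K_def)
  have low_K: "400 * \<kappa> c ^ 6 \<le> K c" if "c \<in> F" for c
  proof -
    have "\<kappa> c ^ 6 \<le> \<kappa> c ^ 17"
      using \<kappa>(2)[OF that] by (intro power_increasing) auto
    then show ?thesis
      using \<kappa>(2)[OF that] unfolding K_def by (intro mult_mono) auto
  qed
  have C: "(\<Sum>c\<in>F. K c) \<le> C" "0 < C"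
    using sum_nonneg[of F K] K0 by (auto simp: C_def add_pos_nonneg)
  have cover: "grad_integral U' t1 T s u \<le> (\<Sum>c\<in>F. grad_integral (ball c (r c)) t1 T s u)"
    if S: "flow_setting N a \<alpha> U \<phi> G \<Omega> \<rho> k e0 T u0 \<psi> u \<Psi>" and "0 \<le> t1"
    for \<phi> G \<Omega> \<rho> k e0 T u0 \<psi> u \<Psi> t1 s
  proof (rule grad_integral_cover[OF U(2)])
    show "C21_cylinder U T u"
      using S unfolding flow_setting_def ibvp_solution_def by simp
    show "U' \<subseteq> (\<Union>c\<in>F. ball c (r c))" "U' \<subseteq> U"
      using closure_subset F(3) U'(3) by blast+
  qed (use F(2) rF(3) U'(1) that(2) in auto)
  have law: "flow_law (\<kappa> c) (chi_star U \<phi> G \<Omega> \<rho>) \<theta> (forch_X N a \<alpha> (rot_number \<phi> \<Omega> \<rho>) k)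
      (\<lambda>y. g (norm (forch_X N a \<alpha> (rot_number \<phi> \<Omega> \<rho>) k y)))"
    if S: "flow_setting N a \<alpha> U \<phi> G \<Omega> \<rho> k e0 T u0 \<psi> u \<Psi>" and c: "c \<in> F"
    for \<phi> G \<Omega> \<rho> k e0 T u0 \<psi> u \<Psi> c
  proof (rule \<kappa>0[OF \<kappa>(1)[OF c]])
    have pos: "0 < \<phi>" "0 < G" "0 \<le> \<Omega>" "0 \<le> \<rho>" and k: "norm k = 1"
      using S unfolding flow_setting_def by auto
    show "0 \<le> rot_number \<phi> \<Omega> \<rho>"
      using pos by (simp add: rot_number_def)
    show "rot_number \<phi> \<Omega> \<rho> \<le> chi_star U \<phi> G \<Omega> \<rho>" "1 \<le> chi_star U \<phi> G \<Omega> \<rho>"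
      using chi_star_bounds[OF U pos] by auto
    show "norm k = 1"
      by (rule k)
  qed
  have nonneg: "1 \<le> chi_star U \<phi> G \<Omega> \<rho>" "0 \<le> M_star U T u"
    if S: "flow_setting N a \<alpha> U \<phi> G \<Omega> \<rho> k e0 T u0 \<psi> u \<Psi>" for \<phi> G \<Omega> \<rho> k e0 T u0 \<psi> u \<Psi>
    using S M_star_nonneg[OF U(1,3)] unfolding flow_setting_def ibvp_solution_def
    by (auto simp: chi_star_def)
  show thesis
  proof (rule that[OF C(2)])
    fix \<phi> G \<Omega> \<rho> k e0 T u0 \<psi> u \<Psi>
    assume S: "flow_setting N a \<alpha> U \<phi> G \<Omega> \<rho> k e0 T u0 \<psi> u \<Psi>"
    note n = nonneg[OF S]
    note b = ball_grad_integral_bounds[OF U S law[OF S] rF(1,2) \<kappa>(2-5)]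
    define \<xi> m where "\<xi> = chi_star U \<phi> G \<Omega> \<rho>" and "m = M_star U T u + 1"
    have p: "0 \<le> \<xi>" "0 \<le> m"
      using n by (auto simp: \<xi>_def m_def)
    have "grad_integral U' 0 T (2 - \<theta>) u \<le> ennreal (C * (\<xi> ^ 6 * m ^ 4)) * N_star U T \<phi> u0 \<Psi>"
    proof (rule order_trans[OF cover[OF S order_refl]], rule sum_le_ennreal_mult[OF _ K0 _ C(1)])
      fix c assume c: "c \<in> F"
      have "grad_integral (ball c (r c)) 0 T (2 - \<theta>) u
          \<le> ennreal (400 * \<kappa> c ^ 6 * \<xi> ^ 6 * m ^ 4) * N_star U T \<phi> u0 \<Psi>"
        unfolding \<xi>_def m_def by (rule b(1)[OF c c c c c c c])
      also have "\<dots> \<le> ennreal (K c * (\<xi> ^ 6 * m ^ 4)) * N_star U T \<phi> u0 \<Psi>"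
      proof (intro mult_right_mono ennreal_leI)
        show "400 * \<kappa> c ^ 6 * \<xi> ^ 6 * m ^ 4 \<le> K c * (\<xi> ^ 6 * m ^ 4)"
          unfolding mult.assoc[of _ "\<xi> ^ 6"] using low_K[OF c] p by (intro mult_right_mono) auto
      qed simp
      finally show "grad_integral (ball c (r c)) 0 T (2 - \<theta>) u
          \<le> ennreal (K c * (\<xi> ^ 6 * m ^ 4)) * N_star U T \<phi> u0 \<Psi>" .
    qed (use p in auto)
    then show "grad_integral U' 0 T (2 - \<theta>) u
        \<le> ennreal (C * (chi_star U \<phi> G \<Omega> \<rho> ^ 6 * (M_star U T u + 1) ^ 4)) * N_star U T \<phi> u0 \<Psi>"
      by (simp add: \<xi>_def m_def)
    show "grad_integral U' 0 T (4 - \<theta>) u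
        \<le> ennreal (C * (chi_star U \<phi> G \<Omega> \<rho> ^ 16 * (M_star U T u + 1) ^ 12)) * N_2 U T \<phi> u0 w \<Psi>"
      if "weak_gradient U u0 w" for w
    proof (rule order_trans[OF cover[OF S order_refl]], rule sum_le_ennreal_mult[OF _ K0 _ C(1)])
      fix c assume c: "c \<in> F"
      show "grad_integral (ball c (r c)) 0 T (4 - \<theta>) u
          \<le> ennreal (K c * (chi_star U \<phi> G \<Omega> \<rho> ^ 16 * (M_star U T u + 1) ^ 12)) * N_2 U T \<phi> u0 w \<Psi>"
        using b(2)[OF c c c c c c c that] by (simp add: K_def mult.assoc)
    qed (use n in auto)
    show "grad_integral U' T0 T (4 - \<theta>) u
        \<le> ennreal (C * ((1 + 1 / T0)\<^sup>2 * chi_star U \<phi> G \<Omega> \<rho> ^ 16 * (M_star U T u + 1) ^ 12)) * N_star U T \<phi> u0 \<Psi>"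
      if T0: "0 < T0" "T0 < T" for T0
    proof (rule order_trans[OF cover[OF S less_imp_le[OF T0(1)]]], rule sum_le_ennreal_mult[OF _ K0 _ C(1)])
      fix c assume c: "c \<in> F"
      show "grad_integral (ball c (r c)) T0 T (4 - \<theta>) u
          \<le> ennreal (K c * ((1 + 1 / T0)\<^sup>2 * chi_star U \<phi> G \<Omega> \<rho> ^ 16 * (M_star U T u + 1) ^ 12)) * N_star U T \<phi> u0 \<Psi>"
        using b(3)[OF c c c c c c c T0] by (simp add: K_def mult.assoc)
    qed (use n in auto)
  qed
qed

text \<open>The level \<open>\<mu>\<close> is the one that balances the factors \<open>\<tau>\<close> and \<open>m\<close> of the two
  endpoint bounds; the powers of \<open>\<xi>\<close> leave some slack.\<close>

lemma interpolation_weights: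
  fixes \<tau> \<xi> m \<theta> s :: real
  assumes ge: "1 \<le> \<tau>" "1 \<le> \<xi>" "1 \<le> m" "0 \<le> \<theta>"
  defines "\<mu> \<equiv> \<tau> * \<xi> powr (4 + \<theta>) * m ^ 4"
    and "B \<equiv> \<tau> powr (s + \<theta> - 2) * \<xi> powr ((4 + \<theta>) * (s + \<theta>)) * m powr (4 * (s + \<theta> - 1))"
  shows "\<mu> powr (s - (2 - \<theta>)) * (\<xi> ^ 6 * m ^ 4) \<le> B"
    and "\<mu> powr (s - (4 - \<theta>)) * (\<tau>\<^sup>2 * \<xi> ^ 16 * m ^ 12) \<le> B"
proof -
  have \<mu>: "\<mu> powr e = \<tau> powr e * \<xi> powr ((4 + \<theta>) * e) * m powr (4 * e)" for e
  proof -
    have "(m ^ 4) powr e = (m powr 4) powr e"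
      using ge by simp
    then show ?thesis
      using ge by (simp add: \<mu>_def powr_mult powr_powr del: powr_numeral)
  qed
  have pow: "\<xi> ^ 6 = \<xi> powr 6" "m ^ 4 = m powr 4" "\<tau>\<^sup>2 = \<tau> powr 2" "\<xi> ^ 16 = \<xi> powr 16" "m ^ 12 = m powr 12"
    using ge by (simp_all add: powr_numeral)
  have "\<mu> powr (s - (2 - \<theta>)) * (\<xi> ^ 6 * m ^ 4)
      = \<tau> powr (s + \<theta> - 2) * (\<xi> powr ((4 + \<theta>) * (s - (2 - \<theta>))) * \<xi> powr 6) * (m powr (4 * (s - (2 - \<theta>))) * m powr 4)"
    unfolding \<mu> pow by (simp add: algebra_simps)
  also have "\<dots> = \<tau> powr (s + \<theta> - 2) * \<xi> powr ((4 + \<theta>) * (s - (2 - \<theta>)) + 6) * m powr (4 * (s + \<theta> - 1))"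
    unfolding powr_add[symmetric] by (simp add: algebra_simps)
  also have "\<dots> \<le> B"
    unfolding B_def
  proof (rule mult_right_mono[OF mult_left_mono])
    show "\<xi> powr ((4 + \<theta>) * (s - (2 - \<theta>)) + 6) \<le> \<xi> powr ((4 + \<theta>) * (s + \<theta>))"
      using ge by (intro powr_mono) (simp_all add: algebra_simps)
  qed auto
  finally show "\<mu> powr (s - (2 - \<theta>)) * (\<xi> ^ 6 * m ^ 4) \<le> B" .
  have "\<mu> powr (s - (4 - \<theta>)) * (\<tau>\<^sup>2 * \<xi> ^ 16 * m ^ 12)
      = (\<tau> powr (s - (4 - \<theta>)) * \<tau> powr 2) * (\<xi> powr ((4 + \<theta>) * (s - (4 - \<theta>))) * \<xi> powr 16) * (m powr (4 * (s - (4 - \<theta>))) * m powr 12)"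
    unfolding \<mu> pow by (simp only: ac_simps)
  also have "\<dots> = \<tau> powr (s + \<theta> - 2) * \<xi> powr ((4 + \<theta>) * (s - (4 - \<theta>)) + 16) * m powr (4 * (s + \<theta> - 1))"
    unfolding powr_add[symmetric] by (simp add: algebra_simps)
  also have "\<dots> \<le> B"
    unfolding B_def
  proof (rule mult_right_mono[OF mult_left_mono])
    show "\<xi> powr ((4 + \<theta>) * (s - (4 - \<theta>)) + 16) \<le> \<xi> powr ((4 + \<theta>) * (s + \<theta>))"
      using ge by (intro powr_mono) (simp_all add: algebra_simps)
  qed auto
  finally show "\<mu> powr (s - (4 - \<theta>)) * (\<tau>\<^sup>2 * \<xi> ^ 16 * m ^ 12) \<le> B" .
qed

lemma ennreal_interpolation:
  fixes E E1 E2 n n' :: ennreal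
  assumes E: "E \<le> ennreal p * E1 + ennreal q * E2"
    and E1: "E1 \<le> ennreal (C * A1) * n'" "n' \<le> n" and E2: "E2 \<le> ennreal (C * A2) * n"
    and B: "p * A1 \<le> B" "q * A2 \<le> B" and nonneg: "0 \<le> C" "0 \<le> p" "0 \<le> q" "0 \<le> B"
  shows "E \<le> ennreal (2 * C * B) * n"
proof -
  have "ennreal p * E1 \<le> ennreal p * (ennreal (C * A1) * n)"
    by (intro mult_left_mono order_trans[OF E1(1)] E1(2)) auto
  also have "\<dots> = ennreal (C * (p * A1)) * n"
    using nonneg by (simp only: mult.left_commute[of C] ennreal_mult'[of p] mult.assoc)
  also have "\<dots> \<le> ennreal (C * B) * n"
    using B(1) nonneg by (intro mult_right_mono ennreal_leI mult_left_mono) auto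
  finally have 1: "ennreal p * E1 \<le> ennreal (C * B) * n" .
  have "ennreal q * E2 \<le> ennreal q * (ennreal (C * A2) * n)"
    by (intro mult_left_mono E2) auto
  also have "\<dots> = ennreal (C * (q * A2)) * n"
    using nonneg by (simp only: mult.left_commute[of C] ennreal_mult'[of q] mult.assoc)
  also have "\<dots> \<le> ennreal (C * B) * n"
    using B(2) nonneg by (intro mult_right_mono ennreal_leI mult_left_mono) auto
  finally have 2: "ennreal q * E2 \<le> ennreal (C * B) * n" .
  have "E \<le> ennreal (C * B) * n + ennreal (C * B) * n"
    using E add_mono[OF 1 2] by (rule order_trans)
  also have "\<dots> = ennreal (2 * C * B) * n"
    using nonneg by (simp flip: distrib_right ennreal_plus add: mult.assoc)
  finally show ?thesis .
qed

theorem corollary6p5: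
  fixes N :: nat and a \<alpha> :: "nat \<Rightarrow> real" and U U' :: "(real^3) set"
  assumes "N \<ge> 1"
    and "\<alpha> 0 = 0" and "strict_mono_on {0..N} \<alpha>"
    and "\<forall>i\<le>N. a i > 0"
    and "U \<noteq> {}" and "open U" and "bounded U" and "C1_boundary U"
    and "open U'" and "compact (closure U')" and "closure U' \<subseteq> U"
  shows
    "(\<exists>C>0. \<forall>\<phi> G \<Omega> \<rho> k e0 T u0 \<psi> u \<Psi> T0.
        flow_setting N a \<alpha> U \<phi> G \<Omega> \<rho> k e0 T u0 \<psi> u \<Psi> \<and> 0 < T0 \<and> T0 < T \<longrightarrow>
        (\<forall>w. weak_gradient U u0 w \<longrightarrow>
           grad_integral U' 0 T (4 - forch_exp N \<alpha>) u
             \<le> ennreal (C * chi_star U \<phi> G \<Omega> \<rho> powr (4 * (4 + forch_exp N \<alpha>))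
                        * (M_star U T u + 1) ^ 12)
               * N_2 U T \<phi> u0 w \<Psi>) \<and>
        grad_integral U' T0 T (4 - forch_exp N \<alpha>) u
          \<le> ennreal (C * (1 + 1 / T0)\<^sup>2
                     * chi_star U \<phi> G \<Omega> \<rho> powr (4 * (4 + forch_exp N \<alpha>))
                     * (M_star U T u + 1) ^ 12)
            * N_star U T \<phi> u0 \<Psi>) \<and>
     (\<forall>s. 2 - forch_exp N \<alpha> < s \<and> s < 4 - forch_exp N \<alpha> \<longrightarrow>
      (\<exists>C>0. \<forall>\<phi> G \<Omega> \<rho> k e0 T u0 \<psi> u \<Psi> T0.
        flow_setting N a \<alpha> U \<phi> G \<Omega> \<rho> k e0 T u0 \<psi> u \<Psi> \<and> 0 < T0 \<and> T0 < T \<longrightarrow>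
        (\<forall>w. weak_gradient U u0 w \<longrightarrow>
           grad_integral U' 0 T s u
             \<le> ennreal (C * chi_star U \<phi> G \<Omega> \<rho> powr ((4 + forch_exp N \<alpha>) * (s + forch_exp N \<alpha>))
                        * (M_star U T u + 1) powr (4 * (s + forch_exp N \<alpha> - 1)))
               * N_2 U T \<phi> u0 w \<Psi>) \<and>
        grad_integral U' T0 T s u
          \<le> ennreal (C * (1 + 1 / T0) powr (s + forch_exp N \<alpha> - 2)
                     * chi_star U \<phi> G \<Omega> \<rho> powr ((4 + forch_exp N \<alpha>) * (s + forch_exp N \<alpha>))
                     * (M_star U T u + 1) powr (4 * (s + forch_exp N \<alpha> - 1)))
            * N_star U T \<phi> u0 \<Psi>))"
proof -
  define \<theta> where "\<theta> = forch_exp N \<alpha>"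
  have "\<alpha> 0 < \<alpha> N"
    using assms(1,3) by (auto simp: strict_mono_on_def)
  then have \<theta>: "0 \<le> \<theta>"
    using assms(2) by (simp add: \<theta>_def forch_exp_def)
  obtain C where C: "0 < C"
    and low: "\<And>\<phi> G \<Omega> \<rho> k e0 T u0 \<psi> u \<Psi>. flow_setting N a \<alpha> U \<phi> G \<Omega> \<rho> k e0 T u0 \<psi> u \<Psi> \<Longrightarrow>
      grad_integral U' 0 T (2 - \<theta>) u
        \<le> ennreal (C * (chi_star U \<phi> G \<Omega> \<rho> ^ 6 * (M_star U T u + 1) ^ 4)) * N_star U T \<phi> u0 \<Psi>"
    and initial: "\<And>\<phi> G \<Omega> \<rho> k e0 T u0 \<psi> u \<Psi> w. flow_setting N a \<alpha> U \<phi> G \<Omega> \<rho> k e0 T u0 \<psi> u \<Psi> \<Longrightarrow> weak_gradient U u0 w \<Longrightarrow>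
      grad_integral U' 0 T (4 - \<theta>) u
        \<le> ennreal (C * (chi_star U \<phi> G \<Omega> \<rho> ^ 16 * (M_star U T u + 1) ^ 12)) * N_2 U T \<phi> u0 w \<Psi>"
    and interior: "\<And>\<phi> G \<Omega> \<rho> k e0 T u0 \<psi> u \<Psi> T0. flow_setting N a \<alpha> U \<phi> G \<Omega> \<rho> k e0 T u0 \<psi> u \<Psi> \<Longrightarrow> 0 < T0 \<Longrightarrow> T0 < T \<Longrightarrow>
      grad_integral U' T0 T (4 - \<theta>) u
        \<le> ennreal (C * ((1 + 1 / T0)\<^sup>2 * chi_star U \<phi> G \<Omega> \<rho> ^ 16 * (M_star U T u + 1) ^ 12)) * N_star U T \<phi> u0 \<Psi>"
    using local_grad_integral_bounds[OF assms(1-7,9-11)] unfolding \<theta>_def by blast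
  have nonneg: "1 \<le> chi_star U \<phi> G \<Omega> \<rho>" "0 \<le> M_star U T u"
    if S: "flow_setting N a \<alpha> U \<phi> G \<Omega> \<rho> k e0 T u0 \<psi> u \<Psi>" for \<phi> G \<Omega> \<rho> k e0 T u0 \<psi> u \<Psi>
    using S M_star_nonneg[OF assms(5,7)] unfolding flow_setting_def ibvp_solution_def
    by (auto simp: chi_star_def)
  \<comment> \<open>The exponent 16 of the local estimate is at most 4(4 + \<theta>), and the base
    is at least 1.\<close>
  have chi_pow: "chi_star U \<phi> G \<Omega> \<rho> ^ 16 \<le> chi_star U \<phi> G \<Omega> \<rho> powr (4 * (4 + \<theta>))" for \<phi> G \<Omega> \<rho>
  proof -
    have 1: "1 \<le> chi_star U \<phi> G \<Omega> \<rho>"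
      by (simp add: chi_star_def)
    then have "chi_star U \<phi> G \<Omega> \<rho> ^ 16 = chi_star U \<phi> G \<Omega> \<rho> powr 16"
      by (simp add: powr_numeral)
    also have "\<dots> \<le> chi_star U \<phi> G \<Omega> \<rho> powr (4 * (4 + \<theta>))"
      using 1 \<theta> by (intro powr_mono) auto
    finally show ?thesis .
  qed
  have interpolation: "grad_integral U' t1 T s u
      \<le> ennreal (\<mu> powr (s - (2 - \<theta>))) * grad_integral U' 0 T (2 - \<theta>) u
        + ennreal (\<mu> powr (s - (4 - \<theta>))) * grad_integral U' t1 T (4 - \<theta>) u"
    if S: "flow_setting N a \<alpha> U \<phi> G \<Omega> \<rho> k e0 T u0 \<psi> u \<Psi>" and t1: "0 \<le> t1" and s: "2 - \<theta> < s" "s < 4 - \<theta>" and \<mu>: "0 < \<mu>"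
    for \<phi> G \<Omega> \<rho> k e0 T u0 \<psi> u \<Psi> t1 s \<mu>
  proof -
    have "C21_cylinder U T u"
      using S unfolding flow_setting_def ibvp_solution_def by simp
    moreover have "U' \<subseteq> U"
      using assms(11) closure_subset by blast
    ultimately have "grad_integral U' t1 T s u
      \<le> ennreal (\<mu> powr (s - (2 - \<theta>))) * grad_integral U' t1 T (2 - \<theta>) u
        + ennreal (\<mu> powr (s - (4 - \<theta>))) * grad_integral U' t1 T (4 - \<theta>) u"
      using assms(6,9) t1 s \<mu> by (intro grad_integral_interpolation) auto
    \<comment> \<open>The lower power has a bound down to time 0 that carries no factor in
      \<open>T0\<close>, so its interval is enlarged.\<close>
    moreover have "grad_integral U' t1 T (2 - \<theta>) u \<le> grad_integral U' 0 T (2 - \<theta>) u"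
      unfolding grad_integral_def using t1 by (intro nn_integral_mono) (auto simp: indicator_def)
    ultimately show ?thesis
      by (meson add_right_mono mult_left_mono order_trans zero_le)
  qed
  show ?thesis
    unfolding \<theta>_def[symmetric]
  proof (intro conjI allI impI)
    show "\<exists>C>0. \<forall>\<phi> G \<Omega> \<rho> k e0 T u0 \<psi> u \<Psi> T0.
        flow_setting N a \<alpha> U \<phi> G \<Omega> \<rho> k e0 T u0 \<psi> u \<Psi> \<and> 0 < T0 \<and> T0 < T \<longrightarrow>
        (\<forall>w. weak_gradient U u0 w \<longrightarrow>
           grad_integral U' 0 T (4 - \<theta>) u
             \<le> ennreal (C * chi_star U \<phi> G \<Omega> \<rho> powr (4 * (4 + \<theta>)) * (M_star U T u + 1) ^ 12)
               * N_2 U T \<phi> u0 w \<Psi>) \<and>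
        grad_integral U' T0 T (4 - \<theta>) u
          \<le> ennreal (C * (1 + 1 / T0)\<^sup>2 * chi_star U \<phi> G \<Omega> \<rho> powr (4 * (4 + \<theta>)) * (M_star U T u + 1) ^ 12)
            * N_star U T \<phi> u0 \<Psi>"
    proof (rule exI[of _ C], intro conjI allI impI C)
      fix \<phi> G \<Omega> \<rho> k e0 T u0 \<psi> u \<Psi> T0
      assume asm: "flow_setting N a \<alpha> U \<phi> G \<Omega> \<rho> k e0 T u0 \<psi> u \<Psi> \<and> 0 < T0 \<and> T0 < T"
      then have S: "flow_setting N a \<alpha> U \<phi> G \<Omega> \<rho> k e0 T u0 \<psi> u \<Psi>" and T0: "0 < T0" "T0 < T"
        by auto
      note n = nonneg[OF S]
      show "grad_integral U' 0 T (4 - \<theta>) u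
          \<le> ennreal (C * chi_star U \<phi> G \<Omega> \<rho> powr (4 * (4 + \<theta>)) * (M_star U T u + 1) ^ 12) * N_2 U T \<phi> u0 w \<Psi>"
        if "weak_gradient U u0 w" for w
      proof (rule order_trans[OF initial[OF S that] mult_right_mono[OF ennreal_leI]])
        show "C * (chi_star U \<phi> G \<Omega> \<rho> ^ 16 * (M_star U T u + 1) ^ 12)
            \<le> C * chi_star U \<phi> G \<Omega> \<rho> powr (4 * (4 + \<theta>)) * (M_star U T u + 1) ^ 12"
          unfolding mult.assoc using chi_pow[of \<phi> G \<Omega> \<rho>] n C by (intro mult_left_mono mult_right_mono) auto
      qed simp
      show "grad_integral U' T0 T (4 - \<theta>) u
          \<le> ennreal (C * (1 + 1 / T0)\<^sup>2 * chi_star U \<phi> G \<Omega> \<rho> powr (4 * (4 + \<theta>)) * (M_star U T u + 1) ^ 12)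
            * N_star U T \<phi> u0 \<Psi>"
      proof (rule order_trans[OF interior[OF S T0] mult_right_mono[OF ennreal_leI]])
        show "C * ((1 + 1 / T0)\<^sup>2 * chi_star U \<phi> G \<Omega> \<rho> ^ 16 * (M_star U T u + 1) ^ 12)
            \<le> C * (1 + 1 / T0)\<^sup>2 * chi_star U \<phi> G \<Omega> \<rho> powr (4 * (4 + \<theta>)) * (M_star U T u + 1) ^ 12"
          unfolding mult.assoc using chi_pow[of \<phi> G \<Omega> \<rho>] n C by (intro mult_left_mono mult_right_mono) auto
      qed simp
    qed
  next
    fix s assume "2 - \<theta> < s \<and> s < 4 - \<theta>"
    then have s: "2 - \<theta> < s" "s < 4 - \<theta>"
      by auto
    show "\<exists>C>0. \<forall>\<phi> G \<Omega> \<rho> k e0 T u0 \<psi> u \<Psi> T0.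
        flow_setting N a \<alpha> U \<phi> G \<Omega> \<rho> k e0 T u0 \<psi> u \<Psi> \<and> 0 < T0 \<and> T0 < T \<longrightarrow>
        (\<forall>w. weak_gradient U u0 w \<longrightarrow>
           grad_integral U' 0 T s u
             \<le> ennreal (C * chi_star U \<phi> G \<Omega> \<rho> powr ((4 + \<theta>) * (s + \<theta>)) * (M_star U T u + 1) powr (4 * (s + \<theta> - 1)))
               * N_2 U T \<phi> u0 w \<Psi>) \<and>
        grad_integral U' T0 T s u
          \<le> ennreal (C * (1 + 1 / T0) powr (s + \<theta> - 2) * chi_star U \<phi> G \<Omega> \<rho> powr ((4 + \<theta>) * (s + \<theta>))
                     * (M_star U T u + 1) powr (4 * (s + \<theta> - 1)))
            * N_star U T \<phi> u0 \<Psi>"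
    \<comment> \<open>The 2 counts the two terms of the interpolation, each at most \<open>C\<close>
      times the target.\<close>
    proof (rule exI[of _ "2 * C"], intro conjI allI impI)
      show "0 < 2 * C"
        using C by simp
      fix \<phi> G \<Omega> \<rho> k e0 T u0 \<psi> u \<Psi> T0
      assume asm: "flow_setting N a \<alpha> U \<phi> G \<Omega> \<rho> k e0 T u0 \<psi> u \<Psi> \<and> 0 < T0 \<and> T0 < T"
      then have S: "flow_setting N a \<alpha> U \<phi> G \<Omega> \<rho> k e0 T u0 \<psi> u \<Psi>" and T0: "0 < T0" "T0 < T"
        by auto
      define \<xi> m where "\<xi> = chi_star U \<phi> G \<Omega> \<rho>" and "m = M_star U T u + 1"
      have ge: "1 \<le> \<xi>" "1 \<le> m" "1 \<le> 1 + 1 / T0"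
        using nonneg[OF S] T0 by (auto simp: \<xi>_def m_def)
      have \<mu>_pos: "0 < \<tau> * \<xi> powr (4 + \<theta>) * m ^ 4" if "1 \<le> \<tau>" for \<tau>
        using that ge by (intro mult_pos_pos) auto
      show "grad_integral U' 0 T s u
          \<le> ennreal (2 * C * chi_star U \<phi> G \<Omega> \<rho> powr ((4 + \<theta>) * (s + \<theta>)) * (M_star U T u + 1) powr (4 * (s + \<theta> - 1)))
            * N_2 U T \<phi> u0 w \<Psi>" if w: "weak_gradient U u0 w" for w
      proof -
        have N: "N_star U T \<phi> u0 \<Psi> \<le> N_2 U T \<phi> u0 w \<Psi>"
          unfolding N_star_def N_2_def by (intro add_mono mult_left_mono) auto
        \<comment> \<open>The level is taken with \<tau> = 1, because the endpoint bounds from the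
          initial instant contain no time factor.\<close>
        have "grad_integral U' 0 T s u \<le> ennreal (2 * C * (1 powr (s + \<theta> - 2) * \<xi> powr ((4 + \<theta>) * (s + \<theta>))
            * m powr (4 * (s + \<theta> - 1)))) * N_2 U T \<phi> u0 w \<Psi>"
          using interpolation_weights[OF order_refl ge(1,2) \<theta>, of s] C
            initial[OF S w] low[OF S]
          by (intro ennreal_interpolation[OF interpolation[OF S order_refl s \<mu>_pos[OF order_refl]] _ N])
             (auto simp: \<xi>_def m_def)
        then show ?thesis
          by (simp add: \<xi>_def m_def mult.assoc)
      qed
      \<comment> \<open>Here \<tau> = 1 + 1 / T0. The higher endpoint bound contributes \<tau>^2 and
        its weight \<tau>^(s + \<theta> - 4), which together give the exponent s + \<theta> - 2; the
        weight of the lower endpoint has the same exponent.\<close>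
      have "grad_integral U' T0 T s u \<le> ennreal (2 * C * ((1 + 1 / T0) powr (s + \<theta> - 2) * \<xi> powr ((4 + \<theta>) * (s + \<theta>))
          * m powr (4 * (s + \<theta> - 1)))) * N_star U T \<phi> u0 \<Psi>"
        using C low[OF S] interior[OF S T0]
        by (intro ennreal_interpolation[OF interpolation[OF S less_imp_le[OF T0(1)] s \<mu>_pos[OF ge(3)]] _ order_refl _
              interpolation_weights[OF ge(3,1,2) \<theta>, of s]])
           (auto simp: \<xi>_def m_def)
      then show "grad_integral U' T0 T s u
          \<le> ennreal (2 * C * (1 + 1 / T0) powr (s + \<theta> - 2) * chi_star U \<phi> G \<Omega> \<rho> powr ((4 + \<theta>) * (s + \<theta>))
              * (M_star U T u + 1) powr (4 * (s + \<theta> - 1))) * N_star U T \<phi> u0 \<Psi>"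
        by (simp add: \<xi>_def m_def mult.assoc)
    qed
  qed
qed

end
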